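(* Let $\sigma>1$, and let $2\le \widetilde q\le\infty$, $2<q<\infty$ and $6<r\le\widetilde r<\infty$ satisfy $$\frac{1}{\widetilde q}+\frac{3}{\widetilde r}>\frac32-\sigma\qquad\text{and}\qquad \frac1q+\frac3r=\frac12 .$$ Then there is a constant $C>0$ such that for all $f\in H^\sigma(\mathbb{R}^3;\mathbb{C}^4)$, $$\big\|e^{-it(\mathcal D+\beta)}f\big\|_{W(\widetilde q,q)_t W(\widetilde r,r)_x}\le C\,\|f\|_{H^\sigma}.$$
   Context: Dirac flow. The space dimension is $3$ and the mass is normalized to $m=1$. $\mathcal D=-i\sum_{j=1}^3\alpha_j\partial_j$, where $\alpha_j=\begin{pmatrix}0&\sigma_j\\ \sigma_j&0\end{pmatrix}$ and $\beta=\begin{pmatrix}I_2&0\\0&-I_2\end{pmatrix}$ are $4\times4$ complex matrices built from the Pauli matrices $\sigma_1=\begin{pmatrix}0&1\\1&0\end{pmatrix}$, $\sigma_2=\begin{pmatrix}0&-i\\ i&0\end{pmatrix}$, $\sigma_3=\begin{pmatrix}1&0\\0&-1\end{pmatrix}$. The flow $u(x,t)=e^{-it(\mathcal D+\beta)}f(x)$ is the solution $u:\mathbb{R}^{3+1}\to\mathbb{C}^4$ of $-i\partial_tu+\mathcal Du+\beta u=0$, $u(x,0)=f(x)$; equivalently, it is the Fourier multiplier in $x$ with matrix symbol $e^{-it(\alpha\cdot\xi+\beta)}$, where $\alpha\cdot\xi=\sum_j\xi_j\alpha_j$. $H^\sigma$ is the $L^2$-based inhomogeneous Sobolev space, $\|f\|_{H^\sigma}=\|\langle\xi\rangle^\sigma\widehat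 f\|_{L^2}$ up to a normalizing constant, with $\langle\xi\rangle=\sqrt{1+|\xi|^2}$. Wiener amalgam spaces. Fix $\varphi\in C_0^\infty(\mathbb{R}^n)$ with $\|\varphi\|_{L^2}=1$ and put $\tau_x\varphi(\cdot)=\varphi(\cdot-x)$. For $1\le p,q\le\infty$, $W(p,q)$ is the space of $f\in L^p_{\mathrm{loc}}(\mathbb{R}^n)$ with finite norm $\|f\|_{W(p,q)}=\big\|\,\|f\,\tau_x\varphi\|_{L^p}\big\|_{L^q_x}$; different choices of $\varphi$ give equivalent norms. For a function $F(x,t)$, $\|F\|_{W(\widetilde q,q)_tW(\widetilde r,r)_x}$ is the $W(\widetilde q,q)(\mathbb{R})$ norm in $t$ of the function $t\mapsto\|F(\cdot,t)\|_{W(\widetilde r,r)(\mathbb{R}^3)}$. For $\mathbb{C}^4$-valued functions, absolute values are replaced by the Euclidean norm on $\mathbb{C}^4$. *)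

theory Defs
  imports "HOL-Analysis.Analysis" "HOL-Probability.Essential_Supremum"
begin

section \<open>Lebesgue norms\<close>

text \<open>\<open>x powr a\<close> for extended nonnegative \<open>x\<close> and real \<open>a > 0\<close>.\<close>

definition ennreal_powr :: "ennreal \<Rightarrow> real \<Rightarrow> ennreal" where
  "ennreal_powr x a = (if x = top then top else ennreal (enn2real x powr a))"

text \<open>
  The \<open>L\<^sup>p\<close> norm, \<open>1 \<le> p \<le> \<infinity>\<close>, of an extended nonnegative function \<open>h\<close>; for a function with values
  in a normed space, \<open>h\<close> is its pointwise norm. Admitting the value \<open>\<infinity>\<close> lets the norm be iterated.
  Nonmeasurable functions get norm \<open>\<infinity>\<close> (\<open>esssup\<close> has the same convention), so that a
  finite norm entails measurability.
\<close>

definition Lp_norm :: "ennreal \<Rightarrow> ('a::euclidean_space \<Rightarrow> ennreal) \<Rightarrow> ennreal" where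
  "Lp_norm p h =
     (if p = top then esssup lebesgue h
      else if h \<in> borel_measurable lebesgue
      then ennreal_powr (\<integral>\<^sup>+x. ennreal_powr (h x) (enn2real p) \<partial>lebesgue) (1 / enn2real p)
      else top)"

definition L2 :: "('a::euclidean_space \<Rightarrow> 'b::euclidean_space) set" where
  "L2 = {f. f \<in> borel_measurable lebesgue \<and> Lp_norm 2 (\<lambda>x. ennreal (norm (f x))) < top}"

section \<open>Wiener amalgam norms\<close>

primrec continuously_differentiable ::
    "nat \<Rightarrow> ('a::euclidean_space \<Rightarrow> 'b::real_normed_vector) \<Rightarrow> bool" where
  "continuously_differentiable 0 f \<longleftrightarrow> continuous_on UNIV f"
| "continuously_differentiable (Suc k) f \<longleftrightarrow>
     (\<forall>x. f differentiable (at x)) \<and>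
     (\<forall>b\<in>Basis. continuously_differentiable k (\<lambda>x. frechet_derivative f (at x) b))"

definition test_function :: "('a::euclidean_space \<Rightarrow> complex) \<Rightarrow> bool" where
  "test_function \<phi> \<longleftrightarrow> (\<forall>k. continuously_differentiable k \<phi>) \<and> compact (closure {x. \<phi> x \<noteq> 0})"

definition window :: "('a::euclidean_space \<Rightarrow> complex) \<Rightarrow> bool" where
  "window \<phi> \<longleftrightarrow> test_function \<phi> \<and> Lp_norm 2 (\<lambda>x. ennreal (norm (\<phi> x))) = 1"

text \<open>The \<open>W(p,q)\<close> norm of a function with pointwise norm \<open>h\<close>: \<open>p\<close> is the local exponent and \<open>q\<close> the
  global one.\<close>

definition wiener_norm ::
    "('a::euclidean_space \<Rightarrow> complex) \<Rightarrow> ennreal \<Rightarrow> ennreal \<Rightarrow> ('a \<Rightarrow> ennreal) \<Rightarrow> ennreal" where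
  "wiener_norm \<phi> p q h = Lp_norm q (\<lambda>x. Lp_norm p (\<lambda>y. h y * ennreal (norm (\<phi> (y - x)))))"

text \<open>The norm of \<open>W(p\<^sub>1,q\<^sub>1)\<^sub>t W(p\<^sub>2,q\<^sub>2)\<^sub>x\<close>, for functions \<open>F\<close> with the time variable as first
  argument.\<close>

definition mixed_wiener_norm ::
    "(real \<Rightarrow> complex) \<Rightarrow> (real ^ 3 \<Rightarrow> complex) \<Rightarrow> ennreal \<Rightarrow> ennreal \<Rightarrow> ennreal \<Rightarrow> ennreal \<Rightarrow>
     (real \<Rightarrow> real ^ 3 \<Rightarrow> complex ^ 4) \<Rightarrow> ennreal" where
  "mixed_wiener_norm \<phi> \<psi> p\<^sub>1 q\<^sub>1 p\<^sub>2 q\<^sub>2 F =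
     wiener_norm \<phi> p\<^sub>1 q\<^sub>1 (\<lambda>t. wiener_norm \<psi> p\<^sub>2 q\<^sub>2 (\<lambda>x. ennreal (norm (F t x))))"

section \<open>Fourier transform and Sobolev spaces\<close>

text \<open>
  The Fourier transform on \<open>L\<^sup>2\<close> in its unitary normalization, given as in Plancherel's theorem by
  the \<open>L\<^sup>2\<close> limit of the truncated Fourier integrals. It is determined up to a null set.
\<close>

definition truncated_fourier ::
    "real \<Rightarrow> (real ^ 3 \<Rightarrow> complex ^ 4) \<Rightarrow> real ^ 3 \<Rightarrow> complex ^ 4" where
  "truncated_fourier R f \<xi> =
     (2 * pi) powr (- 3 / 2) *\<^sub>R (LINT x:cball 0 R|lebesgue. cis (- (x \<bullet> \<xi>)) *s f x)"

definition is_fourier :: "(real ^ 3 \<Rightarrow> complex ^ 4) \<Rightarrow> (real ^ 3 \<Rightarrow> complex ^ 4) \<Rightarrow> bool" where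
  "is_fourier f g \<longleftrightarrow> f \<in> L2 \<and> g \<in> L2 \<and>
     ((\<lambda>R. Lp_norm 2 (\<lambda>\<xi>. ennreal (norm (truncated_fourier R f \<xi> - g \<xi>)))) \<longlongrightarrow> 0) at_top"

definition fourier :: "(real ^ 3 \<Rightarrow> complex ^ 4) \<Rightarrow> real ^ 3 \<Rightarrow> complex ^ 4" where
  "fourier f = (SOME g. is_fourier f g)"

definition inverse_fourier :: "(real ^ 3 \<Rightarrow> complex ^ 4) \<Rightarrow> real ^ 3 \<Rightarrow> complex ^ 4" where
  "inverse_fourier g = (SOME f. is_fourier f g)"

definition sobolev_norm :: "real \<Rightarrow> (real ^ 3 \<Rightarrow> complex ^ 4) \<Rightarrow> ennreal" where
  "sobolev_norm \<sigma> f =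
     Lp_norm 2 (\<lambda>\<xi>. ennreal (sqrt (1 + (norm \<xi>)\<^sup>2) powr \<sigma> * norm (fourier f \<xi>)))"

text \<open>For \<open>\<sigma> \<ge> 0\<close> only, where \<open>H\<^sup>\<sigma>\<close> consists of \<open>L\<^sup>2\<close> functions.\<close>

definition sobolev_space :: "real \<Rightarrow> (real ^ 3 \<Rightarrow> complex ^ 4) set" where
  "sobolev_space \<sigma> = {f \<in> L2. sobolev_norm \<sigma> f < top}"

section \<open>The Dirac flow\<close>

definition pauli :: "3 \<Rightarrow> complex ^ 2 ^ 2" where
  "pauli j =
     (if j = 1 then vector [vector [0, 1], vector [1, 0]]
      else if j = 2 then vector [vector [0, - \<i>], vector [\<i>, 0]]
      else vector [vector [1, 0], vector [0, - 1]])"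

definition block_matrix ::
    "complex ^ 2 ^ 2 \<Rightarrow> complex ^ 2 ^ 2 \<Rightarrow> complex ^ 2 ^ 2 \<Rightarrow> complex ^ 2 ^ 2 \<Rightarrow> complex ^ 4 ^ 4" where
  "block_matrix A B C D = vector
     [vector [A $ 1 $ 1, A $ 1 $ 2, B $ 1 $ 1, B $ 1 $ 2],
      vector [A $ 2 $ 1, A $ 2 $ 2, B $ 2 $ 1, B $ 2 $ 2],
      vector [C $ 1 $ 1, C $ 1 $ 2, D $ 1 $ 1, D $ 1 $ 2],
      vector [C $ 2 $ 1, C $ 2 $ 2, D $ 2 $ 1, D $ 2 $ 2]]"

definition dirac_alpha :: "3 \<Rightarrow> complex ^ 4 ^ 4" where
  "dirac_alpha j = block_matrix 0 (pauli j) (pauli j) 0"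

definition dirac_beta :: "complex ^ 4 ^ 4" where
  "dirac_beta = block_matrix (mat 1) 0 0 (- mat 1)"

definition dirac_symbol :: "real ^ 3 \<Rightarrow> complex ^ 4 ^ 4" where
  "dirac_symbol \<xi> = (\<Sum>j\<in>UNIV. (\<xi> $ j) *\<^sub>R dirac_alpha j) + dirac_beta"

text \<open>The product \<open>(*)\<close> of the type \<open>complex ^ 4 ^ 4\<close> is componentwise, so the exponential
  series has to be written with the matrix product.\<close>

definition matrix_exp :: "complex ^ 'n ^ 'n \<Rightarrow> complex ^ 'n ^ 'n" where
  "matrix_exp A = (\<Sum>k. (1 / fact k) *\<^sub>R (((**) A) ^^ k) (mat 1))"

definition dirac_flow :: "(real ^ 3 \<Rightarrow> complex ^ 4) \<Rightarrow> real \<Rightarrow> real ^ 3 \<Rightarrow> complex ^ 4" where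
  "dirac_flow f t =
     inverse_fourier
       (\<lambda>\<xi>. matrix_exp (mat (- \<i> * complex_of_real t) ** dirac_symbol \<xi>) *v fourier f \<xi>)"

end

theory Submission
  imports Defs "HOL-Probability.Characteristic_Functions"
begin

text \<open>
  The symbol \<open>\<alpha> \<cdot> \<xi> + \<beta>\<close> squares to \<open>\<langle>\<xi>\<rangle>\<^sup>2\<close>, so the flow is the sum of the two half waves with phases
  \<open>\<plusminus> t \<langle>\<xi>\<rangle>\<close>, and by the \<open>T T\<^sup>*\<close> argument everything rests on the kernel
  \<open>K(t, z) = \<integral> e\<^bsup>i(z \<xi> + t \<langle>\<xi>\<rangle>)\<^esup> \<langle>\<xi>\<rangle>\<^bsup>-2\<sigma>\<^esup> d\<xi>\<close>, cut off to \<open>\<bar>\<xi>\<bar> \<le> R\<close> with bounds uniform in \<open>R\<close>. In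
  polar coordinates the angular integral is explicit, and one integration by parts yields
  \<open>\<bar>K\<bar> \<le> C max(\<bar>t\<bar>, \<bar>z\<bar>)\<^bsup>-a\<^esup>\<close> for \<open>a = 1\<close>, which governs the large scales, and for some
  \<open>a < 2 / q' + 6 / r'\<close> with \<open>a > 3 - 2 \<sigma>\<close>, which makes the singularity integrable on unit cubes and unit
  time intervals. No further decay is needed: summing over the cubes (Young's inequality in the
  weighted arithmetic-geometric form) leaves the factor \<open>(1 + \<bar>t\<bar>)\<^bsup>6/r - 1\<^esup> = (1 + \<bar>t\<bar>)\<^bsup>-2/q\<^esup>\<close>, and the
  sum over the time intervals is a discrete Hardy-Littlewood-Sobolev inequality.

  As the flow at each time is only determined up to a null set, the estimates are carried out for
  the jointly measurable function \<open>liminf\<^sub>n \<bar>u\<^sub>n\<bar>\<close>, with \<open>u\<^sub>n\<close> the flow truncated to frequencies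
  \<open>\<bar>\<xi>\<bar> \<le> R\<^sub>n\<close>; it equals the norm of the flow almost everywhere at every time.
\<close>

text \<open>The singularity of order \<open>a\<close> is shared between the variables as
  \<open>|t|^-b |z|^-(a - b)\<close>. Young's inequality on pairs of unit cells asks for local
  integrability of the \<open>r'/2\<close>-th power in space and of the \<open>q'/2\<close>-th power
  in time, that is \<open>a - b < 6/r'\<close> and \<open>b < 2/q'\<close>, with
  \<open>b = 0\<close> for infinite \<open>q'\<close>; the gap hypothesis leaves room for such a
  splitting. The condition \<open>r > 6\<close> makes the \<open>r/2\<close>-th power of the decay
  of order 1 summable over the cubes. The cutoff \<open>R\<close> is kept because for \<sigma> \<le>
  3/2 the kernel integral does not converge absolutely. The obstacle is duality for norms that might
  be infinite a priori, with test functions that must depend measurably on time. Therefore the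
  estimates live in \<open>ennreal\<close>, extremizers are given by formulas and not by choice,
  they are applied to bounded truncations of bounded support, and monotone convergence removes the
  truncations. The transforms in the statement are picked by \<open>SOME\<close>, so they carry no
  information before existence and inversion are known; this is why Plancherel's theorem is
  developed, by Gaussian regularization.\<close>

abbreviation nn_integral_lborel :: "('a::euclidean_space \<Rightarrow> ennreal) \<Rightarrow> ennreal" (binder "\<integral>" 10) where
  "nn_integral_lborel f \<equiv> nn_integral lborel f"

abbreviation nn_sum :: "('i \<Rightarrow> ennreal) \<Rightarrow> ennreal" (binder "\<Sum>\<^sub>+" 10) where
  "nn_sum f \<equiv> nn_integral (count_space UNIV) f"

abbreviation borel_fun :: "('a::topological_space \<Rightarrow> 'b::topological_space) set" where
  "borel_fun \<equiv> borel_measurable borel"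

abbreviation epowr :: "ennreal \<Rightarrow> real \<Rightarrow> ennreal" where
  "epowr \<equiv> ennreal_powr"

section \<open>Powers of extended nonnegative reals\<close>

lemma ennreal_powr_ennreal [simp]: "x \<ge> 0 ==> epowr (ennreal x) a = ennreal (x powr a)"
  by (simp add: ennreal_powr_def)

lemma ennreal_powr_top [simp]: "epowr top a = top"
  by (simp add: ennreal_powr_def)

lemma ennreal_powr_0 [simp]: "epowr 0 a = 0"
  by (simp add: ennreal_powr_def)

lemma ennreal_powr_1 [simp]: "epowr 1 a = 1"
  by (simp add: ennreal_powr_def)

lemma ennreal_powr_one [simp]: "epowr x 1 = x"
  by (cases x) (simp_all add: ennreal_powr_def)

lemma ennreal_powr_mono:
  assumes "x \<le> y" "a \<ge> 0" shows "epowr x a \<le> epowr y a"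
proof (cases "y = top")
  case False
  then show ?thesis using assms
    by (auto simp: ennreal_powr_def top_unique enn2real_mono less_top[symmetric] intro!: ennreal_leI powr_mono2)
qed simp

lemma ennreal_powr_mult: "epowr (x * y) a = epowr x a * epowr y a"
  by (cases x; cases y)
     (auto simp: ennreal_powr_def enn2real_mult powr_mult ennreal_mult' ennreal_mult_eq_top_iff
       ennreal_top_mult ennreal_mult_top)

lemma ennreal_powr_powr: "epowr (epowr x a) b = epowr x (a * b)"
  by (simp add: ennreal_powr_def powr_powr)

lemma ennreal_powr_inverse [simp]:
  assumes "a \<noteq> 0"
  shows "epowr (epowr x a) (1 / a) = x" "epowr (epowr x (1 / a)) a = x"
  using assms by (simp_all add: ennreal_powr_powr)

lemma ennreal_powr_measurable [measurable]:
  assumes "f \<in> borel_measurable M"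
  shows "(\<lambda>x. epowr (f x) a) \<in> borel_measurable M"
  unfolding ennreal_powr_def using assms by measurable

lemma ennreal_powr_le_iff:
  assumes "a > 0" shows "epowr x a \<le> epowr y a \<longleftrightarrow> x \<le> y"
proof
  assume "epowr x a \<le> epowr y a"
  then have "epowr (epowr x a) (1 / a) \<le> epowr (epowr y a) (1 / a)"
    using assms by (intro ennreal_powr_mono[of "epowr x a"]) auto
  moreover have "a \<noteq> 0" using assms by simp
  ultimately show "x \<le> y" by (simp only: ennreal_powr_inverse(1)[OF \<open>a \<noteq> 0\<close>])
qed (use assms in \<open>auto intro: ennreal_powr_mono\<close>)

lemma ennreal_powr_le_powr_iff:
  assumes "a > 0" shows "epowr x (1 / a) \<le> y \<longleftrightarrow> x \<le> epowr y a"
  using ennreal_powr_le_iff[OF assms, of "epowr x (1 / a)" y] assms by simp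

lemma ennreal_powr_eq_0_iff [simp]: "epowr x a = 0 \<longleftrightarrow> x = 0"
  by (cases x) (auto simp: ennreal_powr_def)

lemma ennreal_powr_eq_top_iff [simp]: "epowr x a = top \<longleftrightarrow> x = top"
  by (auto simp: ennreal_powr_def)

lemma ennreal_powr_SUP:
  assumes "a > 0" shows "epowr (SUP i\<in>I. f i) a = (SUP i\<in>I. epowr (f i) a)"
proof (rule antisym)
  have "f i \<le> epowr (SUP i\<in>I. epowr (f i) a) (1 / a)" if "i \<in> I" for i
  proof -
    have "epowr (epowr (f i) a) (1 / a) \<le> epowr (SUP i\<in>I. epowr (f i) a) (1 / a)"
      using assms that by (intro ennreal_powr_mono SUP_upper) auto
    then show ?thesis using assms by simp
  qed
  then have "(SUP i\<in>I. f i) \<le> epowr (SUP i\<in>I. epowr (f i) a) (1 / a)"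
    by (rule SUP_least)
  then have "epowr (SUP i\<in>I. f i) a \<le> epowr (epowr (SUP i\<in>I. epowr (f i) a) (1 / a)) a"
    using assms by (intro ennreal_powr_mono) auto
  then show "epowr (SUP i\<in>I. f i) a \<le> (SUP i\<in>I. epowr (f i) a)"
    using assms by simp
qed (use assms in \<open>auto intro!: SUP_least ennreal_powr_mono SUP_upper\<close>)

text \<open>The sum is at most \<open>card A\<close> times its largest term. This crude argument
  covers all \<open>a \<ge> 0\<close>, in particular the exponents \<open>1 / e\<close> below 1 that
  occur when a root is taken.\<close>

lemma ennreal_powr_sum_le:
  assumes "finite A" "a \<ge> 0"
  shows "epowr (\<Sum>i\<in>A. f i) a \<le> ennreal (real (card A) powr a) * (\<Sum>i\<in>A. epowr (f i) a)"
proof (cases "A = {}")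
  case False
  define m where "m = Max (f ` A)"
  have m: "m \<in> f ` A" "\<And>i. i \<in> A ==> f i \<le> m"
    using assms False by (auto simp: m_def)
  then obtain j where j: "j \<in> A" "m = f j" by auto
  have "(\<Sum>i\<in>A. f i) \<le> of_nat (card A) * m"
    using sum_bounded_above[of A f m] m by auto
  then have "epowr (\<Sum>i\<in>A. f i) a \<le> epowr (of_nat (card A) * m) a"
    using assms by (intro ennreal_powr_mono)
  also have "... = ennreal (real (card A) powr a) * epowr (f j) a"
    by (simp add: ennreal_powr_mult j flip: ennreal_of_nat_eq_real_of_nat)
       (simp add: ennreal_of_nat_eq_real_of_nat)
  also have "epowr (f j) a \<le> (\<Sum>i\<in>A. epowr (f i) a)"
    using assms j by (intro member_le_sum) auto
  finally show ?thesis by (simp add: mult_left_mono)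
qed simp

section \<open>Young's inequality as a trilinear weighted arithmetic-geometric mean\<close>

lemma weighted_am_gm3:
  fixes x y z a b c :: real
  assumes "x > 0" "y > 0" "z > 0" "a \<ge> 0" "b \<ge> 0" "c \<ge> 0" "a + b + c = 1"
  shows "x powr a * y powr b * z powr c \<le> a * x + b * y + c * z"
proof -
  define m where "m = a * x + b * y + c * z"
  define l where "l = min x (min y z)"
  have "l = (a + b + c) * l" using assms by simp
  also have "... = a * l + b * l + c * l" by (simp add: distrib_right)
  also have "... \<le> m"
    unfolding m_def l_def using assms by (intro add_mono mult_left_mono) auto
  finally have m: "m > 0" using assms by (auto simp: l_def)
  \<comment> \<open>Tangent to \<open>ln\<close> at the mean \<open>m\<close>: in the weighted sum
    of the three tangent bounds the linear parts cancel and \<open>ln m\<close> remains. The minimum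
    \<open>l\<close> above only serves to see that \<open>m\<close> is positive.\<close>
  have L: "ln u \<le> ln m + (u / m - 1)" if "u > 0" for u
    using ln_le_minus_one[of "u / m"] that m by (simp add: ln_div)
  have mm: "m / m = a * (x / m) + b * (y / m) + c * (z / m)"
    by (subst (1) m_def) (simp add: add_divide_distrib)
  have "a * ln x + b * ln y + c * ln z
      \<le> a * (ln m + (x / m - 1)) + b * (ln m + (y / m - 1)) + c * (ln m + (z / m - 1))"
    using assms by (intro add_mono mult_left_mono L) auto
  also have "... = (a + b + c) * (ln m - 1) + m / m"
    unfolding mm by (simp only: distrib_left distrib_right right_diff_distrib left_diff_distrib)
  also have "... = ln m" using assms m by simp
  finally have "exp (a * ln x + b * ln y + c * ln z) \<le> m" using m
    by (metis exp_le_cancel_iff exp_ln)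
  then show ?thesis using assms by (simp add: powr_def exp_add m_def)
qed

text \<open>Weighted means of the three products \<open>f^p g^p\<close>, \<open>f^p k^(q/2)\<close>,
  \<open>g^p k^(q/2)\<close> with weights \<open>2/p - 1\<close>, \<open>1/q\<close>,
  \<open>1/q\<close>. As \<open>1/q = 1 - 1/p\<close>, the weights add up to 1 and each of
  \<open>f\<close>, \<open>g\<close>, \<open>k\<close> gets total exponent 1 in the geometric mean;
  \<open>p \<le> 2\<close> keeps the first weight nonnegative.\<close>

lemma trilinear_young_pointwise:
  fixes f g k :: ennreal
  assumes p: "p > 1" "p \<le> 2" and q: "q = p / (p - 1)"
  shows "f * g * k \<le> ennreal (2 / p - 1) * (epowr f p * epowr g p)
      + (ennreal (1 / q) * (epowr f p * epowr k (q / 2))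
       + ennreal (1 / q) * (epowr g p * epowr k (q / 2)))"
proof -
  have q0: "q > 0" using p by (simp add: q)
  consider "f = 0 \<or> g = 0 \<or> k = 0" | "f \<noteq> 0" "g \<noteq> 0" "k \<noteq> 0" "f = top \<or> g = top \<or> k = top"
    | "f \<noteq> 0" "g \<noteq> 0" "k \<noteq> 0" "f \<noteq> top" "g \<noteq> top" "k \<noteq> top" by blast
  then show ?thesis
  proof cases
    case 1
    then show ?thesis by auto
  next
    case 2
    \<comment> \<open>An infinite factor makes one of the last two products infinite, because the
      other factors are nonzero and the weight \<open>1 / q\<close> is positive.\<close>
    then have "ennreal (1 / q) * (epowr f p * epowr k (q / 2)) = top
       \<or> ennreal (1 / q) * (epowr g p * epowr k (q / 2)) = top"
      using q0 by (auto simp: ennreal_mult_eq_top_iff)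
    then show ?thesis by auto
  next
    case 3
    then obtain a b c where abc: "f = ennreal a" "g = ennreal b" "k = ennreal c" "a > 0" "b > 0" "c > 0"
      by (cases f; cases g; cases k) (auto simp: less_le)
    have e1: "p * (2 / p - 1) + p * (1 / q) = 1" "q / 2 * (1 / q) = 1/2" "(2 / p - 1) + 1 / q + 1 / q = 1"
      using p by (auto simp: q field_simps)
    have "(a powr p * b powr p) powr (2 / p - 1) * (a powr p * c powr (q/2)) powr (1/q)
            * (b powr p * c powr (q/2)) powr (1/q)
      \<le> (2 / p - 1) * (a powr p * b powr p) + 1 / q * (a powr p * c powr (q/2))
        + 1 / q * (b powr p * c powr (q/2))"
      using abc e1 p q0 by (intro weighted_am_gm3) auto
    also have "(a powr p * b powr p) powr (2 / p - 1) * (a powr p * c powr (q/2)) powr (1/q)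
            * (b powr p * c powr (q/2)) powr (1/q)
       = a powr (p * (2 / p - 1) + p * (1 / q)) * b powr (p * (2 / p - 1) + p * (1 / q))
         * c powr (q / 2 * (1 / q) + q / 2 * (1 / q))"
      using abc unfolding powr_add by (simp add: powr_mult powr_powr mult_ac)
    also have "... = a * b * c" unfolding e1 using abc by simp
    finally have F: "a * b * c \<le> (2 / p - 1) * (a powr p * b powr p) + (1 / q * (a powr p * c powr (q/2))
        + 1 / q * (b powr p * c powr (q/2)))" by simp
    have "2 / p - 1 \<ge> 0" using p by simp
    then show ?thesis
      using abc F q0 p by (simp add: ennreal_mult'[symmetric] ennreal_plus[symmetric] del: ennreal_plus)
  qed
qed

lemma nn_integral_lin3:
  fixes a b c :: ennreal
  assumes "f \<in> borel_measurable M" "g \<in> borel_measurable M" "h \<in> borel_measurable M"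
  shows "(\<integral>\<^sup>+x. a * f x + (b * g x + c * h x) \<partial>M)
    = a * (\<integral>\<^sup>+x. f x \<partial>M) + (b * (\<integral>\<^sup>+x. g x \<partial>M) + c * (\<integral>\<^sup>+x. h x \<partial>M))"
  using assms by (simp add: nn_integral_add nn_integral_cmult)

text \<open>Dual form of the statement that a kernel whose \<open>q/2\<close>-norms in each variable
  are at most \<open>K\<close> maps \<open>L^p\<close> to the conjugate \<open>L^q\<close>. The
  pointwise bound is integrated: each of the three products has integral at most 1 once
  \<open>k\<close> is divided by \<open>K\<close>, and the weights add up to 1.\<close>

lemma trilinear_young:
  assumes M: "sigma_finite_measure M" and N: "sigma_finite_measure N"
    and p: "p > 1" "p \<le> 2" and q: "q = p / (p - 1)" and K: "K > 0"
    and [measurable]: "f \<in> borel_measurable M" "g \<in> borel_measurable N"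
      "(\<lambda>(x, y). k x y) \<in> borel_measurable (M \<Otimes>\<^sub>M N)"
    and f: "(\<integral>\<^sup>+x. epowr (f x) p \<partial>M) \<le> 1" and g: "(\<integral>\<^sup>+y. epowr (g y) p \<partial>N) \<le> 1"
    and k1: "\<And>x. x \<in> space M ==> (\<integral>\<^sup>+y. epowr (k x y) (q / 2) \<partial>N) \<le> ennreal (K powr (q / 2))"
    and k2: "\<And>y. y \<in> space N ==> (\<integral>\<^sup>+x. epowr (k x y) (q / 2) \<partial>M) \<le> ennreal (K powr (q / 2))"
  shows "(\<integral>\<^sup>+x. \<integral>\<^sup>+y. f x * g y * k x y \<partial>N \<partial>M) \<le> ennreal K"
proof -
  interpret M: sigma_finite_measure M by fact
  interpret N: sigma_finite_measure N by fact
  interpret P: pair_sigma_finite M N ..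
  have q0: "q > 0" using p by (simp add: q)
  define k' where "k' x y = ennreal (1 / K) * k x y" for x y
  have kk: "k x y = ennreal K * k' x y" for x y
    using K unfolding k'_def by (simp add: mult.assoc[symmetric] ennreal_mult'[symmetric])
  have [measurable]: "(\<lambda>(x, y). k' x y) \<in> borel_measurable (M \<Otimes>\<^sub>M N)"
    unfolding k'_def by measurable
  have c1: "ennreal (K powr (- (q/2))) * ennreal (K powr (q / 2)) = 1"
    using K by (simp add: ennreal_mult'[symmetric] powr_add[symmetric])
  have kp: "epowr (k' x y) (q / 2) = ennreal (K powr (- (q/2))) * epowr (k x y) (q / 2)" for x y
    using K unfolding k'_def by (simp add: ennreal_powr_mult powr_minus powr_divide inverse_eq_divide)
  have k1': "(\<integral>\<^sup>+y. epowr (k' x y) (q / 2) \<partial>N) \<le> 1" if [simp]: "x \<in> space M" for x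
  proof -
    have "(\<integral>\<^sup>+y. epowr (k' x y) (q / 2) \<partial>N)
      = ennreal (K powr (- (q/2))) * (\<integral>\<^sup>+y. epowr (k x y) (q / 2) \<partial>N)"
      unfolding kp by (intro nn_integral_cmult) simp
    then show ?thesis using mult_left_mono[OF k1[OF that], of "ennreal (K powr (- (q/2)))"] c1 by simp
  qed
  have k2': "(\<integral>\<^sup>+x. epowr (k' x y) (q / 2) \<partial>M) \<le> 1" if [simp]: "y \<in> space N" for y
  proof -
    have "(\<integral>\<^sup>+x. epowr (k' x y) (q / 2) \<partial>M)
      = ennreal (K powr (- (q/2))) * (\<integral>\<^sup>+x. epowr (k x y) (q / 2) \<partial>M)"
      unfolding kp by (intro nn_integral_cmult) simp
    then show ?thesis using mult_left_mono[OF k2[OF that], of "ennreal (K powr (- (q/2)))"] c1 by simp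
  qed
  define I1 where "I1 = (\<integral>\<^sup>+x. \<integral>\<^sup>+y. epowr (f x) p * epowr (g y) p \<partial>N \<partial>M)"
  define I2 where "I2 = (\<integral>\<^sup>+x. \<integral>\<^sup>+y. epowr (f x) p * epowr (k' x y) (q/2) \<partial>N \<partial>M)"
  define I3 where "I3 = (\<integral>\<^sup>+x. \<integral>\<^sup>+y. epowr (g y) p * epowr (k' x y) (q/2) \<partial>N \<partial>M)"
  have "I1 = (\<integral>\<^sup>+x. epowr (f x) p \<partial>M) * (\<integral>\<^sup>+y. epowr (g y) p \<partial>N)"
    unfolding I1_def by (simp add: nn_integral_cmult nn_integral_multc)
  then have I1: "I1 \<le> 1" using mult_mono[OF f g] by simp
  have "I2 = (\<integral>\<^sup>+x. epowr (f x) p * (\<integral>\<^sup>+y. epowr (k' x y) (q/2) \<partial>N) \<partial>M)"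
    unfolding I2_def by (intro nn_integral_cong nn_integral_cmult) simp
  also have "... \<le> (\<integral>\<^sup>+x. epowr (f x) p * 1 \<partial>M)"
    by (intro nn_integral_mono mult_left_mono k1') auto
  finally have I2: "I2 \<le> 1" using f by simp
  have "I3 = (\<integral>\<^sup>+y. \<integral>\<^sup>+x. epowr (g y) p * epowr (k' x y) (q/2) \<partial>M \<partial>N)"
    unfolding I3_def by (rule P.Fubini'[symmetric]) simp
  also have "... = (\<integral>\<^sup>+y. epowr (g y) p * (\<integral>\<^sup>+x. epowr (k' x y) (q/2) \<partial>M) \<partial>N)"
    by (intro nn_integral_cong nn_integral_cmult) simp
  also have "... \<le> (\<integral>\<^sup>+y. epowr (g y) p * 1 \<partial>N)"
    by (intro nn_integral_mono mult_left_mono k2') auto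
  finally have I3: "I3 \<le> 1" using g by simp
  have "(\<integral>\<^sup>+x. \<integral>\<^sup>+y. f x * g y * k' x y \<partial>N \<partial>M)
     \<le> (\<integral>\<^sup>+x. \<integral>\<^sup>+y. ennreal (2 / p - 1) * (epowr (f x) p * epowr (g y) p)
      + (ennreal (1 / q) * (epowr (f x) p * epowr (k' x y) (q / 2))
       + ennreal (1 / q) * (epowr (g y) p * epowr (k' x y) (q / 2))) \<partial>N \<partial>M)"
    by (intro nn_integral_mono trilinear_young_pointwise p q)
  also have "... = ennreal (2 / p - 1) * I1 + (ennreal (1 / q) * I2 + ennreal (1 / q) * I3)"
    unfolding I1_def I2_def I3_def
    by (subst nn_integral_lin3[symmetric], measurable)
       (intro nn_integral_cong nn_integral_lin3, measurable)
  also have "... \<le> ennreal (2 / p - 1) * 1 + (ennreal (1 / q) * 1 + ennreal (1 / q) * 1)"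
    by (intro add_mono mult_left_mono I1 I2 I3) auto
  also have "... = ennreal ((2 / p - 1) + (1 / q + 1 / q))"
    using p q0 by (simp add: ennreal_plus[symmetric] del: ennreal_plus)
  also have "(2 / p - 1) + (1 / q + 1 / q) = 1" using p by (simp add: q field_simps)
  finally have A: "(\<integral>\<^sup>+x. \<integral>\<^sup>+y. f x * g y * k' x y \<partial>N \<partial>M) \<le> 1" by simp
  have "(\<integral>\<^sup>+x. \<integral>\<^sup>+y. f x * g y * k x y \<partial>N \<partial>M) = (\<integral>\<^sup>+x. \<integral>\<^sup>+y. ennreal K * (f x * g y * k' x y) \<partial>N \<partial>M)"
    by (simp add: kk mult_ac)
  also have "... = ennreal K * (\<integral>\<^sup>+x. \<integral>\<^sup>+y. f x * g y * k' x y \<partial>N \<partial>M)"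
    by (subst nn_integral_cmult[symmetric], measurable) (intro nn_integral_cong nn_integral_cmult, measurable)
  also have "... \<le> ennreal K" using mult_left_mono[OF A, of "ennreal K"] by simp
  finally show ?thesis .
qed

section \<open>Polar coordinates in three dimensions\<close>

lemma prod_Basis_vec3: "(\<Prod>b\<in>Basis. (u::real^3) \<bullet> b) = u $ 1 * u $ 2 * u $ 3"
proof -
  have "(\<Prod>b\<in>Basis. u \<bullet> b) = (\<Prod>i\<in>UNIV. u $ i)"
  proof -
    have "(Basis :: (real^3) set) = (\<lambda>i. axis i 1) ` UNIV"
      by (auto simp: Basis_vec_def)
    then have "(\<Prod>b\<in>Basis. u \<bullet> b) = (\<Prod>b\<in>(\<lambda>i::3. axis i (1::real)) ` UNIV. u \<bullet> b)"
      by (rule arg_cong)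
    also have "... = (\<Prod>i\<in>UNIV. u \<bullet> axis i 1)"
      by (subst prod.reindex) (auto simp: inj_on_def axis_eq_axis)
    finally show ?thesis by (simp only: inner_axis inner_real_def mult_1_right)
  qed
  then show ?thesis unfolding UNIV_3 by (simp add: mult.assoc)
qed

text \<open>Carries Lebesgue measure from the nested product to \<open>real^3\<close>, so that
  integrals over \<open>real^3\<close> can be iterated.\<close>

definition vec_of_triple :: "real \<times> real \<times> real => real^3" where
  "vec_of_triple = (\<lambda>(a, b, c). vector [a, b, c])"

lemma measurable_vec_of_triple [measurable]:
  "vec_of_triple \<in> borel_measurable (borel :: (real \<times> real \<times> real) measure)"
  unfolding vec_of_triple_def
  by (intro borel_measurable_continuous_onI, subst continuous_on_componentwise)
     (auto simp: Basis_vec_def inner_axis split_beta forall_3 vector_3 intro!: continuous_intros)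

lemma emeasure_lborel_Times:
  assumes "A \<in> sets borel" "B \<in> sets borel"
  shows "emeasure (lborel :: ('a::euclidean_space \<times> 'b::euclidean_space) measure) (A \<times> B)
    = emeasure lborel A * emeasure lborel B"
  using assms by (simp add: lborel_prod[symmetric] lborel.emeasure_pair_measure_Times)

lemma nn_integral_lborel_pair:
  fixes f :: "'a::euclidean_space \<times> 'b::euclidean_space => ennreal"
  assumes "f \<in> borel_fun"
  shows "(\<integral>p. f p) = (\<integral>x. \<integral>y. f (x, y))"
proof -
  have "f \<in> borel_measurable (lborel \<Otimes>\<^sub>M lborel)" using assms by (simp add: lborel_prod)
  from lborel.nn_integral_fst[OF this] show ?thesis by (simp add: lborel_prod)
qed

lemma lborel_vec_of_triple:
  "distr lborel borel vec_of_triple = (lborel :: (real^3) measure)"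
proof (rule lborel_eqI[symmetric])
  fix l u :: "real^3" assume lu: "\<And>b. b \<in> Basis ==> l \<bullet> b \<le> u \<bullet> b"
  have l: "l $ i \<le> u $ i" for i using lu[of "axis i 1"] by (auto simp: inner_axis Basis_vec_def)
  have "vec_of_triple -` box l u =
    {l $ 1<..<u $ 1} \<times> ({l $ 2<..<u $ 2} \<times> {l $ 3<..<u $ 3})"
    by (auto simp: vec_of_triple_def mem_box_cart forall_3 vector_3)
  then have "emeasure (distr lborel borel vec_of_triple) (box l u)
     = emeasure lborel ({l $ 1<..<u $ 1} \<times> ({l $ 2<..<u $ 2} \<times> {l $ 3<..<u $ 3}))"
    by (subst emeasure_distr) auto
  also have "... = ennreal (u $ 1 - l $ 1) * (ennreal (u $ 2 - l $ 2) * ennreal (u $ 3 - l $ 3))"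
    by (simp add: emeasure_lborel_Times borel_Times l)
  also have "... = (\<Prod>b\<in>Basis. (u - l) \<bullet> b)"
    by (simp add: prod_Basis_vec3 ennreal_mult'[symmetric] l mult.assoc)
  finally show "emeasure (distr lborel borel vec_of_triple) (box l u)
    = (\<Prod>b\<in>Basis. (u - l) \<bullet> b)" .
qed simp

lemma borel_measurable_orthogonal:
  fixes f :: "'a::euclidean_space => 'a"
  assumes "orthogonal_transformation f"
  shows "f \<in> borel_fun"
proof -
  have "bounded_linear f"
    using orthogonal_transformation_linear[OF assms] by (simp add: linear_conv_bounded_linear)
  then show ?thesis by (intro borel_measurable_continuous_onI linear_continuous_on)
qed

lemma lborel_orthogonal:
  fixes f :: "real^'n::{finite,wellorder} => real^'n::_"
  assumes f: "orthogonal_transformation f"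
  shows "distr lborel borel f = lborel"
proof (rule lborel_eqI[symmetric])
  have [measurable]: "f \<in> borel_fun"
    by (rule borel_measurable_orthogonal[OF f])
  fix l u :: "real^'n::{finite,wellorder}" assume lu: "\<And>b. b \<in> Basis ==> l \<bullet> b \<le> u \<bullet> b"
  have g: "orthogonal_transformation (inv f)" using f by (rule orthogonal_transformation_inv)
  have e: "f -` box l u = inv f ` box l u"
    using orthogonal_transformation_bij[OF f] by (simp add: bij_vimage_eq_inv_image)
  have "inv f ` box l u \<in> lmeasurable" by (rule measurable_orthogonal_image[OF g]) simp
  then have "emeasure lebesgue (f -` box l u) = ennreal (measure lebesgue (box l u))"
    unfolding e by (subst emeasure_eq_measure2) (auto simp: measure_orthogonal_image[OF g])
  also have "... = emeasure lborel (box l u)"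
    using emeasure_lborel_box_finite[of l u] by (subst emeasure_eq_ennreal_measure[symmetric]) auto
  finally have "emeasure lborel (f -` box l u) = emeasure lborel (box l u)"
    using measurable_sets[of f borel borel "box l u"] by simp
  then show "emeasure (distr lborel borel f) (box l u) = (\<Prod>b\<in>Basis. (u - l) \<bullet> b)"
    by (subst emeasure_distr) (auto simp: emeasure_lborel_box lu)
qed simp

text \<open>Both measures are compared on the half-lines \<open>{..w}\<close>: each gives the area
  \<open>pi (w^2 - a^2)\<close> of the disc of radius \<open>sqrt (w^2 - a^2)\<close>, and 0 if
  \<open>w < |a|\<close>.\<close>

lemma distr_disc:
  "distr (lborel :: (real \<times> real) measure) borel (\<lambda>y. sqrt (a\<^sup>2 + (norm y)\<^sup>2))
   = density lborel (\<lambda>s. ennreal (2 * pi * s) * indicator {\<bar>a\<bar>..} s)" (is "?M = ?N")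
proof (rule measure_eqI_generator_eq[where \<Omega> = UNIV and E = "range atMost" and A = "\<lambda>n::nat. {..real n}"])
  have M: "emeasure ?M {..w} = (if w < \<bar>a\<bar> then 0 else ennreal (pi * (w\<^sup>2 - a\<^sup>2)))" for w
  proof (cases "w < \<bar>a\<bar>")
    case True
    have "sqrt (a\<^sup>2 + (norm y)\<^sup>2) > w" for y :: "real \<times> real"
    proof -
      have "\<bar>a\<bar> \<le> sqrt (a\<^sup>2 + (norm y)\<^sup>2)" by (simp add: real_le_rsqrt)
      then show ?thesis using True by linarith
    qed
    then have "(\<lambda>y::real\<times>real. sqrt (a\<^sup>2 + (norm y)\<^sup>2)) -` {..w} = {}"
      by (intro equals0I) (metis atMost_iff not_le vimage_eq)
    then show ?thesis using True by (subst emeasure_distr) auto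
  next
    case False
    then have w: "\<bar>a\<bar> \<le> w" "w \<ge> 0" by auto
    have aw: "a\<^sup>2 \<le> w\<^sup>2" using w power_mono[of "\<bar>a\<bar>" w 2] by simp
    have "sqrt (a\<^sup>2 + (norm y)\<^sup>2) \<le> w \<longleftrightarrow> norm y \<le> sqrt (w\<^sup>2 - a\<^sup>2)" for y :: "real \<times> real"
    proof -
      have "sqrt (a\<^sup>2 + (norm y)\<^sup>2) \<le> w \<longleftrightarrow> a\<^sup>2 + (norm y)\<^sup>2 \<le> w\<^sup>2"
        using w real_le_lsqrt sqrt_le_D by blast
      also have "... \<longleftrightarrow> (norm y)\<^sup>2 \<le> w\<^sup>2 - a\<^sup>2" by linarith
      also have "... \<longleftrightarrow> norm y \<le> sqrt (w\<^sup>2 - a\<^sup>2)"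
        using real_le_rsqrt sqrt_ge_absD[of "norm y" "w\<^sup>2 - a\<^sup>2"] by auto
      finally show ?thesis .
    qed
    then have "(\<lambda>y::real\<times>real. sqrt (a\<^sup>2 + (norm y)\<^sup>2)) -` {..w} = cball 0 (sqrt (w\<^sup>2 - a\<^sup>2))"
      by auto
    then have "emeasure ?M {..w} = emeasure lborel (cball (0::real\<times>real) (sqrt (w\<^sup>2 - a\<^sup>2)))"
      by (subst emeasure_distr) auto
    also have "... = ennreal (pi * (w\<^sup>2 - a\<^sup>2))"
      using aw by (subst emeasure_cball) (auto simp: unit_ball_vol_2)
    finally show ?thesis using False by simp
  qed
  have N: "emeasure ?N {..w} = (if w < \<bar>a\<bar> then 0 else ennreal (pi * (w\<^sup>2 - a\<^sup>2)))" for w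
  proof -
    have "emeasure ?N {..w} = (\<integral>s. ennreal (2 * pi * s) * indicator {\<bar>a\<bar>..w} s)"
      by (subst emeasure_density) (auto intro!: nn_integral_cong split: split_indicator)
    also have "... = (if w < \<bar>a\<bar> then 0 else ennreal (pi * (w\<^sup>2 - a\<^sup>2)))"
    proof (cases "w < \<bar>a\<bar>")
      case False
      have "(\<integral>s. ennreal (2 * pi * s) * indicator {\<bar>a\<bar>..w} s)
        = ennreal (pi * w\<^sup>2 - pi * \<bar>a\<bar>\<^sup>2)"
        using False by (intro nn_integral_FTC_Icc) (auto intro!: derivative_eq_intros)
      then show ?thesis using False by (simp add: right_diff_distrib)
    qed simp
    finally show ?thesis .
  qed
  show "Int_stable (range (atMost :: real => _))" by (auto simp: Int_stable_def)
  show "\<And>X. X \<in> range atMost ==> emeasure ?M X = emeasure ?N X" using M N by auto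
  show "sets ?M = sigma_sets UNIV (range atMost)" "sets ?N = sigma_sets UNIV (range atMost)"
    by (simp_all add: borel_eq_atMost)
  show "(\<Union>n::nat. {..real n}) = UNIV" using real_arch_simple by blast
  show "emeasure ?M {..real n} \<noteq> \<infinity>" for n using M by simp
qed auto

text \<open>Joint law of the component along a unit vector and of the norm (Archimedes: each sphere
  projects uniformly onto a diameter). A rotation moves \<open>e\<close> to the first axis; for a
  fixed first coordinate the remaining plane is treated by \<open>distr_disc\<close>.\<close>

lemma nn_integral_radial_law:
  fixes e :: "real^3" and F :: "real \<times> real => ennreal"
  assumes e: "norm e = 1" and [measurable]: "F \<in> borel_fun"
  shows "(\<integral>x. F (e \<bullet> x, norm x))
     = (\<integral>p. ennreal (2 * pi * snd p) * (if \<bar>fst p\<bar> \<le> snd p then 1 else 0) * F p)"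
proof -
  have "norm (axis 1 1 :: real^3) = norm e" using e by simp
  then obtain f :: "real^3 => real^3" where f: "orthogonal_transformation f" "f (axis 1 1) = e"
    by (rule orthogonal_transformation_exists)
  have [measurable]: "f \<in> borel_fun"
    by (rule borel_measurable_orthogonal[OF f(1)])
  have "(\<integral>x. F (e \<bullet> x, norm x)) = (\<integral>\<^sup>+x. F (e \<bullet> x, norm x) \<partial>distr lborel borel f)"
    by (simp add: lborel_orthogonal[OF f(1)])
  also have "... = (\<integral>x. F (e \<bullet> f x, norm (f x)))"
    by (subst nn_integral_distr) auto
  also have "... = (\<integral>\<^sup>+(x :: real^3). F (x $ 1, norm x) \<partial>lborel)"
  proof (intro nn_integral_cong)
    fix x
    have "e \<bullet> f x = axis 1 1 \<bullet> x"
      using f by (metis orthogonal_transformation_def)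
    then show "F (e \<bullet> f x, norm (f x)) = F (x $ 1, norm x)"
      using f by (simp add: orthogonal_transformation_norm inner_axis')
  qed
  also have "... = (\<integral>\<^sup>+(x :: real^3). F (x $ 1, norm x) \<partial>distr lborel borel vec_of_triple)"
    by (simp add: lborel_vec_of_triple)
  also have "... = (\<integral>\<^sup>+(a, y :: real \<times> real). F (a, sqrt (a\<^sup>2 + (norm y)\<^sup>2)) \<partial>lborel)"
  proof -
    have "(\<integral>\<^sup>+(x :: real^3). F (x $ 1, norm x) \<partial>distr lborel borel vec_of_triple)
      = (\<integral>x. F (vec_of_triple x $ 1,
        norm (vec_of_triple x)))"
      by (subst nn_integral_distr) auto
    also have "... = (\<integral>\<^sup>+(a, y :: real \<times> real). F (a, sqrt (a\<^sup>2 + (norm y)\<^sup>2)) \<partial>lborel)"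
    proof (intro nn_integral_cong)
      fix x :: "real \<times> real \<times> real"
      obtain a b c where "x = (a, b, c)" by (cases x) auto
      then show "F (vec_of_triple x $ 1,
          norm (vec_of_triple x))
        = (case x of (a, y) => F (a, sqrt (a\<^sup>2 + (norm y)\<^sup>2)))"
        by (simp add: vec_of_triple_def norm_vec_def L2_set_def sum_3 vector_3 norm_Pair add.assoc)
    qed
    finally show ?thesis .
  qed
  also have "... = (\<integral>a. \<integral>\<^sup>+(y :: real \<times> real). F (a, sqrt (a\<^sup>2 + (norm y)\<^sup>2)) \<partial>lborel)"
  proof (subst nn_integral_lborel_pair)
    have "(\<lambda>p :: real \<times> real \<times> real. (fst p, sqrt ((fst p)\<^sup>2 + (norm (snd p))\<^sup>2))) \<in> borel_fun"
      by (intro borel_measurable_continuous_onI continuous_intros)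
    from measurable_compose[OF this assms(2)]
    show "(\<lambda>(a, y :: real \<times> real). F (a, sqrt (a\<^sup>2 + (norm y)\<^sup>2))) \<in> borel_fun"
      by (simp add: split_beta)
  qed simp
  also have "... = (\<integral>a. \<integral>\<^sup>+s. F (a, s) \<partial>distr (lborel :: (real \<times> real) measure) borel (\<lambda>y. sqrt (a\<^sup>2 + (norm y)\<^sup>2)))"
    by (intro nn_integral_cong, subst nn_integral_distr) auto
  also have "... = (\<integral>a. \<integral>s. ennreal (2 * pi * s) * indicator {\<bar>a\<bar>..} s * F (a, s))"
    unfolding distr_disc by (intro nn_integral_cong, subst nn_integral_density) auto
  also have "... = (\<integral>p. ennreal (2 * pi * snd p) * (if \<bar>fst p\<bar> \<le> snd p then 1 else 0) * F p)"
  proof (subst nn_integral_lborel_pair)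
    show "(\<lambda>p::real\<times>real. ennreal (2 * pi * snd p) * (if \<bar>fst p\<bar> \<le> snd p then 1 else 0) * F p) \<in> borel_fun"
      unfolding borel_prod[symmetric] by (intro borel_measurable_times_ennreal) (measurable, simp add: borel_prod)
  qed (auto intro!: nn_integral_cong split: split_indicator)
  finally show ?thesis .
qed

text \<open>The same law as an identity of measures, which also transports Bochner integrals of
  complex functions.\<close>

lemma distr_radial_law:
  fixes e :: "real^3"
  assumes "norm e = 1"
  shows "distr lborel borel (\<lambda>x. (e \<bullet> x, norm x))
     = density lborel (\<lambda>p. ennreal (2 * pi * snd p) * (if \<bar>fst p\<bar> \<le> snd p then 1 else 0))"
proof (rule measure_eqI)
  fix A assume "A \<in> sets (distr lborel borel (\<lambda>x. (e \<bullet> x, norm x)))"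
  then have [measurable]: "A \<in> sets borel" by simp
  have "emeasure (distr lborel borel (\<lambda>x. (e \<bullet> x, norm x))) A
    = (\<integral>\<^sup>+x. indicator A x \<partial>distr lborel borel (\<lambda>x. (e \<bullet> x, norm x)))" by simp
  also have "... = (\<integral>x. indicator A (e \<bullet> x, norm x))"
    by (subst nn_integral_distr) auto
  also have "... = (\<integral>p. ennreal (2 * pi * snd p) * (if \<bar>fst p\<bar> \<le> snd p then 1 else 0) * indicator A p)"
    by (rule nn_integral_radial_law[OF assms]) measurable
  also have "... = emeasure (density lborel (\<lambda>p. ennreal (2 * pi * snd p) * (if \<bar>fst p\<bar> \<le> snd p then 1 else 0))) A"
  proof -
    have "(\<lambda>p::real\<times>real. ennreal (2 * pi * snd p) * (if \<bar>fst p\<bar> \<le> snd p then 1 else 0)) \<in> borel_fun"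
      unfolding borel_prod[symmetric] by measurable
    then show ?thesis by (subst emeasure_density) auto
  qed
  finally show "emeasure (distr lborel borel (\<lambda>x. (e \<bullet> x, norm x))) A
    = emeasure (density lborel (\<lambda>p. ennreal (2 * pi * snd p) * (if \<bar>fst p\<bar> \<le> snd p then 1 else 0))) A" .
qed simp

section \<open>A discrete Hardy-Littlewood-Sobolev inequality\<close>

lemma sum_int_le_twice_sum_nat:
  fixes f :: "nat => real"
  assumes "finite M" "\<And>k. f k \<ge> 0"
  shows "\<exists>N. (\<Sum>n\<in>M. f (nat \<bar>m - n\<bar>)) \<le> 2 * (\<Sum>k<N. f k)"
proof -
  define N where "N = Suc (Max (insert 0 ((\<lambda>n. nat \<bar>m - n\<bar>) ` M)))"
  have N: "nat \<bar>m - n\<bar> < N" if "n \<in> M" for n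
    using assms that unfolding N_def by (auto intro!: le_imp_less_Suc Max_ge)
  let ?A = "(\<lambda>k. m + int k) ` {..<N}" and ?B = "(\<lambda>k. m - int k) ` {..<N}"
  have "n \<in> ?A \<union> ?B" if "n \<in> M" for n
  proof (cases "n \<ge> m")
    case True
    then show ?thesis using N[OF that] by (intro UnI1 image_eqI[of _ _ "nat \<bar>m - n\<bar>"]) auto
  next
    case False
    then show ?thesis using N[OF that] by (intro UnI2 image_eqI[of _ _ "nat \<bar>m - n\<bar>"]) auto
  qed
  then have "(\<Sum>n\<in>M. f (nat \<bar>m - n\<bar>)) \<le> (\<Sum>n\<in>?A \<union> ?B. f (nat \<bar>m - n\<bar>))"
    using assms by (intro sum_mono2) auto
  also have "... \<le> (\<Sum>n\<in>?A. f (nat \<bar>m - n\<bar>)) + (\<Sum>n\<in>?B. f (nat \<bar>m - n\<bar>))"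
    using sum.union_inter[of ?A ?B "\<lambda>n. f (nat \<bar>m - n\<bar>)"] sum_nonneg[of "?A \<inter> ?B" "\<lambda>n. f (nat \<bar>m - n\<bar>)"] assms
    by simp
  also have "(\<Sum>n\<in>?A. f (nat \<bar>m - n\<bar>)) = (\<Sum>k<N. f k)"
    by (subst sum.reindex) (auto simp: inj_on_def)
  also have "(\<Sum>n\<in>?B. f (nat \<bar>m - n\<bar>)) = (\<Sum>k<N. f k)"
    by (subst sum.reindex) (auto simp: inj_on_def)
  finally show ?thesis by (intro exI[of _ N]) simp
qed

text \<open>Mean value theorem, with the derivative of \<open>x powr m\<close> decreasing because
  \<open>m \<le> 1\<close>. The point \<open>x = 0\<close> is separate since the derivative may be
  singular there.\<close>

lemma powr_difference_bound:
  fixes x m :: real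
  assumes "x \<ge> 0" "0 < m" "m \<le> 1"
  shows "m * (1 + x) powr (m - 1) \<le> (1 + x) powr m - x powr m"
proof (cases "x = 0")
  case False
  then have x: "x > 0" using assms by simp
  obtain z where z: "x < z" "z < 1 + x" "(1 + x) powr m - x powr m = (1 + x - x) * (m * z powr (m - 1))"
  proof -
    have "\<exists>z>x. z < 1 + x \<and> (1 + x) powr m - x powr m = (1 + x - x) * (m * z powr (m - 1))"
      using x by (intro MVT2) (auto intro!: derivative_eq_intros)
    then show ?thesis using that by blast
  qed
  have "(1 + x) powr (m - 1) \<le> z powr (m - 1)"
    using z x assms by (intro powr_mono2') auto
  then show ?thesis using z assms by simp
qed (use assms in auto)

text \<open>Each term is dominated by an increment of \<open>x powr m / m\<close>, so the sum
  telescopes; the cap \<open>L + 1\<close> freezes the bound once the terms stop. The constant 2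
  absorbs \<open>L + 1 \<le> 2 L\<close> and \<open>2 powr m \<le> 2\<close>.\<close>

lemma sum_powr_near:
  fixes m L :: real
  assumes "0 < m" "m \<le> 1" "L \<ge> 1"
  shows "(\<Sum>k<N. if real k \<le> L then (1 + real k) powr (m - 1) else 0) \<le> 2 / m * L powr m"
proof -
  have "(\<Sum>k<N. if real k \<le> L then (1 + real k) powr (m - 1) else 0) \<le> (min (real N) (L + 1)) powr m / m"
  proof (induction N)
    case (Suc N)
    show ?case
    proof (cases "real N \<le> L")
      case True
      have "(\<Sum>k<Suc N. if real k \<le> L then (1 + real k) powr (m - 1) else 0)
        \<le> real N powr m / m + (1 + real N) powr (m - 1)"
        using Suc True by simp
      also have "... \<le> (1 + real N) powr m / m"
        using divide_right_mono[OF powr_difference_bound[of "real N" m], of m] assms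
        by (simp add: diff_divide_distrib)
      also have "1 + real N = min (real (Suc N)) (L + 1)" using True by auto
      finally show ?thesis .
    next
      case False
      then have "(min (real N) (L + 1)) powr m / m \<le> (min (real (Suc N)) (L + 1)) powr m / m"
        using assms by (intro divide_right_mono powr_mono2) auto
      then show ?thesis using Suc False by simp
    qed
  qed (use assms in auto)
  also have "... \<le> (2 * L) powr m / m"
    using assms by (intro divide_right_mono powr_mono2) auto
  also have "... = 2 powr m * L powr m / m" using assms by (simp add: powr_mult)
  also have "... \<le> 2 powr 1 * L powr m / m"
    using assms by (intro divide_right_mono mult_right_mono powr_mono) auto
  finally show ?thesis by simp
qed

text \<open>Telescoping: \<open>1 / (1 + N)^2\<close> is at most
  \<open>1/N - 1/(N + 1)\<close>.\<close>

lemma sum_inverse_square_far: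
  fixes L :: real
  assumes "L \<ge> 1"
  shows "(\<Sum>k<N. if real k > L then (1 + real k) powr (- 2) else 0) \<le> 1 / L"
proof -
  have "(\<Sum>k<N. if real k > L then (1 + real k) powr (- 2) else 0) \<le> (if real N > L then 1 / L - 1 / real N else 0)"
  proof (induction N)
    case (Suc N)
    show ?case
    proof (cases "real N > L")
      case True
      then have N: "real N > 0" using assms by linarith
      have "(1 + real N) powr (- 2) = 1 / (1 + real N)\<^sup>2"
        by (simp add: powr_minus_divide)
      also have "... \<le> 1 / (real N * (1 + real N))"
        using N by (intro divide_left_mono) (auto simp: power2_eq_square)
      also have "... = 1 / real N - 1 / real (Suc N)" using N by (simp add: field_simps)
      finally have "(1 + real N) powr (- 2) \<le> 1 / real N - 1 / real (Suc N)" .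
      then show ?thesis using Suc True by simp
    next
      case False
      have "1 / real (Suc N) \<le> 1 / L" if "L < real (Suc N)"
        using assms that by (intro divide_left_mono) auto
      then show ?thesis using Suc False by auto
    qed
  qed (use assms in auto)
  also have "... \<le> 1 / L" using assms by auto
  finally show ?thesis .
qed

text \<open>By symmetry only the pairs with \<open>c n \<le> c m\<close> matter, and for fixed \<open>m\<close> the sum over \<open>n\<close>
  splits at the distance \<open>c m powr (- p)\<close>: below it \<open>c n\<close> is bounded by \<open>c m\<close>, above it by Hoelder.
  This gives \<open>O(c m powr (p - 1))\<close> in both ranges.\<close>

lemma discrete_hls:
  fixes c :: "int => real" and p :: real
  assumes p: "1 < p" "p < 2" and M: "finite M" and c: "\<And>m. c m \<ge> 0" and sum: "(\<Sum>m\<in>M. c m powr p) \<le> 1"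
  shows "(\<Sum>m\<in>M. \<Sum>n\<in>M. c m * c n * (1 + real_of_int \<bar>m - n\<bar>) powr (2 / p - 2)) \<le> 2 * (4 / (2 / p - 1) + 3)"
proof -
  define \<mu> where "\<mu> = 2 / p - 1"
  have \<mu>: "0 < \<mu>" "\<mu> \<le> 1" using p by (auto simp: \<mu>_def field_simps)
  have e: "2 / p - 2 = \<mu> - 1" by (simp add: \<mu>_def)
  define K where "K k = (1 + real k) powr (\<mu> - 1)" for k
  have K0: "K k \<ge> 0" for k by (simp add: K_def)
  have Kc: "(1 + real_of_int \<bar>m - n\<bar>) powr (2 / p - 2) = K (nat \<bar>m - n\<bar>)" for m n
    by (simp add: K_def e)
  define C where "C = 4 / \<mu> + 3"
  have main: "c m * (\<Sum>n\<in>{n\<in>M. c n \<le> c m}. c n * K (nat \<bar>m - n\<bar>)) \<le> C * c m powr p" if m: "m \<in> M" for m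
  proof (cases "c m = 0")
    case False
    define v where "v = c m"
    have v: "v > 0" using False c[of m] by (simp add: v_def)
    have "v powr p \<le> (\<Sum>m\<in>M. c m powr p)" unfolding v_def
      using m M by (intro member_le_sum[of m M "\<lambda>m. c m powr p"]) auto
    then have vp: "v powr p \<le> 1" using sum by simp
    define L where "L = v powr (- p)"
    have L: "L \<ge> 1" using vp v by (simp add: L_def powr_minus field_simps)
    \<comment> \<open>The conjugate exponent satisfies \<open>(\<mu> - 1) q = -2\<close>, so the
      \<open>q\<close>-th power of the kernel is exactly the inverse square treated by
      \<open>sum_inverse_square_far\<close>.\<close>
    define q where "q = p / (p - 1)"
    have q: "q > 0" "1 / p + 1 / q = 1" "(\<mu> - 1) * q = - 2" "1 / q = (p - 1) / p"
      using p by (auto simp: q_def \<mu>_def field_simps)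
    \<comment> \<open>Scale for Young's inequality. With \<open>\<kappa> powr (- q) = L\<close> the
      far kernel sum, at most \<open>2 / L\<close>, is multiplied by \<open>L\<close>, so both Young
      terms contribute a constant times \<open>\<kappa>\<close>; and \<open>\<kappa>\<close> equals
      \<open>v powr (p - 1)\<close>, the size of the near part.\<close>
    define \<kappa> where "\<kappa> = L powr (- 1 / q)"
    have \<kappa>: "\<kappa> > 0" using L by (simp add: \<kappa>_def)
    have "\<kappa> = v powr (p / q)" using v by (simp add: \<kappa>_def L_def powr_powr)
    also have "p / q = p - 1" using p by (simp add: q_def)
    finally have \<kappa>v: "\<kappa> = v powr (p - 1)" .
    have \<kappa>q: "\<kappa> powr (- q) = L"
      unfolding \<kappa>_def powr_powr using L q(1) by simp
    have far: "c n * K k \<le> \<kappa> * (c n powr p + L * (K k powr q))" for n k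
    proof (cases "c n = 0")
      case True
      then show ?thesis using \<kappa> L by simp
    next
      case False
      then have cn: "c n > 0" using c[of n] by simp
      have Kk: "K k > 0" by (simp add: K_def)
      have "c n * (K k / \<kappa>) \<le> c n powr p / p + (K k / \<kappa>) powr q / q"
        using p q cn \<kappa> Kk by (intro Youngs_inequality) (auto simp: q_def)
      also have "... \<le> c n powr p / 1 + (K k / \<kappa>) powr q / 1"
        using p by (intro add_mono divide_left_mono) (auto simp: q_def field_simps)
      finally have "c n * (K k / \<kappa>) \<le> c n powr p + (K k / \<kappa>) powr q" by simp
      also have "(K k / \<kappa>) powr q = L * K k powr q"
        using \<kappa> Kk \<kappa>q by (simp add: powr_divide powr_minus field_simps)
      finally have "\<kappa> * (c n * (K k / \<kappa>)) \<le> \<kappa> * (c n powr p + L * (K k powr q))"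
        using \<kappa> by (intro mult_left_mono) auto
      then show ?thesis using \<kappa> by simp
    qed
    let ?k = "\<lambda>n. nat \<bar>m - n\<bar>"
    have Kq: "K k powr q = (1 + real k) powr (- 2)" for k using q by (simp add: K_def powr_powr)
    let ?near = "\<lambda>k. if real k \<le> L then K k else 0"
    let ?far = "\<lambda>k. if real k > L then (1 + real k) powr (- 2) else 0"
    have near0: "?near k \<ge> 0" and far0: "?far k \<ge> 0" for k by (simp_all add: K0)
    have "(\<Sum>n\<in>{n\<in>M. c n \<le> c m}. c n * K (?k n))
      \<le> (\<Sum>n\<in>{n\<in>M. c n \<le> c m}. v * ?near (?k n) + \<kappa> * (c n powr p + L * ?far (?k n)))"
    proof (intro sum_mono)
      fix n assume n: "n \<in> {n\<in>M. c n \<le> c m}"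
      show "c n * K (?k n) \<le> v * ?near (?k n) + \<kappa> * (c n powr p + L * ?far (?k n))"
      proof (cases "real (?k n) \<le> L")
        case True
        have "c n * K (?k n) \<le> v * K (?k n)" using n K0 by (intro mult_right_mono) (auto simp: v_def)
        then show ?thesis using True \<kappa> by (auto intro: add_increasing2)
      next
        case False
        then show ?thesis using far[of n "?k n"] by (simp add: Kq)
      qed
    qed
    also have "... \<le> (\<Sum>n\<in>M. v * ?near (?k n) + \<kappa> * (c n powr p + L * ?far (?k n)))"
      using M v \<kappa> L K0 by (intro sum_mono2) (auto intro!: add_nonneg_nonneg mult_nonneg_nonneg)
    also have "... = v * (\<Sum>n\<in>M. ?near (?k n)) + \<kappa> * ((\<Sum>n\<in>M. c n powr p) + L * (\<Sum>n\<in>M. ?far (?k n)))"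
      by (simp only: sum.distrib sum_distrib_left distrib_left)
    also have "... \<le> v * (2 * (2 / \<mu> * L powr \<mu>)) + \<kappa> * (1 + L * (2 * (1 / L)))"
    proof (intro add_mono mult_left_mono)
      obtain N where "(\<Sum>n\<in>M. ?near (?k n)) \<le> 2 * (\<Sum>k<N. ?near k)"
        using sum_int_le_twice_sum_nat[OF M, of ?near m, OF near0] by blast
      also have "... \<le> 2 * (2 / \<mu> * L powr \<mu>)"
        unfolding K_def by (rule mult_left_mono[OF sum_powr_near[OF \<mu> L]]) simp
      finally show "(\<Sum>n\<in>M. ?near (?k n)) \<le> 2 * (2 / \<mu> * L powr \<mu>)" .
      obtain N where "(\<Sum>n\<in>M. ?far (?k n)) \<le> 2 * (\<Sum>k<N. ?far k)"
        using sum_int_le_twice_sum_nat[OF M, of ?far m, OF far0] by blast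
      also have "... \<le> 2 * (1 / L)" using sum_inverse_square_far[OF L, of N] by simp
      finally show "(\<Sum>n\<in>M. ?far (?k n)) \<le> 2 * (1 / L)" .
    qed (use sum v \<kappa> L in auto)
    also have "... = 4 / \<mu> * (v * L powr \<mu>) + 3 * \<kappa>" using L by (simp add: field_simps)
    also have "v * L powr \<mu> = v powr (1 + (- p) * \<mu>)"
      using v unfolding powr_add by (simp add: L_def powr_powr)
    also have "1 + (- p) * \<mu> = p - 1" using p by (simp add: \<mu>_def field_simps)
    finally have "(\<Sum>n\<in>{n\<in>M. c n \<le> c m}. c n * K (?k n)) \<le> C * v powr (p - 1)"
      by (simp add: \<kappa>v C_def algebra_simps)
    then have "v * (\<Sum>n\<in>{n\<in>M. c n \<le> c m}. c n * K (?k n)) \<le> v * (C * v powr (p - 1))"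
      using v by (intro mult_left_mono) auto
    also have "... = C * v powr p" using v by (simp add: powr_diff)
    finally show ?thesis by (simp add: v_def)
  qed simp
  have sym: "K (nat \<bar>m - n\<bar>) = K (nat \<bar>n - m\<bar>)" for m n by (simp add: abs_minus_commute)
  let ?T = "\<Sum>m\<in>M. \<Sum>n\<in>M. if c n \<le> c m then c m * c n * K (nat \<bar>m - n\<bar>) else 0"
  have "?T = (\<Sum>m\<in>M. c m * (\<Sum>n\<in>{n\<in>M. c n \<le> c m}. c n * K (nat \<bar>m - n\<bar>)))"
    using M by (intro sum.cong refl)
       (simp add: sum_distrib_left mult.assoc sum.inter_filter[symmetric])
  also have "... \<le> (\<Sum>m\<in>M. C * c m powr p)" by (intro sum_mono main)
  also have "... = C * (\<Sum>m\<in>M. c m powr p)" by (simp add: sum_distrib_left)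
  also have "... \<le> C * 1" using sum \<mu> by (intro mult_left_mono) (auto simp: C_def)
  finally have T: "?T \<le> C" by simp
  \<comment> \<open>Every pair lies in at least one of the two halves, and the pairs with
    \<open>c m = c n\<close> in both; nonnegativity gives the inequality.\<close>
  have "(\<Sum>m\<in>M. \<Sum>n\<in>M. c m * c n * K (nat \<bar>m - n\<bar>))
     \<le> (\<Sum>m\<in>M. \<Sum>n\<in>M. (if c n \<le> c m then c m * c n * K (nat \<bar>m - n\<bar>) else 0)
         + (if c m \<le> c n then c m * c n * K (nat \<bar>m - n\<bar>) else 0))"
    using c K0 by (intro sum_mono) auto
  also have "... = ?T + (\<Sum>m\<in>M. \<Sum>n\<in>M. if c m \<le> c n then c m * c n * K (nat \<bar>m - n\<bar>) else 0)"
    by (simp only: sum.distrib)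
  also have "(\<Sum>m\<in>M. \<Sum>n\<in>M. if c m \<le> c n then c m * c n * K (nat \<bar>m - n\<bar>) else 0) = ?T"
    by (subst sum.swap, intro sum.cong refl) (simp add: mult.commute sym)
  finally have "(\<Sum>m\<in>M. \<Sum>n\<in>M. c m * c n * K (nat \<bar>m - n\<bar>)) \<le> 2 * C" using T by linarith
  then show ?thesis unfolding Kc C_def \<mu>_def .
qed

section \<open>Quadratic forms\<close>

lemma integrable_pair_mult:
  fixes f :: "'a => complex" and g :: "'b => complex"
  assumes M: "sigma_finite_measure M" and N: "sigma_finite_measure N"
    and f: "integrable M f" and g: "integrable N g"
  shows "integrable (M \<Otimes>\<^sub>M N) (\<lambda>(x, y). f x * g y)"
proof -
  interpret M: sigma_finite_measure M by fact
  interpret N: sigma_finite_measure N by fact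
  interpret P: pair_sigma_finite M N ..
  have [measurable]: "f \<in> borel_measurable M" "g \<in> borel_measurable N" using f g by auto
  show ?thesis
  proof (rule P.Fubini_integrable)
    show "(\<lambda>(x, y). f x * g y) \<in> borel_measurable (M \<Otimes>\<^sub>M N)" by measurable
    have "(\<lambda>x. LINT y|N. norm (f x * g y)) = (\<lambda>x. norm (f x) * (LINT y|N. norm (g y)))"
      by (simp add: norm_mult)
    then show "integrable M (\<lambda>x. LINT y|N. norm (case (x, y) of (x, y) => f x * g y))"
      using f by simp
    show "AE x in M. integrable N (\<lambda>y. case (x, y) of (x, y) => f x * g y)"
      using g by simp
  qed
qed

lemma borel_measurable_cnj [measurable]:
  assumes "f \<in> borel_measurable M" shows "(\<lambda>x. cnj (f x)) \<in> borel_measurable M"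
  using measurable_compose[OF assms borel_measurable_continuous_onI[OF continuous_on_cnj[OF continuous_on_id]]]
  by simp

lemma norm_integral_le_nn_integral:
  fixes f :: "'a => 'b::{banach, second_countable_topology}"
  shows "ennreal (norm (integral\<^sup>L M f)) \<le> (\<integral>\<^sup>+x. ennreal (norm (f x)) \<partial>M)"
  by (cases "integrable M f") (auto simp: integral_norm_bound_ennreal not_integrable_integral_eq)

text \<open>The \<open>T T\<^sup>*\<close> identity: \<open>\<kappa>\<close> is the kernel of \<open>T T\<^sup>*\<close> when \<open>T\<^sup>* H = (\<integral>e(p, \<cdot>) H(p) dp)\<close>.\<close>

lemma quadratic_form_kernel:
  fixes e :: "'a => 'b => complex" and H :: "'a => complex" and m :: "'b => real"
  assumes M: "sigma_finite_measure M" and N: "sigma_finite_measure N"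
    and [measurable]: "(\<lambda>(p, \<xi>). e p \<xi>) \<in> borel_measurable (M \<Otimes>\<^sub>M N)"
    and e: "\<And>p \<xi>. norm (e p \<xi>) \<le> 1"
    and H: "integrable M H" and m: "integrable N m" and m0: "\<And>\<xi>. m \<xi> \<ge> 0"
  defines "\<kappa> \<equiv> \<lambda>p p'. LINT \<xi>|N. of_real (m \<xi>) * (e p \<xi> * cnj (e p' \<xi>))"
  shows "integrable N (\<lambda>\<xi>. m \<xi> * (cmod (LINT p|M. e p \<xi> * H p))\<^sup>2)" (is ?A)
    and "of_real (LINT \<xi>|N. m \<xi> * (cmod (LINT p|M. e p \<xi> * H p))\<^sup>2)
      = (LINT q|(M \<Otimes>\<^sub>M M). H (fst q) * cnj (H (snd q)) * \<kappa> (fst q) (snd q))" (is ?B)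
proof -
  interpret M: sigma_finite_measure M by fact
  interpret N: sigma_finite_measure N by fact
  interpret MM: pair_sigma_finite M M ..
  interpret sMM: sigma_finite_measure "M \<Otimes>\<^sub>M M" by (rule MM.sigma_finite_measure_axioms)
  interpret P: pair_sigma_finite N "M \<Otimes>\<^sub>M M" ..
  have [measurable]: "H \<in> borel_measurable M" "m \<in> borel_measurable N" using H m by auto
  define F where "F \<xi> q = of_real (m \<xi>) * ((e (fst q) \<xi> * H (fst q)) * cnj (e (snd q) \<xi> * H (snd q)))" for \<xi> q
  have meas: "(\<lambda>(\<xi>, q). F \<xi> q) \<in> borel_measurable (N \<Otimes>\<^sub>M (M \<Otimes>\<^sub>M M))"
    unfolding F_def split_beta by measurable
  have HH: "integrable (M \<Otimes>\<^sub>M M) (\<lambda>(p, p'). H p * cnj (H p'))"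
    using integrable_pair_mult[OF M M H, of "\<lambda>p. cnj (H p)"] H by simp
  have mHH: "integrable (N \<Otimes>\<^sub>M (M \<Otimes>\<^sub>M M)) (\<lambda>(\<xi>, q). complex_of_real (m \<xi>) * (case q of (p, p') => H p * cnj (H p')))"
    using integrable_pair_mult[OF N MM.sigma_finite_measure_axioms _ HH, of "\<lambda>\<xi>. complex_of_real (m \<xi>)"] m by simp
  have FI: "integrable (N \<Otimes>\<^sub>M (M \<Otimes>\<^sub>M M)) (\<lambda>(\<xi>, q). F \<xi> q)"
  proof (rule Bochner_Integration.integrable_bound[OF mHH meas], intro AE_I2)
    fix z :: "'b \<times> 'a \<times> 'a"
    obtain \<xi> p p' where z: "z = (\<xi>, p, p')" by (cases z) auto
    have "norm (e p \<xi>) * norm (e p' \<xi>) \<le> 1 * 1" by (intro mult_mono e) auto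
    then have "norm (F \<xi> (p, p')) \<le> m \<xi> * (norm (H p) * norm (H p')) * 1"
      using mult_left_mono[of "norm (e p \<xi>) * norm (e p' \<xi>)" 1 "m \<xi> * (norm (H p) * norm (H p'))"] m0[of \<xi>]
      by (simp add: F_def norm_mult mult_ac)
    then show "norm (case z of (\<xi>, q) => F \<xi> q)
      \<le> norm (case z of (\<xi>, q) => complex_of_real (m \<xi>) * (case q of (p, p') => H p * cnj (H p')))"
      using m0[of \<xi>] by (simp add: z norm_mult)
  qed
  have eH: "integrable M (\<lambda>p. e p \<xi> * H p)" if "\<xi> \<in> space N" for \<xi>
  proof (rule Bochner_Integration.integrable_bound[OF H])
    show "(\<lambda>p. e p \<xi> * H p) \<in> borel_measurable M" using that by measurable
    show "AE p in M. norm (e p \<xi> * H p) \<le> norm (H p)"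
      using e by (intro AE_I2) (simp add: norm_mult mult_left_le_one_le)
  qed
  have inner: "(LINT q|(M \<Otimes>\<^sub>M M). F \<xi> q) = of_real (m \<xi> * (cmod (LINT p|M. e p \<xi> * H p))\<^sup>2)"
    if \<xi>: "\<xi> \<in> space N" for \<xi>
  proof -
    define u where "u p = e p \<xi> * H p" for p
    have u: "integrable M u" unfolding u_def by (rule eH[OF \<xi>])
    have "integrable (M \<Otimes>\<^sub>M M) (\<lambda>(p, p'). u p * cnj (u p'))"
      using integrable_pair_mult[OF M M u, of "\<lambda>p. cnj (u p)"] u by simp
    from MM.integral_fst'[OF this]
    have "(LINT q|(M \<Otimes>\<^sub>M M). u (fst q) * cnj (u (snd q))) = (LINT p|M. LINT p'|M. u p * cnj (u p'))"
      by (simp add: case_prod_unfold)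
    also have "... = (LINT p|M. u p) * cnj (LINT p'|M. u p')" by simp
    finally have "(LINT q|(M \<Otimes>\<^sub>M M). u (fst q) * cnj (u (snd q))) = of_real ((cmod (LINT p|M. u p))\<^sup>2)"
      by (simp only: complex_norm_square)
    moreover have "(LINT q|(M \<Otimes>\<^sub>M M). F \<xi> q) = of_real (m \<xi>) * (LINT q|(M \<Otimes>\<^sub>M M). u (fst q) * cnj (u (snd q)))"
      by (simp add: F_def u_def)
    ultimately show ?thesis by (simp add: u_def)
  qed
  have I1: "integrable N (\<lambda>\<xi>. LINT q|(M \<Otimes>\<^sub>M M). F \<xi> q)"
    using P.integrable_fst'[OF FI] by simp
  have I2: "integrable N (\<lambda>\<xi>. complex_of_real (m \<xi> * (cmod (LINT p|M. e p \<xi> * H p))\<^sup>2))"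
  proof -
    have "integrable N (\<lambda>\<xi>. LINT q|(M \<Otimes>\<^sub>M M). F \<xi> q)
      \<longleftrightarrow> integrable N (\<lambda>\<xi>. complex_of_real (m \<xi> * (cmod (LINT p|M. e p \<xi> * H p))\<^sup>2))"
      by (intro Bochner_Integration.integrable_cong refl inner)
    then show ?thesis using I1 by blast
  qed
  from integrable_Re[OF I2] show ?A by simp
  have "complex_of_real (LINT \<xi>|N. m \<xi> * (cmod (LINT p|M. e p \<xi> * H p))\<^sup>2)
     = (LINT \<xi>|N. LINT q|(M \<Otimes>\<^sub>M M). F \<xi> q)"
    unfolding integral_complex_of_real[symmetric]
    by (intro Bochner_Integration.integral_cong refl) (simp only: inner)
  also have "... = (LINT q|(M \<Otimes>\<^sub>M M). LINT \<xi>|N. F \<xi> q)"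
    using P.Fubini_integral[OF FI] by simp
  also have "... = (LINT q|(M \<Otimes>\<^sub>M M). H (fst q) * cnj (H (snd q)) * \<kappa> (fst q) (snd q))"
  proof (intro Bochner_Integration.integral_cong refl)
    fix q
    have "(LINT \<xi>|N. F \<xi> q) = (LINT \<xi>|N. (H (fst q) * cnj (H (snd q))) * (of_real (m \<xi>) * (e (fst q) \<xi> * cnj (e (snd q) \<xi>))))"
      by (intro Bochner_Integration.integral_cong refl) (simp add: F_def)
    also have "... = H (fst q) * cnj (H (snd q)) * \<kappa> (fst q) (snd q)"
      unfolding \<kappa>_def by (rule integral_mult_right_zero)
    finally show "(LINT \<xi>|N. F \<xi> q) = H (fst q) * cnj (H (snd q)) * \<kappa> (fst q) (snd q)" .
  qed
  finally show ?B .
qed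

text \<open>Only a majorant \<open>k\<close> of the kernel of T T* enters, and the right-hand side
  may be infinite, so no integrability has to be checked for \<open>k\<close>.\<close>

lemma quadratic_form_kernel_le:
  fixes e :: "'a => 'b => complex" and H :: "'a => complex" and m :: "'b => real"
  assumes M: "sigma_finite_measure M" and N: "sigma_finite_measure N"
    and [measurable]: "(\<lambda>(p, y). e p y) \<in> borel_measurable (M \<Otimes>\<^sub>M N)"
    and e: "\<And>p y. norm (e p y) \<le> 1"
    and H: "integrable M H" and m: "integrable N m" and m0: "\<And>y. m y \<ge> 0"
    and k [measurable]: "(\<lambda>(p, p'). k p p') \<in> borel_measurable (M \<Otimes>\<^sub>M M)"
    and \<kappa>: "\<And>p p'. ennreal (norm (LINT y|N. of_real (m y) * (e p y * cnj (e p' y)))) \<le> k p p'"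
  shows "(\<integral>\<^sup>+y. ennreal (m y * (cmod (LINT p|M. e p y * H p))\<^sup>2) \<partial>N)
    \<le> (\<integral>\<^sup>+p. \<integral>\<^sup>+p'. ennreal (norm (H p)) * ennreal (norm (H p')) * k p p' \<partial>M \<partial>M)"
proof -
  interpret M: sigma_finite_measure M by fact
  interpret N: sigma_finite_measure N by fact
  interpret MM: pair_sigma_finite M M ..
  have [measurable]: "H \<in> borel_measurable M" using H by auto
  note Q = quadratic_form_kernel[OF M N assms(3) e H m m0]
  have "(\<integral>\<^sup>+y. ennreal (m y * (cmod (LINT p|M. e p y * H p))\<^sup>2) \<partial>N)
    = ennreal (LINT y|N. m y * (cmod (LINT p|M. e p y * H p))\<^sup>2)"
    using Q(1) m0 by (intro nn_integral_eq_integral) auto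
  also have "... = ennreal (norm (complex_of_real (LINT y|N. m y * (cmod (LINT p|M. e p y * H p))\<^sup>2)))"
    using m0 by (simp add: integral_nonneg_AE)
  also have "... \<le> (\<integral>\<^sup>+q. ennreal (norm (H (fst q) * cnj (H (snd q))
       * (LINT y|N. of_real (m y) * (e (fst q) y * cnj (e (snd q) y))))) \<partial>(M \<Otimes>\<^sub>M M))"
    unfolding Q(2) by (rule norm_integral_le_nn_integral)
  also have "... \<le> (\<integral>\<^sup>+q. ennreal (norm (H (fst q))) * ennreal (norm (H (snd q))) * k (fst q) (snd q) \<partial>(M \<Otimes>\<^sub>M M))"
    by (intro nn_integral_mono) (simp add: norm_mult ennreal_mult' mult_left_mono \<kappa>)
  also have "... = (\<integral>\<^sup>+p. \<integral>\<^sup>+p'. ennreal (norm (H p)) * ennreal (norm (H p')) * k p p' \<partial>M \<partial>M)"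
    by (subst M.nn_integral_fst[symmetric]) (auto simp: split_beta)
  finally show ?thesis .
qed

section \<open>The Klein-Gordon kernel\<close>

lemma borel_measurable_cis [measurable]:
  assumes "f \<in> borel_measurable M" shows "(\<lambda>x. cis (f x)) \<in> borel_measurable M"
proof -
  have "cis \<in> borel_fun"
    by (intro borel_measurable_continuous_onI continuous_intros)
  from measurable_compose[OF assms this] show ?thesis .
qed

text \<open>Polymorphic, so that one symbol serves the frequency vector and its radius;
  \<open>bracket_norm\<close> identifies the two.\<close>

definition bracket :: "'a::real_normed_vector => real" where
  "bracket x = sqrt (1 + (norm x)\<^sup>2)"

lemma bracket_ge_1: "bracket x \<ge> 1" by (simp add: bracket_def)

lemma bracket_pos: "bracket x > 0" using bracket_ge_1[of x] by linarith

lemma borel_measurable_bracket [measurable]: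
  "bracket \<in> borel_measurable (borel :: 'a::real_normed_vector measure)"
  unfolding bracket_def by measurable

lemma bracket_neq_0 [simp]: "bracket x \<noteq> 0" using bracket_pos[of x] by simp

lemma norm_le_bracket: "norm x \<le> bracket x"
  by (simp add: bracket_def real_le_rsqrt)

lemma bracket_norm: "bracket (norm x) = bracket x" by (simp add: bracket_def)

text \<open>Fourier integral of the indicator of \<open>[-\<rho>, \<rho>]\<close> at
  \<open>c\<close>. Multiplied by \<open>2 * pi * \<rho>\<close> it is the Fourier integral of the
  surface measure of the sphere of radius \<rho> at a point of norm \<open>c\<close>.\<close>

definition slice :: "real => real => real" where
  "slice c \<rho> = (if c = 0 then 2 * \<rho> else 2 * sin (c * \<rho>) / c)"

lemma slice_integral:
  assumes "u \<ge> 0"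
  shows "(LINT s|lborel. indicator {-u..u} s *\<^sub>R cis (c * s)) = of_real (slice c u)"
proof (cases "c = 0")
  case True
  then show ?thesis using assms
    by (simp add: slice_def integral_indicator[of "{-u..u}"] scaleR_conv_of_real)
next
  case False
  define F where "F s = cis (c * s) / (\<i> * of_real c)" for s
  have "(LINT s|lborel. indicator {-u..u} s *\<^sub>R cis (c * s)) = F u - F (-u)"
  proof (rule integral_FTC_atLeastAtMost)
    show "(F has_vector_derivative cis (c * x)) (at x within {-u..u})" for x
      using False unfolding F_def has_vector_derivative_def
      by (auto intro!: derivative_eq_intros simp: fun_eq_iff scaleR_conv_of_real field_simps)
  qed (use assms in \<open>auto intro!: continuous_intros\<close>)
  also have "... = (cis (c * u) - cis (- (c * u))) / (\<i> * of_real c)"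
    by (simp add: F_def diff_divide_distrib)
  also have "cis (c * u) - cis (- (c * u)) = 2 * \<i> * of_real (sin (c * u))"
    by (simp add: complex_eq_iff)
  finally show ?thesis using False by (simp add: slice_def)
qed

text \<open>Apart from the cutoff, the integrand depends only on the norm of \<xi> and on its
  component along \<open>z\<close>, whose joint law is \<open>distr_radial_law\<close>; integrating
  out the component produces \<open>slice\<close>. For \<open>z = 0\<close> any direction will
  do.\<close>

lemma radial_fourier_integral:
  fixes h :: "real => complex" and z :: "real^3"
  assumes R: "R \<ge> 0" and [measurable]: "h \<in> borel_fun"
    and h: "\<And>\<rho>. 0 \<le> \<rho> ==> \<rho> \<le> R ==> norm (h \<rho>) \<le> B"
  shows "(LINT \<xi>|lborel. indicator (cball 0 R) \<xi> *\<^sub>R (h (norm \<xi>) * cis (z \<bullet> \<xi>)))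
    = (LINT \<rho>|lborel. indicator {0..R} \<rho> *\<^sub>R (of_real (2 * pi * \<rho>) * h \<rho> * of_real (slice (norm z) \<rho>)))"
proof -
  define c where "c = norm z"
  obtain e :: "real^3" where e: "norm e = 1" "z = c *\<^sub>R e"
  proof (cases "z = 0")
    case True
    then show ?thesis using that[of "axis 1 1"] by (simp add: c_def)
  next
    case False
    then show ?thesis using that[of "z /\<^sub>R norm z"] by (simp add: c_def)
  qed
  define g :: "real \<times> real => complex" where
    "g p = (if snd p \<le> R then h (snd p) * cis (c * fst p) else 0)" for p
  define w :: "real \<times> real => real" where "w p = (if \<bar>fst p\<bar> \<le> snd p then 2 * pi * snd p else 0)" for p
  have [measurable]: "g \<in> borel_fun" unfolding g_def borel_prod[symmetric] by measurable
  have [measurable]: "w \<in> borel_fun" unfolding w_def borel_prod[symmetric] by measurable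
  have w0: "w p \<ge> 0" for p unfolding w_def by auto
  have "(LINT \<xi>|lborel. indicator (cball 0 R) \<xi> *\<^sub>R (h (norm \<xi>) * cis (z \<bullet> \<xi>)))
     = (LINT \<xi>|lborel. g (e \<bullet> \<xi>, norm \<xi>))"
    by (intro Bochner_Integration.integral_cong) (auto simp: g_def e(2) indicator_def)
  also have "... = (LINT p|distr lborel borel (\<lambda>\<xi>. (e \<bullet> \<xi>, norm \<xi>)). g p)"
    by (subst integral_distr) auto
  also have "distr lborel borel (\<lambda>\<xi>. (e \<bullet> \<xi>, norm \<xi>)) = density lborel (\<lambda>p. ennreal (w p))"
    unfolding distr_radial_law[OF e(1)]
    by (intro arg_cong2[where f=density] refl ext) (auto simp: w_def)
  also have "(LINT p|density lborel (\<lambda>p. ennreal (w p)). g p) = (LINT p|lborel. w p *\<^sub>R g p)"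
    by (rule integral_density) (use w0 in auto)
  also have "... = (LINT p|(lborel \<Otimes>\<^sub>M lborel). (\<lambda>(x, y). w (x, y) *\<^sub>R g (x, y)) p)"
    by (simp add: lborel_prod split_beta)
  also have "... = (LINT \<rho>|lborel. LINT s|lborel. w (s, \<rho>) *\<^sub>R g (s, \<rho>))"
  proof (rule lborel_pair.integral_snd[symmetric])
    show "integrable (lborel \<Otimes>\<^sub>M lborel) (\<lambda>(x, y). w (x, y) *\<^sub>R g (x, y))"
    proof (rule integrableI_bounded_set[where A = "{-R..R} \<times> {0..R}" and B = "2 * pi * R * B"])
      show "emeasure (lborel \<Otimes>\<^sub>M lborel) ({- R..R} \<times> {0..R}) < \<infinity>"
        using R by (simp add: lborel.emeasure_pair_measure_Times ennreal_mult_less_top emeasure_lborel_Icc_eq)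
      have "norm (w p *\<^sub>R g p) \<le> 2 * pi * R * B" if "p \<in> {-R..R} \<times> {0..R}" for p
      proof -
        have "\<bar>w p\<bar> \<le> 2 * pi * R" using that R by (auto simp: w_def)
        moreover have "norm (g p) \<le> B" using that h[of "snd p"] by (auto simp: g_def norm_mult)
        ultimately show ?thesis using R by (simp add: mult_mono)
      qed
      then show "AE p in lborel \<Otimes>\<^sub>M lborel. p \<in> {-R..R} \<times> {0..R} \<longrightarrow>
          norm ((\<lambda>(x, y). w (x, y) *\<^sub>R g (x, y)) p) \<le> 2 * pi * R * B" by auto
      have "w p *\<^sub>R g p = 0" if "p \<notin> {-R..R} \<times> {0..R}" for p
        using that by (cases p) (auto simp: w_def g_def)
      then show "AE p in lborel \<Otimes>\<^sub>M lborel. p \<notin> {-R..R} \<times> {0..R} \<longrightarrow>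
          (\<lambda>(x, y). w (x, y) *\<^sub>R g (x, y)) p = 0" by auto
    qed (simp_all add: split_beta)
  qed
  also have "... = (LINT \<rho>|lborel. indicator {0..R} \<rho> *\<^sub>R (of_real (2 * pi * \<rho>) * h \<rho> * of_real (slice c \<rho>)))"
  proof (intro Bochner_Integration.integral_cong refl)
    fix \<rho> :: real
    show "(LINT s|lborel. w (s, \<rho>) *\<^sub>R g (s, \<rho>))
      = indicator {0..R} \<rho> *\<^sub>R (of_real (2 * pi * \<rho>) * h \<rho> * of_real (slice c \<rho>))"
    proof (cases "\<rho> \<in> {0..R}")
      case True
      have "(LINT s|lborel. w (s, \<rho>) *\<^sub>R g (s, \<rho>))
        = (LINT s|lborel. of_real (2 * pi * \<rho>) * h \<rho> * (indicator {-\<rho>..\<rho>} s *\<^sub>R cis (c * s)))"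
        using True by (intro Bochner_Integration.integral_cong refl)
          (auto simp: w_def g_def indicator_def scaleR_conv_of_real)
      also have "... = of_real (2 * pi * \<rho>) * h \<rho> * of_real (slice c \<rho>)"
        using True by (subst integral_mult_right_zero, subst slice_integral) auto
      finally show ?thesis using True by simp
    next
      case False
      then have "(\<lambda>s. w (s, \<rho>) *\<^sub>R g (s, \<rho>)) = (\<lambda>s. 0)" by (auto simp: w_def g_def fun_eq_iff)
      then show ?thesis using False by (simp only:) simp
    qed
  qed
  finally show ?thesis by (simp add: c_def)
qed

section \<open>The kernel and its pointwise bounds, uniform in the cutoff\<close>

definition kg_kernel :: "real => real => real => real^3 => complex" where
  "kg_kernel R \<sigma> t z = (LINT \<xi>|lborel. indicator (cball 0 R) \<xi> *\<^sub>R
     (of_real (bracket \<xi> powr (- 2 * \<sigma>)) * cis (t * bracket \<xi>) * cis (z \<bullet> \<xi>)))"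

lemma kg_kernel_radial:
  assumes "R \<ge> 0" "\<sigma> \<ge> 0"
  shows "kg_kernel R \<sigma> t z = (LINT s|lborel. indicator {0..R} s *\<^sub>R
    (of_real (2 * pi * s) * (of_real (bracket s powr (- 2 * \<sigma>)) * cis (t * bracket s))
      * of_real (slice (norm z) s)))"
proof -
  have "norm (of_real (bracket s powr (- 2 * \<sigma>)) * cis (t * bracket s)) \<le> 1" for s :: real
    using assms bracket_ge_1[of s] powr_mono[of "- 2 * \<sigma>" 0 "bracket s"] by (simp add: norm_mult)
  then show ?thesis using radial_fourier_integral[OF assms(1), where z = z and B = 1
      and h = "\<lambda>s. of_real (bracket s powr (- 2 * \<sigma>)) * cis (t * bracket s)"]
    unfolding kg_kernel_def by (simp add: bracket_norm)
qed

text \<open>The bound is uniform in \<open>R\<close>. The factor \<open>2 powr (e / 2)\<close> comes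
  from \<open>1 + s \<le> sqrt 2 * bracket s\<close>, which reduces the integral to an explicit
  primitive.\<close>

lemma bracket_integral_bound:
  assumes e: "e > 1" and R: "R \<ge> 0"
  shows "integrable lborel (\<lambda>s. indicator {0..R} s *\<^sub>R bracket (s::real) powr (- e))"
    and "(LINT s|lborel. indicator {0..R} s *\<^sub>R bracket (s::real) powr (- e)) \<le> 2 powr (e / 2) / (e - 1)"
proof -
  have cont: "continuous_on {0..R} (\<lambda>s::real. bracket s powr (- e))"
    unfolding bracket_def by (intro continuous_intros) (auto simp: add_nonneg_eq_0_iff)
  show i: "integrable lborel (\<lambda>s. indicator {0..R} s *\<^sub>R bracket (s::real) powr (- e))"
    by (intro borel_integrable_compact cont) auto
  have cont2: "continuous_on {0..R} (\<lambda>s::real. 2 powr (e / 2) * (1 + s) powr (- e))"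
    by (intro continuous_intros) auto
  have i2: "integrable lborel (\<lambda>s. indicator {0..R} s *\<^sub>R (2 powr (e / 2) * (1 + s) powr (- e)))"
    by (intro borel_integrable_compact cont2) auto
  have pw: "bracket s powr (- e) \<le> 2 powr (e / 2) * (1 + s) powr (- e)" if "s \<ge> 0" for s :: real
  proof -
    have "(1 + s) / sqrt 2 \<le> bracket s"
    proof -
      have "((1 + s) / sqrt 2)\<^sup>2 \<le> 1 + s\<^sup>2"
        using zero_le_power2[of "1 - s"] by (simp add: power_divide power2_eq_square algebra_simps)
      then show ?thesis unfolding bracket_def by (intro real_le_rsqrt) auto
    qed
    then have "bracket s powr (- e) \<le> ((1 + s) / sqrt 2) powr (- e)"
      using that e by (intro powr_mono2') auto
    also have "... = (1 + s) powr (- e) * (sqrt 2 powr e)"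
      using that by (simp add: powr_divide powr_minus field_simps)
    also have "sqrt 2 powr e = 2 powr (e / 2)"
      by (simp add: powr_half_sqrt[symmetric] powr_powr)
    finally show ?thesis by (simp add: mult.commute)
  qed
  have "(LINT s|lborel. indicator {0..R} s *\<^sub>R bracket (s::real) powr (- e))
     \<le> (LINT s|lborel. indicator {0..R} s *\<^sub>R (2 powr (e / 2) * (1 + s) powr (- e)))"
    by (intro integral_mono i i2) (auto simp: indicator_def pw)
  also have "... = - (2 powr (e / 2) / (e - 1)) * (1 + R) powr (1 - e)
      - (- (2 powr (e / 2) / (e - 1)) * (1 + 0) powr (1 - e))"
  proof (rule integral_FTC_atLeastAtMost[OF R _ cont2])
    fix s :: real assume s: "0 \<le> s"
    have "((\<lambda>s. - (2 powr (e / 2) / (e - 1)) * (1 + s) powr (1 - e)) has_real_derivative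
       - (2 powr (e / 2) / (e - 1)) * ((1 - e) * (1 + s) powr (1 - e - 1))) (at s within {0..R})"
      using s e by (auto intro!: derivative_eq_intros)
    also have "- (2 powr (e / 2) / (e - 1)) * ((1 - e) * (1 + s) powr (1 - e - 1))
       = 2 powr (e / 2) * (1 + s) powr (- e)"
      using e by (simp add: divide_simps) (simp add: algebra_simps)
    finally show "((\<lambda>s. - (2 powr (e / 2) / (e - 1)) * (1 + s) powr (1 - e)) has_vector_derivative
       2 powr (e / 2) * (1 + s) powr (- e)) (at s within {0..R})"
      by (simp only: has_real_derivative_iff_has_vector_derivative)
  qed
  also have "... \<le> 2 powr (e / 2) / (e - 1)" using e by simp
  finally show "(LINT s|lborel. indicator {0..R} s *\<^sub>R bracket (s::real) powr (- e)) \<le> 2 powr (e / 2) / (e - 1)" .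
qed

lemma integral_norm_bracket_bound:
  fixes f :: "real => complex"
  assumes e: "e > 1" and R: "R \<ge> 0" and A: "A \<ge> 0" and f: "continuous_on {0..R} f"
    and le: "\<And>s. 0 \<le> s ==> s \<le> R ==> norm (f s) \<le> A * bracket s powr (- e)"
  shows "norm (LINT s|lborel. indicator {0..R} s *\<^sub>R f s) \<le> A * (2 powr (e / 2) / (e - 1))"
proof -
  have "norm (LINT s|lborel. indicator {0..R} s *\<^sub>R f s)
    \<le> (LINT s|lborel. A * (indicator {0..R} s *\<^sub>R bracket s powr (- e)))"
    by (intro Bochner_Integration.integral_norm_bound_integral integrable_mult_right
        bracket_integral_bound(1)[OF e R] borel_integrable_compact f)
       (auto simp: indicator_def le)
  also have "... = A * (LINT s|lborel. indicator {0..R} s *\<^sub>R bracket s powr (- e))"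
    by (rule integral_mult_right_zero)
  also have "... \<le> A * (2 powr (e / 2) / (e - 1))"
    using A by (intro mult_left_mono bracket_integral_bound(2)[OF e R])
  finally show ?thesis .
qed

lemma abs_slice_le: "\<bar>slice c s\<bar> \<le> 2 * \<bar>s\<bar>"
proof (cases "c = 0")
  case False
  have "\<bar>sin (c * s)\<bar> \<le> \<bar>c\<bar> * \<bar>s\<bar>" using abs_sin_x_le_abs_x[of "c * s"] by (simp add: abs_mult)
  then show ?thesis using False by (simp add: slice_def abs_mult field_simps)
qed (simp add: slice_def)

text \<open>Interpolates between the trivial bound 1 and the linear bound. It is applied to the sine
  in \<open>slice\<close> and to \<open>cis - 1\<close> in the time bound, and the free exponent
  \<open>s\<close> becomes \<open>1 - a\<close>.\<close>

lemma min_1_le_powr: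
  fixes x s :: real
  assumes "x > 0" "0 \<le> s" "s \<le> 1" shows "min 1 x \<le> x powr s"
proof (cases "x \<le> 1")
  case True
  then show ?thesis using powr_mono'[of s 1 x] assms by simp
next
  case False
  then show ?thesis using powr_mono[of 0 s x] assms by simp
qed

lemma abs_slice_le_powr:
  assumes "c > 0" "u > 0" "0 \<le> s" "s \<le> 1"
  shows "\<bar>slice c u\<bar> \<le> 2 * c powr (s - 1) * u powr s"
proof -
  have "\<bar>sin (c * u)\<bar> \<le> min 1 (c * u)" using abs_sin_x_le_abs_x[of "c * u"] assms by simp
  also have "... \<le> (c * u) powr s" using assms by (intro min_1_le_powr) auto
  finally have "\<bar>sin (c * u)\<bar> \<le> c powr s * u powr s" using assms by (simp add: powr_mult)
  then show ?thesis using assms by (simp add: slice_def abs_mult powr_diff divide_right_mono)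
qed

lemma continuous_on_slice [continuous_intros]:
  fixes f :: "real => real"
  shows "continuous_on S f ==> continuous_on S (\<lambda>x. slice c (f x))"
  by (cases "c = 0") (auto simp: slice_def intro!: continuous_intros)

lemma continuous_on_bracket [continuous_intros]:
  "continuous_on S f ==> continuous_on S (\<lambda>x. bracket (f x))"
  unfolding bracket_def by (intro continuous_intros)

lemma continuous_on_bracket_powr [continuous_intros]:
  "continuous_on S f ==> continuous_on S (\<lambda>x. bracket (f x) powr a)"
  by (intro continuous_intros) auto

text \<open>Decay in \<open>z\<close> comes from \<open>slice\<close>, while the phase in
  \<open>t\<close> is estimated by 1. The radial integrand is at most a constant times
  \<open>bracket \<rho> powr (1 + s - 2 * \<sigma>)\<close>, which is integrable since
  \<open>s < 2 * \<sigma> - 2\<close>.\<close>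

lemma kg_kernel_space_bound:
  assumes "\<sigma> > 1" "0 \<le> s" "s \<le> 1" "s < 2 * \<sigma> - 2" "R \<ge> 0" "z \<noteq> 0"
  shows "norm (kg_kernel R \<sigma> t z)
    \<le> 4 * pi * norm z powr (s - 1) * (2 powr ((2 * \<sigma> - 1 - s) / 2) / (2 * \<sigma> - 1 - s - 1))"
proof -
  have "norm (kg_kernel R \<sigma> t z) = norm (LINT \<rho>|lborel. indicator {0..R} \<rho> *\<^sub>R
    (of_real (2 * pi * \<rho>) * (of_real (bracket \<rho> powr (- 2 * \<sigma>)) * cis (t * bracket \<rho>))
      * of_real (slice (norm z) \<rho>)))"
    using assms by (subst kg_kernel_radial) auto
  also have "... \<le> (4 * pi * norm z powr (s - 1)) * (2 powr ((2 * \<sigma> - 1 - s) / 2) / (2 * \<sigma> - 1 - s - 1))"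
  proof (rule integral_norm_bracket_bound)
    fix \<rho> :: real assume \<rho>: "0 \<le> \<rho>" "\<rho> \<le> R"
    show "norm (of_real (2 * pi * \<rho>) * (of_real (bracket \<rho> powr (- 2 * \<sigma>)) * cis (t * bracket \<rho>))
      * of_real (slice (norm z) \<rho>)) \<le> 4 * pi * norm z powr (s - 1) * bracket \<rho> powr (- (2 * \<sigma> - 1 - s))"
    proof (cases "\<rho> = 0")
      case False
      then have \<rho>0: "\<rho> > 0" using \<rho> by simp
      have r: "\<rho> \<le> bracket \<rho>" using norm_le_bracket[of \<rho>] by simp
      have "norm (of_real (2 * pi * \<rho>) * (of_real (bracket \<rho> powr (- 2 * \<sigma>)) * cis (t * bracket \<rho>))
        * of_real (slice (norm z) \<rho>)) = 2 * pi * \<rho> * bracket \<rho> powr (- 2 * \<sigma>) * \<bar>slice (norm z) \<rho>\<bar>"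
        using \<rho>0 by (simp add: norm_mult)
      also have "... \<le> 2 * pi * bracket \<rho> * bracket \<rho> powr (- 2 * \<sigma>)
           * (2 * norm z powr (s - 1) * bracket \<rho> powr s)"
      proof (intro mult_mono mult_left_mono)
        have "\<bar>slice (norm z) \<rho>\<bar> \<le> 2 * norm z powr (s - 1) * \<rho> powr s"
          using assms \<rho>0 by (intro abs_slice_le_powr) auto
        also have "... \<le> 2 * norm z powr (s - 1) * bracket \<rho> powr s"
          using r \<rho>0 assms by (intro mult_left_mono powr_mono2) auto
        finally show "\<bar>slice (norm z) \<rho>\<bar> \<le> 2 * norm z powr (s - 1) * bracket \<rho> powr s" .
      qed (use \<rho>0 r bracket_pos[of \<rho>] in auto)
      also have "... = 4 * pi * norm z powr (s - 1) * bracket \<rho> powr (1 + (- 2 * \<sigma> + s))"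
        using bracket_pos[of \<rho>] unfolding powr_add by simp
      finally show ?thesis by (simp add: algebra_simps)
    qed simp
  qed (use assms in \<open>auto intro!: continuous_intros\<close>)
  finally show ?thesis .
qed

lemma has_real_derivative_bracket:
  "((\<lambda>s::real. bracket s) has_real_derivative s / bracket s) (at s within A)"
proof -
  have "1 + s\<^sup>2 > 0" by (simp add: add_pos_nonneg)
  then show ?thesis unfolding bracket_def
    by (auto intro!: derivative_eq_intros simp: field_simps)
qed

lemma has_real_derivative_slice:
  "((\<lambda>s. slice c s) has_real_derivative 2 * cos (c * s)) (at s within A)"
  by (cases "c = 0") (auto simp: slice_def intro!: derivative_eq_intros)

text \<open>Integration by parts against the primitive \<open>(cis (t \<langle>\<rho>\<rangle>) - 1) / (i t)\<close> of
  \<open>\<rho> cis (t \<langle>\<rho>\<rangle>) / \<langle>\<rho>\<rangle>\<close>, which is \<open>O(\<bar>t\<bar> powr (s - 1) * \<langle>\<rho>\<rangle> powr s)\<close> for every \<open>0 \<le> s \<le> 1\<close>.\<close>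

lemma kg_kernel_time_bound:
  assumes \<sigma>: "\<sigma> > 1" and s: "0 \<le> s" "s \<le> 1" "s < 2 * \<sigma> - 2" and R: "R \<ge> 0" and t: "t \<noteq> 0"
  shows "norm (kg_kernel R \<sigma> t z) \<le> 2 * pi * \<bar>t\<bar> powr (s - 1)
    * (4 + 8 * \<sigma> * (2 powr ((2 * \<sigma> - 1 - s) / 2) / (2 * \<sigma> - 1 - s - 1)))"
proof -
  define c where "c = norm z"
  define P where "P \<rho> = (cis (t * bracket \<rho>) - 1) / (\<i> * of_real t)" for \<rho> :: real
  define P' where "P' \<rho> = (\<rho> / bracket \<rho>) *\<^sub>R cis (t * bracket \<rho>)" for \<rho> :: real
  \<comment> \<open>The other factor of the radial integrand: the power of the bracket is raised by
    one because \<open>P'\<close> contains \<open>\<rho> / bracket \<rho>\<close> in place of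
    \<open>\<rho>\<close>.\<close>
  define Q where "Q \<rho> = bracket \<rho> powr (1 - 2 * \<sigma>) * slice c \<rho>" for \<rho> :: real
  define Q' where "Q' \<rho> = (1 - 2 * \<sigma>) * bracket \<rho> powr (- 2 * \<sigma>) * (\<rho> / bracket \<rho>) * slice c \<rho>
    + bracket \<rho> powr (1 - 2 * \<sigma>) * (2 * cos (c * \<rho>))" for \<rho> :: real
  have nz: "bracket \<rho> \<noteq> 0" for \<rho> :: real using bracket_pos[of \<rho>] by simp
  have dP: "(P has_vector_derivative P' \<rho>) (at \<rho> within A)" for \<rho> A
  proof -
    have "((\<lambda>\<rho>::real. t * bracket \<rho>) has_derivative (\<lambda>x. x * (t * (\<rho> / bracket \<rho>)))) (at \<rho> within A)"
    proof -
      have "(*) (t * (\<rho> / bracket \<rho>)) = (\<lambda>x. x * (t * (\<rho> / bracket \<rho>)))" by (auto simp: mult.commute)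
      then show ?thesis
        using DERIV_cmult[OF has_real_derivative_bracket, of t \<rho> A]
        unfolding has_field_derivative_def by (simp only:)
    qed
    from has_derivative_cis[OF this]
    have "((\<lambda>\<rho>::real. (cis (t * bracket \<rho>) - 1) * (1 / (\<i> * of_real t))) has_derivative
      (\<lambda>x. ((x * (t * (\<rho> / bracket \<rho>))) *\<^sub>R (\<i> * cis (t * bracket \<rho>)) - 0) * (1 / (\<i> * of_real t)))) (at \<rho> within A)"
      by (intro has_derivative_mult_left has_derivative_diff has_derivative_const)
    also have "(\<lambda>x. ((x * (t * (\<rho> / bracket \<rho>))) *\<^sub>R (\<i> * cis (t * bracket \<rho>)) - 0) * (1 / (\<i> * of_real t)))
      = (\<lambda>x. x *\<^sub>R P' \<rho>)"
      using t by (auto simp: fun_eq_iff P'_def scaleR_conv_of_real)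
    finally show ?thesis unfolding P_def has_vector_derivative_def by simp
  qed
  have dQ: "(Q has_real_derivative Q' \<rho>) (at \<rho> within A)" for \<rho> A
  proof -
    have "((\<lambda>\<rho>. bracket \<rho> powr (1 - 2 * \<sigma>)) has_real_derivative
        (1 - 2 * \<sigma>) * bracket \<rho> powr (1 - 2 * \<sigma> - 1) * (\<rho> / bracket \<rho>)) (at \<rho>)"
      using DERIV_fun_powr[OF has_real_derivative_bracket bracket_pos, of "1 - 2 * \<sigma>" \<rho>] by simp
    from DERIV_mult[OF this has_real_derivative_slice[of c \<rho> UNIV]]
    have "(Q has_real_derivative Q' \<rho>) (at \<rho>)"
      unfolding Q_def Q'_def by (simp add: algebra_simps)
    then show ?thesis by (rule has_field_derivative_at_within)
  qed
  have Pbound: "norm (P \<rho>) \<le> 2 * \<bar>t\<bar> powr (s - 1) * bracket \<rho> powr s" for \<rho>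
  proof -
    have "norm (cis (t * bracket \<rho>) - 1) \<le> 2 * min 1 (\<bar>t\<bar> * bracket \<rho>)"
    proof -
      have "norm (cis (t * bracket \<rho>) - 1) \<le> 2"
        using norm_triangle_ineq4[of "cis (t * bracket \<rho>)" 1] by simp
      moreover have "norm (cis (t * bracket \<rho>) - 1) \<le> 2 * (\<bar>t\<bar> * bracket \<rho>)"
      proof -
        \<comment> \<open>The chord of the unit circle:
          \<open>|cis (2 x) - 1| = 2 |sin x|\<close>.\<close>
        have "(norm (cis (t * bracket \<rho>) - 1))\<^sup>2 = (2 * sin (t * bracket \<rho> / 2))\<^sup>2"
        proof -
          define x where "x = t * bracket \<rho> / 2"
          have c: "cos (2 * x) = 1 - 2 * (sin x)\<^sup>2" by (simp add: cos_double_sin)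
          have "(cos (2 * x) - 1)\<^sup>2 + (sin (2 * x))\<^sup>2 = 2 - 2 * cos (2 * x)"
            using sin_cos_squared_add[of "2 * x"] by (simp add: power2_eq_square algebra_simps)
          also have "... = (2 * sin x)\<^sup>2" using c by (simp add: power2_eq_square)
          finally show ?thesis by (simp add: cmod_power2 x_def)
        qed
        then have "sqrt ((norm (cis (t * bracket \<rho>) - 1))\<^sup>2) = sqrt ((2 * sin (t * bracket \<rho> / 2))\<^sup>2)"
          by (rule arg_cong)
        then have "norm (cis (t * bracket \<rho>) - 1) = \<bar>2 * sin (t * bracket \<rho> / 2)\<bar>"
          by (simp only: real_sqrt_abs abs_norm_cancel)
        also have "... = 2 * \<bar>sin (t * bracket \<rho> / 2)\<bar>" by (simp only: abs_mult abs_numeral)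
        also have "... \<le> 2 * \<bar>t * bracket \<rho> / 2\<bar>"
          by (intro mult_left_mono abs_sin_x_le_abs_x) simp
        also have "... \<le> 2 * (\<bar>t\<bar> * bracket \<rho>)"
          using bracket_pos[of \<rho>] by (simp add: abs_mult)
        finally show ?thesis .
      qed
      ultimately show ?thesis by simp
    qed
    also have "... \<le> 2 * (\<bar>t\<bar> * bracket \<rho>) powr s"
      using t s bracket_pos[of \<rho>] by (intro mult_left_mono min_1_le_powr) auto
    finally show ?thesis
      using t bracket_pos[of \<rho>]
      by (simp add: P_def norm_divide norm_mult powr_mult powr_diff divide_right_mono)
  qed
  have Q'bound: "\<bar>Q' \<rho>\<bar> \<le> 4 * \<sigma> * bracket \<rho> powr (1 - 2 * \<sigma>)" if \<rho>: "\<rho> \<ge> 0" for \<rho>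
  proof -
    have r: "\<rho> \<le> bracket \<rho>" using norm_le_bracket[of \<rho>] by simp
    have "\<bar>Q' \<rho>\<bar> \<le> (2 * \<sigma> - 1) * bracket \<rho> powr (- 2 * \<sigma>) * (\<rho> / bracket \<rho>) * \<bar>slice c \<rho>\<bar>
        + bracket \<rho> powr (1 - 2 * \<sigma>) * (2 * \<bar>cos (c * \<rho>)\<bar>)"
      unfolding Q'_def using \<rho> \<sigma> bracket_pos[of \<rho>]
      by (intro order_trans[OF abs_triangle_ineq]) (simp add: abs_mult)
    also have "... \<le> (2 * \<sigma> - 1) * bracket \<rho> powr (- 2 * \<sigma>) * 1 * (2 * bracket \<rho>)
        + bracket \<rho> powr (1 - 2 * \<sigma>) * (2 * 1)"
    proof (intro add_mono mult_mono)
      show "\<bar>slice c \<rho>\<bar> \<le> 2 * bracket \<rho>" using abs_slice_le[of c \<rho>] r \<rho> by simp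
    qed (use \<rho> r \<sigma> bracket_pos[of \<rho>] in auto)
    also have "... = 4 * \<sigma> * bracket \<rho> powr (1 - 2 * \<sigma>)"
      using bracket_pos[of \<rho>] by (simp add: powr_diff powr_minus field_simps)
    finally show ?thesis .
  qed
  have e: "2 * \<sigma> - 1 - s > 1" using s by simp
  define C where "C = 2 powr ((2 * \<sigma> - 1 - s) / 2) / (2 * \<sigma> - 1 - s - 1)"
  have contP: "continuous_on {0..R} P" unfolding P_def using t by (intro continuous_intros) auto
  have contP': "continuous_on {0..R} P'" unfolding P'_def using nz by (intro continuous_intros) auto
  have contQ: "continuous_on {0..R} Q" unfolding Q_def by (intro continuous_intros)
  have contQ': "continuous_on {0..R} Q'" unfolding Q'_def using nz by (intro continuous_intros) auto
  have FTC: "(LINT \<rho>|lborel. indicator {0..R} \<rho> *\<^sub>R (P' \<rho> * of_real (Q \<rho>) + P \<rho> * of_real (Q' \<rho>)))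
     = P R * of_real (Q R) - P 0 * of_real (Q 0)"
  proof (rule integral_FTC_atLeastAtMost[where F = "\<lambda>\<rho>. P \<rho> * of_real (Q \<rho>)"])
    fix \<rho> :: real
    have "((\<lambda>x. of_real (Q x) :: complex) has_vector_derivative of_real (Q' \<rho>)) (at \<rho> within {0..R})"
      using dQ[of \<rho> "{0..R}"] by (rule has_vector_derivative_of_real)
    from has_vector_derivative_mult[OF dP this]
    show "((\<lambda>\<rho>. P \<rho> * of_real (Q \<rho>)) has_vector_derivative P' \<rho> * of_real (Q \<rho>) + P \<rho> * of_real (Q' \<rho>)) (at \<rho> within {0..R})"
      by (simp add: add.commute)
  qed (use R contP contP' contQ contQ' in \<open>auto intro!: continuous_intros\<close>)
  have i1: "integrable lborel (\<lambda>\<rho>. indicator {0..R} \<rho> *\<^sub>R (P' \<rho> * of_real (Q \<rho>)))"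
    using contP' contQ by (intro borel_integrable_compact continuous_intros) auto
  have i2: "integrable lborel (\<lambda>\<rho>. indicator {0..R} \<rho> *\<^sub>R (P \<rho> * of_real (Q' \<rho>)))"
    using contP contQ' by (intro borel_integrable_compact continuous_intros) auto
  have split: "(LINT \<rho>|lborel. indicator {0..R} \<rho> *\<^sub>R (P' \<rho> * of_real (Q \<rho>)))
     = P R * of_real (Q R) - (LINT \<rho>|lborel. indicator {0..R} \<rho> *\<^sub>R (P \<rho> * of_real (Q' \<rho>)))"
  proof -
    \<comment> \<open>The boundary term at the origin vanishes with \<open>slice c 0\<close>; only
      the one at the cutoff \<open>R\<close> is left.\<close>
    have "Q 0 = 0" by (simp add: Q_def slice_def)
    then show ?thesis using FTC i1 i2 by (simp add: scaleR_add_right eq_diff_eq)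
  qed
  have "kg_kernel R \<sigma> t z = (LINT \<rho>|lborel. of_real (2 * pi) * (indicator {0..R} \<rho> *\<^sub>R (P' \<rho> * of_real (Q \<rho>))))"
    using R \<sigma> unfolding kg_kernel_radial[OF R order_trans[OF zero_le_one less_imp_le[OF \<sigma>]]]
    by (intro Bochner_Integration.integral_cong refl)
       (auto simp: P'_def Q_def c_def powr_diff powr_minus scaleR_conv_of_real nz abs_of_pos[OF bracket_pos] field_simps)
  also have "... = of_real (2 * pi) * (LINT \<rho>|lborel. indicator {0..R} \<rho> *\<^sub>R (P' \<rho> * of_real (Q \<rho>)))"
    by (rule integral_mult_right_zero)
  finally have "norm (kg_kernel R \<sigma> t z)
     = 2 * pi * norm (P R * of_real (Q R) - (LINT \<rho>|lborel. indicator {0..R} \<rho> *\<^sub>R (P \<rho> * of_real (Q' \<rho>))))"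
    unfolding split by (simp add: norm_mult)
  also have "... \<le> 2 * pi * (4 * \<bar>t\<bar> powr (s - 1) + 8 * \<sigma> * \<bar>t\<bar> powr (s - 1) * C)"
  proof (intro mult_left_mono order_trans[OF norm_triangle_ineq4] add_mono)
    have r: "R \<le> bracket R" using norm_le_bracket[of R] by simp
    have "norm (P R * of_real (Q R)) \<le> (2 * \<bar>t\<bar> powr (s - 1) * bracket R powr s) * (bracket R powr (1 - 2 * \<sigma>) * (2 * bracket R))"
      unfolding norm_mult
    proof (intro mult_mono Pbound)
      show "norm (complex_of_real (Q R)) \<le> bracket R powr (1 - 2 * \<sigma>) * (2 * bracket R)"
        unfolding norm_of_real Q_def abs_mult using abs_slice_le[of c R] r R by (intro mult_mono) auto
    qed auto
    also have "... = 4 * \<bar>t\<bar> powr (s - 1) * bracket R powr (s + (1 - 2 * \<sigma>) + 1)"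
      using bracket_pos[of R] unfolding powr_add by simp
    \<comment> \<open>The exponent \<open>s + 2 - 2 * \<sigma>\<close> is negative, so the boundary
      term stays bounded as \<open>R\<close> grows.\<close>
    also have "... \<le> 4 * \<bar>t\<bar> powr (s - 1) * bracket R powr 0"
      using s bracket_ge_1[of R] by (intro mult_left_mono powr_mono) auto
    finally show "norm (P R * of_real (Q R)) \<le> 4 * \<bar>t\<bar> powr (s - 1)"
      using bracket_pos[of R] by simp
    have "norm (LINT \<rho>|lborel. indicator {0..R} \<rho> *\<^sub>R (P \<rho> * of_real (Q' \<rho>)))
       \<le> (8 * \<sigma> * \<bar>t\<bar> powr (s - 1)) * (2 powr ((2 * \<sigma> - 1 - s) / 2) / (2 * \<sigma> - 1 - s - 1))"
    proof (rule integral_norm_bracket_bound[OF e R])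
      fix \<rho> :: real assume \<rho>: "0 \<le> \<rho>" "\<rho> \<le> R"
      have "norm (P \<rho> * of_real (Q' \<rho>)) \<le> (2 * \<bar>t\<bar> powr (s - 1) * bracket \<rho> powr s) * (4 * \<sigma> * bracket \<rho> powr (1 - 2 * \<sigma>))"
        unfolding norm_mult using Q'bound[OF \<rho>(1)] by (intro mult_mono Pbound) auto
      also have "... = 8 * \<sigma> * \<bar>t\<bar> powr (s - 1) * bracket \<rho> powr (s + (1 - 2 * \<sigma>))"
        unfolding powr_add by simp
      finally show "norm (P \<rho> * of_real (Q' \<rho>)) \<le> 8 * \<sigma> * \<bar>t\<bar> powr (s - 1) * bracket \<rho> powr (- (2 * \<sigma> - 1 - s))"
        by (simp add: algebra_simps)
    qed (use \<sigma> contP contQ' in \<open>auto intro!: continuous_intros\<close>)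
    then show "norm (LINT \<rho>|lborel. indicator {0..R} \<rho> *\<^sub>R (P \<rho> * of_real (Q' \<rho>)))
       \<le> 8 * \<sigma> * \<bar>t\<bar> powr (s - 1) * C" by (simp only: C_def)
  qed auto
  also have "... = 2 * pi * \<bar>t\<bar> powr (s - 1) * (4 + 8 * \<sigma> * C)" by (simp add: algebra_simps)
  finally show ?thesis by (simp only: C_def)
qed

section \<open>Plancherel's theorem\<close>

text \<open>The square of the \<open>L^2\<close> norm, kept without the root so that Plancherel and
  the parallelogram law are linear identities in \<open>ennreal\<close>, valid also for infinite
  values.\<close>

definition energy :: "('a::euclidean_space => 'b::real_normed_vector) => ennreal" where
  "energy f = (\<integral>x. ennreal ((norm (f x))\<^sup>2))"

lemma integral_lborel_scale:
  fixes f :: "'a::euclidean_space => 'b::{banach, second_countable_topology}"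
  assumes c: "c \<noteq> 0" and f [measurable]: "f \<in> borel_fun"
  shows "(LINT x|lborel. f x) = \<bar>c\<bar> ^ DIM('a) *\<^sub>R (LINT x|lborel. f (t + c *\<^sub>R x))"
proof -
  have "(LINT x|lborel. f x) = (LINT x|density (distr lborel borel (\<lambda>x. t + c *\<^sub>R x)) (\<lambda>_. ennreal (\<bar>c\<bar> ^ DIM('a))). f x)"
    using lborel_affine[OF c, of t] by simp
  also have "... = (LINT x|distr lborel borel (\<lambda>x. t + c *\<^sub>R x). \<bar>c\<bar> ^ DIM('a) *\<^sub>R f x)"
    by (subst integral_density) auto
  also have "... = (LINT x|lborel. \<bar>c\<bar> ^ DIM('a) *\<^sub>R f (t + c *\<^sub>R x))"
    by (subst integral_distr) auto
  finally show ?thesis by simp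
qed

lemma integral_lborel_pair_mult:
  fixes f :: "'a::euclidean_space => complex" and g :: "'b::euclidean_space => complex"
  assumes "integrable lborel f" "integrable lborel g"
  shows "integrable lborel (\<lambda>p. f (fst p) * g (snd p))"
    and "(LINT p|lborel. f (fst p) * g (snd p)) = (LINT x|lborel. f x) * (LINT y|lborel. g y)"
proof -
  have I: "integrable (lborel \<Otimes>\<^sub>M lborel) (\<lambda>(x, y). f x * g y)"
    by (rule integrable_pair_mult[OF lborel.sigma_finite_measure_axioms lborel.sigma_finite_measure_axioms assms])
  then show "integrable lborel (\<lambda>p. f (fst p) * g (snd p))"
    by (simp add: lborel_prod case_prod_unfold)
  from lborel_pair.integral_fst'[OF I]
  show "(LINT p|lborel. f (fst p) * g (snd p)) = (LINT x|lborel. f x) * (LINT y|lborel. g y)"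
    by (simp add: lborel_prod case_prod_unfold)
qed

section \<open>Gaussians and their Fourier integrals\<close>

lemma gaussian_fourier_real:
  shows "integrable lborel (\<lambda>x::real. complex_of_real (exp (- x\<^sup>2 / 2)) * cis (t * x))"
    and "(LINT x|lborel. complex_of_real (exp (- x\<^sup>2 / 2)) * cis (t * x)) = of_real (sqrt (2 * pi) * exp (- t\<^sup>2 / 2))"
proof -
  have d: "std_normal_density x = exp (- x\<^sup>2 / 2) / sqrt (2 * pi)" for x
    by (simp add: normal_density_def)
  have "integrable lborel std_normal_density" by (rule integrable_normal_density) simp
  then have "integrable lborel (\<lambda>x. sqrt (2 * pi) * std_normal_density x)" by simp
  then have i: "integrable lborel (\<lambda>x::real. exp (- x\<^sup>2 / 2))" by (simp add: d)
  show "integrable lborel (\<lambda>x::real. complex_of_real (exp (- x\<^sup>2 / 2)) * cis (t * x))"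
    by (rule Bochner_Integration.integrable_bound[OF i]) (auto simp: norm_mult)
  have "complex_of_real (exp (- t\<^sup>2 / 2)) = (LINT x|density lborel (\<lambda>x. ennreal (std_normal_density x)). cis (t * x))"
    using fun_cong[OF char_std_normal_distribution, of t] by (simp add: char_def cis_conv_exp)
  also have "... = (LINT x|lborel. std_normal_density x *\<^sub>R cis (t * x))"
    by (subst integral_density) auto
  also have "... = (LINT x|lborel. of_real (1 / sqrt (2 * pi)) * (complex_of_real (exp (- x\<^sup>2 / 2)) * cis (t * x)))"
    by (intro Bochner_Integration.integral_cong refl) (simp add: d scaleR_conv_of_real)
  also have "... = of_real (1 / sqrt (2 * pi)) * (LINT x|lborel. complex_of_real (exp (- x\<^sup>2 / 2)) * cis (t * x))"
    by (rule integral_mult_right_zero)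
  finally have "complex_of_real (sqrt (2 * pi)) * complex_of_real (exp (- t\<^sup>2 / 2))
     = of_real (sqrt (2 * pi)) * (of_real (1 / sqrt (2 * pi)) * (LINT x|lborel. complex_of_real (exp (- x\<^sup>2 / 2)) * cis (t * x)))"
    by (rule arg_cong)
  then show "(LINT x|lborel. complex_of_real (exp (- x\<^sup>2 / 2)) * cis (t * x)) = of_real (sqrt (2 * pi) * exp (- t\<^sup>2 / 2))"
    by simp
qed

lemma norm_vec_of_triple: "(norm (vec_of_triple p))\<^sup>2 = (fst p)\<^sup>2 + ((fst (snd p))\<^sup>2 + (snd (snd p))\<^sup>2)"
  by (cases p) (simp add: vec_of_triple_def norm_vec_def L2_set_def sum_3 vector_3 add.assoc)

lemma inner_vec_of_triple: "z \<bullet> vec_of_triple p = z $ 1 * fst p + (z $ 2 * fst (snd p) + z $ 3 * snd (snd p))"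
  by (cases p) (simp add: vec_of_triple_def inner_vec_def sum_3 vector_3)

lemma gaussian_fourier_vec:
  fixes z :: "real^3"
  shows "integrable lborel (\<lambda>\<xi>. complex_of_real (exp (- (norm \<xi>)\<^sup>2 / 2)) * cis (z \<bullet> \<xi>))"
    and "(LINT \<xi>|lborel. complex_of_real (exp (- (norm \<xi>)\<^sup>2 / 2)) * cis (z \<bullet> \<xi>))
       = of_real ((2 * pi) powr (3 / 2) * exp (- (norm z)\<^sup>2 / 2))"
proof -
  define g where "g t x = complex_of_real (exp (- x\<^sup>2 / 2)) * cis (t * x)" for t x :: real
  have g: "integrable lborel (g t)" "(LINT x|lborel. g t x) = of_real (sqrt (2 * pi) * exp (- t\<^sup>2 / 2))" for t
    unfolding g_def using gaussian_fourier_real by auto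
  define F where "F \<xi> = complex_of_real (exp (- (norm \<xi>)\<^sup>2 / 2)) * cis (z \<bullet> \<xi>)" for \<xi> :: "real^3"
  have [measurable]: "F \<in> borel_fun" unfolding F_def by measurable
  have Fp: "F (vec_of_triple p) = g (z $ 1) (fst p) * (\<lambda>q. g (z $ 2) (fst q) * g (z $ 3) (snd q)) (snd p)" for p
    unfolding F_def g_def norm_vec_of_triple inner_vec_of_triple
  proof -
    have "exp (- ((fst p)\<^sup>2 + ((fst (snd p))\<^sup>2 + (snd (snd p))\<^sup>2)) / 2)
      = exp (- (fst p)\<^sup>2 / 2) * (exp (- (fst (snd p))\<^sup>2 / 2) * exp (- (snd (snd p))\<^sup>2 / 2))"
      unfolding exp_add[symmetric] by (rule arg_cong[where f = exp]) (simp add: field_simps)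
    moreover have "cis (z $ 1 * fst p + (z $ 2 * fst (snd p) + z $ 3 * snd (snd p)))
      = cis (z $ 1 * fst p) * (cis (z $ 2 * fst (snd p)) * cis (z $ 3 * snd (snd p)))"
      by (simp only: cis_mult)
    ultimately show "complex_of_real (exp (- ((fst p)\<^sup>2 + ((fst (snd p))\<^sup>2 + (snd (snd p))\<^sup>2)) / 2))
        * cis (z $ 1 * fst p + (z $ 2 * fst (snd p) + z $ 3 * snd (snd p)))
      = complex_of_real (exp (- (fst p)\<^sup>2 / 2)) * cis (z $ 1 * fst p) *
        (complex_of_real (exp (- (fst (snd p))\<^sup>2 / 2)) * cis (z $ 2 * fst (snd p)) *
         (complex_of_real (exp (- (snd (snd p))\<^sup>2 / 2)) * cis (z $ 3 * snd (snd p))))"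
      by (simp only: of_real_mult mult_ac)
  qed
  note q = integral_lborel_pair_mult[OF g(1)[of "z $ 2"] g(1)[of "z $ 3"]]
  note p = integral_lborel_pair_mult[OF g(1)[of "z $ 1"] q(1)]
  have "integrable (distr lborel borel vec_of_triple) F"
    by (subst integrable_distr_eq) (use p(1) in \<open>simp_all add: Fp\<close>)
  then show "integrable lborel (\<lambda>\<xi>. complex_of_real (exp (- (norm \<xi>)\<^sup>2 / 2)) * cis (z \<bullet> \<xi>))"
    by (simp add: lborel_vec_of_triple F_def[abs_def])
  have "(LINT \<xi>|lborel. F \<xi>) = (LINT \<xi>|distr lborel borel vec_of_triple. F \<xi>)" by (simp add: lborel_vec_of_triple)
  also have "... = (LINT p|lborel. F (vec_of_triple p))" by (subst integral_distr) auto
  also have "... = of_real (sqrt (2 * pi) * exp (- (z $ 1)\<^sup>2 / 2)) *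
      (of_real (sqrt (2 * pi) * exp (- (z $ 2)\<^sup>2 / 2)) * of_real (sqrt (2 * pi) * exp (- (z $ 3)\<^sup>2 / 2)))"
    unfolding Fp p(2) q(2) g(2) ..
  also have "... = of_real ((sqrt (2 * pi) * (sqrt (2 * pi) * sqrt (2 * pi)))
      * (exp (- (z $ 1)\<^sup>2 / 2) * (exp (- (z $ 2)\<^sup>2 / 2) * exp (- (z $ 3)\<^sup>2 / 2))))"
    by (simp only: of_real_mult mult_ac)
  also have "sqrt (2 * pi) * (sqrt (2 * pi) * sqrt (2 * pi)) = (2 * pi) powr (3 / 2)"
    using powr_add[of "2 * pi" 1 "1/2"] by (simp add: powr_half_sqrt)
  also have "exp (- (z $ 1)\<^sup>2 / 2) * (exp (- (z $ 2)\<^sup>2 / 2) * exp (- (z $ 3)\<^sup>2 / 2)) = exp (- (norm z)\<^sup>2 / 2)"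
    by (simp add: exp_add[symmetric] norm_vec_def L2_set_def sum_3 sum_nonneg add_divide_distrib)
  finally show "(LINT \<xi>|lborel. complex_of_real (exp (- (norm \<xi>)\<^sup>2 / 2)) * cis (z \<bullet> \<xi>))
       = of_real ((2 * pi) powr (3 / 2) * exp (- (norm z)\<^sup>2 / 2))"
    by (simp add: F_def)
qed

text \<open>Frequency cutoff that increases to 1 as \<delta> decreases to 0.\<close>

definition gauss :: "real => real^3 => real" where
  "gauss \<delta> \<xi> = exp (- (norm (\<delta> *\<^sub>R \<xi>))\<^sup>2 / 2)"

lemma borel_measurable_gauss [measurable]: "gauss d \<in> borel_fun"
  unfolding gauss_def by measurable

lemma gauss_pos: "gauss d y > 0" by (simp add: gauss_def)

lemma gauss_le_1: "gauss d y \<le> 1" by (simp add: gauss_def)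

lemma integrable_gauss_1: "integrable lborel (gauss 1)"
  using integrable_norm[OF gaussian_fourier_vec(1)[of 0]] by (simp add: gauss_def[abs_def] norm_mult)

lemma integral_gauss_1: "(LINT y|lborel. gauss 1 y) = (2 * pi) powr (3 / 2)"
proof -
  have "complex_of_real (LINT y|lborel. gauss 1 y) = of_real ((2 * pi) powr (3 / 2))"
    using gaussian_fourier_vec(2)[of 0] by (simp add: gauss_def integral_complex_of_real[symmetric] del: integral_complex_of_real)
  then show ?thesis by (simp only: of_real_eq_iff)
qed

lemma integrable_gauss:
  assumes "d > 0" shows "integrable lborel (gauss d)"
proof -
  have "gauss d = (\<lambda>x. gauss 1 (0 + d *\<^sub>R x))" by (simp add: gauss_def fun_eq_iff)
  moreover have "integrable (density (distr lborel borel (\<lambda>x. 0 + d *\<^sub>R x)) (\<lambda>_. ennreal (\<bar>d\<bar> ^ DIM(real^3)))) (gauss 1)"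
    using integrable_gauss_1 lborel_affine[of d "0 :: real^3"] assms by simp
  ultimately show ?thesis using assms
    by (subst (asm) integrable_density) (auto simp: integrable_distr_eq)
qed

lemma gauss_fourier:
  assumes \<delta>: "\<delta> > 0"
  shows "(LINT \<xi>|lborel. of_real (gauss \<delta> \<xi>) * cis (z \<bullet> \<xi>))
    = of_real ((2 * pi) powr (3 / 2) / \<delta> ^ 3 * gauss (1 / \<delta>) z)"
proof -
  have "(LINT \<xi>|lborel. of_real (gauss 1 \<xi>) * cis ((z /\<^sub>R \<delta>) \<bullet> \<xi>))
     = \<bar>\<delta>\<bar> ^ DIM(real^3) *\<^sub>R (LINT \<xi>|lborel. of_real (gauss 1 (0 + \<delta> *\<^sub>R \<xi>)) * cis ((z /\<^sub>R \<delta>) \<bullet> (0 + \<delta> *\<^sub>R \<xi>)))"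
    using \<delta> by (intro integral_lborel_scale) auto
  also have "... = of_real (\<delta> ^ 3) * (LINT \<xi>|lborel. of_real (gauss \<delta> \<xi>) * cis (z \<bullet> \<xi>))"
    using \<delta> by (simp add: gauss_def scaleR_conv_of_real[where 'a=complex] mult.assoc[symmetric])
  finally have "of_real (\<delta> ^ 3) * (LINT \<xi>|lborel. of_real (gauss \<delta> \<xi>) * cis (z \<bullet> \<xi>))
     = of_real ((2 * pi) powr (3 / 2) * gauss (1 / \<delta>) z)"
    using gaussian_fourier_vec(2)[of "z /\<^sub>R \<delta>"] \<delta> by (simp add: gauss_def inverse_eq_divide)
  then show ?thesis using \<delta> by (simp add: field_simps)
qed

section \<open>Plancherel's identity for scalar functions, regularized by a Gaussian\<close>

definition fourier_integral :: "real => (real^3 => complex) => real^3 => complex" where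
  "fourier_integral e f \<xi> = (LINT x|lborel. cis (e * (x \<bullet> \<xi>)) * f x)"

lemma borel_measurable_fourier_integral [measurable]:
  assumes [measurable]: "f \<in> borel_fun"
  shows "fourier_integral e f \<in> borel_fun"
proof -
  have "(\<lambda>\<xi>. LINT x|lborel. (\<lambda>(\<xi>, x). cis (e * (x \<bullet> \<xi>)) * f x) (\<xi>, x)) \<in> borel_fun"
    by (intro lborel.borel_measurable_lebesgue_integral) (simp add: split_beta borel_prod)
  then show ?thesis by (simp add: fourier_integral_def[abs_def])
qed

text \<open>\<open>quadratic_form_kernel\<close> with the Gaussian as multiplier: its Fourier
  transform is again a Gaussian, so the weighted energy of the transform becomes a double integral
  of \<open>f\<close> against an explicit convolution kernel. The sign \<open>e\<close> disappears
  because that kernel is even.\<close>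

lemma
  fixes f :: "real^3 => complex"
  assumes f: "integrable lborel f" and \<delta>: "\<delta> > 0" and e: "\<bar>e\<bar> = 1"
  shows fourier_integral_gauss_kernel: "(LINT \<xi>|lborel. of_real (gauss \<delta> \<xi>) * (cis (e * (x \<bullet> \<xi>)) * cnj (cis (e * (y \<bullet> \<xi>)))))
      = of_real ((2 * pi) powr (3 / 2) / \<delta> ^ 3 * gauss (1 / \<delta>) (x - y))"
    and fourier_integral_gauss_energy: "of_real (LINT \<xi>|lborel. gauss \<delta> \<xi> * (cmod (fourier_integral e f \<xi>))\<^sup>2)
      = (LINT q|(lborel \<Otimes>\<^sub>M lborel). f (fst q) * cnj (f (snd q)) *
          of_real ((2 * pi) powr (3 / 2) / \<delta> ^ 3 * gauss (1 / \<delta>) (fst q - snd q)))"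
    and fourier_integral_gauss_integrable: "integrable lborel (\<lambda>\<xi>. gauss \<delta> \<xi> * (cmod (fourier_integral e f \<xi>))\<^sup>2)"
proof -
  have n: "gauss (1 / \<delta>) (e *\<^sub>R z) = gauss (1 / \<delta>) z" for z using e by (simp add: gauss_def)
  have K: "(LINT \<xi>|lborel. of_real (gauss \<delta> \<xi>) * (cis (e * (x \<bullet> \<xi>)) * cnj (cis (e * (y \<bullet> \<xi>)))))
      = of_real ((2 * pi) powr (3 / 2) / \<delta> ^ 3 * gauss (1 / \<delta>) (x - y))" for x y
    using gauss_fourier[OF \<delta>, of "e *\<^sub>R (x - y)"]
    by (simp add: n cis_cnj cis_mult inner_diff_left right_diff_distrib)
  show "(LINT \<xi>|lborel. of_real (gauss \<delta> \<xi>) * (cis (e * (x \<bullet> \<xi>)) * cnj (cis (e * (y \<bullet> \<xi>)))))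
      = of_real ((2 * pi) powr (3 / 2) / \<delta> ^ 3 * gauss (1 / \<delta>) (x - y))" by (rule K)
  have ph: "(\<lambda>(p::real^3, \<xi>). cis (e * (p \<bullet> \<xi>))) \<in> borel_measurable (lborel \<Otimes>\<^sub>M lborel)"
    unfolding split_beta by measurable
  note Q = quadratic_form_kernel[OF lborel.sigma_finite_measure_axioms lborel.sigma_finite_measure_axioms ph _ f integrable_gauss[OF \<delta>] less_imp_le[OF gauss_pos]]
  show "of_real (LINT \<xi>|lborel. gauss \<delta> \<xi> * (cmod (fourier_integral e f \<xi>))\<^sup>2)
      = (LINT q|(lborel \<Otimes>\<^sub>M lborel). f (fst q) * cnj (f (snd q)) *
          of_real ((2 * pi) powr (3 / 2) / \<delta> ^ 3 * gauss (1 / \<delta>) (fst q - snd q)))"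
    unfolding fourier_integral_def by (subst Q(2)) (simp_all only: K norm_cis order_refl)
  show "integrable lborel (\<lambda>\<xi>. gauss \<delta> \<xi> * (cmod (fourier_integral e f \<xi>))\<^sup>2)"
    unfolding fourier_integral_def by (rule Q(1)) simp
qed

text \<open>The Gaussians increase to 1 along \<delta> = 1/(n + 1), so monotone convergence applies
  even before the energy is known to be finite.\<close>

lemma energy_gauss_limit:
  fixes h :: "real^3 => complex"
  assumes [measurable]: "h \<in> borel_fun"
  shows "energy h = (SUP n. (\<integral>y. ennreal (gauss (1 / (real n + 1)) y * (cmod (h y))\<^sup>2)))"
    and "incseq (\<lambda>n. (\<integral>y. ennreal (gauss (1 / (real n + 1)) y * (cmod (h y))\<^sup>2)))"
proof -
  have mono: "gauss (1 / (real m + 1)) y \<le> gauss (1 / (real n + 1)) y" if "m \<le> n" for m n y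
  proof -
    have "norm ((1 / (real n + 1)) *\<^sub>R y) \<le> norm ((1 / (real m + 1)) *\<^sub>R y)"
      using that by (auto intro!: mult_right_mono divide_left_mono)
    then show ?thesis unfolding gauss_def by (auto intro!: power_mono)
  qed
  have inc: "incseq (\<lambda>n y. ennreal (gauss (1 / (real n + 1)) y * (cmod (h y))\<^sup>2))"
    by (auto simp: incseq_def le_fun_def intro!: ennreal_leI mult_right_mono mono)
  have "(\<lambda>n. gauss (1 / (real n + 1)) y) \<longlonglongrightarrow> 1" for y
  proof -
    have "(\<lambda>n. gauss (1 / (real n + 1)) y) \<longlonglongrightarrow> exp (- (norm ((0::real) *\<^sub>R y))\<^sup>2 / 2)"
      unfolding gauss_def
      using LIMSEQ_inverse_real_of_nat by (intro tendsto_intros) (auto simp: inverse_eq_divide add.commute)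
    then show ?thesis by simp
  qed
  then have lim: "(\<lambda>n. ennreal (gauss (1 / (real n + 1)) y * (cmod (h y))\<^sup>2)) \<longlonglongrightarrow> ennreal ((cmod (h y))\<^sup>2)" for y
    by (intro tendsto_ennrealI) (auto intro!: tendsto_eq_intros)
  have "(SUP n. ennreal (gauss (1 / (real n + 1)) y * (cmod (h y))\<^sup>2)) = ennreal ((cmod (h y))\<^sup>2)" for y
    using LIMSEQ_unique[OF LIMSEQ_SUP lim[of y]] inc by (auto simp: incseq_def le_fun_def)
  then show "energy h = (SUP n. (\<integral>y. ennreal (gauss (1 / (real n + 1)) y * (cmod (h y))\<^sup>2)))"
    unfolding energy_def using nn_integral_monotone_convergence_SUP[OF inc, of lborel] by simp
  show "incseq (\<lambda>n. (\<integral>y. ennreal (gauss (1 / (real n + 1)) y * (cmod (h y))\<^sup>2)))"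
    using inc by (auto simp: incseq_def le_fun_def intro!: nn_integral_mono)
qed

lemma nn_integral_lborel_scale:
  fixes f :: "'a::euclidean_space => ennreal"
  assumes c: "c \<noteq> 0" and f [measurable]: "f \<in> borel_fun"
  shows "(\<integral>x. f x) = ennreal (\<bar>c\<bar> ^ DIM('a)) * (\<integral>x. f (t + c *\<^sub>R x))"
proof -
  have "(\<integral>x. f x) = (\<integral>\<^sup>+x. f x \<partial>density (distr lborel borel (\<lambda>x. t + c *\<^sub>R x)) (\<lambda>_. ennreal (\<bar>c\<bar> ^ DIM('a))))"
    using lborel_affine[OF c, of t] by simp
  also have "... = (\<integral>\<^sup>+x. ennreal (\<bar>c\<bar> ^ DIM('a)) * f x \<partial>distr lborel borel (\<lambda>x. t + c *\<^sub>R x))"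
    by (subst nn_integral_density) auto
  also have "... = (\<integral>x. ennreal (\<bar>c\<bar> ^ DIM('a)) * f (t + c *\<^sub>R x))"
    by (subst nn_integral_distr) auto
  also have "... = ennreal (\<bar>c\<bar> ^ DIM('a)) * (\<integral>x. f (t + c *\<^sub>R x))"
    by (subst nn_integral_cmult) auto
  finally show ?thesis .
qed

lemma two_pi_powr_3: "(2 * pi) powr (3 / 2) * (2 * pi) powr (3 / 2) = (2 * pi) ^ 3"
proof -
  have "(2 * pi) powr (3 / 2) * (2 * pi) powr (3 / 2) = (2 * pi) powr (real 3)"
    by (simp add: powr_add[symmetric])
  also have "... = (2 * pi) ^ 3" by (rule powr_realpow) simp
  finally show ?thesis .
qed

text \<open>The Gaussian approximate identity of width \<delta>, times \<open>(2 * pi) ^ 3\<close>;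
  this total mass is the constant in Plancherel's identity for the unnormalized transform.\<close>

definition heat :: "real => real^3 => real" where
  "heat \<delta> z = (2 * pi) powr (3 / 2) / \<delta> ^ 3 * gauss (1 / \<delta>) z"

lemma borel_measurable_heat [measurable]: "heat d \<in> borel_fun"
  unfolding heat_def by measurable

lemma heat_nonneg: "d > 0 ==> heat d z \<ge> 0"
  using gauss_pos[of "1 / d" z] by (simp add: heat_def)

lemma heat_scale: "d > 0 ==> heat d (d *\<^sub>R z) = (2 * pi) powr (3 / 2) / d ^ 3 * gauss 1 z"
  by (simp add: heat_def gauss_def)

lemma heat_minus: "heat d (- z) = heat d z"
  by (simp add: heat_def gauss_def)

lemma nn_integral_heat:
  assumes d: "d > 0"
  shows "(\<integral>y. ennreal (heat d (y - x))) = ennreal ((2 * pi) ^ 3)"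
proof -
  have "(\<integral>y. ennreal (heat d (y - x)))
    = ennreal (\<bar>d\<bar> ^ DIM(real^3)) * (\<integral>z. ennreal (heat d ((x + d *\<^sub>R z) - x)))"
    using d by (intro nn_integral_lborel_scale) auto
  also have "... = ennreal (d ^ 3) * (\<integral>z. ennreal ((2 * pi) powr (3 / 2) / d ^ 3) * ennreal (gauss 1 z))"
  proof -
    have "ennreal (heat d ((x + d *\<^sub>R z) - x)) = ennreal ((2 * pi) powr (3 / 2) / d ^ 3) * ennreal (gauss 1 z)" for z
      by (simp only: add_diff_cancel_left' heat_scale[OF d]) (rule ennreal_mult'', rule less_imp_le[OF gauss_pos])
    then show ?thesis using d by simp
  qed
  also have "... = ennreal (d ^ 3) * (ennreal ((2 * pi) powr (3 / 2) / d ^ 3) * ennreal ((2 * pi) powr (3 / 2)))"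
    by (subst nn_integral_cmult)
       (auto simp: nn_integral_eq_integral integrable_gauss_1 integral_gauss_1 less_imp_le[OF gauss_pos])
  also have "... = ennreal ((2 * pi) powr (3 / 2) * (2 * pi) powr (3 / 2))"
    using d by (simp add: ennreal_mult'[symmetric])
  finally show ?thesis by (simp only: two_pi_powr_3)
qed

text \<open>Schur's test for the regularized energy: the product of two values of \<open>f\<close>
  is at most half the sum of their squares, and each square is integrated against the total mass of
  \<open>heat\<close>. The bound does not depend on \<delta>, so the regularization can be
  removed.\<close>

lemma fourier_integral_energy_le:
  fixes f :: "real^3 => complex"
  assumes f: "integrable lborel f" and e: "\<bar>e\<bar> = 1"
  shows "energy (fourier_integral e f) \<le> ennreal ((2 * pi) ^ 3) * energy f"
proof -
  have [measurable]: "f \<in> borel_fun" using f by auto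
  have bd: "(\<integral>\<xi>. ennreal (gauss \<delta> \<xi> * (cmod (fourier_integral e f \<xi>))\<^sup>2))
     \<le> ennreal ((2 * pi) ^ 3) * energy f" if \<delta>: "\<delta> > 0" for \<delta>
  proof -
    have ph: "(\<lambda>(p::real^3, \<xi>). cis (e * (p \<bullet> \<xi>))) \<in> borel_measurable (lborel \<Otimes>\<^sub>M lborel)"
      unfolding split_beta by measurable
    have km: "(\<lambda>(p, p'). ennreal (heat \<delta> (p - p'))) \<in> borel_measurable (lborel \<Otimes>\<^sub>M lborel)"
      unfolding split_beta by measurable
    have K: "ennreal (norm (LINT \<xi>|lborel. complex_of_real (gauss \<delta> \<xi>) * (cis (e * (x \<bullet> \<xi>)) * cnj (cis (e * (y \<bullet> \<xi>))))))
       \<le> ennreal (heat \<delta> (x - y))" for x y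
      unfolding fourier_integral_gauss_kernel[OF f \<delta> e] heat_def[symmetric]
      using heat_nonneg[OF \<delta>, of "x - y"] by (simp only: norm_of_real abs_of_nonneg order_refl)
    have "(\<integral>\<xi>. ennreal (gauss \<delta> \<xi> * (cmod (fourier_integral e f \<xi>))\<^sup>2))
      \<le> (\<integral>x. \<integral>y. ennreal (norm (f x)) * ennreal (norm (f y)) * ennreal (heat \<delta> (x - y)))"
      unfolding fourier_integral_def
      by (rule quadratic_form_kernel_le[OF lborel.sigma_finite_measure_axioms lborel.sigma_finite_measure_axioms ph _ f
            integrable_gauss[OF \<delta>] less_imp_le[OF gauss_pos] km K]) simp
    also have "... \<le> (\<integral>x. \<integral>y. ennreal (1/2) * (ennreal ((norm (f x))\<^sup>2) * ennreal (heat \<delta> (y - x)))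
       + ennreal (1/2) * (ennreal ((norm (f y))\<^sup>2) * ennreal (heat \<delta> (x - y))))"
    proof (intro nn_integral_mono)
      fix x y
      have h: "heat \<delta> (y - x) = heat \<delta> (x - y)" using heat_minus[of \<delta> "x - y"] by simp
      have "norm (f x) * norm (f y) \<le> (1/2) * (norm (f x))\<^sup>2 + (1/2) * (norm (f y))\<^sup>2"
        using zero_le_power2[of "norm (f x) - norm (f y)"] by (simp add: power2_eq_square algebra_simps)
      then have "norm (f x) * norm (f y) * heat \<delta> (x - y) \<le> ((1/2) * (norm (f x))\<^sup>2 + (1/2) * (norm (f y))\<^sup>2) * heat \<delta> (x - y)"
        using heat_nonneg[OF \<delta>] by (intro mult_right_mono) auto
      then have "norm (f x) * norm (f y) * heat \<delta> (x - y) \<le> (1/2) * ((norm (f x))\<^sup>2 * heat \<delta> (x - y)) + (1/2) * ((norm (f y))\<^sup>2 * heat \<delta> (x - y))"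
        by (simp add: algebra_simps)
      then show "ennreal (norm (f x)) * ennreal (norm (f y)) * ennreal (heat \<delta> (x - y))
        \<le> ennreal (1/2) * (ennreal ((norm (f x))\<^sup>2) * ennreal (heat \<delta> (y - x)))
         + ennreal (1/2) * (ennreal ((norm (f y))\<^sup>2) * ennreal (heat \<delta> (x - y)))"
        unfolding h using heat_nonneg[OF \<delta>, of "x - y"]
        by (simp only: ennreal_mult[symmetric] ennreal_plus[symmetric] norm_ge_zero mult_nonneg_nonneg
              zero_le_power2 zero_le_divide_1_iff zero_le_numeral) (rule ennreal_leI)
    qed
    also have "... = ennreal (1/2) * (\<integral>x. \<integral>y. ennreal ((norm (f x))\<^sup>2) * ennreal (heat \<delta> (y - x)))
       + ennreal (1/2) * (\<integral>x. \<integral>y. ennreal ((norm (f y))\<^sup>2) * ennreal (heat \<delta> (x - y)))"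
      by (simp add: nn_integral_add nn_integral_cmult del: ennreal_half)
    also have "(\<integral>x. \<integral>y. ennreal ((norm (f y))\<^sup>2) * ennreal (heat \<delta> (x - y)))
       = (\<integral>y. \<integral>x. ennreal ((norm (f y))\<^sup>2) * ennreal (heat \<delta> (x - y)))"
      by (rule lborel_pair.Fubini'[symmetric]) (unfold split_beta, measurable)
    also have "(\<integral>x. \<integral>y. ennreal ((norm (f x))\<^sup>2) * ennreal (heat \<delta> (y - x)))
       = ennreal ((2 * pi) ^ 3) * energy f"
      by (simp add: nn_integral_cmult nn_integral_heat[OF \<delta>] nn_integral_multc energy_def mult.commute)
    also have "ennreal (1/2) * (ennreal ((2 * pi) ^ 3) * energy f) + ennreal (1/2) * (ennreal ((2 * pi) ^ 3) * energy f)
        = (ennreal (1/2) + ennreal (1/2)) * (ennreal ((2 * pi) ^ 3) * energy f)"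
      by (simp only: distrib_right)
    also have "ennreal (1/2) + ennreal (1/2) = 1"
      by (simp only: ennreal_plus[symmetric]) simp
    finally show ?thesis by simp
  qed
  show ?thesis
    unfolding energy_gauss_limit(1)[OF borel_measurable_fourier_integral[OF \<open>f \<in> borel_fun\<close>]]
    by (intro SUP_least bd) auto
qed

lemma integrable_continuous_bounded_support:
  fixes g :: "'a::euclidean_space => complex"
  assumes "continuous_on UNIV g" "\<And>x. norm x > r ==> g x = 0"
  shows "integrable lborel g"
proof -
  have "integrable lborel (\<lambda>x. indicator (cball 0 r) x *\<^sub>R g x)"
    by (intro borel_integrable_compact continuous_on_subset[OF assms(1)]) auto
  moreover have "(\<lambda>x. indicator (cball 0 r) x *\<^sub>R g x) = g"
    using assms(2) by (auto simp: fun_eq_iff indicator_def not_le)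
  ultimately show ?thesis by simp
qed

text \<open>The substitution \<open>y = x + \<delta> z\<close> moves \<delta> from the concentrating
  kernel into the argument of \<open>f\<close>, which prepares dominated convergence. The bound
  \<open>B\<close> makes the new double integral absolutely convergent.\<close>

lemma fourier_integral_gauss_energy_scaled:
  fixes f :: "real^3 => complex"
  assumes f: "integrable lborel f" and \<delta>: "\<delta> > 0" and e: "\<bar>e\<bar> = 1"
    and B: "\<And>x. norm (f x) \<le> B"
  shows "of_real (LINT \<xi>|lborel. gauss \<delta> \<xi> * (cmod (fourier_integral e f \<xi>))\<^sup>2)
    = of_real ((2 * pi) powr (3 / 2)) * (LINT q|(lborel \<Otimes>\<^sub>M lborel). f (fst q) * cnj (f (fst q + \<delta> *\<^sub>R snd q)) * of_real (gauss 1 (snd q)))"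
proof -
  have [measurable]: "f \<in> borel_fun" using f by auto
  have B0: "B \<ge> 0" using B[of 0] norm_ge_zero order_trans by blast
  have s: "sigma_finite_measure (lborel :: (real^3) measure)" ..
  define K where "K = (2 * pi) powr (3 / 2) / \<delta> ^ 3"
  have K0: "K \<ge> 0" using \<delta> by (simp add: K_def)
  have I1: "integrable (lborel \<Otimes>\<^sub>M lborel) (\<lambda>(x, y). f x * cnj (f y) * of_real (heat \<delta> (x - y)))"
  proof (rule Bochner_Integration.integrable_bound)
    show "integrable (lborel \<Otimes>\<^sub>M lborel) (\<lambda>(x, y). (of_real K * f x) * cnj (f y))"
      using f by (intro integrable_pair_mult s) auto
    show "(\<lambda>(x, y). f x * cnj (f y) * of_real (heat \<delta> (x - y))) \<in> borel_measurable (lborel \<Otimes>\<^sub>M lborel)"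
      unfolding split_beta by measurable
    have "\<bar>heat \<delta> z\<bar> \<le> (2 * pi) powr (3 / 2) / \<delta> ^ 3" for z
      using gauss_le_1[of "1 / \<delta>" z] gauss_pos[of "1 / \<delta>" z] \<delta> by (simp add: heat_def abs_mult mult_left_le divide_right_mono)
    then show "AE q in lborel \<Otimes>\<^sub>M lborel. norm (case q of (x, y) => f x * cnj (f y) * of_real (heat \<delta> (x - y)))
      \<le> norm (case q of (x, y) => (of_real K * f x) * cnj (f y))"
    proof (intro AE_I2)
      fix q :: "(real^3) \<times> (real^3)"
      obtain x y where q: "q = (x, y)" by (cases q)
      have "norm (f x) * norm (f y) * \<bar>heat \<delta> (x - y)\<bar> \<le> norm (f x) * norm (f y) * K"
        using \<open>\<And>z. \<bar>heat \<delta> z\<bar> \<le> (2 * pi) powr (3 / 2) / \<delta> ^ 3\<close> unfolding K_def by (intro mult_left_mono) auto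
      then show "norm (case q of (x, y) => f x * cnj (f y) * of_real (heat \<delta> (x - y)))
        \<le> norm (case q of (x, y) => (of_real K * f x) * cnj (f y))"
        using K0 by (simp add: q norm_mult mult_ac)
    qed
  qed
  have I2: "integrable (lborel \<Otimes>\<^sub>M lborel) (\<lambda>(x, z). f x * cnj (f (x + \<delta> *\<^sub>R z)) * of_real (gauss 1 z))"
  proof (rule Bochner_Integration.integrable_bound)
    show "integrable (lborel \<Otimes>\<^sub>M lborel) (\<lambda>(x, z). (of_real B * f x) * complex_of_real (gauss 1 z))"
      using f integrable_gauss_1 by (intro integrable_pair_mult s) auto
    show "(\<lambda>(x, z). f x * cnj (f (x + \<delta> *\<^sub>R z)) * of_real (gauss 1 z)) \<in> borel_measurable (lborel \<Otimes>\<^sub>M lborel)"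
      unfolding split_beta by measurable
    show "AE q in lborel \<Otimes>\<^sub>M lborel. norm (case q of (x, z) => f x * cnj (f (x + \<delta> *\<^sub>R z)) * of_real (gauss 1 z))
      \<le> norm (case q of (x, z) => (of_real B * f x) * complex_of_real (gauss 1 z))"
    proof (intro AE_I2)
      fix q :: "(real^3) \<times> (real^3)"
      obtain x z where q: "q = (x, z)" by (cases q)
      have "norm (f x) * norm (f (x + \<delta> *\<^sub>R z)) * gauss 1 z \<le> norm (f x) * B * gauss 1 z"
        using less_imp_le[OF gauss_pos] by (intro mult_left_mono mult_right_mono B) auto
      then show "norm (case q of (x, z) => f x * cnj (f (x + \<delta> *\<^sub>R z)) * of_real (gauss 1 z))
        \<le> norm (case q of (x, z) => (of_real B * f x) * complex_of_real (gauss 1 z))"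
        using B0 less_imp_le[OF gauss_pos[of 1 z]] by (simp add: q norm_mult mult_ac)
    qed
  qed
  have "complex_of_real (LINT \<xi>|lborel. gauss \<delta> \<xi> * (cmod (fourier_integral e f \<xi>))\<^sup>2)
    = (LINT q|(lborel \<Otimes>\<^sub>M lborel). f (fst q) * cnj (f (snd q)) * of_real (heat \<delta> (fst q - snd q)))"
    unfolding heat_def by (rule fourier_integral_gauss_energy[OF f \<delta> e])
  also have "... = (LINT x|lborel. LINT y|lborel. f x * cnj (f y) * of_real (heat \<delta> (x - y)))"
    using lborel_pair.integral_fst'[OF I1] by (simp add: case_prod_unfold)
  also have "... = (LINT x|lborel. of_real ((2 * pi) powr (3 / 2)) * (LINT z|lborel. f x * cnj (f (x + \<delta> *\<^sub>R z)) * of_real (gauss 1 z)))"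
  proof (intro Bochner_Integration.integral_cong refl)
    fix x
    have "(LINT y|lborel. f x * cnj (f y) * of_real (heat \<delta> (x - y)))
      = \<bar>\<delta>\<bar> ^ DIM(real^3) *\<^sub>R (LINT z|lborel. f x * cnj (f (x + \<delta> *\<^sub>R z)) * of_real (heat \<delta> (x - (x + \<delta> *\<^sub>R z))))"
      using \<delta> by (intro integral_lborel_scale) auto
    also have "... = \<bar>\<delta>\<bar> ^ DIM(real^3) *\<^sub>R (LINT z|lborel. of_real ((2 * pi) powr (3 / 2) / \<delta> ^ 3) * (f x * cnj (f (x + \<delta> *\<^sub>R z)) * of_real (gauss 1 z)))"
    proof (intro arg_cong2[where f = scaleR] refl Bochner_Integration.integral_cong)
      fix z
      have "heat \<delta> (x - (x + \<delta> *\<^sub>R z)) = (2 * pi) powr (3 / 2) / \<delta> ^ 3 * gauss 1 z"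
        using heat_minus[of \<delta> "\<delta> *\<^sub>R z"] heat_scale[OF \<delta>, of z] by simp
      then show "f x * cnj (f (x + \<delta> *\<^sub>R z)) * of_real (heat \<delta> (x - (x + \<delta> *\<^sub>R z)))
        = of_real ((2 * pi) powr (3 / 2) / \<delta> ^ 3) * (f x * cnj (f (x + \<delta> *\<^sub>R z)) * of_real (gauss 1 z))"
        by (simp only: of_real_mult mult_ac)
    qed
    also have "... = of_real (\<delta> ^ 3) * (of_real ((2 * pi) powr (3 / 2) / \<delta> ^ 3) * (LINT z|lborel. f x * cnj (f (x + \<delta> *\<^sub>R z)) * of_real (gauss 1 z)))"
      using \<delta> by (subst integral_mult_right_zero) (simp add: scaleR_conv_of_real)
    also have "... = of_real ((2 * pi) powr (3 / 2)) * (LINT z|lborel. f x * cnj (f (x + \<delta> *\<^sub>R z)) * of_real (gauss 1 z))"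
      using \<delta> by simp
    finally show "(LINT y|lborel. f x * cnj (f y) * of_real (heat \<delta> (x - y)))
      = of_real ((2 * pi) powr (3 / 2)) * (LINT z|lborel. f x * cnj (f (x + \<delta> *\<^sub>R z)) * of_real (gauss 1 z))" .
  qed
  also have "... = of_real ((2 * pi) powr (3 / 2)) * (LINT x|lborel. LINT z|lborel. f x * cnj (f (x + \<delta> *\<^sub>R z)) * of_real (gauss 1 z))"
    by (rule integral_mult_right_zero)
  also have "(LINT x|lborel. LINT z|lborel. f x * cnj (f (x + \<delta> *\<^sub>R z)) * of_real (gauss 1 z))
    = (LINT q|(lborel \<Otimes>\<^sub>M lborel). f (fst q) * cnj (f (fst q + \<delta> *\<^sub>R snd q)) * of_real (gauss 1 (snd q)))"
    using lborel_pair.integral_fst'[OF I2] by (simp add: case_prod_unfold)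
  finally show ?thesis .
qed

lemma energy_eq_integral:
  assumes "integrable lborel (\<lambda>x. (norm (f x))\<^sup>2)"
  shows "energy f = ennreal (LINT x|lborel. (norm (f x))\<^sup>2)"
  unfolding energy_def by (rule nn_integral_eq_integral[OF assms]) auto

text \<open>Let \<delta> tend to 0 in the scaled identity: by continuity the shifted value of
  \<open>f\<close> tends to \<open>f x\<close>, and the two Gaussian constants multiply to
  \<open>(2 * pi) ^ 3\<close>. The same quantities tend to the energy of the transform by
  \<open>energy_gauss_limit\<close>.\<close>

lemma fourier_integral_energy_continuous:
  fixes f :: "real^3 => complex"
  assumes e: "\<bar>e\<bar> = 1" and cont: "continuous_on UNIV f" and supp: "\<And>x. norm x > r ==> f x = 0"
  shows "energy (fourier_integral e f) = ennreal ((2 * pi) ^ 3) * energy f"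
proof -
  have f: "integrable lborel f" by (rule integrable_continuous_bounded_support[OF cont supp])
  have [measurable]: "f \<in> borel_fun" using f by auto
  have "bounded (f ` cball 0 r)"
    by (intro compact_imp_bounded compact_continuous_image continuous_on_subset[OF cont]) auto
  then obtain B where "\<forall>x\<in>cball 0 r. norm (f x) \<le> B" by (auto simp: bounded_iff)
  then have B: "norm (f x) \<le> max B 0" for x using supp[of x] by (cases "norm x \<le> r") force+
  have s: "sigma_finite_measure (lborel :: (real^3) measure)" ..
  define \<delta> where "\<delta> n = 1 / (real n + 1)" for n
  have \<delta>0: "\<delta> n > 0" for n by (simp add: \<delta>_def)
  have \<delta>lim: "\<delta> \<longlonglongrightarrow> 0"
    using LIMSEQ_inverse_real_of_nat by (simp add: \<delta>_def[abs_def] inverse_eq_divide add.commute)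
  have "(\<lambda>n. LINT q|(lborel \<Otimes>\<^sub>M lborel). f (fst q) * cnj (f (fst q + \<delta> n *\<^sub>R snd q)) * of_real (gauss 1 (snd q)))
     \<longlonglongrightarrow> (LINT q|(lborel \<Otimes>\<^sub>M lborel). f (fst q) * cnj (f (fst q)) * of_real (gauss 1 (snd q)))"
  proof (rule integral_dominated_convergence[where w = "\<lambda>(x, z). max B 0 * norm (f x) * gauss 1 z"])
    have "integrable (lborel \<Otimes>\<^sub>M lborel) (\<lambda>q. norm (case q of (x, z) => (of_real (max B 0) * f x) * complex_of_real (gauss 1 z)))"
      using f integrable_gauss_1 by (intro integrable_norm integrable_pair_mult s) auto
    moreover have "(\<lambda>q. norm (case q of (x, z) => (of_real (max B 0) * f x) * complex_of_real (gauss 1 z)))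
      = (\<lambda>(x, z). max B 0 * norm (f x) * gauss 1 z)"
      using less_imp_le[OF gauss_pos[of 1]] by (auto simp: fun_eq_iff norm_mult)
    ultimately show "integrable (lborel \<Otimes>\<^sub>M lborel) (\<lambda>(x, z). max B 0 * norm (f x) * gauss 1 z)" by simp
    show "AE q in lborel \<Otimes>\<^sub>M lborel. (\<lambda>n. f (fst q) * cnj (f (fst q + \<delta> n *\<^sub>R snd q)) * of_real (gauss 1 (snd q)))
       \<longlonglongrightarrow> f (fst q) * cnj (f (fst q)) * of_real (gauss 1 (snd q))"
    proof (intro AE_I2)
      fix q :: "(real^3) \<times> (real^3)"
      have "(\<lambda>n. fst q + \<delta> n *\<^sub>R snd q) \<longlonglongrightarrow> fst q + 0 *\<^sub>R snd q"
        by (intro tendsto_intros \<delta>lim)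
      then have "(\<lambda>n. fst q + \<delta> n *\<^sub>R snd q) \<longlonglongrightarrow> fst q" by simp
      from continuous_on_tendsto_compose[OF cont this]
      have "(\<lambda>n. f (fst q + \<delta> n *\<^sub>R snd q)) \<longlonglongrightarrow> f (fst q)" by simp
      then show "(\<lambda>n. f (fst q) * cnj (f (fst q + \<delta> n *\<^sub>R snd q)) * of_real (gauss 1 (snd q)))
         \<longlonglongrightarrow> f (fst q) * cnj (f (fst q)) * of_real (gauss 1 (snd q))"
        by (intro tendsto_intros tendsto_cnj)
    qed
    show "AE q in lborel \<Otimes>\<^sub>M lborel. norm (f (fst q) * cnj (f (fst q + \<delta> n *\<^sub>R snd q)) * of_real (gauss 1 (snd q)))
       \<le> (case q of (x, z) => max B 0 * norm (f x) * gauss 1 z)" for n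
    proof (intro AE_I2)
      fix q :: "(real^3) \<times> (real^3)"
      have "norm (f (fst q)) * norm (f (fst q + \<delta> n *\<^sub>R snd q)) * gauss 1 (snd q)
         \<le> norm (f (fst q)) * max B 0 * gauss 1 (snd q)"
        using less_imp_le[OF gauss_pos[of 1 "snd q"]] B by (intro mult_right_mono mult_left_mono) auto
      then show "norm (f (fst q) * cnj (f (fst q + \<delta> n *\<^sub>R snd q)) * of_real (gauss 1 (snd q)))
         \<le> (case q of (x, z) => max B 0 * norm (f x) * gauss 1 z)"
        using less_imp_le[OF gauss_pos[of 1 "snd q"]] by (simp add: norm_mult split_beta mult_ac)
    qed
  qed measurable
  also have "(LINT q|(lborel \<Otimes>\<^sub>M lborel). f (fst q) * cnj (f (fst q)) * of_real (gauss 1 (snd q)))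
     = of_real ((2 * pi) powr (3 / 2) * (LINT x|lborel. (norm (f x))\<^sup>2))"
  proof -
    have c: "f x * cnj (f x) = complex_of_real ((norm (f x))\<^sup>2)" for x by (simp only: complex_norm_square)
    have "integrable lborel (\<lambda>x. f x * cnj (f x))"
      by (rule integrable_continuous_bounded_support[of _ r]) (auto intro!: continuous_intros cont simp: supp)
    from integral_lborel_pair_mult(2)[OF this, of "\<lambda>z. complex_of_real (gauss 1 z)"]
    show ?thesis using integrable_gauss_1 integral_gauss_1
      by (simp add: c lborel_prod mult.commute del: of_real_power)
  qed
  finally have "(\<lambda>n. of_real ((2 * pi) powr (3 / 2)) * (LINT q|(lborel \<Otimes>\<^sub>M lborel). f (fst q) * cnj (f (fst q + \<delta> n *\<^sub>R snd q)) * of_real (gauss 1 (snd q))))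
    \<longlonglongrightarrow> of_real ((2 * pi) powr (3 / 2)) * of_real ((2 * pi) powr (3 / 2) * (LINT x|lborel. (norm (f x))\<^sup>2))"
    by (intro tendsto_intros)
  then have "(\<lambda>n. complex_of_real (LINT \<xi>|lborel. gauss (\<delta> n) \<xi> * (cmod (fourier_integral e f \<xi>))\<^sup>2))
    \<longlonglongrightarrow> complex_of_real ((2 * pi) ^ 3 * (LINT x|lborel. (norm (f x))\<^sup>2))"
    unfolding fourier_integral_gauss_energy_scaled[OF f \<delta>0 e B] two_pi_powr_3[symmetric]
    by (simp only: of_real_mult mult.assoc)
  then have "(\<lambda>n. LINT \<xi>|lborel. gauss (\<delta> n) \<xi> * (cmod (fourier_integral e f \<xi>))\<^sup>2)
    \<longlonglongrightarrow> (2 * pi) ^ 3 * (LINT x|lborel. (norm (f x))\<^sup>2)"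
    by (simp only: tendsto_of_real_iff)
  then have L1: "(\<lambda>n. (\<integral>\<xi>. ennreal (gauss (\<delta> n) \<xi> * (cmod (fourier_integral e f \<xi>))\<^sup>2)))
    \<longlonglongrightarrow> ennreal ((2 * pi) ^ 3 * (LINT x|lborel. (norm (f x))\<^sup>2))"
    by (subst nn_integral_eq_integral[OF fourier_integral_gauss_integrable[OF f \<delta>0 e]])
       (auto intro!: tendsto_ennrealI AE_I2 mult_nonneg_nonneg less_imp_le[OF gauss_pos])
  have L2: "(\<lambda>n. (\<integral>\<xi>. ennreal (gauss (\<delta> n) \<xi> * (cmod (fourier_integral e f \<xi>))\<^sup>2)))
    \<longlonglongrightarrow> energy (fourier_integral e f)"
    unfolding \<delta>_def energy_gauss_limit(1)[OF borel_measurable_fourier_integral[OF \<open>f \<in> borel_fun\<close>]]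
    by (intro LIMSEQ_SUP energy_gauss_limit(2)) simp
  have "integrable lborel (\<lambda>x. complex_of_real ((norm (f x))\<^sup>2))"
    by (rule integrable_continuous_bounded_support[of _ r]) (auto intro!: continuous_intros cont simp: supp)
  then have "integrable lborel (\<lambda>x. (norm (f x))\<^sup>2)" by (simp only: complex_of_real_integrable_eq)
  from energy_eq_integral[OF this] LIMSEQ_unique[OF L2 L1] show ?thesis
    by (simp add: ennreal_mult')
qed

section \<open>Approximation in energy by continuous functions, and Plancherel's identity\<close>

lemma cball_borel [measurable]: "cball x r \<in> sets borel" by simp

lemma energy_tendsto_0:
  fixes h :: "nat => 'a::euclidean_space => 'b::{second_countable_topology, real_normed_vector}"
  assumes [measurable]: "\<And>n. h n \<in> borel_fun" "w \<in> borel_fun"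
    and lim: "AE x in lborel. (\<lambda>n. h n x) \<longlonglongrightarrow> 0"
    and le: "\<And>n x. (norm (h n x))\<^sup>2 \<le> w x" and w: "(\<integral>x. ennreal (w x)) < \<infinity>"
  shows "(\<lambda>n. energy (h n)) \<longlonglongrightarrow> 0"
proof -
  have "(\<lambda>n. (\<integral>x. ennreal ((norm (h n x))\<^sup>2))) \<longlonglongrightarrow> (\<integral>\<^sup>+x. 0 \<partial>(lborel :: 'a measure))"
  proof (rule nn_integral_dominated_convergence[where w = "\<lambda>x. ennreal (w x)"])
    show "AE x in lborel. (\<lambda>n. ennreal ((norm (h n x))\<^sup>2)) \<longlonglongrightarrow> 0"
      using lim
    proof eventually_elim
      case (elim x)
      then have "(\<lambda>n. (norm (h n x))\<^sup>2) \<longlonglongrightarrow> (norm (0::'b))\<^sup>2" by (intro tendsto_intros)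
      then have "(\<lambda>n. ennreal ((norm (h n x))\<^sup>2)) \<longlonglongrightarrow> ennreal 0" by (intro tendsto_ennrealI) simp
      then show ?case by simp
    qed
  qed (use le w in \<open>auto intro!: ennreal_leI AE_I2\<close>)
  then show ?thesis by (simp add: energy_def)
qed

lemma energy_add_le:
  assumes [measurable]: "a \<in> borel_fun" "b \<in> borel_fun"
  shows "energy (\<lambda>x. a x + b x) \<le> 2 * energy a + 2 * energy b"
proof -
  have p: "ennreal ((norm (u + v))\<^sup>2) \<le> 2 * ennreal ((norm u)\<^sup>2) + 2 * ennreal ((norm v)\<^sup>2)" for u v :: 'b
  proof -
    have "(norm (u + v))\<^sup>2 \<le> (norm u + norm v)\<^sup>2" by (intro power_mono norm_triangle_ineq) simp
    also have "... \<le> 2 * (norm u)\<^sup>2 + 2 * (norm v)\<^sup>2"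
      using zero_le_power2[of "norm u - norm v"] by (simp add: power2_eq_square algebra_simps)
    finally have "ennreal ((norm (u + v))\<^sup>2) \<le> ennreal (2 * (norm u)\<^sup>2 + 2 * (norm v)\<^sup>2)" by (rule ennreal_leI)
    then show ?thesis by (simp add: ennreal_mult')
  qed
  have "energy (\<lambda>x. a x + b x) \<le> (\<integral>x. 2 * ennreal ((norm (a x))\<^sup>2) + 2 * ennreal ((norm (b x))\<^sup>2))"
    unfolding energy_def by (intro nn_integral_mono p)
  also have "... = 2 * energy a + 2 * energy b"
    unfolding energy_def by (simp add: nn_integral_add nn_integral_cmult)
  finally show ?thesis .
qed

lemma energy_parallelogram:
  fixes a b :: "'a::euclidean_space => 'b::euclidean_space"
  assumes [measurable]: "a \<in> borel_fun" "b \<in> borel_fun"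
  shows "energy (\<lambda>x. a x + b x) + energy (\<lambda>x. a x - b x) = 2 * energy a + 2 * energy b"
proof -
  have p: "ennreal ((norm (u + v))\<^sup>2) + ennreal ((norm (u - v))\<^sup>2) = 2 * ennreal ((norm u)\<^sup>2) + 2 * ennreal ((norm v)\<^sup>2)" for u v :: 'b
  proof -
    have "(norm (u + v))\<^sup>2 + (norm (u - v))\<^sup>2 = 2 * (norm u)\<^sup>2 + 2 * (norm v)\<^sup>2"
      by (simp add: power2_norm_eq_inner inner_simps inner_commute)
    then have "ennreal ((norm (u + v))\<^sup>2 + (norm (u - v))\<^sup>2) = ennreal (2 * (norm u)\<^sup>2 + 2 * (norm v)\<^sup>2)" by simp
    then show ?thesis by (simp add: ennreal_mult')
  qed
  have "energy (\<lambda>x. a x + b x) + energy (\<lambda>x. a x - b x)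
     = (\<integral>x. ennreal ((norm (a x + b x))\<^sup>2) + ennreal ((norm (a x - b x))\<^sup>2))"
    unfolding energy_def by (rule nn_integral_add[symmetric]) measurable
  also have "... = 2 * energy a + 2 * energy b"
    unfolding energy_def p by (simp add: nn_integral_add nn_integral_cmult)
  finally show ?thesis .
qed

lemma energy_approx_truncation:
  fixes f :: "'a::euclidean_space => 'b::{second_countable_topology, real_normed_vector}"
  assumes [measurable]: "f \<in> borel_fun" and fin: "energy f < \<infinity>" and d: "d > 0"
  shows "\<exists>k::nat. energy (\<lambda>x. f x - (if norm x \<le> k \<and> norm (f x) \<le> k then f x else 0)) < ennreal d"
proof -
  have "(\<lambda>k. energy (\<lambda>x. f x - (if norm x \<le> real k \<and> norm (f x) \<le> real k then f x else 0))) \<longlonglongrightarrow> 0"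
  proof (rule energy_tendsto_0[where w = "\<lambda>x. (norm (f x))\<^sup>2"])
    show "AE x in lborel. (\<lambda>n. f x - (if norm x \<le> real n \<and> norm (f x) \<le> real n then f x else 0)) \<longlonglongrightarrow> 0"
    proof (intro AE_I2)
      fix x
      obtain n0 :: nat where n0: "max (norm x) (norm (f x)) \<le> real n0" using real_arch_simple by blast
      have "eventually (\<lambda>n. f x - (if norm x \<le> real n \<and> norm (f x) \<le> real n then f x else 0) = 0) sequentially"
        using eventually_ge_at_top[of n0]
      proof eventually_elim
        case (elim n)
        then have "real n0 \<le> real n" by simp
        then show ?case using n0 by auto
      qed
      then show "(\<lambda>n. f x - (if norm x \<le> real n \<and> norm (f x) \<le> real n then f x else 0)) \<longlonglongrightarrow> 0"
        by (rule tendsto_eventually)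
    qed
  qed (use fin in \<open>auto simp: energy_def\<close>)
  then have "eventually (\<lambda>k. energy (\<lambda>x. f x - (if norm x \<le> real k \<and> norm (f x) \<le> real k then f x else 0)) < ennreal d) sequentially"
    using d by (intro order_tendstoD(2)[where y = 0]) auto
  then show ?thesis by (auto simp: eventually_sequentially)
qed

text \<open>\<open>measurable_on\<close> supplies continuous functions tending to \<open>f\<close>
  almost everywhere. Projecting their values to the ball of radius \<open>K\<close> and multiplying
  by a cutoff keeps them continuous and dominates the errors by \<open>2 * K\<close> on a fixed
  ball, so dominated convergence applies.\<close>

lemma energy_approx_continuous_bounded:
  fixes f :: "real^3 => complex"
  assumes f [measurable]: "f \<in> borel_fun" and K: "K \<ge> 0" and bd: "\<And>x. norm (f x) \<le> K"
    and supp: "\<And>x. norm x > K ==> f x = 0" and d: "d > 0"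
  shows "\<exists>g. continuous_on UNIV g \<and> (\<forall>x. norm x > K + 1 \<longrightarrow> g x = 0) \<and> energy (\<lambda>x. f x - g x) < ennreal d"
proof -
  have "f measurable_on UNIV"
    using f by (subst measurable_on_iff_borel_measurable) (auto simp: lebesgue_on_UNIV_eq intro: measurable_completion)
  then obtain N G where N: "negligible N" and G: "\<And>n. continuous_on UNIV (G n)"
    and lim: "\<And>x. x \<notin> N ==> (\<lambda>n. G n x) \<longlonglongrightarrow> f x"
    unfolding measurable_on_def by auto
  define cl where "cl = closest_point (cball (0::complex) K)"
  have ccl: "continuous_on UNIV cl"
    unfolding cl_def using K by (intro continuous_on_closest_point) auto
  have cl_le: "norm (cl z) \<le> K" for z
    using closest_point_in_set[of "cball 0 K" z] K by (auto simp: cl_def)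
  have cl_id: "norm z \<le> K ==> cl z = z" for z
    unfolding cl_def by (rule closest_point_self) simp
  define \<eta> where "\<eta> x = max 0 (min 1 (K + 1 - norm x))" for x :: "real^3"
  have c\<eta>: "continuous_on UNIV \<eta>" unfolding \<eta>_def by (intro continuous_intros)
  have \<eta>: "0 \<le> \<eta> x" "\<eta> x \<le> 1" "norm x \<le> K ==> \<eta> x = 1" "norm x > K + 1 ==> \<eta> x = 0" for x
    by (auto simp: \<eta>_def)
  define g where "g n x = \<eta> x *\<^sub>R cl (G n x)" for n x
  have cg: "continuous_on UNIV (g n)" for n
    unfolding g_def using continuous_on_compose2[OF ccl G[of n]] c\<eta> by (intro continuous_intros) auto
  have [measurable]: "g n \<in> borel_fun" for n by (intro borel_measurable_continuous_onI cg)
  have g0: "norm x > K + 1 ==> g n x = 0" for n x using \<eta> by (simp add: g_def)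
  have gle: "norm (g n x) \<le> K" for n x
    using mult_mono[OF \<eta>(2)[of x] cl_le[of "G n x"]] \<eta>(1)[of x] by (simp add: g_def)
  have "(\<lambda>n. energy (\<lambda>x. f x - g n x)) \<longlonglongrightarrow> 0"
  proof (rule energy_tendsto_0[where w = "\<lambda>x. (2 * K)\<^sup>2 * indicator (cball 0 (K + 1)) x"])
    have "AE x in lebesgue. x \<notin> N" using N by (intro AE_not_in) (simp add: negligible_iff_null_sets)
    then have "AE x in lborel. x \<notin> N" by (simp add: AE_completion_iff)
    then show "AE x in lborel. (\<lambda>n. f x - g n x) \<longlonglongrightarrow> 0"
    proof eventually_elim
      case (elim x)
      have "isCont cl (f x)" using ccl by (simp add: continuous_on_eq_continuous_at)
      then have "(\<lambda>n. cl (G n x)) \<longlonglongrightarrow> cl (f x)" using lim[OF elim] by (rule isCont_tendsto_compose)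
      then have "(\<lambda>n. f x - g n x) \<longlonglongrightarrow> f x - \<eta> x *\<^sub>R cl (f x)" unfolding g_def by (intro tendsto_intros)
      also have "f x - \<eta> x *\<^sub>R cl (f x) = 0"
        using \<eta>(3)[of x] supp[of x] cl_id[OF bd[of x]] by (cases "norm x \<le> K") auto
      finally show ?case .
    qed
    show "(norm (f x - g n x))\<^sup>2 \<le> (2 * K)\<^sup>2 * indicator (cball 0 (K + 1)) x" for n x
    proof (cases "norm x \<le> K + 1")
      case True
      have "norm (f x - g n x) \<le> 2 * K"
        using norm_triangle_ineq4[of "f x" "g n x"] bd[of x] gle[of n x] by linarith
      then have "(norm (f x - g n x))\<^sup>2 \<le> (2 * K)\<^sup>2" by (intro power_mono) auto
      then show ?thesis using True by simp
    qed (use g0 supp in auto)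
    have "(\<integral>x. ennreal ((2 * K)\<^sup>2 * indicator (cball (0::real^3) (K + 1)) x))
      = (\<integral>x. ennreal ((2 * K)\<^sup>2) * indicator (cball (0::real^3) (K + 1)) x)"
      by (intro nn_integral_cong) (auto split: split_indicator)
    also have "... < \<infinity>"
      using emeasure_lborel_cball_finite[of "0::real^3" "K + 1"]
      by (subst nn_integral_cmult_indicator) (auto simp: ennreal_mult_less_top)
    finally show "(\<integral>x. ennreal ((2 * K)\<^sup>2 * indicator (cball (0::real^3) (K + 1)) x)) < \<infinity>" .
  qed measurable
  then have "eventually (\<lambda>n. energy (\<lambda>x. f x - g n x) < ennreal d) sequentially"
    using d by (intro order_tendstoD(2)[where y = 0]) auto
  then obtain n where "energy (\<lambda>x. f x - g n x) < ennreal d" by (auto simp: eventually_sequentially)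
  then show ?thesis using cg g0 by blast
qed

lemma energy_approx_continuous:
  fixes f :: "real^3 => complex"
  assumes f [measurable]: "f \<in> borel_fun" and fin: "energy f < \<infinity>" and d: "d > 0"
  shows "\<exists>g r. continuous_on UNIV g \<and> (\<forall>x. norm x > r \<longrightarrow> g x = 0) \<and> energy (\<lambda>x. f x - g x) \<le> ennreal d"
proof -
  \<comment> \<open>Two approximations of error \<open>d / 4\<close> are combined;
    \<open>energy_add_le\<close> doubles both.\<close>
  obtain k :: nat where k: "energy (\<lambda>x. f x - (if norm x \<le> k \<and> norm (f x) \<le> k then f x else 0)) < ennreal (d / 4)"
    using energy_approx_truncation[OF f fin, of "d / 4"] d by auto
  define h where "h x = (if norm x \<le> k \<and> norm (f x) \<le> k then f x else 0)" for x
  have [measurable]: "h \<in> borel_fun" unfolding h_def by measurable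
  obtain g where g: "continuous_on UNIV g" "\<forall>x. norm x > real k + 1 \<longrightarrow> g x = 0" "energy (\<lambda>x. h x - g x) < ennreal (d / 4)"
  proof -
    have "norm (h x) \<le> real k" "norm x > real k ==> h x = 0" for x by (auto simp: h_def)
    then show ?thesis using energy_approx_continuous_bounded[of h "real k" "d / 4"] d that by auto
  qed
  have [measurable]: "g \<in> borel_fun" by (intro borel_measurable_continuous_onI g)
  have "energy (\<lambda>x. f x - g x) = energy (\<lambda>x. (f x - h x) + (h x - g x))" by simp
  also have "... \<le> 2 * energy (\<lambda>x. f x - h x) + 2 * energy (\<lambda>x. h x - g x)"
    by (rule energy_add_le) measurable
  also have "... \<le> 2 * ennreal (d / 4) + 2 * ennreal (d / 4)"
    using k g(3) by (intro add_mono mult_left_mono) (auto simp: h_def)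
  also have "... = ennreal d"
  proof -
    have "2 * ennreal (d / 4) = ennreal (2 * (d / 4))" using d by (subst ennreal_mult) auto
    then have "2 * ennreal (d / 4) + 2 * ennreal (d / 4) = ennreal (2 * (d / 4) + 2 * (d / 4))"
      using d by (simp only:) (rule ennreal_plus[symmetric], auto)
    then show ?thesis by simp
  qed
  finally show ?thesis using g by auto
qed

lemma fourier_integral_add:
  assumes "integrable lborel f" "integrable lborel g"
  shows "fourier_integral e (\<lambda>x. f x + g x) = (\<lambda>\<xi>. fourier_integral e f \<xi> + fourier_integral e g \<xi>)"
    and "fourier_integral e (\<lambda>x. f x - g x) = (\<lambda>\<xi>. fourier_integral e f \<xi> - fourier_integral e g \<xi>)"
proof -
  have [measurable]: "f \<in> borel_fun" "g \<in> borel_fun" using assms by auto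
  have i: "integrable lborel (\<lambda>x. cis (e * (x \<bullet> \<xi>)) * u x)" if "integrable lborel u" for u \<xi>
  proof (rule Bochner_Integration.integrable_bound[OF that])
    show "(\<lambda>x. cis (e * (x \<bullet> \<xi>)) * u x) \<in> borel_measurable lborel" using that by measurable
  qed (auto simp: norm_mult)
  show "fourier_integral e (\<lambda>x. f x + g x) = (\<lambda>\<xi>. fourier_integral e f \<xi> + fourier_integral e g \<xi>)"
    "fourier_integral e (\<lambda>x. f x - g x) = (\<lambda>\<xi>. fourier_integral e f \<xi> - fourier_integral e g \<xi>)"
    using i[OF assms(1)] i[OF assms(2)] by (auto simp: fourier_integral_def fun_eq_iff distrib_left right_diff_distrib)
qed

text \<open>The defect \<open>(2 \<pi>)\<^sup>3 energy f - energy (fourier_integral e f)\<close> is a nonnegative quadratic form that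
  vanishes on continuous functions of bounded support, so by the parallelogram law it is at most
  twice its value at \<open>f - g\<close> for such \<open>g\<close>.\<close>

theorem fourier_integral_energy:
  fixes f :: "real^3 => complex"
  assumes f: "integrable lborel f" and fin: "energy f < \<infinity>" and e: "\<bar>e\<bar> = 1"
  shows "energy (fourier_integral e f) = ennreal ((2 * pi) ^ 3) * energy f"
proof (rule antisym[OF fourier_integral_energy_le[OF f e]])
  have [measurable]: "f \<in> borel_fun" using f by auto
  define c where "c = ennreal ((2 * pi) ^ 3)"
  have cfin: "c < top" by (simp add: c_def)
  show "ennreal ((2 * pi) ^ 3) * energy f \<le> energy (fourier_integral e f)"
    unfolding c_def[symmetric]
  proof (rule ennreal_le_epsilon)
    fix \<epsilon> :: real assume \<epsilon>: "\<epsilon> > 0"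
    \<comment> \<open>Chosen so that twice \<open>(2 * pi) ^ 3\<close> times it is \<epsilon>, the
      total loss below.\<close>
    define \<epsilon>' where "\<epsilon>' = \<epsilon> / (2 * (2 * pi) ^ 3)"
    have \<epsilon>': "\<epsilon>' > 0" using \<epsilon> by (simp add: \<epsilon>'_def)
    obtain g r where g: "continuous_on UNIV g" "\<And>x. norm x > r ==> g x = 0" and "energy (\<lambda>x. f x - g x) \<le> ennreal \<epsilon>'"
      using energy_approx_continuous[OF _ fin \<epsilon>'] by auto
    define h where "h x = f x - g x" for x
    have eh: "energy h \<le> ennreal \<epsilon>'" using \<open>energy (\<lambda>x. f x - g x) \<le> ennreal \<epsilon>'\<close> by (simp add: h_def[abs_def])
    have gi: "integrable lborel g" by (rule integrable_continuous_bounded_support[OF g])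
    have hi: "integrable lborel h" unfolding h_def using f gi by simp
    have [measurable]: "g \<in> borel_fun" "h \<in> borel_fun" using gi hi by auto
    let ?F = "fourier_integral e"
    have fgh: "f = (\<lambda>x. g x + h x)" by (simp add: h_def fun_eq_iff)
    have ghi: "integrable lborel (\<lambda>x. g x - h x)" using gi hi by simp
    have eg: "energy (?F g) = c * energy g" unfolding c_def by (rule fourier_integral_energy_continuous[OF e g])
    have P1: "energy f + energy (\<lambda>x. g x - h x) = 2 * energy g + 2 * energy h"
      unfolding fgh by (rule energy_parallelogram) measurable
    have P2: "energy (?F f) + energy (?F (\<lambda>x. g x - h x)) = 2 * energy (?F g) + 2 * energy (?F h)"
      unfolding fgh fourier_integral_add[OF gi hi] by (rule energy_parallelogram) measurable
    \<comment> \<open>Finiteness is what permits cancelling this energy in \<open>ennreal\<close> at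
      the end.\<close>
    have gf: "energy (\<lambda>x. g x - h x) < top"
    proof -
      have "energy g = energy (\<lambda>x. f x + (- h x))" by (simp add: h_def)
      also have "... \<le> 2 * energy f + 2 * energy (\<lambda>x. - h x)" by (rule energy_add_le) measurable
      also have "energy (\<lambda>x. - h x) = energy h" by (simp add: energy_def)
      also have "2 * energy f + 2 * energy h < top"
        using fin eh by (auto simp: ennreal_mult_less_top le_less_trans[OF _ ennreal_less_top])
      finally have "energy g < top" .
      then have "2 * energy g + 2 * energy h < top"
        using eh by (auto simp: ennreal_mult_less_top le_less_trans[OF _ ennreal_less_top])
      then show ?thesis unfolding P1[symmetric] by (simp add: less_top)
    qed
    have "c * energy (\<lambda>x. g x - h x) + c * energy f = 2 * energy (?F g) + c * (2 * energy h)"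
      using arg_cong[OF P1, of "\<lambda>t. c * t"] by (simp add: eg distrib_left mult_ac add.commute)
    also have "... \<le> (energy (?F f) + energy (?F (\<lambda>x. g x - h x))) + c * (2 * energy h)"
      unfolding P2 by (intro add_right_mono) simp
    also have "... \<le> (energy (?F f) + c * energy (\<lambda>x. g x - h x)) + c * (2 * ennreal \<epsilon>')"
      unfolding c_def by (intro add_mono mult_left_mono order_refl fourier_integral_energy_le[OF ghi e] eh) auto
    also have "... = c * energy (\<lambda>x. g x - h x) + (energy (?F f) + c * (2 * ennreal \<epsilon>'))"
      by (simp add: ac_simps)
    finally have "c * energy f \<le> energy (?F f) + c * (2 * ennreal \<epsilon>')"
      using gf cfin by (auto simp: ennreal_add_left_cancel_le ennreal_mult_eq_top_iff)
    also have "c * (2 * ennreal \<epsilon>') = ennreal \<epsilon>"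
    proof -
      have "c * (2 * ennreal \<epsilon>') = ennreal ((2 * pi) ^ 3 * (2 * \<epsilon>'))"
        using \<epsilon>' unfolding c_def by (subst ennreal_mult) (auto simp: ennreal_mult')
      also have "(2 * pi) ^ 3 * (2 * \<epsilon>') = \<epsilon>" by (simp add: \<epsilon>'_def)
      finally show ?thesis .
    qed
    finally show "c * energy f \<le> energy (?F f) + ennreal \<epsilon>" .
  qed
qed

section \<open>Completeness of the space of finite energy\<close>

lemma energy_minus_commute: "energy (\<lambda>x. a x - b x) = energy (\<lambda>x. b x - a x)"
  by (simp add: energy_def norm_minus_commute)

text \<open>The rate 1/8 leaves room for the weight \<open>2 ^ k\<close>: the weighted squares have
  integrals at most \<open>(1/4) ^ k\<close>, hence are summable almost everywhere, and
  \<open>|d| \<le> (1/2) ^ k + 2 ^ k |d|^2\<close> passes from squares to norms.\<close>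

lemma AE_summable_of_energy:
  fixes d :: "nat => 'a::euclidean_space => 'b::{second_countable_topology, real_normed_vector}"
  assumes [measurable]: "\<And>k. d k \<in> borel_fun"
    and le: "\<And>k. energy (d k) \<le> ennreal ((1/8) ^ k)"
  shows "AE x in lborel. summable (\<lambda>k. norm (d k x))"
proof -
  have "(\<integral>x. (\<Sum>k. ennreal (2 ^ k * (norm (d k x))\<^sup>2))) = (\<Sum>k. (\<integral>x. ennreal (2 ^ k * (norm (d k x))\<^sup>2)))"
    by (rule nn_integral_suminf) measurable
  also have "... = (\<Sum>k. ennreal (2 ^ k) * energy (d k))"
    unfolding energy_def by (simp add: ennreal_mult' nn_integral_cmult)
  also have "... \<le> (\<Sum>k. ennreal ((1/4) ^ k))"
  proof (intro suminf_le summableI)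
    fix k
    have "ennreal (2 ^ k) * energy (d k) \<le> ennreal (2 ^ k) * ennreal ((1/8) ^ k)"
      by (intro mult_left_mono le) simp
    also have "... = ennreal (2 ^ k * (1/8) ^ k)" by (rule ennreal_mult'[symmetric]) simp
    also have "(2::real) ^ k * (1/8) ^ k = (1/4) ^ k" by (simp add: power_mult_distrib[symmetric])
    finally show "ennreal (2 ^ k) * energy (d k) \<le> ennreal ((1/4) ^ k)" .
  qed
  also have "... = ennreal (\<Sum>k. (1/4) ^ k)"
    by (intro suminf_ennreal2 summable_geometric) auto
  also have "... < \<infinity>" by simp
  finally have "(\<integral>x. (\<Sum>k. ennreal (2 ^ k * (norm (d k x))\<^sup>2))) \<noteq> \<infinity>" by simp
  then have "AE x in lborel. (\<Sum>k. ennreal (2 ^ k * (norm (d k x))\<^sup>2)) \<noteq> \<infinity>"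
    by (intro nn_integral_PInf_AE) measurable
  then show ?thesis
  proof eventually_elim
    case (elim x)
    have s: "summable (\<lambda>k. 2 ^ k * (norm (d k x))\<^sup>2)"
      by (rule summable_suminf_not_top) (use elim in auto)
    have "norm (d k x) \<le> (1/2) ^ k + 2 ^ k * (norm (d k x))\<^sup>2" for k
    proof (cases "norm (d k x) \<le> (1/2) ^ k")
      case False
      then have "1 \<le> 2 ^ k * norm (d k x)" by (simp add: field_simps)
      then have "1 * norm (d k x) \<le> 2 ^ k * norm (d k x) * norm (d k x)" by (intro mult_right_mono) auto
      moreover have "(1/2 :: real) ^ k \<ge> 0" by simp
      ultimately show ?thesis unfolding power2_eq_square mult.assoc by linarith
    next
      case True
      moreover have "2 ^ k * (norm (d k x))\<^sup>2 \<ge> 0" by simp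
      ultimately show ?thesis by linarith
    qed
    then have le': "norm (norm (d k x)) \<le> (1/2) ^ k + 2 ^ k * (norm (d k x))\<^sup>2" for k by simp
    have "summable (\<lambda>k. (1/2) ^ k + 2 ^ k * (norm (d k x))\<^sup>2)"
      by (rule summable_add[OF _ s]) (rule summable_geometric, simp)
    then show ?case by (rule summable_comparison_test'[where N = 0]) (rule le')
  qed
qed

lemma energy_liminf_le:
  fixes u :: "nat => 'a::euclidean_space => 'b::{second_countable_topology, real_normed_vector}"
  assumes [measurable]: "\<And>k. u k \<in> borel_fun"
    and lim: "AE x in lborel. (\<lambda>k. u k x) \<longlonglongrightarrow> g x"
    and le: "eventually (\<lambda>k. energy (u k) \<le> a) sequentially"
  shows "energy g \<le> a"
proof -
  have "energy g = (\<integral>x. liminf (\<lambda>k. ennreal ((norm (u k x))\<^sup>2)))"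
    unfolding energy_def
  proof (rule nn_integral_cong_AE, use lim in eventually_elim)
    case (elim x)
    then have "(\<lambda>k. ennreal ((norm (u k x))\<^sup>2)) \<longlonglongrightarrow> ennreal ((norm (g x))\<^sup>2)"
      by (intro tendsto_ennrealI tendsto_intros)
    then show ?case by (metis lim_imp_Liminf trivial_limit_sequentially)
  qed
  also have "... \<le> liminf (\<lambda>k. energy (u k))"
    unfolding energy_def by (rule nn_integral_liminf) measurable
  also have "... \<le> limsup (\<lambda>k. energy (u k))" by (rule Liminf_le_Limsup) simp
  also have "... \<le> a" using le by (intro Limsup_bounded) auto
  finally show ?thesis .
qed

text \<open>Riesz-Fischer: the increments of a rapidly Cauchy subsequence are summable almost
  everywhere. Only this pointwise limit is recorded; convergence in energy follows later from Fatou
  through \<open>energy_liminf_le\<close>.\<close>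

lemma L2_complete:
  fixes u :: "nat => 'a::euclidean_space => 'b::euclidean_space"
  assumes u [measurable]: "\<And>k. u k \<in> borel_fun"
    and cauchy: "\<And>h. h > 0 ==> \<exists>N. \<forall>m\<ge>N. \<forall>n\<ge>N. energy (\<lambda>x. u m x - u n x) \<le> ennreal h"
  shows "\<exists>g s. g \<in> borel_fun \<and> strict_mono s \<and> (AE x in lborel. (\<lambda>k. u (s k) x) \<longlonglongrightarrow> g x)"
proof -
  have "\<exists>N. \<forall>k. \<forall>m\<ge>N k. \<forall>n\<ge>N k. energy (\<lambda>x. u m x - u n x) \<le> ennreal ((1/8) ^ k)"
    by (intro choice allI cauchy) simp
  then obtain N where N: "\<And>k m n. m \<ge> N k ==> n \<ge> N k ==> energy (\<lambda>x. u m x - u n x) \<le> ennreal ((1/8) ^ k)"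
    by blast
  \<comment> \<open>The sum makes \<open>s k\<close> at least \<open>N k\<close>, and the summand
    \<open>k\<close> makes \<open>s\<close> strictly increasing.\<close>
  define s where "s k = (\<Sum>i\<le>k. N i) + k" for k :: nat
  have s: "strict_mono s" by (rule strict_mono_Suc_iff[THEN iffD2]) (auto simp: s_def)
  have sN: "s k \<ge> N k" for k unfolding s_def by (simp add: trans_le_add1 member_le_sum)
  define d where "d k x = u (s (Suc k)) x - u (s k) x" for k x
  have [measurable]: "d k \<in> borel_fun" for k unfolding d_def by measurable
  have "AE x in lborel. summable (\<lambda>k. norm (d k x))"
  proof (rule AE_summable_of_energy)
    fix k
    have "s k \<le> s (Suc k)" using s by (simp add: strict_mono_less_eq)
    then show "energy (d k) \<le> ennreal ((1/8) ^ k)"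
      unfolding d_def using sN[of k] by (intro N) auto
  qed measurable
  then have conv: "AE x in lborel. convergent (\<lambda>k. u (s k) x)"
  proof eventually_elim
    case (elim x)
    then have "summable (\<lambda>k. d k x)" by (rule summable_norm_cancel)
    then obtain l where "(\<lambda>k. d k x) sums l" by (auto simp: summable_def)
    then have "(\<lambda>n. \<Sum>k<n. d k x) \<longlonglongrightarrow> l" by (simp add: sums_def)
    moreover have "(\<Sum>k<n. d k x) = u (s n) x - u (s 0) x" for n
      unfolding d_def by (rule sum_lessThan_telescope)
    ultimately have "(\<lambda>n. u (s n) x - u (s 0) x) \<longlonglongrightarrow> l" by simp
    from tendsto_add[OF this tendsto_const[of "u (s 0) x"]]
    have "(\<lambda>n. u (s n) x) \<longlonglongrightarrow> l + u (s 0) x" by simp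
    then show ?case by (auto simp: convergent_def)
  qed
  define g where "g x = lim (\<lambda>k. u (s k) x)" for x
  have "g \<in> borel_fun" unfolding g_def by (rule borel_measurable_lim_metric) measurable
  moreover have "AE x in lborel. (\<lambda>k. u (s k) x) \<longlonglongrightarrow> g x"
    using conv by eventually_elim (simp add: g_def convergent_LIMSEQ_iff)
  ultimately show ?thesis using s by blast
qed

text \<open>\<open>e = -1\<close> is the direct and \<open>e = 1\<close> the inverse transform.\<close>

definition truncated_transform :: "real => real => (real^3 => complex^4) => real^3 => complex^4" where
  "truncated_transform e R f \<xi> = (2 * pi) powr (- 3 / 2) *\<^sub>R
     (LINT x|lborel. indicator (cball 0 R) x *\<^sub>R (cis (e * (x \<bullet> \<xi>)) *s f x))"

section \<open>Measurability and isometry of the truncated vector-valued transform\<close>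

lemma norm_vector_scalar_mult: "norm (c *s v) = norm c * norm (v :: complex^'n)"
  by (simp add: norm_vec_def L2_set_def norm_mult power_mult_distrib sum_distrib_left[symmetric] real_sqrt_mult)

lemma borel_measurable_vec_nth [measurable]:
  fixes f :: "'a => 'b::euclidean_space ^ 'n"
  assumes "f \<in> borel_measurable M" shows "(\<lambda>x. f x $ i) \<in> borel_measurable M"
  by (rule borel_measurable_continuous_on[OF _ assms]) (intro continuous_intros)

lemma borel_measurable_vector_scalar_mult [measurable]:
  fixes f :: "'a => complex" and g :: "'a => complex^'n"
  assumes [measurable]: "f \<in> borel_measurable M" "g \<in> borel_measurable M"
  shows "(\<lambda>x. f x *s g x) \<in> borel_measurable M"
proof -
  have "continuous_on UNIV (\<lambda>p :: complex \<times> (complex^'n). fst p *s snd p)"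
    unfolding vector_scalar_mult_def by (intro continuous_on_vec_lambda continuous_intros)
  from borel_measurable_continuous_on[OF this, of "\<lambda>x. (f x, g x)" M] show ?thesis by simp
qed

lemma energy_vec_nth:
  fixes f :: "'a::euclidean_space => complex^4"
  assumes [measurable]: "f \<in> borel_fun"
  shows "energy f = (\<Sum>i\<in>UNIV. energy (\<lambda>x. f x $ i))"
proof -
  have "ennreal ((norm v)\<^sup>2) = (\<Sum>i\<in>UNIV. ennreal ((norm (v $ i))\<^sup>2))" for v :: "complex^4"
    by (simp add: norm_vec_def L2_set_def sum_nonneg)
  then have "energy f = (\<integral>x. (\<Sum>i\<in>UNIV. ennreal ((norm (f x $ i))\<^sup>2)))"
    unfolding energy_def by simp
  also have "... = (\<Sum>i\<in>UNIV. energy (\<lambda>x. f x $ i))"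
    unfolding energy_def by (rule nn_integral_sum) measurable
  finally show ?thesis .
qed

lemma energy_indicator_le: "energy (\<lambda>x. indicator A x *\<^sub>R f x) \<le> energy f"
  unfolding energy_def by (intro nn_integral_mono) (auto split: split_indicator)

lemma integrable_of_energy_bounded:
  fixes f :: "'a::euclidean_space => 'b::euclidean_space"
  assumes [measurable]: "f \<in> borel_fun" and fin: "energy f < \<infinity>"
  shows "integrable lborel (\<lambda>x. indicator (cball 0 R) x *\<^sub>R f x)"
proof (rule integrableI_bounded)
  have "(\<integral>x. ennreal (norm (indicator (cball 0 R) x *\<^sub>R f x)))
    \<le> (\<integral>x. indicator (cball 0 R) x + ennreal ((norm (f x))\<^sup>2))"
  proof (intro nn_integral_mono)
    fix x
    have "norm (f x) \<le> 1 + (norm (f x))\<^sup>2"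
      using zero_le_power2[of "norm (f x) - 1"] norm_ge_zero[of "f x"]
      unfolding power2_eq_square right_diff_distrib left_diff_distrib by linarith
    then have "ennreal (norm (f x)) \<le> ennreal (1 + (norm (f x))\<^sup>2)" by (rule ennreal_leI)
    then show "ennreal (norm (indicator (cball 0 R) x *\<^sub>R f x)) \<le> indicator (cball 0 R) x + ennreal ((norm (f x))\<^sup>2)"
      by (auto split: split_indicator)
  qed
  also have "... = emeasure lborel (cball (0::'a) R) + energy f"
    unfolding energy_def by (subst nn_integral_add) (auto intro!: borel_measurable_indicator)
  also have "... < \<infinity>" using fin emeasure_lborel_cball_finite[of "0::'a" R] by (simp add: less_top)
  finally show "(\<integral>x. ennreal (norm (indicator (cball 0 R) x *\<^sub>R f x))) < \<infinity>" .
qed measurable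

lemma borel_measurable_truncated_transform [measurable]:
  assumes [measurable]: "f \<in> borel_fun"
  shows "truncated_transform e R f \<in> borel_fun"
proof -
  have "(\<lambda>y. LINT x|lborel. (\<lambda>(y, x). indicator (cball 0 R) x *\<^sub>R (cis (e * (x \<bullet> y)) *s f x)) (y, x)) \<in> borel_fun"
    by (intro lborel.borel_measurable_lebesgue_integral) (simp only: split_beta fst_conv snd_conv, measurable)
  then show ?thesis unfolding truncated_transform_def by measurable
qed

lemma truncated_transform_nth:
  assumes [measurable]: "f \<in> borel_fun" and fin: "energy f < \<infinity>"
  shows "truncated_transform e R f y $ i
    = (2 * pi) powr (- 3 / 2) *\<^sub>R fourier_integral e (\<lambda>x. indicator (cball 0 R) x *\<^sub>R f x $ i) y"
proof -
  have "integrable lborel (\<lambda>x. indicator (cball 0 R) x *\<^sub>R (cis (e * (x \<bullet> y)) *s f x))"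
    by (rule Bochner_Integration.integrable_bound[OF integrable_of_energy_bounded[OF assms, of R]])
       (measurable, simp add: norm_vector_scalar_mult)
  from integral_bounded_linear[OF bounded_linear_vec_nth this, of i]
  show ?thesis unfolding truncated_transform_def fourier_integral_def
    by (simp add: scaleR_conv_of_real[where 'a=complex] mult.left_commute)
qed

text \<open>On a ball finite energy implies integrability, so the scalar identity applies to every
  component of the truncated function; the square of the normalizing factor cancels
  \<open>(2 * pi) ^ 3\<close>.\<close>

theorem truncated_transform_energy:
  assumes f [measurable]: "f \<in> borel_fun" and fin: "energy f < \<infinity>" and e: "\<bar>e\<bar> = 1"
  shows "energy (truncated_transform e R f) = energy (\<lambda>x. indicator (cball 0 R) x *\<^sub>R f x)"
proof -
  have c: "ennreal (((2 * pi) powr (- 3 / 2))\<^sup>2) * ennreal ((2 * pi) ^ 3) = 1"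
  proof -
    have "((2 * pi) powr (- 3 / 2))\<^sup>2 * (2 * pi) ^ 3 = ((2 * pi) powr (- 3 / 2) * (2 * pi) powr (3 / 2))\<^sup>2"
      unfolding two_pi_powr_3[symmetric] by (simp add: power2_eq_square mult_ac)
    also have "... = 1" by (simp add: powr_add[symmetric])
    finally show ?thesis by (simp add: ennreal_mult'[symmetric])
  qed
  have main: "energy (\<lambda>y. truncated_transform e R f y $ i) = energy (\<lambda>x. indicator (cball 0 R) x *\<^sub>R f x $ i)" for i
  proof -
    let ?h = "\<lambda>x. indicator (cball 0 R) x *\<^sub>R f x $ i"
    have fi: "energy (\<lambda>x. f x $ i) < \<infinity>"
    proof -
      have "energy (\<lambda>x. f x $ i) \<le> energy f"
        unfolding energy_def by (intro nn_integral_mono ennreal_leI power_mono Finite_Cartesian_Product.norm_nth_le) auto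
      then show ?thesis using fin by (rule le_less_trans)
    qed
    have hi: "integrable lborel ?h" by (rule integrable_of_energy_bounded[OF _ fi]) measurable
    have hf: "energy ?h < \<infinity>" using energy_indicator_le fi by (rule le_less_trans)
    have "energy (\<lambda>y. truncated_transform e R f y $ i)
      = (\<integral>y. ennreal (((2 * pi) powr (- 3 / 2))\<^sup>2) * ennreal ((norm (fourier_integral e ?h y))\<^sup>2))"
      unfolding energy_def truncated_transform_nth[OF f fin]
      by (intro nn_integral_cong) (simp add: power_mult_distrib ennreal_mult')
    also have "... = ennreal (((2 * pi) powr (- 3 / 2))\<^sup>2) * energy (fourier_integral e ?h)"
      unfolding energy_def by (rule nn_integral_cmult) measurable
    also have "... = (ennreal (((2 * pi) powr (- 3 / 2))\<^sup>2) * ennreal ((2 * pi) ^ 3)) * energy ?h"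
      unfolding fourier_integral_energy[OF hi hf e] by (simp only: mult.assoc)
    finally show ?thesis unfolding c by simp
  qed
  have "energy (truncated_transform e R f) = (\<Sum>i\<in>UNIV. energy (\<lambda>y. truncated_transform e R f y $ i))"
    by (rule energy_vec_nth) measurable
  also have "... = (\<Sum>i\<in>UNIV. energy (\<lambda>x. (indicator (cball 0 R) x *\<^sub>R f x) $ i))"
    by (simp only: main vector_scaleR_component)
  also have "... = energy (\<lambda>x. indicator (cball 0 R) x *\<^sub>R f x)"
    by (rule energy_vec_nth[symmetric]) measurable
  finally show ?thesis .
qed

section \<open>Adjoints, inversion and existence of transform pairs\<close>

lemma integrable_norm_square:
  fixes f :: "'a::euclidean_space => 'b::euclidean_space"
  assumes [measurable]: "f \<in> borel_fun" and fin: "energy f < \<infinity>"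
  shows "integrable lborel (\<lambda>x. (norm (f x))\<^sup>2)"
  by (rule integrableI_bounded) (use fin in \<open>auto simp: energy_def\<close>)

lemma integrable_inner_of_energy:
  fixes f g :: "'a::euclidean_space => 'b::euclidean_space"
  assumes [measurable]: "f \<in> borel_fun" "g \<in> borel_fun"
    and fin: "energy f < \<infinity>" "energy g < \<infinity>"
  shows "integrable lborel (\<lambda>x. f x \<bullet> g x)"
proof (rule Bochner_Integration.integrable_bound)
  show "integrable lborel (\<lambda>x. (norm (f x))\<^sup>2 + (norm (g x))\<^sup>2)"
    using fin by (intro Bochner_Integration.integrable_add integrable_norm_square) auto
  show "AE x in lborel. norm (f x \<bullet> g x) \<le> norm ((norm (f x))\<^sup>2 + (norm (g x))\<^sup>2)"
  proof (intro AE_I2)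
    fix x
    have "norm (f x) * norm (g x) \<le> (norm (f x))\<^sup>2 + (norm (g x))\<^sup>2"
    proof -
      have "2 * norm (f x) * norm (g x) \<le> (norm (f x))\<^sup>2 + (norm (g x))\<^sup>2" by (rule sum_squares_bound)
      moreover have "0 \<le> norm (f x) * norm (g x)" by simp
      ultimately show ?thesis by linarith
    qed
    then show "norm (f x \<bullet> g x) \<le> norm ((norm (f x))\<^sup>2 + (norm (g x))\<^sup>2)"
      using Cauchy_Schwarz_ineq2[of "f x" "g x"] by simp
  qed
qed measurable

text \<open>Cauchy-Schwarz, carried out in \<open>ennreal\<close> for the squares.\<close>

lemma integral_inner_tendsto_0:
  fixes h :: "nat => 'a::euclidean_space => 'b::euclidean_space"
  assumes [measurable]: "\<And>n. h n \<in> borel_fun" "g \<in> borel_fun"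
    and fin: "energy g < \<infinity>" and lim: "(\<lambda>n. energy (h n)) \<longlonglongrightarrow> 0"
  shows "(\<lambda>n. LINT x|lborel. h n x \<bullet> g x) \<longlonglongrightarrow> 0"
proof -
  have le: "ennreal ((LINT x|lborel. h n x \<bullet> g x)\<^sup>2) \<le> energy (h n) * energy g" for n
  proof -
    have "ennreal (norm (LINT x|lborel. h n x \<bullet> g x)) \<le> (\<integral>x. ennreal (norm (h n x \<bullet> g x)))"
      by (rule norm_integral_le_nn_integral)
    also have "... \<le> (\<integral>x. ennreal (norm (h n x)) * ennreal (norm (g x)))"
      by (intro nn_integral_mono) (auto simp: ennreal_mult'[symmetric] Cauchy_Schwarz_ineq2 intro!: ennreal_leI)
    finally have "(ennreal (norm (LINT x|lborel. h n x \<bullet> g x)))\<^sup>2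
      \<le> (\<integral>x. ennreal (norm (h n x)) * ennreal (norm (g x)))\<^sup>2"
      by (rule power_mono) simp
    also have "... \<le> (\<integral>x. (ennreal (norm (h n x)))\<^sup>2) * (\<integral>x. (ennreal (norm (g x)))\<^sup>2)"
      by (rule Cauchy_Schwarz_nn_integral) measurable
    finally show ?thesis by (simp add: energy_def ennreal_power)
  qed
  have "(\<lambda>n. energy g * energy (h n)) \<longlonglongrightarrow> energy g * 0"
    using fin by (intro ennreal_tendsto_cmult lim) auto
  then have "(\<lambda>n. energy (h n) * energy g) \<longlonglongrightarrow> 0" by (simp add: mult.commute)
  then have "(\<lambda>n. ennreal ((LINT x|lborel. h n x \<bullet> g x)\<^sup>2)) \<longlonglongrightarrow> 0"
    by (rule tendsto_sandwich[OF _ _ tendsto_const, rotated 2]) (auto simp: le)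
  then have "(\<lambda>n. ennreal ((LINT x|lborel. h n x \<bullet> g x)\<^sup>2)) \<longlonglongrightarrow> ennreal 0" by simp
  then have "(\<lambda>n. (LINT x|lborel. h n x \<bullet> g x)\<^sup>2) \<longlonglongrightarrow> 0"
    by (subst (asm) tendsto_ennreal_iff) auto
  then have "(\<lambda>n. sqrt ((LINT x|lborel. h n x \<bullet> g x)\<^sup>2)) \<longlonglongrightarrow> sqrt 0"
    by (rule tendsto_real_sqrt)
  then show ?thesis by (simp add: tendsto_rabs_zero_iff)
qed

lemma inner_cis_mult: "(cis u *s v) \<bullet> w = v \<bullet> (cis (- u) *s (w :: complex^'n))"
  unfolding inner_vec_def
proof (intro sum.cong refl)
  fix i
  show "(cis u *s v) $ i \<bullet> w $ i = v $ i \<bullet> (cis (- u) *s w) $ i"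
    by (simp add: inner_complex_def algebra_simps)
qed

text \<open>Fubini; the cutoffs on both sides make the double integral absolutely convergent. The
  inner product is the real one on \<open>complex^4\<close>, for which multiplication by a phase has
  the conjugate phase as adjoint.\<close>

lemma truncated_transform_adjoint:
  fixes f h :: "real^3 => complex^4"
  assumes f [measurable]: "f \<in> borel_fun" and h [measurable]: "h \<in> borel_fun"
    and fin: "energy f < \<infinity>" "energy h < \<infinity>"
  shows "(LINT y|lborel. truncated_transform e R f y \<bullet> (indicator (cball 0 S) y *\<^sub>R h y))
    = (LINT x|lborel. (indicator (cball 0 R) x *\<^sub>R f x) \<bullet> truncated_transform (- e) S h x)"
proof -
  define F where "F x = indicator (cball 0 R) x *\<^sub>R f x" for x
  define H where "H x = indicator (cball 0 S) x *\<^sub>R h x" for x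
  have [measurable]: "F \<in> borel_fun" "H \<in> borel_fun" unfolding F_def H_def by measurable
  have iF: "integrable lborel F" and iH: "integrable lborel H"
    unfolding F_def H_def by (intro integrable_of_energy_bounded f h fin)+
  have s: "sigma_finite_measure (lborel :: (real^3) measure)" ..
  have icF: "integrable lborel (\<lambda>x. cis (u x) *s F x)" if [measurable]: "u \<in> borel_fun" for u
    by (rule Bochner_Integration.integrable_bound[OF iF]) (auto simp: norm_vector_scalar_mult)
  have icH: "integrable lborel (\<lambda>x. cis (u x) *s H x)" if [measurable]: "u \<in> borel_fun" for u
    by (rule Bochner_Integration.integrable_bound[OF iH]) (auto simp: norm_vector_scalar_mult)
  have TF: "truncated_transform e R f y = (2 * pi) powr (- 3 / 2) *\<^sub>R (LINT x|lborel. cis (e * (x \<bullet> y)) *s F x)" for y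
    unfolding truncated_transform_def F_def
    by (intro arg_cong2[where f = scaleR] refl Bochner_Integration.integral_cong) (auto simp: vec_eq_iff indicator_def)
  have TH: "truncated_transform (- e) S h x = (2 * pi) powr (- 3 / 2) *\<^sub>R (LINT y|lborel. cis (- (e * (x \<bullet> y))) *s H y)" for x
    unfolding truncated_transform_def H_def
    by (intro arg_cong2[where f = scaleR] refl Bochner_Integration.integral_cong)
       (auto simp: vec_eq_iff indicator_def inner_commute)
  have FI: "integrable (lborel \<Otimes>\<^sub>M lborel) (\<lambda>(x, y). (cis (e * (x \<bullet> y)) *s F x) \<bullet> H y)"
  proof (rule Bochner_Integration.integrable_bound)
    show "integrable (lborel \<Otimes>\<^sub>M lborel) (\<lambda>(x, y). complex_of_real (norm (F x)) * complex_of_real (norm (H y)))"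
      using iF iH by (intro integrable_pair_mult s) auto
    show "AE p in lborel \<Otimes>\<^sub>M lborel. norm (case p of (x, y) => (cis (e * (x \<bullet> y)) *s F x) \<bullet> H y)
      \<le> norm (case p of (x, y) => complex_of_real (norm (F x)) * complex_of_real (norm (H y)))"
    proof (intro AE_I2)
      fix p :: "(real^3) \<times> (real^3)"
      obtain x y where p: "p = (x, y)" by (cases p)
      show "norm (case p of (x, y) => (cis (e * (x \<bullet> y)) *s F x) \<bullet> H y)
        \<le> norm (case p of (x, y) => complex_of_real (norm (F x)) * complex_of_real (norm (H y)))"
        using Cauchy_Schwarz_ineq2[of "cis (e * (x \<bullet> y)) *s F x" "H y"]
        by (simp add: p norm_vector_scalar_mult norm_mult)
    qed
    show "(\<lambda>(x, y). (cis (e * (x \<bullet> y)) *s F x) \<bullet> H y) \<in> borel_measurable (lborel \<Otimes>\<^sub>M lborel)"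
      unfolding split_beta by measurable
  qed
  have "(LINT y|lborel. truncated_transform e R f y \<bullet> H y)
    = (LINT y|lborel. (2 * pi) powr (- 3 / 2) * (LINT x|lborel. (cis (e * (x \<bullet> y)) *s F x) \<bullet> H y))"
    unfolding TF by (intro Bochner_Integration.integral_cong refl) (simp add: integral_inner_left[OF icF])
  also have "... = (2 * pi) powr (- 3 / 2) * (LINT y|lborel. LINT x|lborel. (cis (e * (x \<bullet> y)) *s F x) \<bullet> H y)"
    by (rule integral_mult_right_zero)
  also have "(LINT y|lborel. LINT x|lborel. (cis (e * (x \<bullet> y)) *s F x) \<bullet> H y)
    = (LINT x|lborel. LINT y|lborel. (cis (e * (x \<bullet> y)) *s F x) \<bullet> H y)"
    by (rule lborel_pair.Fubini_integral[OF FI])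
  also have "(2 * pi) powr (- 3 / 2) * ...
    = (LINT x|lborel. (2 * pi) powr (- 3 / 2) * (LINT y|lborel. (cis (e * (x \<bullet> y)) *s F x) \<bullet> H y))"
    by (rule integral_mult_right_zero[symmetric])
  also have "... = (LINT x|lborel. F x \<bullet> truncated_transform (- e) S h x)"
    unfolding TH inner_cis_mult
    by (intro Bochner_Integration.integral_cong refl) (simp add: integral_inner_right[OF icH])
  finally show ?thesis unfolding F_def H_def .
qed

text \<open>Borel counterpart of \<open>is_fourier\<close>, for both signs at once, so that
  inversion is a symmetry of the notion.\<close>

definition is_transform :: "real => (real^3 => complex^4) => (real^3 => complex^4) => bool" where
  "is_transform e f g \<longleftrightarrow> f \<in> borel_fun \<and> g \<in> borel_fun \<and> energy f < \<infinity> \<and> energy g < \<infinity>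
    \<and> ((\<lambda>R. energy (\<lambda>\<xi>. truncated_transform e R f \<xi> - g \<xi>)) \<longlongrightarrow> 0) at_top"

lemma energy_tail_tendsto_0:
  fixes f :: "'a::euclidean_space => 'b::euclidean_space"
  assumes [measurable]: "f \<in> borel_fun" and fin: "energy f < \<infinity>"
  shows "(\<lambda>n. energy (\<lambda>x. indicator (- cball 0 (real n)) x *\<^sub>R f x)) \<longlonglongrightarrow> 0"
proof (rule energy_tendsto_0[where w = "\<lambda>x. (norm (f x))\<^sup>2"])
  show "AE x in lborel. (\<lambda>n. indicator (- cball 0 (real n)) x *\<^sub>R f x) \<longlonglongrightarrow> 0"
  proof (intro AE_I2)
    fix x :: 'a
    obtain n0 :: nat where n0: "norm x \<le> real n0" using real_arch_simple by blast
    have "eventually (\<lambda>n. indicator (- cball 0 (real n)) x *\<^sub>R f x = 0) sequentially"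
      using eventually_ge_at_top[of n0]
    proof eventually_elim
      case (elim n)
      then have "real n0 \<le> real n" by simp
      then show ?case using n0 by auto
    qed
    then show "(\<lambda>n. indicator (- cball 0 (real n)) x *\<^sub>R f x) \<longlonglongrightarrow> 0"
      by (rule tendsto_eventually)
  qed
qed (use fin in \<open>auto simp: energy_def split: split_indicator\<close>)

lemma norm_square_diff: "(norm (a - b))\<^sup>2 = (norm a)\<^sup>2 - 2 * (a \<bullet> b) + (norm (b :: 'a::real_inner))\<^sup>2"
  by (simp add: power2_norm_eq_inner inner_simps inner_commute)

lemma integral_norm_square_diff:
  fixes f g :: "'a::euclidean_space => 'b::euclidean_space"
  assumes "f \<in> borel_fun" "g \<in> borel_fun" "energy f < \<infinity>" "energy g < \<infinity>"
  shows "(LINT x|lborel. (norm (f x - g x))\<^sup>2)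
    = (LINT x|lborel. (norm (f x))\<^sup>2) - 2 * (LINT x|lborel. f x \<bullet> g x) + (LINT x|lborel. (norm (g x))\<^sup>2)"
  unfolding norm_square_diff
  using integrable_norm_square[OF assms(1,3)] integrable_norm_square[OF assms(2,4)] integrable_inner_of_energy[OF assms]
  by simp

lemma energy_diff_finite:
  fixes f g :: "'a::euclidean_space => 'b::euclidean_space"
  assumes [measurable]: "f \<in> borel_fun" "g \<in> borel_fun"
    and "energy f < \<infinity>" "energy g < \<infinity>"
  shows "energy (\<lambda>x. f x - g x) < \<infinity>"
proof -
  have "energy (\<lambda>x. f x + (- g x)) \<le> 2 * energy f + 2 * energy (\<lambda>x. - g x)" by (rule energy_add_le) measurable
  also have "... < \<infinity>" using assms by (simp add: energy_def ennreal_mult_less_top)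
  finally show ?thesis by simp
qed

text \<open>With \<open>T\<close> the truncated transform and \<open>u = T\<^sup>* (1\<^sub>R g)\<close>, the adjoint relation gives
  \<open>\<langle>f, u\<rangle> = \<parallel>1\<^sub>R g\<parallel>\<^sup>2 = \<parallel>u\<parallel>\<^sup>2\<close>, hence \<open>\<parallel>f - u\<parallel>\<^sup>2 = \<parallel>f\<parallel>\<^sup>2 - \<parallel>1\<^sub>R g\<parallel>\<^sup>2\<close>, and \<open>\<parallel>f\<parallel> = \<parallel>g\<parallel>\<close> by isometry.\<close>

theorem is_transform_inverse:
  assumes fg: "is_transform e f g" and e: "\<bar>e\<bar> = 1"
  shows "energy (\<lambda>x. f x - truncated_transform (- e) R g x) = energy (\<lambda>\<xi>. indicator (- cball 0 R) \<xi> *\<^sub>R g \<xi>)"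
proof -
  have f [measurable]: "f \<in> borel_fun" and g [measurable]: "g \<in> borel_fun"
    and fin: "energy f < \<infinity>" "energy g < \<infinity>"
    and lim: "((\<lambda>R. energy (\<lambda>\<xi>. truncated_transform e R f \<xi> - g \<xi>)) \<longlongrightarrow> 0) at_top"
    using fg by (auto simp: is_transform_def)
  have e': "\<bar>- e\<bar> = 1" using e by simp
  define T where "T n = truncated_transform e (real n) f" for n
  define u where "u = truncated_transform (- e) R g"
  define gR where "gR \<xi> = indicator (cball 0 R) \<xi> *\<^sub>R g \<xi>" for \<xi>
  define fn where "fn n x = indicator (cball 0 (real n)) x *\<^sub>R f x" for n x
  have [measurable]: "T n \<in> borel_fun" for n unfolding T_def by measurable
  have [measurable]: "u \<in> borel_fun" unfolding u_def by measurable
  have [measurable]: "gR \<in> borel_fun" unfolding gR_def by measurable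
  have [measurable]: "fn n \<in> borel_fun" for n unfolding fn_def by measurable
  have gRfin: "energy gR < \<infinity>" unfolding gR_def using energy_indicator_le fin(2) by (rule le_less_trans)
  have fnfin: "energy (fn n) < \<infinity>" for n unfolding fn_def using energy_indicator_le fin(1) by (rule le_less_trans)
  have eT: "energy (T n) = energy (fn n)" for n
    unfolding T_def fn_def by (rule truncated_transform_energy[OF f fin(1) e])
  have Tfin: "energy (T n) < \<infinity>" for n unfolding eT by (rule fnfin)
  have eu: "energy u = energy gR" unfolding u_def gR_def by (rule truncated_transform_energy[OF g fin(2) e'])
  have ufin: "energy u < \<infinity>" unfolding eu by (rule gRfin)
  have dlim: "(\<lambda>n. energy (\<lambda>\<xi>. T n \<xi> - g \<xi>)) \<longlonglongrightarrow> 0"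
    unfolding T_def by (rule filterlim_compose[OF lim filterlim_real_sequentially])
  have flim: "(\<lambda>n. energy (\<lambda>x. fn n x - f x)) \<longlonglongrightarrow> 0"
  proof -
    have "energy (\<lambda>x. fn n x - f x) = energy (\<lambda>x. indicator (- cball 0 (real n)) x *\<^sub>R f x)" for n
      unfolding energy_def fn_def by (intro nn_integral_cong) (auto split: split_indicator)
    then show ?thesis using energy_tail_tendsto_0[OF f fin(1)] by simp
  qed
  let ?N = "\<lambda>h. LINT x|lborel. (norm (h x))\<^sup>2"
  have N: "energy h = ennreal (?N h)" if "h \<in> borel_fun" "energy h < \<infinity>" for h :: "real^3 => complex^4"
    by (rule energy_eq_integral[OF integrable_norm_square[OF that]])
  have N0: "?N h \<ge> 0" for h :: "real^3 => complex^4" by (rule integral_nonneg_AE) simp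
  \<comment> \<open>Squared norms converge along sequences that converge in energy. Applied to the
    truncated transforms and to the truncations of \<open>f\<close>, whose norms agree by isometry,
    it yields that \<open>f\<close> and \<open>g\<close> have the same norm.\<close>
  have conv: "(\<lambda>n. ?N (a n)) \<longlonglongrightarrow> ?N b"
    if [measurable]: "\<And>n. a n \<in> borel_fun" "b \<in> borel_fun"
      and af: "\<And>n. energy (a n) < \<infinity>" and bf: "energy b < \<infinity>"
      and l: "(\<lambda>n. energy (\<lambda>x. a n x - b x)) \<longlonglongrightarrow> 0" for a :: "nat => real^3 => complex^4" and b
  proof -
    have abf: "energy (\<lambda>x. a n x - b x) < \<infinity>" for n by (rule energy_diff_finite[OF _ _ af bf]) measurable
    have eq: "?N (a n) = ?N (\<lambda>x. a n x - b x) + 2 * (LINT x|lborel. (a n x - b x) \<bullet> b x) + ?N b" for n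
    proof -
      have "?N (\<lambda>x. (a n x - b x) - (- b x)) = ?N (\<lambda>x. a n x - b x)
          - 2 * (LINT x|lborel. (a n x - b x) \<bullet> (- b x)) + ?N (\<lambda>x. - b x)"
        using abf bf by (intro integral_norm_square_diff) (auto simp: energy_def)
      then show ?thesis by simp
    qed
    have "(\<lambda>n. ennreal (?N (\<lambda>x. a n x - b x))) \<longlonglongrightarrow> ennreal 0"
      using l N[OF _ abf] by simp
    then have l1: "(\<lambda>n. ?N (\<lambda>x. a n x - b x)) \<longlonglongrightarrow> 0"
      by (subst (asm) tendsto_ennreal_iff) (auto simp: N0)
    have l2: "(\<lambda>n. LINT x|lborel. (a n x - b x) \<bullet> b x) \<longlonglongrightarrow> 0"
      by (rule integral_inner_tendsto_0[OF _ _ bf l]) measurable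
    have "(\<lambda>n. ?N (\<lambda>x. a n x - b x) + 2 * (LINT x|lborel. (a n x - b x) \<bullet> b x) + ?N b) \<longlonglongrightarrow> 0 + 2 * 0 + ?N b"
      by (intro tendsto_intros l1 l2)
    then show ?thesis unfolding eq by simp
  qed
  have "?N (T n) = ?N (fn n)" for n
    using eT[of n] N[OF _ Tfin[of n]] N[OF _ fnfin[of n]] by (simp add: N0)
  moreover have "(\<lambda>n. ?N (T n)) \<longlonglongrightarrow> ?N g" by (rule conv[OF _ _ Tfin fin(2) dlim]) measurable
  moreover have "(\<lambda>n. ?N (fn n)) \<longlonglongrightarrow> ?N f" by (rule conv[OF _ _ fnfin fin(1) flim]) measurable
  ultimately have Nfg: "?N f = ?N g" using LIMSEQ_unique by auto
  have Nu: "?N u = ?N gR"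
    using eu N[OF _ ufin] N[OF _ gRfin] by (simp add: N0)
  \<comment> \<open>The adjoint relation is available only for truncations of \<open>f\<close>; both
    of its sides are passed to the limit.\<close>
  have ip: "(LINT x|lborel. f x \<bullet> u x) = ?N gR"
  proof -
    have i1: "(LINT \<xi>|lborel. T n \<xi> \<bullet> gR \<xi>) = (LINT x|lborel. fn n x \<bullet> u x)" for n
      unfolding T_def gR_def fn_def u_def by (rule truncated_transform_adjoint[OF f g fin])
    have "(LINT \<xi>|lborel. T n \<xi> \<bullet> gR \<xi>) = (LINT \<xi>|lborel. (T n \<xi> - g \<xi>) \<bullet> gR \<xi>) + (LINT \<xi>|lborel. g \<xi> \<bullet> gR \<xi>)" for n
      using integrable_inner_of_energy[OF _ _ Tfin[of n] gRfin] integrable_inner_of_energy[OF _ _ fin(2) gRfin]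
      by (simp add: inner_diff_left)
    moreover have "(\<lambda>n. (LINT \<xi>|lborel. (T n \<xi> - g \<xi>) \<bullet> gR \<xi>) + (LINT \<xi>|lborel. g \<xi> \<bullet> gR \<xi>)) \<longlonglongrightarrow> 0 + (LINT \<xi>|lborel. g \<xi> \<bullet> gR \<xi>)"
      by (intro tendsto_intros integral_inner_tendsto_0[OF _ _ gRfin dlim]) measurable
    ultimately have L1: "(\<lambda>n. LINT x|lborel. fn n x \<bullet> u x) \<longlonglongrightarrow> (LINT \<xi>|lborel. g \<xi> \<bullet> gR \<xi>)" by (simp add: i1)
    have "(LINT x|lborel. fn n x \<bullet> u x) = (LINT x|lborel. (fn n x - f x) \<bullet> u x) + (LINT x|lborel. f x \<bullet> u x)" for n
      using integrable_inner_of_energy[OF _ _ fnfin[of n] ufin] integrable_inner_of_energy[OF _ _ fin(1) ufin]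
      by (simp add: inner_diff_left)
    moreover have "(\<lambda>n. (LINT x|lborel. (fn n x - f x) \<bullet> u x) + (LINT x|lborel. f x \<bullet> u x)) \<longlonglongrightarrow> 0 + (LINT x|lborel. f x \<bullet> u x)"
      by (intro tendsto_intros integral_inner_tendsto_0[OF _ _ ufin flim]) measurable
    ultimately have L2: "(\<lambda>n. LINT x|lborel. fn n x \<bullet> u x) \<longlonglongrightarrow> (LINT x|lborel. f x \<bullet> u x)" by simp
    have "(LINT \<xi>|lborel. g \<xi> \<bullet> gR \<xi>) = ?N gR"
      by (intro Bochner_Integration.integral_cong refl) (auto simp: gR_def power2_norm_eq_inner split: split_indicator)
    then show ?thesis using LIMSEQ_unique[OF L2 L1] by simp
  qed
  have "?N (\<lambda>x. f x - u x) = ?N g - ?N gR"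
    using integral_norm_square_diff[OF _ _ fin(1) ufin] by (simp add: ip Nu Nfg)
  also have "... = ?N (\<lambda>\<xi>. indicator (- cball 0 R) \<xi> *\<^sub>R g \<xi>)"
  proof -
    have "?N g = (LINT \<xi>|lborel. (norm (gR \<xi>))\<^sup>2 + (norm (indicator (- cball 0 R) \<xi> *\<^sub>R g \<xi>))\<^sup>2)"
      by (intro Bochner_Integration.integral_cong refl) (auto simp: gR_def split: split_indicator)
    also have "... = ?N gR + ?N (\<lambda>\<xi>. indicator (- cball 0 R) \<xi> *\<^sub>R g \<xi>)"
      by (intro Bochner_Integration.integral_add integrable_norm_square gRfin le_less_trans[OF energy_indicator_le fin(2)]) measurable
    finally show ?thesis by simp
  qed
  finally have "?N (\<lambda>x. f x - u x) = ?N (\<lambda>\<xi>. indicator (- cball 0 R) \<xi> *\<^sub>R g \<xi>)" .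
  moreover have "energy (\<lambda>x. f x - u x) = ennreal (?N (\<lambda>x. f x - u x))"
    by (intro N energy_diff_finite fin ufin) measurable
  moreover have "energy (\<lambda>\<xi>. indicator (- cball 0 R) \<xi> *\<^sub>R g \<xi>) = ennreal (?N (\<lambda>\<xi>. indicator (- cball 0 R) \<xi> *\<^sub>R g \<xi>))"
    by (intro N le_less_trans[OF energy_indicator_le fin(2)]) measurable
  ultimately show ?thesis by (simp add: u_def)
qed

lemma energy_tail_antimono:
  "r \<le> R ==> energy (\<lambda>x. indicator (- cball 0 R) x *\<^sub>R f x) \<le> energy (\<lambda>x. indicator (- cball 0 r) x *\<^sub>R f x)"
  unfolding energy_def by (intro nn_integral_mono) (auto split: split_indicator)

lemma energy_tail_tendsto_0_at_top:
  fixes f :: "'a::euclidean_space => 'b::euclidean_space"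
  assumes f: "f \<in> borel_fun" and fin: "energy f < \<infinity>"
  shows "((\<lambda>R. energy (\<lambda>x. indicator (- cball 0 R) x *\<^sub>R f x)) \<longlongrightarrow> 0) at_top"
proof (rule order_tendstoI)
  fix a :: ennreal assume "0 < a"
  with energy_tail_tendsto_0[OF f fin] have "eventually (\<lambda>n. energy (\<lambda>x. indicator (- cball 0 (real n)) x *\<^sub>R f x) < a) sequentially"
    by (rule order_tendstoD)
  then obtain n where n: "energy (\<lambda>x. indicator (- cball 0 (real n)) x *\<^sub>R f x) < a" by (auto simp: eventually_sequentially)
  show "eventually (\<lambda>R. energy (\<lambda>x. indicator (- cball 0 R) x *\<^sub>R f x) < a) at_top"
    using eventually_ge_at_top[of "real n"]
  proof eventually_elim
    case (elim R)
    show ?case by (rule le_less_trans[OF energy_tail_antimono[OF elim] n])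
  qed
qed simp

text \<open>The error in \<open>is_transform_inverse\<close> is the energy of a tail of
  \<open>g\<close>, which vanishes as the radius grows; this is exactly the limit required of the
  inverse pair.\<close>

lemma is_transform_swap:
  assumes "is_transform e f g" "\<bar>e\<bar> = 1"
  shows "is_transform (- e) g f"
proof -
  have "energy (\<lambda>x. truncated_transform (- e) R g x - f x) = energy (\<lambda>y. indicator (- cball 0 R) y *\<^sub>R g y)" for R
    using is_transform_inverse[OF assms] by (simp add: energy_minus_commute)
  then show ?thesis using assms energy_tail_tendsto_0_at_top[of g] by (simp add: is_transform_def)
qed

text \<open>Two truncated transforms differ in energy by at most a tail of \<open>f\<close>, so they
  form a Cauchy family. A subsequence has a pointwise limit, and Fatou turns the Cauchy estimate
  into the same tail bound for the distance to that limit, now for all real radii.\<close>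

theorem is_transform_exists:
  assumes f [measurable]: "f \<in> borel_fun" and fin: "energy f < \<infinity>" and e: "\<bar>e\<bar> = 1"
  shows "\<exists>g. is_transform e f g"
proof -
  let ?T = "\<lambda>R. truncated_transform e R f"
  let ?t = "\<lambda>R. energy (\<lambda>x. indicator (- cball 0 R) x *\<^sub>R f x)"
  have d1: "energy (\<lambda>y. ?T R y - ?T r y) \<le> ?t r" if "r \<le> R" for r R
  proof -
    let ?h = "\<lambda>x. indicator (- cball 0 r) x *\<^sub>R f x"
    have hf: "energy ?h < \<infinity>" using energy_indicator_le fin by (rule le_less_trans)
    have i: "integrable lborel (\<lambda>x. indicator (cball 0 R) x *\<^sub>R (cis (e * (x \<bullet> y)) *s f x))" for R y
      by (rule Bochner_Integration.integrable_bound[OF integrable_of_energy_bounded[OF f fin, of R]])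
         (measurable, simp add: norm_vector_scalar_mult)
    \<comment> \<open>The difference is itself a truncated transform, namely of \<open>f\<close>
      restricted to the outside of the smaller ball, so the isometry applies to it.\<close>
    have "?T R y - ?T r y = truncated_transform e R ?h y" for y
      unfolding truncated_transform_def scaleR_diff_right[symmetric] Bochner_Integration.integral_diff[OF i i, symmetric]
      by (intro arg_cong2[where f = scaleR] refl Bochner_Integration.integral_cong)
         (use that in \<open>auto simp: vec_eq_iff split: split_indicator\<close>)
    then have "energy (\<lambda>y. ?T R y - ?T r y) = energy (truncated_transform e R ?h)" by simp
    also have "... = energy (\<lambda>x. indicator (cball 0 R) x *\<^sub>R ?h x)"
      by (rule truncated_transform_energy[OF _ hf e]) measurable
    also have "... \<le> energy ?h" by (rule energy_indicator_le)
    finally show ?thesis .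
  qed
  have d: "energy (\<lambda>y. ?T R y - ?T S y) \<le> ?t r" if "r \<le> R" "r \<le> S" for r R S
  proof (cases "S \<le> R")
    case True
    show ?thesis by (rule order_trans[OF d1[OF True] energy_tail_antimono[OF that(2)]])
  next
    case False
    then have "energy (\<lambda>y. ?T S y - ?T R y) \<le> ?t R" by (intro d1) simp
    then show ?thesis using energy_tail_antimono[OF that(1), of f] by (simp add: energy_minus_commute[of "?T R"])
  qed
  have "\<exists>g s. g \<in> borel_fun \<and> strict_mono s \<and> (AE y in lborel. (\<lambda>k. ?T (real (s k)) y) \<longlonglongrightarrow> g y)"
  proof (rule L2_complete)
    fix c :: real assume "c > 0"
    then have "eventually (\<lambda>n. ?t (real n) < ennreal c) sequentially"
      by (intro order_tendstoD(2)[OF energy_tail_tendsto_0[OF f fin]]) simp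
    then obtain N where "?t (real N) < ennreal c" by (auto simp: eventually_sequentially)
    then show "\<exists>N. \<forall>m\<ge>N. \<forall>n\<ge>N. energy (\<lambda>x. ?T (real m) x - ?T (real n) x) \<le> ennreal c"
    proof (intro exI[of _ N] allI impI)
      fix m n assume "N \<le> m" "N \<le> n"
      then have "energy (\<lambda>x. ?T (real m) x - ?T (real n) x) \<le> ?t (real N)" by (intro d) auto
      also have "... \<le> ennreal c" using \<open>?t (real N) < ennreal c\<close> by simp
      finally show "energy (\<lambda>x. ?T (real m) x - ?T (real n) x) \<le> ennreal c" .
    qed
  qed measurable
  then obtain g s where [measurable]: "g \<in> borel_fun" and s: "strict_mono s"
    and lim: "AE y in lborel. (\<lambda>k. ?T (real (s k)) y) \<longlonglongrightarrow> g y" by blast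
  have dg: "energy (\<lambda>y. ?T R y - g y) \<le> ?t R" for R
  proof (rule energy_liminf_le[where u = "\<lambda>k y. ?T R y - ?T (real (s k)) y"])
    show "AE y in lborel. (\<lambda>k. ?T R y - ?T (real (s k)) y) \<longlonglongrightarrow> ?T R y - g y"
      using lim by eventually_elim (intro tendsto_intros)
    have "filterlim (\<lambda>k. real (s k)) at_top sequentially"
      by (rule filterlim_compose[OF filterlim_real_sequentially filterlim_subseq[OF s]])
    then have "eventually (\<lambda>k. R \<le> real (s k)) sequentially" by (simp add: filterlim_at_top)
    then show "eventually (\<lambda>k. energy (\<lambda>y. ?T R y - ?T (real (s k)) y) \<le> ?t R) sequentially"
      by eventually_elim (intro d, auto)
  qed measurable
  have "energy g < \<infinity>"
  proof -
    have T0: "energy (?T 0) < \<infinity>"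
      unfolding truncated_transform_energy[OF f fin e] using energy_indicator_le fin by (rule le_less_trans)
    have D0: "energy (\<lambda>y. ?T 0 y - g y) < \<infinity>"
      by (rule le_less_trans[OF dg le_less_trans[OF energy_indicator_le fin]])
    have "energy (\<lambda>y. ?T 0 y - (?T 0 y - g y)) < \<infinity>"
      by (rule energy_diff_finite[OF _ _ T0 D0]) measurable
    then show ?thesis by simp
  qed
  moreover have "((\<lambda>R. energy (\<lambda>y. ?T R y - g y)) \<longlongrightarrow> 0) at_top"
    by (rule tendsto_sandwich[OF _ _ tendsto_const energy_tail_tendsto_0_at_top[OF f fin]]) (auto simp: dg)
  ultimately show ?thesis using fin f \<open>g \<in> borel_fun\<close>
    by (intro exI[of _ g]) (simp add: is_transform_def)
qed

section \<open>From Lebesgue measurable functions to Borel representatives\<close>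

lemma ex_borel_measurable_AE_eq:
  fixes f :: "'a::euclidean_space => 'b::euclidean_space"
  assumes f: "f \<in> borel_measurable lebesgue"
  shows "\<exists>f'. f' \<in> borel_fun \<and> (AE x in lborel. f x = f' x)"
proof -
  have "\<forall>b\<in>Basis. \<exists>g. g \<in> borel_fun \<and> (AE x in lborel. f x \<bullet> b = g x)"
  proof
    fix b :: 'b
    have "(\<lambda>x. f x \<bullet> b) \<in> borel_measurable lebesgue" using f by measurable
    from completion_ex_borel_measurable_real[OF this]
    show "\<exists>g. g \<in> borel_fun \<and> (AE x in lborel. f x \<bullet> b = g x)" by auto
  qed
  then obtain g where [measurable]: "\<And>b. b \<in> Basis ==> g b \<in> borel_fun"
    and g: "\<And>b. b \<in> Basis ==> AE x in lborel. f x \<bullet> b = g b x"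
    by (auto simp: bchoice_iff)
  have "(\<lambda>x. \<Sum>b\<in>Basis. g b x *\<^sub>R b) \<in> borel_fun" by measurable
  moreover have "AE x in lborel. \<forall>b\<in>Basis. f x \<bullet> b = g b x"
    using g by (intro AE_finite_allI) auto
  then have "AE x in lborel. f x = (\<Sum>b\<in>Basis. g b x *\<^sub>R b)"
  proof eventually_elim
    case (elim x)
    have "f x = (\<Sum>b\<in>Basis. (f x \<bullet> b) *\<^sub>R b)" by (rule euclidean_representation[symmetric])
    also have "... = (\<Sum>b\<in>Basis. g b x *\<^sub>R b)" by (intro sum.cong) (auto simp: elim)
    finally show ?case .
  qed
  ultimately show ?thesis by blast
qed

lemma borel_measurable_lebesgue_AE:
  fixes f g :: "'a::euclidean_space => 'b::euclidean_space"
  assumes "g \<in> borel_fun" "AE x in lborel. f x = g x"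
  shows "f \<in> borel_measurable lebesgue"
proof (rule borel_measurable_AE)
  show "g \<in> borel_measurable lebesgue" using assms(1) by (auto intro: measurable_completion)
  show "AE x in lebesgue. g x = f x" using assms(2) by (intro AE_completion) auto
qed

lemma energy_cong_AE: "AE x in lborel. f x = g x ==> energy f = energy g"
  unfolding energy_def by (rule nn_integral_cong_AE) auto

lemma Lp_norm_2_eq:
  fixes h :: "'a::euclidean_space => 'b::euclidean_space"
  assumes "h \<in> borel_measurable lebesgue"
  shows "Lp_norm 2 (\<lambda>x. ennreal (norm (h x))) = epowr (energy h) (1 / 2)"
proof -
  have "(\<lambda>x. ennreal (norm (h x))) \<in> borel_measurable lebesgue" using assms by measurable
  moreover have "enn2real 2 = 2" by simp
  moreover have "norm v powr 2 = (norm v)\<^sup>2" for v :: 'b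
    by (cases "v = 0") (auto simp: powr_numeral)
  ultimately show ?thesis
    by (simp add: Lp_norm_def energy_def nn_integral_completion)
qed

lemma L2_iff:
  fixes f :: "'a::euclidean_space => 'b::euclidean_space"
  shows "f \<in> L2 \<longleftrightarrow> f \<in> borel_measurable lebesgue \<and> energy f < \<infinity>"
  by (auto simp: L2_def Lp_norm_2_eq less_top[symmetric])

lemma ennreal_powr_less_iff: "a > 0 ==> epowr x a < epowr y a \<longleftrightarrow> x < y"
  by (simp add: ennreal_powr_le_iff flip: not_le)

lemma ennreal_powr_tendsto_0:
  assumes "(f \<longlongrightarrow> 0) F" "c > 0" shows "((\<lambda>x. epowr (f x) c) \<longlongrightarrow> 0) F"
proof (rule order_tendstoI)
  fix a :: ennreal assume a: "0 < a"
  then have "0 < epowr a (1 / c)" by (simp add: zero_less_iff_neq_zero)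
  with assms(1) have "eventually (\<lambda>x. f x < epowr a (1 / c)) F" by (rule order_tendstoD)
  then show "eventually (\<lambda>x. epowr (f x) c < a) F"
  proof eventually_elim
    case (elim x)
    then have "epowr (f x) c < epowr (epowr a (1 / c)) c"
      using assms(2) by (simp add: ennreal_powr_less_iff del: ennreal_powr_inverse)
    then show ?case using assms(2) by simp
  qed
qed simp

lemma ennreal_powr_tendsto_0_iff:
  assumes "c > 0" shows "((\<lambda>x. epowr (f x) c) \<longlongrightarrow> 0) F \<longleftrightarrow> (f \<longlongrightarrow> 0) F"
proof
  assume "((\<lambda>x. epowr (f x) c) \<longlongrightarrow> 0) F"
  then have "((\<lambda>x. epowr (epowr (f x) c) (1 / c)) \<longlongrightarrow> 0) F"
    by (rule ennreal_powr_tendsto_0) (use assms in auto)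
  moreover have "c \<noteq> 0" using assms by simp
  ultimately show "(f \<longlongrightarrow> 0) F" by (simp only: ennreal_powr_inverse(1)[OF \<open>c \<noteq> 0\<close>])
qed (rule ennreal_powr_tendsto_0[OF _ assms])

lemma truncated_fourier_eq:
  assumes [measurable]: "f' \<in> borel_fun" and ae: "AE x in lborel. f x = f' x"
  shows "truncated_fourier R f \<xi> = truncated_transform (- 1) R f' \<xi>"
proof -
  let ?F = "\<lambda>f x. indicator (cball 0 R) x *\<^sub>R (cis (- (x \<bullet> \<xi>)) *s f x)"
  have b: "?F f' \<in> borel_fun" by measurable
  have ae': "AE x in lborel. ?F f x = ?F f' x" using ae by eventually_elim simp
  have "(LINT x|lebesgue. ?F f x) = (LINT x|lebesgue. ?F f' x)"
  proof (rule integral_cong_AE)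
    show "?F f \<in> borel_measurable lebesgue" by (rule borel_measurable_lebesgue_AE[OF b ae'])
    show "?F f' \<in> borel_measurable lebesgue" using b by (auto intro: measurable_completion)
    show "AE x in lebesgue. ?F f x = ?F f' x" using ae' by (rule AE_completion)
  qed
  also have "... = (LINT x|lborel. ?F f' x)" using b by (intro integral_completion) simp
  finally show ?thesis
    by (simp add: truncated_fourier_def truncated_transform_def set_lebesgue_integral_def)
qed

text \<open>Both sides are insensitive to null sets: the truncated integrals do not change at all,
  and the energies agree. This transfers existence and inversion to the transforms of the
  statement.\<close>

lemma is_fourier_iff_is_transform:
  assumes f' [measurable]: "f' \<in> borel_fun" and g' [measurable]: "g' \<in> borel_fun"
    and f: "AE x in lborel. f x = f' x" and g: "AE x in lborel. g x = g' x"
  shows "is_fourier f g \<longleftrightarrow> is_transform (- 1) f' g'"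
proof -
  have "f \<in> L2 \<longleftrightarrow> energy f' < \<infinity>" "g \<in> L2 \<longleftrightarrow> energy g' < \<infinity>"
    using borel_measurable_lebesgue_AE[OF f' f] borel_measurable_lebesgue_AE[OF g' g]
      energy_cong_AE[OF f] energy_cong_AE[OF g] by (auto simp: L2_iff)
  moreover have "Lp_norm 2 (\<lambda>\<xi>. ennreal (norm (truncated_fourier R f \<xi> - g \<xi>)))
     = epowr (energy (\<lambda>\<xi>. truncated_transform (- 1) R f' \<xi> - g' \<xi>)) (1 / 2)" for R
  proof -
    have ae: "AE \<xi> in lborel. truncated_fourier R f \<xi> - g \<xi> = truncated_transform (- 1) R f' \<xi> - g' \<xi>"
      using g by eventually_elim (simp add: truncated_fourier_eq[OF f' f])
    have "(\<lambda>\<xi>. truncated_fourier R f \<xi> - g \<xi>) \<in> borel_measurable lebesgue"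
      by (rule borel_measurable_lebesgue_AE[OF _ ae]) measurable
    then show ?thesis by (simp only: Lp_norm_2_eq energy_cong_AE[OF ae])
  qed
  ultimately show ?thesis
    by (simp add: is_fourier_def is_transform_def ennreal_powr_tendsto_0_iff)
qed

text \<open>Certifies that the choice in \<open>fourier\<close> is made from a nonempty set.\<close>

lemma is_fourier_fourier:
  assumes "f \<in> L2" shows "is_fourier f (fourier f)"
proof -
  obtain f' where f': "f' \<in> borel_fun" "AE x in lborel. f x = f' x"
    using ex_borel_measurable_AE_eq assms by (auto simp: L2_iff)
  have "energy f' < \<infinity>" using energy_cong_AE[OF f'(2)] assms by (simp add: L2_iff)
  then obtain g where g: "is_transform (- 1) f' g" using is_transform_exists[OF f'(1)] by fastforce
  then have "g \<in> borel_fun" by (simp add: is_transform_def)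
  then have "is_fourier f g" using is_fourier_iff_is_transform[OF f'(1) _ f'(2)] g by blast
  then show ?thesis unfolding fourier_def by (rule someI[of "is_fourier f"])
qed

text \<open>Surjectivity of the transform: the candidate is the transform with the opposite sign,
  turned around by \<open>is_transform_swap\<close>.\<close>

lemma is_fourier_inverse_fourier:
  assumes "g \<in> L2" shows "is_fourier (inverse_fourier g) g"
proof -
  obtain g' where g': "g' \<in> borel_fun" "AE x in lborel. g x = g' x"
    using ex_borel_measurable_AE_eq assms by (auto simp: L2_iff)
  have "energy g' < \<infinity>" using energy_cong_AE[OF g'(2)] assms by (simp add: L2_iff)
  then obtain f where "is_transform 1 g' f" using is_transform_exists[OF g'(1), of 1] by fastforce
  then have f: "is_transform (- 1) f g'" using is_transform_swap[of 1 g' f] by simp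
  then have "f \<in> borel_fun" by (simp add: is_transform_def)
  then have "is_fourier f g" using is_fourier_iff_is_transform[OF _ g'(1) _ g'(2), of f f] f by simp
  then show ?thesis unfolding inverse_fourier_def by (rule someI[of "\<lambda>f. is_fourier f g"])
qed

text \<open>Inversion with an explicit error, needed because the truncated flow has to converge at a
  prescribed rate.\<close>

lemma is_fourier_inversion:
  assumes fg: "is_fourier f g" and g': "g' \<in> borel_fun" and g: "AE x in lborel. g x = g' x"
  shows "energy (\<lambda>x. f x - truncated_transform 1 R g' x) = energy (\<lambda>\<xi>. indicator (- cball 0 R) \<xi> *\<^sub>R g' \<xi>)"
proof -
  have "f \<in> borel_measurable lebesgue" using fg by (simp add: is_fourier_def L2_iff)
  then obtain f' where f': "f' \<in> borel_fun" "AE x in lborel. f x = f' x"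
    using ex_borel_measurable_AE_eq by blast
  have "is_transform (- 1) f' g'" using fg is_fourier_iff_is_transform[OF f'(1) g' f'(2) g] by simp
  from is_transform_inverse[OF this, of R]
  have "energy (\<lambda>x. f' x - truncated_transform 1 R g' x) = energy (\<lambda>\<xi>. indicator (- cball 0 R) \<xi> *\<^sub>R g' \<xi>)" by simp
  moreover have "energy (\<lambda>x. f x - truncated_transform 1 R g' x) = energy (\<lambda>x. f' x - truncated_transform 1 R g' x)"
    using f'(2) by (intro energy_cong_AE) (auto elim: eventually_mono)
  ultimately show ?thesis by simp
qed

section \<open>The Dirac symbol\<close>

lemma vector_4 [simp]:
  "(vector [w, x, y, z] :: 'a::zero ^ 4) $ 1 = w" "(vector [w, x, y, z] :: 'a ^ 4) $ 2 = x"
  "(vector [w, x, y, z] :: 'a ^ 4) $ 3 = y" "(vector [w, x, y, z] :: 'a ^ 4) $ 4 = z"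
  unfolding vector_def by simp_all

lemma dirac_symbol_explicit:
  "dirac_symbol \<xi> = vector
     [vector [1, 0, of_real (\<xi> $ 3), Complex (\<xi> $ 1) (- \<xi> $ 2)],
      vector [0, 1, Complex (\<xi> $ 1) (\<xi> $ 2), - of_real (\<xi> $ 3)],
      vector [of_real (\<xi> $ 3), Complex (\<xi> $ 1) (- \<xi> $ 2), - 1, 0],
      vector [Complex (\<xi> $ 1) (\<xi> $ 2), - of_real (\<xi> $ 3), 0, - 1]]"
  unfolding dirac_symbol_def dirac_alpha_def dirac_beta_def block_matrix_def pauli_def
  by (simp add: vec_eq_iff forall_4 sum_3 mat_def complex_eq_iff)

lemma dirac_symbol_square: "dirac_symbol \<xi> ** dirac_symbol \<xi> = mat (of_real ((bracket \<xi>)\<^sup>2))"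
proof -
  have "(bracket \<xi>)\<^sup>2 = 1 + ((\<xi> $ 1)\<^sup>2 + (\<xi> $ 2)\<^sup>2 + (\<xi> $ 3)\<^sup>2)"
    by (simp add: bracket_def norm_vec_def L2_set_def sum_3 add_nonneg_nonneg)
  then show ?thesis
    unfolding dirac_symbol_explicit
    by (simp add: vec_eq_iff forall_4 matrix_matrix_mult_def sum_4 mat_def complex_eq_iff power2_eq_square algebra_simps)
qed

lemma mat_nth: "mat c $ i $ j = (if i = j then c else 0)"
  by (simp add: mat_def)

lemma mat_mult_nth: "(mat c ** M) $ i $ j = (c::complex) * M $ i $ j"
  by (simp add: matrix_matrix_mult_def mat_def if_distrib[of "\<lambda>x. x * _"] sum.delta cong: if_cong)

lemma mat_mult_mat_mult:
  fixes M N :: "complex ^ 'n ^ 'n"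
  shows "(mat a ** M) ** (mat b ** N) = mat (a * b) ** (M ** N)"
  by (simp add: vec_eq_iff mat_mult_nth) (simp add: matrix_matrix_mult_def[of "mat a ** M"] matrix_matrix_mult_def[of M] mat_mult_nth sum_distrib_left mult_ac)

lemma mat_mult_vector: "(mat c ** M) *v v = (c::complex) *s (M *v v)"
  by (simp add: vec_eq_iff matrix_vector_mult_def mat_mult_nth sum_distrib_left mult.assoc)

text \<open>The symbol divided by its eigenvalue modulus, hence an involution with eigenvalues 1 and
  -1.\<close>

definition unit_symbol :: "real^3 => complex^4^4" where
  "unit_symbol \<xi> = mat (of_real (1 / bracket \<xi>)) ** dirac_symbol \<xi>"

lemma unit_symbol_square: "unit_symbol \<xi> ** unit_symbol \<xi> = mat 1"
  unfolding unit_symbol_def mat_mult_mat_mult dirac_symbol_square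
  by (simp add: vec_eq_iff mat_mult_nth) (simp add: mat_def power2_eq_square)

text \<open>The powers of an involution alternate between \<open>mat 1\<close> and itself, so the
  exponential series splits into the cosine series and the sine series.\<close>

lemma matrix_exp_dirac:
  "matrix_exp (mat (- \<i> * complex_of_real t) ** dirac_symbol \<xi>)
    = cos (t * bracket \<xi>) *\<^sub>R mat 1 + sin (t * bracket \<xi>) *\<^sub>R (mat (- \<i>) ** unit_symbol \<xi>)"
proof -
  define x where "x = t * bracket \<xi>"
  define U where "U = unit_symbol \<xi>"
  define B where "B = mat (- \<i> * complex_of_real t) ** dirac_symbol \<xi>"
  have B: "B = mat (- \<i> * of_real x) ** U"
    unfolding B_def U_def unit_symbol_def x_def by (simp add: vec_eq_iff mat_mult_nth)
  have P: "((**) B ^^ k) (mat 1) = mat ((- \<i> * of_real x) ^ k) ** (if even k then mat 1 else U)" for k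
  proof (induction k)
    case (Suc k)
    have "((**) B ^^ Suc k) (mat 1) = (mat (- \<i> * of_real x) ** U) ** (mat ((- \<i> * of_real x) ^ k) ** (if even k then mat 1 else U))"
    proof -
      have "((**) B ^^ Suc k) (mat 1) = B ** (mat ((- \<i> * of_real x) ^ k) ** (if even k then mat 1 else U))"
        by (simp only: funpow.simps comp_apply Suc.IH)
      then show ?thesis by (simp only: B)
    qed
    also have "... = mat ((- \<i> * of_real x) ^ Suc k) ** (U ** (if even k then mat 1 else U))"
      by (simp add: mat_mult_mat_mult)
    also have "U ** (if even k then mat 1 else U) = (if even (Suc k) then mat 1 else U)"
      unfolding U_def by (simp add: unit_symbol_square)
    finally show ?case .
  qed simp
  have coeffs: "(1 / fact k) *\<^sub>R ((**) B ^^ k) (mat 1)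
    = (cos_coeff k *\<^sub>R x ^ k) *\<^sub>R mat 1 + (sin_coeff k *\<^sub>R x ^ k) *\<^sub>R (mat (- \<i>) ** U)" for k
  proof (cases "even k")
    case True
    then obtain m where m: "k = 2 * m" by blast
    have "(- \<i> * complex_of_real x) ^ k = of_real ((-1) ^ m * x ^ k)"
      by (simp add: m power_mult power_mult_distrib power_minus[of "(complex_of_real x)\<^sup>2"])
    then show ?thesis using True unfolding P
      by (simp add: vec_eq_iff mat_mult_nth mat_nth cos_coeff_def sin_coeff_def m scaleR_conv_of_real[where 'a=complex])
  next
    case False
    then obtain m where m: "k = 2 * m + 1" using oddE by blast
    have "(- \<i> * complex_of_real x) ^ k = - \<i> * of_real ((-1) ^ m * x ^ k)"
      by (simp add: m power_mult power_mult_distrib power_minus[of "(complex_of_real x)\<^sup>2"])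
    then show ?thesis using False unfolding P
      by (auto simp: vec_eq_iff mat_mult_nth mat_nth cos_coeff_def sin_coeff_def m scaleR_conv_of_real[where 'a=complex])
  qed
  have "(\<lambda>k. (1 / fact k) *\<^sub>R ((**) B ^^ k) (mat 1)) sums (cos x *\<^sub>R mat 1 + sin x *\<^sub>R (mat (- \<i>) ** U))"
    unfolding coeffs by (intro sums_add sums_scaleR_left cos_converges sin_converges)
  then show ?thesis
    unfolding matrix_exp_def B_def[symmetric] x_def[symmetric] U_def[symmetric] by (rule sums_unique[symmetric])
qed

text \<open>For \<open>e = 1\<close> and \<open>e = - 1\<close> the spectral projection of
  \<open>F\<close> to the eigenvalue \<open>- e\<close> of \<open>unit_symbol\<close>; on that
  eigenspace the flow has the phase \<open>e * t * bracket \<xi>\<close>.\<close>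

definition half_wave :: "real => (real^3 => complex^4) => real^3 => complex^4" where
  "half_wave e F \<xi> = (1/2) *\<^sub>R (F \<xi> - e *\<^sub>R (unit_symbol \<xi> *v F \<xi>))"

lemma matrix_exp_half_wave:
  "matrix_exp (mat (- \<i> * complex_of_real t) ** dirac_symbol \<xi>) *v F \<xi>
    = cis (t * bracket \<xi>) *s half_wave 1 F \<xi> + cis (- (t * bracket \<xi>)) *s half_wave (- 1) F \<xi>"
proof -
  define x where "x = t * bracket \<xi>"
  define v where "v = F \<xi>"
  define w where "w = unit_symbol \<xi> *v F \<xi>"
  have s: "(r *\<^sub>R M) *v u = r *\<^sub>R (M *v u)" for r and M :: "complex^4^4" and u
    by (simp add: vec_eq_iff matrix_vector_mult_def scaleR_sum_right scaleR_conv_of_real[where 'a=complex] sum_distrib_left mult.assoc)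
  have "matrix_exp (mat (- \<i> * complex_of_real t) ** dirac_symbol \<xi>) *v F \<xi>
     = cos x *\<^sub>R v + sin x *\<^sub>R ((- \<i>) *s w)"
    unfolding matrix_exp_dirac by (simp add: matrix_vector_mult_add_rdistrib s mat_mult_vector x_def v_def w_def)
  also have "... = cis x *s ((1/2) *\<^sub>R (v - 1 *\<^sub>R w)) + cis (- x) *s ((1/2) *\<^sub>R (v - (- 1) *\<^sub>R w))"
    by (simp add: vec_eq_iff complex_eq_iff algebra_simps)
  finally show ?thesis by (simp only: half_wave_def x_def v_def w_def)
qed

lemma norm_dirac_symbol_entry: "norm (dirac_symbol \<xi> $ i $ j) \<le> bracket \<xi>"
proof -
  have n: "bracket \<xi> = sqrt (1 + ((\<xi> $ 1)\<^sup>2 + (\<xi> $ 2)\<^sup>2 + (\<xi> $ 3)\<^sup>2))"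
    by (simp add: bracket_def norm_vec_def L2_set_def sum_3 add_nonneg_nonneg)
  have 1: "1 \<le> bracket \<xi>" by (rule bracket_ge_1)
  have 3: "\<bar>\<xi> $ 3\<bar> \<le> bracket \<xi>" unfolding n by (intro real_le_rsqrt) simp
  have 2: "norm (Complex (\<xi> $ 1) (\<xi> $ 2)) \<le> bracket \<xi>" "norm (Complex (\<xi> $ 1) (- \<xi> $ 2)) \<le> bracket \<xi>"
    unfolding n by (simp_all add: complex_norm)
  have "\<forall>i j. norm (dirac_symbol \<xi> $ i $ j) \<le> bracket \<xi>"
    unfolding dirac_symbol_explicit forall_4 using 1 2 3 by simp
  then show ?thesis by blast
qed

text \<open>Entrywise: all 16 entries have modulus at most 1. The later constants follow from it: 9
  bounds 17/2 for a half wave, 18 is the sum of two half waves, and 324 = 18^2.\<close>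

lemma norm_unit_symbol_mult: "norm (unit_symbol \<xi> *v v) \<le> 16 * norm v"
proof -
  have u: "norm (unit_symbol \<xi> $ i $ j) \<le> 1" for i j
    using norm_dirac_symbol_entry[of \<xi> i j] bracket_pos[of \<xi>]
    by (simp add: unit_symbol_def mat_mult_nth norm_mult norm_divide divide_le_eq)
  have "norm ((unit_symbol \<xi> *v v) $ i) \<le> 4 * norm v" for i
  proof -
    have "norm ((unit_symbol \<xi> *v v) $ i) \<le> (\<Sum>j\<in>UNIV. norm (unit_symbol \<xi> $ i $ j * v $ j))"
      unfolding matrix_vector_mult_def by (simp add: norm_sum)
    also have "... \<le> (\<Sum>j\<in>(UNIV :: 4 set). 1 * norm v)"
      unfolding norm_mult by (intro sum_mono mult_mono u Finite_Cartesian_Product.norm_nth_le) auto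
    finally show ?thesis by simp
  qed
  then have "(\<Sum>i\<in>(UNIV :: 4 set). norm ((unit_symbol \<xi> *v v) $ i)) \<le> (\<Sum>i\<in>(UNIV :: 4 set). 4 * norm v)"
    by (intro sum_mono)
  moreover have "norm (unit_symbol \<xi> *v v) \<le> (\<Sum>i\<in>UNIV. norm ((unit_symbol \<xi> *v v) $ i))"
    unfolding norm_vec_def by (intro L2_set_le_sum) auto
  ultimately show ?thesis by simp
qed

lemma norm_half_wave: "\<bar>e\<bar> = 1 ==> norm (half_wave e F y) \<le> 9 * norm (F y)"
proof -
  assume e: "\<bar>e\<bar> = 1"
  have "norm (F y - e *\<^sub>R (unit_symbol y *v F y)) \<le> norm (F y) + norm (unit_symbol y *v F y)"
    using norm_triangle_ineq4[of "F y" "e *\<^sub>R (unit_symbol y *v F y)"] e by simp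
  also have "... \<le> 17 * norm (F y)" using norm_unit_symbol_mult[of y "F y"] by simp
  finally have "norm (F y - e *\<^sub>R (unit_symbol y *v F y)) \<le> 17 * norm (F y)" .
  moreover have "norm (half_wave e F y) = norm (F y - e *\<^sub>R (unit_symbol y *v F y)) / 2"
    by (simp add: half_wave_def)
  ultimately show ?thesis using norm_ge_zero[of "F y"] by linarith
qed

lemma borel_measurable_vec_lambda:
  fixes f :: "'n::finite => 'a => 'b::euclidean_space"
  assumes "\<And>i. f i \<in> borel_measurable M"
  shows "(\<lambda>x. \<chi> i. f i x) \<in> borel_measurable M"
proof -
  have "(\<lambda>x. \<chi> i. f i x) = (\<lambda>x. \<Sum>i\<in>UNIV. axis i (f i x))"
    by (simp add: fun_eq_iff vec_eq_iff axis_def if_distrib sum.delta cong: if_cong)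
  moreover have "(\<lambda>x. axis i (f i x) :: 'b ^ 'n) \<in> borel_measurable M" for i
  proof -
    have "continuous_on UNIV (\<lambda>y :: 'b. axis i y :: 'b ^ 'n)"
    proof (unfold axis_def, intro continuous_on_vec_lambda)
      show "continuous_on UNIV (\<lambda>y :: 'b. if j = i then y else 0)" for j by (cases "j = i") auto
    qed
    from borel_measurable_continuous_on[OF this assms] show ?thesis .
  qed
  ultimately show ?thesis by simp
qed

lemma borel_measurable_half_wave [measurable]:
  assumes [measurable]: "F \<in> borel_fun"
  shows "half_wave e F \<in> borel_fun"
proof -
  have um: "(\<lambda>\<xi>. unit_symbol \<xi> $ i $ j) \<in> borel_fun" for i j
  proof -
    have "\<forall>i j. continuous_on UNIV (\<lambda>\<xi> :: real^3. dirac_symbol \<xi> $ i $ j)"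
      unfolding dirac_symbol_explicit forall_4 by (simp add: Complex_eq) (intro conjI continuous_intros)
    then have "(\<lambda>\<xi>. dirac_symbol \<xi> $ i $ j) \<in> borel_fun"
      by (intro borel_measurable_continuous_onI) auto
    then show ?thesis unfolding unit_symbol_def mat_mult_nth by measurable
  qed
  have [measurable]: "(\<lambda>\<xi>. unit_symbol \<xi> *v F \<xi>) \<in> borel_fun"
    unfolding matrix_vector_mult_def
    by (intro borel_measurable_vec_lambda borel_measurable_sum borel_measurable_times um borel_measurable_vec_nth[OF assms])
  show ?thesis unfolding half_wave_def by measurable
qed

section \<open>Amalgams\<close>

lemma nn_integral_partition:
  fixes c :: "'a => 'i::countable"
  assumes [measurable]: "F \<in> borel_measurable M" "c \<in> M \<rightarrow>\<^sub>M count_space UNIV"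
  shows "(\<integral>\<^sup>+x. F x \<partial>M) = (\<Sum>\<^sub>+k. (\<integral>\<^sup>+x. F x * indicator {k} (c x) \<partial>M))"
proof -
  have "(\<Sum>\<^sub>+k. F x * indicator {k} (c x)) = F x" for x
  proof -
    have "(\<Sum>\<^sub>+k. F x * indicator {k} (c x)) = (\<Sum>\<^sub>+k. F x * indicator {c x} k)"
      by (intro nn_integral_cong) (auto split: split_indicator)
    also have "... = F x * emeasure (count_space UNIV) {c x}" by (rule nn_integral_cmult_indicator) simp
    finally show ?thesis by simp
  qed
  then have "(\<integral>\<^sup>+x. F x \<partial>M) = (\<integral>\<^sup>+x. (\<Sum>\<^sub>+k. F x * indicator {k} (c x)) \<partial>M)" by simp
  also have "... = (\<Sum>\<^sub>+k. (\<integral>\<^sup>+x. F x * indicator {k} (c x) \<partial>M))"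
    by (rule nn_integral_count_space_nn_integral) auto
  finally show ?thesis .
qed

lemma ennreal_powr_add:
  assumes "x \<noteq> top" shows "epowr x a * epowr x b = epowr x (a + b)"
  using assms by (cases x) (auto simp: powr_add ennreal_mult')

lemma ennreal_powr_indicator: "epowr (f * indicator A x) a = epowr f a * indicator A x"
  by (auto split: split_indicator)

text \<open>The function realizing equality in Hoelder's inequality, normalized. Finiteness of
  \<open>X\<close> is needed for the negative power; \<open>epowr 0 a = 0\<close> makes
  \<open>w\<close> vanish when \<open>X = 0\<close>, so both claims persist, the first as an
  inequality.\<close>

lemma dual_extremizer:
  assumes r: "r > 1" and [measurable]: "f \<in> borel_measurable M"
    and fin: "(\<integral>\<^sup>+x. epowr (f x) r \<partial>M) \<noteq> top" and ff: "\<And>x. f x \<noteq> top"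
  defines "X \<equiv> \<integral>\<^sup>+x. epowr (f x) r \<partial>M"
  defines "w \<equiv> \<lambda>x. epowr (f x) (r - 1) * epowr X (1 / r - 1)"
  shows "(\<integral>\<^sup>+x. epowr (w x) (r / (r - 1)) \<partial>M) \<le> 1"
    and "(\<integral>\<^sup>+x. f x * w x \<partial>M) = epowr X (1 / r)"
proof -
  have Xt: "X \<noteq> top" using fin by (simp add: X_def)
  have e: "(r - 1) * (r / (r - 1)) = r" "(1 / r - 1) * (r / (r - 1)) = - 1" "1 + (r - 1) = r" "1 + (1 / r - 1) = 1 / r"
    using r by (auto simp: field_simps)
  have "epowr (w x) (r / (r - 1)) = epowr (f x) r * epowr X (- 1)" for x
    unfolding w_def ennreal_powr_mult ennreal_powr_powr e ..
  then have "(\<integral>\<^sup>+x. epowr (w x) (r / (r - 1)) \<partial>M) = X * epowr X (- 1)"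
    unfolding X_def by (simp add: nn_integral_multc)
  also have "... = epowr X (1 + (- 1))"
    using ennreal_powr_add[OF Xt, of 1 "- 1"] by simp
  also have "... \<le> 1" using Xt by (cases X) auto
  finally show "(\<integral>\<^sup>+x. epowr (w x) (r / (r - 1)) \<partial>M) \<le> 1" .
  have "f x * w x = epowr (f x) r * epowr X (1 / r - 1)" for x
    using ennreal_powr_add[OF ff[of x], of 1 "r - 1"] by (simp add: w_def mult.assoc[symmetric])
  then have "(\<integral>\<^sup>+x. f x * w x \<partial>M) = X * epowr X (1 / r - 1)"
    unfolding X_def by (simp add: nn_integral_multc)
  also have "... = epowr X (1 / r)"
    using ennreal_powr_add[OF Xt, of 1 "1 / r - 1"] by simp
  finally show "(\<integral>\<^sup>+x. f x * w x \<partial>M) = epowr X (1 / r)" .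
qed

text \<open>\<open>ps, qs\<close> are the local exponents and \<open>p, q\<close> the global ones.\<close>

lemma amalgam_young:
  fixes \<iota> :: "'a::euclidean_space => 'i::countable"
  assumes \<iota> [measurable]: "\<iota> \<in> borel \<rightarrow>\<^sub>M count_space UNIV"
    and p: "p > 1" "p \<le> 2" and q: "q = p / (p - 1)" and ps: "ps > 1" "ps \<le> 2" and qs: "qs = ps / (ps - 1)"
    and K: "K > 0" and \<kappa>: "\<And>i j. \<kappa> i j > 0"
    and k [measurable]: "(\<lambda>(x, y). k x y) \<in> borel_measurable (lborel \<Otimes>\<^sub>M lborel)"
    and loc1: "\<And>x l. (\<integral>y. epowr (k x y) (qs / 2) * indicator {l} (\<iota> y)) \<le> ennreal (\<kappa> (\<iota> x) l powr (qs / 2))"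
    and loc2: "\<And>y j. (\<integral>x. epowr (k x y) (qs / 2) * indicator {j} (\<iota> x)) \<le> ennreal (\<kappa> j (\<iota> y) powr (qs / 2))"
    and glob1: "\<And>j. (\<Sum>\<^sub>+l. ennreal (\<kappa> j l powr (q / 2))) \<le> ennreal (K powr (q / 2))"
    and glob2: "\<And>l. (\<Sum>\<^sub>+j. ennreal (\<kappa> j l powr (q / 2))) \<le> ennreal (K powr (q / 2))"
    and c: "(\<Sum>\<^sub>+j. epowr (c j) p) \<le> 1" and d: "(\<Sum>\<^sub>+j. epowr (d j) p) \<le> 1"
    and [measurable]: "w \<in> borel_fun" "v \<in> borel_fun"
    and w: "\<And>j. (\<integral>x. epowr (w x) ps * indicator {j} (\<iota> x)) \<le> 1"
    and v: "\<And>j. (\<integral>x. epowr (v x) ps * indicator {j} (\<iota> x)) \<le> 1"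
  shows "(\<integral>x. \<integral>y. (c (\<iota> x) * w x) * (d (\<iota> y) * v y) * k x y) \<le> ennreal K"
proof -
  have sl: "sigma_finite_measure (lborel :: 'a measure)" ..
  have sc: "sigma_finite_measure (count_space (UNIV :: 'i set))"
    by (rule sigma_finite_measure_count_space_countable) simp
  have cm [measurable]: "(\<lambda>x. c (\<iota> x)) \<in> borel_fun" "(\<lambda>x. d (\<iota> x)) \<in> borel_fun"
    by (rule measurable_compose[OF \<iota>], simp)+
  \<comment> \<open>Young's inequality with the local exponents on one pair of cells; it leaves the
    number \<open>\<kappa> j l\<close>.\<close>
  have cell: "(\<integral>x. \<integral>y. (w x * indicator {j} (\<iota> x)) * (v y * indicator {l} (\<iota> y)) * (k x y * indicator {j} (\<iota> x) * indicator {l} (\<iota> y)))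
    \<le> ennreal (\<kappa> j l)" for j l
  proof (rule trilinear_young[OF sl sl ps qs \<kappa>])
    show "(\<lambda>(x, y). k x y * indicator {j} (\<iota> x) * indicator {l} (\<iota> y)) \<in> borel_measurable (lborel \<Otimes>\<^sub>M lborel)"
      by measurable
    show "(\<integral>x. epowr (w x * indicator {j} (\<iota> x)) ps) \<le> 1"
      unfolding ennreal_powr_indicator by (rule w)
    show "(\<integral>x. epowr (v x * indicator {l} (\<iota> x)) ps) \<le> 1"
      unfolding ennreal_powr_indicator by (rule v)
    show "(\<integral>y. epowr (k x y * indicator {j} (\<iota> x) * indicator {l} (\<iota> y)) (qs / 2)) \<le> ennreal (\<kappa> j l powr (qs / 2))" for x
      using loc1[of x l] unfolding ennreal_powr_indicator by (cases "\<iota> x = j") auto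
    show "(\<integral>x. epowr (k x y * indicator {j} (\<iota> x) * indicator {l} (\<iota> y)) (qs / 2)) \<le> ennreal (\<kappa> j l powr (qs / 2))" for y
      using loc2[of y j] unfolding ennreal_powr_indicator by (cases "\<iota> y = l") auto
  qed measurable
  let ?F = "\<lambda>x y. (c (\<iota> x) * w x) * (d (\<iota> y) * v y) * k x y"
  have "(\<integral>x. \<integral>y. ?F x y)
    = (\<Sum>\<^sub>+j. \<integral>x. (\<integral>y. ?F x y) * indicator {j} (\<iota> x))"
    by (rule nn_integral_partition) measurable
  also have "... = (\<Sum>\<^sub>+j. \<integral>x. \<Sum>\<^sub>+l. \<integral>y. ?F x y * indicator {l} (\<iota> y) * indicator {j} (\<iota> x))"
  proof (intro nn_integral_cong)
    fix j x
    have "(\<integral>y. ?F x y) = (\<Sum>\<^sub>+l. \<integral>y. ?F x y * indicator {l} (\<iota> y))"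
      by (rule nn_integral_partition) measurable
    then have "(\<integral>y. ?F x y) * indicator {j} (\<iota> x)
      = (\<Sum>\<^sub>+l. (\<integral>y. ?F x y * indicator {l} (\<iota> y)) * indicator {j} (\<iota> x))"
      by (simp only:) (rule nn_integral_multc[symmetric], simp)
    also have "... = (\<Sum>\<^sub>+l. \<integral>y. ?F x y * indicator {l} (\<iota> y) * indicator {j} (\<iota> x))"
      by (intro nn_integral_cong nn_integral_multc[symmetric]) measurable
    finally show "(\<integral>y. ?F x y) * indicator {j} (\<iota> x) = ..." .
  qed
  also have "... = (\<Sum>\<^sub>+j. \<Sum>\<^sub>+l. \<integral>x. \<integral>y. ?F x y * indicator {l} (\<iota> y) * indicator {j} (\<iota> x))"
    by (intro nn_integral_cong nn_integral_count_space_nn_integral) auto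
  also have "... = (\<Sum>\<^sub>+j. \<Sum>\<^sub>+l. c j * d l * (\<integral>x. \<integral>y. (w x * indicator {j} (\<iota> x)) * (v y * indicator {l} (\<iota> y)) * (k x y * indicator {j} (\<iota> x) * indicator {l} (\<iota> y))))"
  proof (intro nn_integral_cong)
    fix j l
    have "(\<integral>x. \<integral>y. ?F x y * indicator {l} (\<iota> y) * indicator {j} (\<iota> x))
      = (\<integral>x. \<integral>y. c j * d l * ((w x * indicator {j} (\<iota> x)) * (v y * indicator {l} (\<iota> y)) * (k x y * indicator {j} (\<iota> x) * indicator {l} (\<iota> y))))"
      by (intro nn_integral_cong) (auto split: split_indicator simp: mult_ac)
    also have "... = (\<integral>x. c j * d l * (\<integral>y. (w x * indicator {j} (\<iota> x)) * (v y * indicator {l} (\<iota> y)) * (k x y * indicator {j} (\<iota> x) * indicator {l} (\<iota> y))))"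
      by (intro nn_integral_cong nn_integral_cmult) measurable
    also have "... = c j * d l * (\<integral>x. \<integral>y. (w x * indicator {j} (\<iota> x)) * (v y * indicator {l} (\<iota> y)) * (k x y * indicator {j} (\<iota> x) * indicator {l} (\<iota> y)))"
      by (rule nn_integral_cmult) measurable
    finally show "(\<integral>x. \<integral>y. ?F x y * indicator {l} (\<iota> y) * indicator {j} (\<iota> x)) = ..." .
  qed
  also have "... \<le> (\<Sum>\<^sub>+j. \<Sum>\<^sub>+l. c j * d l * ennreal (\<kappa> j l))"
    by (intro nn_integral_mono mult_left_mono cell) auto
  also have "... \<le> ennreal K"
  \<comment> \<open>The same inequality with the global exponents, now for the counting measure and
    the kernel \<kappa>.\<close>
  proof (rule trilinear_young[OF sc sc p q K])
    show "(\<lambda>(x, y). ennreal (\<kappa> x y)) \<in> borel_measurable (count_space UNIV \<Otimes>\<^sub>M count_space UNIV)"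
      by (simp add: pair_measure_countable)
  qed (use c d glob1 glob2 \<kappa> in \<open>auto simp: less_imp_le\<close>)
  finally show ?thesis .
qed

text \<open>The value at 0 is infinite for \<open>c\<close> other than 0, so that upper bounds by it
  hold at the singularity as well; for \<open>c = 0\<close> it is constantly 1.\<close>

definition inv_power :: "real => real => ennreal" where
  "inv_power c x = (if c = 0 then 1 else if x = 0 then top else ennreal (\<bar>x\<bar> powr (- c)))"

lemma borel_measurable_inv_power [measurable]:
  assumes [measurable]: "f \<in> borel_measurable M"
  shows "(\<lambda>x. inv_power c (f x)) \<in> borel_measurable M"
  unfolding inv_power_def by measurable

lemma inv_power_pos: "inv_power c x > 0"
  by (auto simp: inv_power_def)

lemma inv_power_eq: "x \<noteq> 0 ==> inv_power c x = ennreal (\<bar>x\<bar> powr (- c))"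
  by (auto simp: inv_power_def)

lemma inv_power_powr: "e > 0 ==> epowr (inv_power c x) e = inv_power (c * e) x"
  by (auto simp: inv_power_def powr_powr)

lemma inv_power_uminus [simp]: "inv_power c (- x) = inv_power c x"
  by (simp add: inv_power_def)

text \<open>The interval reaches to 2 because points of the same or of adjacent unit cells differ by
  at most 2 in each coordinate.\<close>

lemma nn_integral_inv_power_finite:
  assumes c: "0 \<le> c" "c < 1"
  shows "(\<integral>s. inv_power c s * indicator {-2..2} s) < top"
proof -
  have half: "(\<integral>s. inv_power c s * indicator {0..2} s) < top"
  proof -
    have "((\<lambda>x. x powr (- c)) has_integral (2 powr (- c + 1) / (- c + 1))) {0..2::real}"
      using c by (intro has_integral_powr_from_0) auto
    then have "((\<lambda>x. if x \<in> {0..2} then x powr (- c) else 0) has_integral (2 powr (- c + 1) / (- c + 1))) (UNIV :: real set)"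
      by (simp only: has_integral_restrict_UNIV)
    then have "(\<integral>x. ennreal (if x \<in> {0..2} then x powr (- c) else 0)) = ennreal (2 powr (- c + 1) / (- c + 1))"
      by (intro nn_integral_has_integral_lborel) auto
    moreover have "(\<integral>s. inv_power c s * indicator {0..2} s) = (\<integral>x. ennreal (if x \<in> {0..2} then x powr (- c) else 0))"
    proof (rule nn_integral_cong_AE)
      have "AE x in lborel. x \<noteq> (0::real)" by (rule AE_lborel_singleton)
      then show "AE x in lborel. inv_power c x * indicator {0..2} x = ennreal (if x \<in> {0..2} then x powr (- c) else 0)"
        by eventually_elim (auto simp: inv_power_eq)
    qed
    ultimately show ?thesis by simp
  qed
  have "(\<integral>s. inv_power c s * indicator {-2..2} s)
    \<le> (\<integral>s. inv_power c s * indicator {0..2} s + inv_power c (- s) * indicator {0..2} (- s))"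
    by (intro nn_integral_mono) (auto split: split_indicator)
  also have "... = (\<integral>s. inv_power c s * indicator {0..2} s) + (\<integral>s. inv_power c (- s) * indicator {0..2} (- s))"
    by (rule nn_integral_add) measurable
  also have "(\<integral>s. inv_power c (- s) * indicator {0..2} (- s)) = (\<integral>s. inv_power c s * indicator {0..2} s)"
    using nn_integral_real_affine[of "\<lambda>s. inv_power c s * indicator {0..2} s" "- 1" 0] by (simp del: inv_power_uminus)
  also have "(\<integral>s. inv_power c s * indicator {0..2} s) + (\<integral>s. inv_power c s * indicator {0..2} s) < top"
    using half by (simp add: less_top[symmetric])
  finally show ?thesis .
qed

text \<open>Comparison with an integral: on the unit interval starting at \<open>n\<close>,
  \<open>T \<ge> 1\<close> gives \<open>T + |s| \<le> 2 (T + |n|)\<close>, which costs the factor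
  \<open>2 powr e\<close>; both half-lines together give \<open>2 / (e - 1)\<close>.\<close>

lemma nn_integral_int_powr_bound:
  assumes e: "e > 1" and T: "T \<ge> 1"
  shows "(\<Sum>\<^sub>+n. ennreal ((T + real_of_int \<bar>n\<bar>) powr (- e))) \<le> ennreal (2 powr e * (2 / (e - 1)) * T powr (1 - e))"
proof -
  have [measurable]: "(floor :: real => int) \<in> borel \<rightarrow>\<^sub>M count_space UNIV" by measurable
  have half: "(\<integral>s. ennreal ((T + s) powr (- e)) * indicator {0..} s) = ennreal (T powr (1 - e) / (e - 1))"
  proof -
    have "((\<lambda>x. x powr (- e)) has_integral - (T powr (- e + 1)) / (- e + 1)) {T..}"
      using e T by (intro has_integral_powr_to_inf) auto
    then have "((\<lambda>x. if x \<in> {T..} then x powr (- e) else 0) has_integral - (T powr (- e + 1)) / (- e + 1)) UNIV"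
      by (simp only: has_integral_restrict_UNIV)
    then have "(\<integral>x. ennreal (if x \<in> {T..} then x powr (- e) else 0)) = ennreal (- (T powr (- e + 1)) / (- e + 1))"
      by (intro nn_integral_has_integral_lborel) auto
    also have "(\<integral>x. ennreal (if x \<in> {T..} then x powr (- e) else 0))
      = (\<integral>s. ennreal (if T + 1 * s \<in> {T..} then (T + 1 * s) powr (- e) else 0))"
      by (subst nn_integral_real_affine[where c = 1 and t = T]) auto
    also have "... = (\<integral>s. ennreal ((T + s) powr (- e)) * indicator {0..} s)"
      by (intro nn_integral_cong) (auto split: split_indicator)
    also have "- (T powr (- e + 1)) / (- e + 1) = T powr (1 - e) / (e - 1)"
      using e by (simp add: field_simps)
    finally show ?thesis .
  qed
  let ?f = "\<lambda>s. ennreal ((T + s) powr (- e)) * indicator {0..} s"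
  have full: "(\<integral>s. ennreal ((T + \<bar>s\<bar>) powr (- e))) \<le> ennreal (2 / (e - 1) * T powr (1 - e))"
  proof -
    have "(\<integral>s. ennreal ((T + \<bar>s\<bar>) powr (- e))) \<le> (\<integral>s. ?f s + ?f (- s))"
      by (intro nn_integral_mono) (auto split: split_indicator)
    also have "... = (\<integral>s. ?f s) + (\<integral>s. ?f (- s))"
      by (rule nn_integral_add) measurable
    also have "(\<integral>s. ?f (- s)) = (\<integral>s. ?f s)"
      using nn_integral_real_affine[of ?f "- 1" 0] by simp
    also have "(\<integral>s. ?f s) + (\<integral>s. ?f s) = ennreal (T powr (1 - e) / (e - 1) + T powr (1 - e) / (e - 1))"
      unfolding half using e by (intro ennreal_plus[symmetric]) auto
    finally show ?thesis by (simp add: mult.commute)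
  qed
  have "(\<Sum>\<^sub>+n. ennreal ((T + real_of_int \<bar>n\<bar>) powr (- e)))
    = (\<Sum>\<^sub>+n. (\<integral>s. ennreal ((T + real_of_int \<bar>n\<bar>) powr (- e)) * indicator {n} \<lfloor>s :: real\<rfloor>))"
  proof (intro nn_integral_cong)
    fix n :: int
    have "(\<integral>s. ennreal ((T + real_of_int \<bar>n\<bar>) powr (- e)) * indicator {n} \<lfloor>s :: real\<rfloor>)
      = (\<integral>s. ennreal ((T + real_of_int \<bar>n\<bar>) powr (- e)) * indicator {real_of_int n..<real_of_int n + 1} s)"
      by (intro nn_integral_cong) (auto split: split_indicator simp: floor_eq_iff floor_unique)
    also have "... = ennreal ((T + real_of_int \<bar>n\<bar>) powr (- e))"
      by (subst nn_integral_cmult_indicator) auto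
    finally show "ennreal ((T + real_of_int \<bar>n\<bar>) powr (- e)) = (\<integral>s. ennreal ((T + real_of_int \<bar>n\<bar>) powr (- e)) * indicator {n} \<lfloor>s :: real\<rfloor>)" by simp
  qed
  also have "... \<le> (\<Sum>\<^sub>+n. (\<integral>s. (ennreal (2 powr e) * ennreal ((T + \<bar>s\<bar>) powr (- e))) * indicator {n} \<lfloor>s :: real\<rfloor>))"
  proof (intro nn_integral_mono)
    fix n s
    show "ennreal ((T + real_of_int \<bar>n\<bar>) powr (- e)) * indicator {n} \<lfloor>s :: real\<rfloor> \<le> (ennreal (2 powr e) * ennreal ((T + \<bar>s\<bar>) powr (- e))) * indicator {n} \<lfloor>s :: real\<rfloor>"
    proof (cases "\<lfloor>s\<rfloor> = n")
      case True
      have "\<bar>s\<bar> \<le> real_of_int \<bar>n\<bar> + 1" using True by linarith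
      then have "(T + \<bar>s\<bar>) / 2 \<le> T + real_of_int \<bar>n\<bar>" using T by simp
      then have "(T + real_of_int \<bar>n\<bar>) powr (- e) \<le> ((T + \<bar>s\<bar>) / 2) powr (- e)"
        using e T by (intro powr_mono2') auto
      also have "... = 2 powr e * (T + \<bar>s\<bar>) powr (- e)"
        using T by (simp add: powr_divide powr_minus field_simps)
      finally show ?thesis using True by (simp add: ennreal_mult'[symmetric])
    qed simp
  qed
  also have "... = (\<integral>s. ennreal (2 powr e) * ennreal ((T + \<bar>s\<bar>) powr (- e)))"
    by (rule nn_integral_partition[symmetric]) measurable
  also have "... = ennreal (2 powr e) * (\<integral>s. ennreal ((T + \<bar>s\<bar>) powr (- e)))"
    by (rule nn_integral_cmult) measurable
  also have "... \<le> ennreal (2 powr e) * ennreal (2 / (e - 1) * T powr (1 - e))"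
    by (intro mult_left_mono full) simp
  also have "... = ennreal (2 powr e * (2 / (e - 1)) * T powr (1 - e))"
    by (simp add: ennreal_mult'[symmetric] mult.assoc)
  finally show ?thesis .
qed

section \<open>The kernel on unit cubes\<close>

definition cell :: "real^3 => int \<times> int \<times> int" where
  "cell x = (\<lfloor>x $ 1\<rfloor>, \<lfloor>x $ 2\<rfloor>, \<lfloor>x $ 3\<rfloor>)"

lemma measurable_cell [measurable]: "cell \<in> borel \<rightarrow>\<^sub>M count_space UNIV"
proof -
  have "(\<lambda>x :: real^3. (\<lfloor>x $ 1\<rfloor>, \<lfloor>x $ 2\<rfloor>, \<lfloor>x $ 3\<rfloor>)) \<in> borel \<rightarrow>\<^sub>M count_space UNIV \<Otimes>\<^sub>M (count_space UNIV \<Otimes>\<^sub>M count_space UNIV)"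
    by measurable
  then show ?thesis by (simp add: cell_def[abs_def] pair_measure_countable)
qed

lemma emeasure_cell_le: "(\<integral>y. indicator {l} (cell y)) \<le> 1"
proof -
  obtain l1 l2 l3 where l: "l = (l1, l2, l3)" by (cases l) auto
  define v :: "real^3" where "v = vector [of_int l1, of_int l2, of_int l3]"
  have "(\<integral>y. indicator {l} (cell y)) \<le> (\<integral>y. indicator (cbox v (v + (\<chi> i. 1))) y)"
    by (intro nn_integral_mono)
       (auto split: split_indicator simp: l cell_def v_def mem_box_cart forall_3 vector_3 floor_eq_iff less_imp_le)
  also have "... = emeasure lborel (cbox v (v + (\<chi> i. 1)))" by simp
  also have "... = 1"
    using prod_Basis_vec3[of "\<chi> i. 1"]
    by (subst emeasure_lborel_cbox) (auto simp: inner_add_left Basis_vec_def inner_axis)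
  finally show ?thesis .
qed

text \<open>Each coordinate is at most the norm in modulus, so \<open>|z|^-c\<close> is at most the
  product of the \<open>|z_i|^-(c/3)\<close>, and \<open>c/3 < 1\<close> makes every one-dimensional
  factor integrable.\<close>

lemma nn_integral_cube_local:
  assumes c: "0 \<le> c" "c < 3"
  shows "\<exists>D>0. \<forall>x::real^3. (\<integral>y. inv_power c (norm (x - y)) * indicator {z. \<forall>i. \<bar>z $ i\<bar> \<le> 2} (x - y)) \<le> ennreal D"
proof -
  define g where "g s = inv_power (c / 3) s * indicator {-2..2} s" for s :: real
  have [measurable]: "g \<in> borel_fun" unfolding g_def by measurable
  define I where "I = (\<integral>s. g s)"
  have "I < top" unfolding I_def g_def using c by (intro nn_integral_inv_power_finite) auto
  then obtain d where d: "I = ennreal d" "d \<ge> 0" by (cases I) auto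
  have shift: "(\<integral>s. g (t - s)) = I" for t
    unfolding I_def using nn_integral_real_affine[of g "- 1" t] by simp
  have bound: "inv_power c (norm z) * indicator {z. \<forall>i. \<bar>z $ i\<bar> \<le> 2} z \<le> g (z $ 1) * (g (z $ 2) * g (z $ 3))" for z :: "real^3"
  proof (cases "\<forall>i. \<bar>z $ i\<bar> \<le> 2")
    case True
    then have "g (z $ i) = inv_power (c / 3) (z $ i)" for i
      using abs_le_iff[of "z $ i" 2] by (auto simp: g_def split: split_indicator)
    moreover have "inv_power c (norm z) \<le> inv_power (c / 3) (z $ 1) * (inv_power (c / 3) (z $ 2) * inv_power (c / 3) (z $ 3))"
    proof (cases "c = 0")
      case True
      then show ?thesis by (simp add: inv_power_def)
    next
      case False
      show ?thesis
      proof (cases "z $ 1 = 0 \<or> z $ 2 = 0 \<or> z $ 3 = 0")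
        case True
        then have "inv_power (c / 3) (z $ 1) * (inv_power (c / 3) (z $ 2) * inv_power (c / 3) (z $ 3)) = top"
        proof -
          have "inv_power (c / 3) 0 = top" using False by (simp add: inv_power_def)
          moreover have "inv_power (c / 3) t \<noteq> 0" for t using inv_power_pos[of "c / 3" t] by simp
          ultimately show ?thesis using True by (auto simp: ennreal_mult_eq_top_iff)
        qed
        then show ?thesis by simp
      next
        case nz: False
        have le: "norm z powr (- (c / 3)) \<le> \<bar>z $ i\<bar> powr (- (c / 3))" if "z $ i \<noteq> 0" for i
          using that c component_le_norm_cart[of z i] by (intro powr_mono2') auto
        have "z \<noteq> 0" using nz by auto
        then have "inv_power c (norm z) = ennreal (norm z powr (- c))" by (simp add: inv_power_eq)
        also have "norm z powr (- c) = norm z powr (- (c / 3)) * (norm z powr (- (c / 3)) * norm z powr (- (c / 3)))"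
          by (simp add: powr_add[symmetric])
        also have "... \<le> \<bar>z $ 1\<bar> powr (- (c / 3)) * (\<bar>z $ 2\<bar> powr (- (c / 3)) * \<bar>z $ 3\<bar> powr (- (c / 3)))"
          using nz by (intro mult_mono le) auto
        finally show ?thesis using nz by (simp add: inv_power_eq ennreal_mult'[symmetric] ennreal_leI)
      qed
    qed
    ultimately show ?thesis using True by simp
  qed simp
  have "(\<integral>y. inv_power c (norm (x - y)) * indicator {z. \<forall>i. \<bar>z $ i\<bar> \<le> 2} (x - y)) \<le> ennreal (d * (d * d) + 1)" for x :: "real^3"
  proof -
    have "(\<integral>y. inv_power c (norm (x - y)) * indicator {z. \<forall>i. \<bar>z $ i\<bar> \<le> 2} (x - y))
       \<le> (\<integral>\<^sup>+(y :: real^3). g (x $ 1 - y $ 1) * (g (x $ 2 - y $ 2) * g (x $ 3 - y $ 3)) \<partial>lborel)"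
      by (intro nn_integral_mono order_trans[OF bound]) simp
    also have "... = (\<integral>\<^sup>+(y :: real^3). g (x $ 1 - y $ 1) * (g (x $ 2 - y $ 2) * g (x $ 3 - y $ 3)) \<partial>distr lborel borel vec_of_triple)"
      by (simp add: lborel_vec_of_triple)
    also have "... = (\<integral>p. g (x $ 1 - vec_of_triple p $ 1) * (g (x $ 2 - vec_of_triple p $ 2) * g (x $ 3 - vec_of_triple p $ 3)))"
      by (rule nn_integral_distr) measurable
    also have "... = (\<integral>s1. \<integral>p. g (x $ 1 - vec_of_triple (s1, p) $ 1) * (g (x $ 2 - vec_of_triple (s1, p) $ 2) * g (x $ 3 - vec_of_triple (s1, p) $ 3)))"
      by (rule nn_integral_lborel_pair) measurable
    also have "... = (\<integral>s1. \<integral>s2. \<integral>s3. g (x $ 1 - s1) * (g (x $ 2 - s2) * g (x $ 3 - s3)))"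
    proof (intro nn_integral_cong)
      fix s1
      have "(\<lambda>p::real\<times>real. g (x $ 1 - s1) * (g (x $ 2 - fst p) * g (x $ 3 - snd p))) \<in> borel_fun"
        unfolding borel_prod[symmetric] by measurable
      from nn_integral_lborel_pair[OF this]
      show "(\<integral>p. g (x $ 1 - vec_of_triple (s1, p) $ 1) * (g (x $ 2 - vec_of_triple (s1, p) $ 2) * g (x $ 3 - vec_of_triple (s1, p) $ 3)))
        = (\<integral>s2. \<integral>s3. g (x $ 1 - s1) * (g (x $ 2 - s2) * g (x $ 3 - s3)))"
        by (simp add: vec_of_triple_def split_beta vector_3)
    qed
    also have "... = I * (I * I)"
      by (simp add: nn_integral_cmult nn_integral_multc shift)
    also have "... = ennreal (d * (d * d))" using d by (simp add: ennreal_mult)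
    also have "... \<le> ennreal (d * (d * d) + 1)" by (intro ennreal_leI) simp
    finally show ?thesis .
  qed
  moreover have "d * (d * d) + 1 > 0" using d by (simp add: add_nonneg_pos)
  ultimately show ?thesis by blast
qed

text \<open>The first bound is for the singularity, with the order \<open>a\<close> distributed as
  \<open>b\<close> in time and \<open>a - b\<close> in space; the second is the decay of order 1 for
  large scales.\<close>

definition kernel_bound :: "real => real => real => real^3 => ennreal" where
  "kernel_bound a b \<tau> z = min (inv_power b \<tau> * inv_power (a - b) (norm z)) (inv_power 1 (max \<bar>\<tau>\<bar> (norm z)))"

lemma measurable_kernel_bound [measurable]:
  assumes [measurable]: "f \<in> borel_measurable M" "g \<in> borel_measurable M"
  shows "(\<lambda>x. kernel_bound a b (f x) (g x)) \<in> borel_measurable M"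
  unfolding kernel_bound_def by measurable

lemma kernel_bound_minus: "kernel_bound a b t (x - y) = kernel_bound a b t (y - x)"
  by (simp add: kernel_bound_def norm_minus_commute)

text \<open>Dominates \<open>inv_power b\<close> away from \<open>\<tau> = 0\<close>, and is at
  least 1 so that it may multiply the large-scale bound too. The case \<open>b = 0\<close> is
  separate because \<open>0 powr 0\<close> is 0.\<close>

definition sing_weight :: "real => real => real" where
  "sing_weight b \<tau> = (if b = 0 then 2 else 1 + \<bar>\<tau>\<bar> powr (- b))"

lemma sing_weight_ge_1: "sing_weight b t \<ge> 1"
  by (simp add: sing_weight_def)

text \<open>The decay of order 1 in the largest of the time and the cell distances, replaced by a
  product of cube roots so that sums over cells factor into one-dimensional sums.\<close>

fun cell_weight :: "real => int \<times> int \<times> int => int \<times> int \<times> int => real" where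
  "cell_weight T (j1, j2, j3) (l1, l2, l3) = (T + of_int \<bar>j1 - l1\<bar>) powr (- 1 / 3)
     * ((T + of_int \<bar>j2 - l2\<bar>) powr (- 1 / 3) * (T + of_int \<bar>j3 - l3\<bar>) powr (- 1 / 3))"

lemma cell_weight_commute: "cell_weight T j l = cell_weight T l j"
  by (cases j; cases l) (simp add: abs_minus_commute)

lemma cell_weight_pos: "T > 0 ==> cell_weight T j l > 0"
  by (cases j; cases l) (auto simp: add_pos_nonneg add_nonneg_eq_0_iff)

text \<open>For small \<open>t\<close> and neighbouring cells the singular bound is integrated over
  a cube and the weight is bounded below; in all other cases the kernel is bounded on the cell by
  its decay. If \<open>b > 0\<close>, time 0 is excluded: there \<open>inv_power b\<close> is
  infinite while \<open>sing_weight b\<close> is 1.\<close>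

lemma kernel_bound_cell:
  assumes b: "0 \<le> b" "b \<le> a" and s: "s > 0" "(a - b) * s < 3"
  shows "\<exists>C>0. \<forall>t x l. b = 0 \<or> t \<noteq> 0 \<longrightarrow>
    (\<integral>y. epowr (kernel_bound a b t (x - y)) s * indicator {l} (cell y))
      \<le> ennreal ((C * sing_weight b t * cell_weight (1 + \<bar>t\<bar>) (cell x) l) powr s)"
proof -
  obtain D where D: "D > 0" and Dle: "\<And>x::real^3. (\<integral>y. inv_power ((a - b) * s) (norm (x - y)) * indicator {z. \<forall>i. \<bar>z $ i\<bar> \<le> 2} (x - y)) \<le> ennreal D"
    using nn_integral_cube_local[of "(a - b) * s"] b s by auto
  \<comment> \<open>The 4 serves the far case; in the near case 3 compensates the lower bound 1/3
    for the cell weight.\<close>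
  define C where "C = max 4 (3 * D powr (1 / s))"
  have "(\<integral>y. epowr (kernel_bound a b t (x - y)) s * indicator {l} (cell y))
      \<le> ennreal ((C * sing_weight b t * cell_weight (1 + \<bar>t\<bar>) (cell x) l) powr s)"
    if t: "b = 0 \<or> t \<noteq> 0" for t x l
  proof -
    define T where "T = 1 + \<bar>t\<bar>"
    define W where "W = cell_weight T (cell x) l"
    have T: "T \<ge> 1" by (simp add: T_def)
    have W0: "W > 0" unfolding W_def using T by (intro cell_weight_pos) simp
    obtain l1 l2 l3 where l: "l = (l1, l2, l3)" by (cases l) auto
    let ?n1 = "\<lfloor>x $ 1\<rfloor> - l1" and ?n2 = "\<lfloor>x $ 2\<rfloor> - l2" and ?n3 = "\<lfloor>x $ 3\<rfloor> - l3"
    have We: "W = (T + of_int \<bar>?n1\<bar>) powr (- 1 / 3) * ((T + of_int \<bar>?n2\<bar>) powr (- 1 / 3) * (T + of_int \<bar>?n3\<bar>) powr (- 1 / 3))"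
      unfolding W_def cell_def l by simp
    have E1: "sing_weight b t \<ge> 1" by (rule sing_weight_ge_1)
    have cells: "\<bar>x $ 1 - y $ 1\<bar> \<le> of_int \<bar>?n1\<bar> + 1 \<and> \<bar>x $ 2 - y $ 2\<bar> \<le> of_int \<bar>?n2\<bar> + 1 \<and> \<bar>x $ 3 - y $ 3\<bar> \<le> of_int \<bar>?n3\<bar> + 1
      \<and> of_int \<bar>?n1\<bar> - 1 \<le> \<bar>x $ 1 - y $ 1\<bar> \<and> of_int \<bar>?n2\<bar> - 1 \<le> \<bar>x $ 2 - y $ 2\<bar> \<and> of_int \<bar>?n3\<bar> - 1 \<le> \<bar>x $ 3 - y $ 3\<bar>"
      if "cell y = l" for y
    proof -
      have f: "\<bar>u - v\<bar> \<le> of_int \<bar>\<lfloor>u\<rfloor> - \<lfloor>v\<rfloor>\<bar> + 1 \<and> of_int \<bar>\<lfloor>u\<rfloor> - \<lfloor>v\<rfloor>\<bar> - 1 \<le> \<bar>u - v\<bar>" for u v :: real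
        by linarith
      have "l1 = \<lfloor>y $ 1\<rfloor>" "l2 = \<lfloor>y $ 2\<rfloor>" "l3 = \<lfloor>y $ 3\<rfloor>" using that by (auto simp: l cell_def)
      then show ?thesis using f by blast
    qed
    show ?thesis
    proof (cases "\<bar>t\<bar> \<le> 1 \<and> \<bar>?n1\<bar> \<le> 1 \<and> \<bar>?n2\<bar> \<le> 1 \<and> \<bar>?n3\<bar> \<le> 1")
      case True
      obtain \<beta> where \<beta>: "inv_power b t = ennreal \<beta>" "0 \<le> \<beta>" "\<beta> \<le> sing_weight b t"
      proof (cases "b = 0")
        case True
        then show ?thesis using that[of 1] by (simp add: inv_power_def sing_weight_def)
      next
        case False
        then show ?thesis using t that[of "\<bar>t\<bar> powr (- b)"] by (simp add: inv_power_eq sing_weight_def)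
      qed
      \<comment> \<open>Here \<open>T \<le> 2\<close> and each cell distance is at most 1, so every
        base is at most 3.\<close>
      have "W \<ge> 3 powr (- 1 / 3) * (3 powr (- 1 / 3) * 3 powr (- 1 / 3))"
      proof -
        have g3: "(3::real) powr (- 1 / 3) \<le> (T + of_int \<bar>n\<bar>) powr (- 1 / 3)" if "\<bar>n\<bar> \<le> 1" for n :: int
        proof (rule powr_mono2')
          have "real_of_int \<bar>n\<bar> \<le> 1" using that by linarith
          then show "T + real_of_int \<bar>n\<bar> \<le> 3" using True by (simp add: T_def)
        qed (use T in auto)
        show ?thesis unfolding We by (intro mult_mono g3) (use True in auto)
      qed
      also have "(3::real) powr (- 1 / 3) * (3 powr (- 1 / 3) * 3 powr (- 1 / 3)) = 1 / 3"
        by (simp add: powr_add[symmetric] powr_minus_divide)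
      finally have W3: "W \<ge> 1 / 3" .
      have "(\<integral>y. epowr (kernel_bound a b t (x - y)) s * indicator {l} (cell y))
        \<le> (\<integral>y. ennreal (\<beta> powr s) * (inv_power ((a - b) * s) (norm (x - y)) * indicator {z. \<forall>i. \<bar>z $ i\<bar> \<le> 2} (x - y)))"
      proof (intro nn_integral_mono)
        fix y
        show "epowr (kernel_bound a b t (x - y)) s * indicator {l} (cell y)
          \<le> ennreal (\<beta> powr s) * (inv_power ((a - b) * s) (norm (x - y)) * indicator {z. \<forall>i. \<bar>z $ i\<bar> \<le> 2} (x - y))"
        proof (cases "cell y = l")
          case cy: True
          have i: "\<forall>i. \<bar>(x - y) $ i\<bar> \<le> 2"
          proof -
            have "of_int \<bar>?n1\<bar> \<le> (1::real)" "of_int \<bar>?n2\<bar> \<le> (1::real)" "of_int \<bar>?n3\<bar> \<le> (1::real)" using True by linarith+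
            then show ?thesis using cells[OF cy] by (simp add: forall_3)
          qed
          have "epowr (kernel_bound a b t (x - y)) s \<le> epowr (inv_power b t * inv_power (a - b) (norm (x - y))) s"
            using s by (intro ennreal_powr_mono) (auto simp: kernel_bound_def)
          also have "... = ennreal (\<beta> powr s) * inv_power ((a - b) * s) (norm (x - y))"
            using s \<beta> by (simp add: ennreal_powr_mult inv_power_powr)
          finally show ?thesis using i cy by simp
        qed simp
      qed
      also have "... = ennreal (\<beta> powr s) * (\<integral>y. inv_power ((a - b) * s) (norm (x - y)) * indicator {z. \<forall>i. \<bar>z $ i\<bar> \<le> 2} (x - y))"
      proof (rule nn_integral_cmult)
        have [measurable]: "{z :: real^3. \<forall>i. \<bar>z $ i\<bar> \<le> 2} \<in> sets borel"
        proof -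
          have "{z :: real^3. \<forall>i. \<bar>z $ i\<bar> \<le> 2} = cbox (\<chi> i. - 2) (\<chi> i. 2)" by (auto simp: mem_box_cart abs_le_iff minus_le_iff)
          then show ?thesis by simp
        qed
        show "(\<lambda>y. inv_power ((a - b) * s) (norm (x - y)) * indicator {z. \<forall>i. \<bar>z $ i\<bar> \<le> 2} (x - y)) \<in> borel_measurable lborel"
          by measurable
      qed
      also have "... \<le> ennreal (\<beta> powr s) * ennreal D" by (intro mult_left_mono Dle) simp
      also have "... = ennreal ((3 * D powr (1 / s) * \<beta> * (1 / 3)) powr s)"
        using D \<beta> s by (simp add: ennreal_mult'[symmetric] powr_mult powr_powr mult.commute)
      also have "... \<le> ennreal ((C * sing_weight b t * W) powr s)"
        using D \<beta> s W3 by (intro ennreal_leI powr_mono2 mult_mono) (auto simp: C_def)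
      finally show ?thesis by (simp only: W_def T_def)
    next
      case False
      have "(\<integral>y. epowr (kernel_bound a b t (x - y)) s * indicator {l} (cell y))
        \<le> (\<integral>y. ennreal ((4 * W) powr s) * indicator {l} (cell y))"
      proof (intro nn_integral_mono)
        fix y
        show "epowr (kernel_bound a b t (x - y)) s * indicator {l} (cell y) \<le> ennreal ((4 * W) powr s) * indicator {l} (cell y)"
        proof (cases "cell y = l")
          case cy: True
          define M where "M = max \<bar>t\<bar> (norm (x - y))"
          have n: "\<bar>x $ i - y $ i\<bar> \<le> norm (x - y)" for i using component_le_norm_cart[of "x - y" i] by simp
          \<comment> \<open>In the far case \<open>|t| > 1\<close> or some cell distance is at least
            2, and cell distances exceed coordinate distances by at most 1, so
            \<open>M \<ge> 1\<close>; then \<open>T + |n| \<le> 2 + 2 M \<le> 4 M\<close>.\<close>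
          have M1: "M \<ge> 1" and MT: "T + of_int \<bar>?n1\<bar> \<le> 4 * M" "T + of_int \<bar>?n2\<bar> \<le> 4 * M" "T + of_int \<bar>?n3\<bar> \<le> 4 * M"
          proof -
            have c: "\<bar>t\<bar> > 1 \<or> \<bar>?n1\<bar> \<ge> 2 \<or> \<bar>?n2\<bar> \<ge> 2 \<or> \<bar>?n3\<bar> \<ge> 2" using False by linarith
            have k: "of_int \<bar>?n1\<bar> \<le> M + 1" "of_int \<bar>?n2\<bar> \<le> M + 1" "of_int \<bar>?n3\<bar> \<le> M + 1" "\<bar>t\<bar> \<le> M"
              using cells[OF cy] n[of 1] n[of 2] n[of 3] unfolding M_def by linarith+
            show "M \<ge> 1" using c k by linarith
            then show "T + of_int \<bar>?n1\<bar> \<le> 4 * M" "T + of_int \<bar>?n2\<bar> \<le> 4 * M" "T + of_int \<bar>?n3\<bar> \<le> 4 * M"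
              using k unfolding T_def by linarith+
          qed
          have g: "M powr (- 1 / 3) \<le> 4 powr (1 / 3) * (T + of_int n) powr (- 1 / 3)" if "T + of_int n \<le> 4 * M" "n \<ge> 0" for n :: int
          proof -
            have p: "T + of_int n > 0" using T that by (simp add: add_pos_nonneg)
            have "M powr (- 1 / 3) \<le> ((T + of_int n) / 4) powr (- 1 / 3)"
              using that p by (intro powr_mono2') auto
            also have "... = 4 powr (1 / 3) * (T + of_int n) powr (- 1 / 3)"
              using p by (simp add: powr_divide powr_minus_divide)
            finally show ?thesis .
          qed
          have "kernel_bound a b t (x - y) \<le> ennreal (M powr (- 1))"
            using M1 by (auto simp: kernel_bound_def M_def[symmetric] inv_power_eq)
          also have "M powr (- 1) = M powr (- 1 / 3) * (M powr (- 1 / 3) * M powr (- 1 / 3))"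
            by (simp add: powr_add[symmetric])
          also have "... \<le> (4 powr (1 / 3) * (T + of_int \<bar>?n1\<bar>) powr (- 1 / 3))
              * ((4 powr (1 / 3) * (T + of_int \<bar>?n2\<bar>) powr (- 1 / 3)) * (4 powr (1 / 3) * (T + of_int \<bar>?n3\<bar>) powr (- 1 / 3)))"
            by (intro mult_mono g MT) auto
          also have "... = (4 powr (1 / 3) * (4 powr (1 / 3) * 4 powr (1 / 3))) * W"
            unfolding We by (simp only: mult_ac)
          also have "(4::real) powr (1 / 3) * (4 powr (1 / 3) * 4 powr (1 / 3)) = 4"
            by (simp add: powr_add[symmetric])
          finally have "kernel_bound a b t (x - y) \<le> ennreal (4 * W)" by (simp add: ennreal_leI)
          then have "epowr (kernel_bound a b t (x - y)) s \<le> epowr (ennreal (4 * W)) s"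
            using s by (intro ennreal_powr_mono) auto
          also have "... = ennreal ((4 * W) powr s)" using W0 by simp
          finally show ?thesis using cy by simp
        qed simp
      qed
      also have "... = ennreal ((4 * W) powr s) * (\<integral>y. indicator {l} (cell y))"
        by (rule nn_integral_cmult) (use measurable_compose[OF measurable_cell, of "indicator {l}" borel] in simp)
      also have "... \<le> ennreal ((4 * W) powr s) * 1" by (intro mult_left_mono emeasure_cell_le) simp
      also have "... \<le> ennreal ((C * sing_weight b t * W) powr s)"
      proof -
        have "4 * 1 \<le> C * sing_weight b t" using E1 by (intro mult_mono) (auto simp: C_def)
        then show ?thesis using W0 s by (simp, intro ennreal_leI powr_mono2) (auto intro: mult_right_mono)
      qed
      finally show ?thesis by (simp only: W_def T_def)
    qed
  qed
  moreover have "C > 0" by (simp add: C_def)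
  ultimately show ?thesis by blast
qed

text \<open>The power \<open>3 * e\<close> turns every cube root into the exponent \<open>e\<close>,
  and the sum becomes a product of three sums over the integers, each of order
  \<open>T powr (1 - e)\<close>.\<close>

lemma nn_integral_cell_weight:
  assumes e: "e > 1" and T: "T \<ge> 1"
  shows "(\<Sum>\<^sub>+l. ennreal (cell_weight T j l powr (3 * e)))
    \<le> ennreal ((2 powr e * (2 / (e - 1))) ^ 3 * T powr (3 - 3 * e))"
proof -
  obtain j1 j2 j3 where j: "j = (j1, j2, j3)" by (cases j) auto
  define I where "I = ennreal (2 powr e * (2 / (e - 1)) * T powr (1 - e))"
  define g where "g n = ennreal ((T + real_of_int \<bar>n\<bar>) powr (- e))" for n :: int
  have shift: "(\<Sum>\<^sub>+l. g (i - l)) \<le> I" for i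
  proof -
    have "(\<Sum>\<^sub>+l. g (i - l)) = (\<Sum>\<^sub>+n. g n)"
      by (rule nn_integral_bij_count_space) (rule bij_betwI[of _ _ _ "\<lambda>n. i - n"], auto)
    also have "... \<le> I" unfolding g_def I_def by (rule nn_integral_int_powr_bound[OF e T])
    finally show ?thesis .
  qed
  have sc: "sigma_finite_measure (count_space (UNIV :: int set))" "sigma_finite_measure (count_space (UNIV :: (int \<times> int) set))"
    by (rule sigma_finite_measure_count_space_countable, simp)+
  have w: "ennreal (cell_weight T j (l1, l2, l3) powr (3 * e)) = g (j1 - l1) * (g (j2 - l2) * g (j3 - l3))" for l1 l2 l3
    using T by (simp add: j g_def powr_mult powr_powr ennreal_mult'[symmetric])
  have "(\<Sum>\<^sub>+l. ennreal (cell_weight T j l powr (3 * e)))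
    = (\<integral>\<^sup>+l. ennreal (cell_weight T j l powr (3 * e)) \<partial>(count_space UNIV \<Otimes>\<^sub>M count_space UNIV))"
    by (simp add: pair_measure_countable)
  also have "... = (\<Sum>\<^sub>+l1. \<Sum>\<^sub>+p. ennreal (cell_weight T j (l1, p) powr (3 * e)))"
    by (rule sigma_finite_measure.nn_integral_fst[symmetric, OF sc(2)]) (simp add: pair_measure_countable)
  also have "... = (\<Sum>\<^sub>+l1. \<integral>\<^sup>+p. ennreal (cell_weight T j (l1, p) powr (3 * e)) \<partial>(count_space UNIV \<Otimes>\<^sub>M count_space UNIV))"
    by (simp add: pair_measure_countable)
  also have "... = (\<Sum>\<^sub>+l1. \<Sum>\<^sub>+l2. \<Sum>\<^sub>+l3. ennreal (cell_weight T j (l1, l2, l3) powr (3 * e)))"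
    by (intro nn_integral_cong sigma_finite_measure.nn_integral_fst[symmetric, OF sc(1)]) (simp add: pair_measure_countable)
  also have "... = (\<Sum>\<^sub>+l1. g (j1 - l1)) * ((\<Sum>\<^sub>+l2. g (j2 - l2)) * (\<Sum>\<^sub>+l3. g (j3 - l3)))"
    unfolding w by (simp add: nn_integral_cmult nn_integral_multc)
  also have "... \<le> I * (I * I)" by (intro mult_mono shift) auto
  also have "... = ennreal ((2 powr e * (2 / (e - 1)) * T powr (1 - e)) * ((2 powr e * (2 / (e - 1)) * T powr (1 - e)) * (2 powr e * (2 / (e - 1)) * T powr (1 - e))))"
    unfolding I_def using e by (simp add: ennreal_mult'[symmetric])
  also have "(2 powr e * (2 / (e - 1)) * T powr (1 - e)) * ((2 powr e * (2 / (e - 1)) * T powr (1 - e)) * (2 powr e * (2 / (e - 1)) * T powr (1 - e)))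
     = (2 powr e * (2 / (e - 1))) ^ 3 * (T powr (1 - e) * (T powr (1 - e) * T powr (1 - e)))"
    by (simp only: power3_eq_cube mult_ac)
  also have "T powr (1 - e) * (T powr (1 - e) * T powr (1 - e)) = T powr (3 - 3 * e)"
    by (simp add: powr_add[symmetric])
  finally show ?thesis .
qed

text \<open>Bound for the spatial bilinear form at time lag \<tau>. The products
  \<open>c (cell x) * w x\<close> run through the unit ball of the dual amalgam: \<open>w\<close>
  normalized on each cube, \<open>c\<close> normalized over the cubes. The excluded lag is a null
  set.\<close>

definition kernel_form_le :: "real => real => real => real => (real => ennreal) => bool" where
  "kernel_form_le a b r rt K \<longleftrightarrow> (\<forall>\<tau> c d w v. b = 0 \<or> \<tau> \<noteq> 0 \<longrightarrow>
    (\<Sum>\<^sub>+j. epowr (c j) (r / (r - 1))) \<le> 1 \<longrightarrow>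
    (\<Sum>\<^sub>+j. epowr (d j) (r / (r - 1))) \<le> 1 \<longrightarrow>
    w \<in> borel_fun \<longrightarrow> v \<in> borel_fun \<longrightarrow>
    (\<forall>j. (\<integral>x. epowr (w x) (rt / (rt - 1)) * indicator {j} (cell x)) \<le> 1) \<longrightarrow>
    (\<forall>j. (\<integral>x. epowr (v x) (rt / (rt - 1)) * indicator {j} (cell x)) \<le> 1) \<longrightarrow>
    (\<integral>x. \<integral>y. (c (cell x) * w x) * (d (cell y) * v y) * kernel_bound a b \<tau> (x - y)) \<le> K \<tau>)"

text \<open>Locally the \<open>rt/2\<close>-th power of the kernel is integrable because
  \<open>(a - b) * (rt / 2) < 3\<close>. Globally \<open>r/2 = 3 * (r/6)\<close> with
  \<open>r/6 > 1\<close>, so the sum over cubes is of order \<open>T powr (3 - r/2)\<close>, and its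
  \<open>2/r\<close>-th power gives \<open>6/r - 1\<close>.\<close>

lemma kernel_form_bound:
  fixes a b r rt :: real
  assumes b: "0 \<le> b" "b \<le> a" and r: "r > 6" "rt \<ge> r" and ab: "(a - b) * (rt / 2) < 3"
  shows "\<exists>C>0. kernel_form_le a b r rt (\<lambda>t. ennreal (C * sing_weight b t * (1 + \<bar>t\<bar>) powr (6 / r - 1)))"
proof -
  have "rt / 2 > 0" using r by simp
  from kernel_bound_cell[OF b this ab]
  obtain C where C: "C > 0" and cellb: "\<And>t x l. b = 0 \<or> t \<noteq> 0 ==>
    (\<integral>y. epowr (kernel_bound a b t (x - y)) (rt / 2) * indicator {l} (cell y))
      \<le> ennreal ((C * sing_weight b t * cell_weight (1 + \<bar>t\<bar>) (cell x) l) powr (rt / 2))"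
    by blast
  define A where "A = (2 powr (r / 6) * (2 / (r / 6 - 1))) ^ 3"
  have A: "A > 0" unfolding A_def using r by (intro zero_less_power mult_pos_pos divide_pos_pos) auto
  define C' where "C' = C * A powr (2 / r)"
  have C': "C' > 0" using C A by (simp add: C'_def)
  have "(\<integral>x. \<integral>y. (c (cell x) * w x) * (d (cell y) * v y) * kernel_bound a b t (x - y))
      \<le> ennreal (C' * sing_weight b t * (1 + \<bar>t\<bar>) powr (6 / r - 1))"
    if t: "b = 0 \<or> t \<noteq> 0"
      and c: "(\<Sum>\<^sub>+j. epowr (c j) (r / (r - 1))) \<le> 1"
      and d: "(\<Sum>\<^sub>+j. epowr (d j) (r / (r - 1))) \<le> 1"
      and [measurable]: "w \<in> borel_fun" "v \<in> borel_fun"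
      and w: "\<forall>j. (\<integral>x. epowr (w x) (rt / (rt - 1)) * indicator {j} (cell x)) \<le> 1"
      and v: "\<forall>j. (\<integral>x. epowr (v x) (rt / (rt - 1)) * indicator {j} (cell x)) \<le> 1"
    for t c d w v
  proof (rule amalgam_young[where \<kappa> = "\<lambda>j l. C * sing_weight b t * cell_weight (1 + \<bar>t\<bar>) j l" and q = r and qs = rt])
    define E where "E = sing_weight b t"
    define T where "T = 1 + \<bar>t\<bar>"
    have E: "E \<ge> 1" unfolding E_def by (rule sing_weight_ge_1)
    have T: "T \<ge> 1" by (simp add: T_def)
    show "1 < r / (r - 1)" "r / (r - 1) \<le> 2" "r = r / (r - 1) / (r / (r - 1) - 1)"
      "1 < rt / (rt - 1)" "rt / (rt - 1) \<le> 2" "rt = rt / (rt - 1) / (rt / (rt - 1) - 1)"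
      using r by (auto simp: field_simps)
    show "C' * sing_weight b t * (1 + \<bar>t\<bar>) powr (6 / r - 1) > 0"
      using C' E T by (intro mult_pos_pos) (auto simp: E_def[symmetric] T_def[symmetric])
    show "C * sing_weight b t * cell_weight (1 + \<bar>t\<bar>) j l > 0" for j l
      using C E T by (intro mult_pos_pos cell_weight_pos) (auto simp: E_def[symmetric])
    show "(\<lambda>(x, y). kernel_bound a b t (x - y)) \<in> borel_measurable (lborel \<Otimes>\<^sub>M lborel)" by measurable
    show "(\<integral>y. epowr (kernel_bound a b t (x - y)) (rt / 2) * indicator {l} (cell y))
      \<le> ennreal ((C * sing_weight b t * cell_weight (1 + \<bar>t\<bar>) (cell x) l) powr (rt / 2))" for x l
      by (rule cellb[OF t])
    show "(\<integral>x. epowr (kernel_bound a b t (x - y)) (rt / 2) * indicator {j} (cell x))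
      \<le> ennreal ((C * sing_weight b t * cell_weight (1 + \<bar>t\<bar>) j (cell y)) powr (rt / 2))" for y j
      using cellb[OF t, of y j] by (simp add: kernel_bound_minus[of _ _ _ _ y] cell_weight_commute[of _ j])
    have glob: "(\<Sum>\<^sub>+l. ennreal ((C * E * cell_weight T j l) powr (r / 2)))
      \<le> ennreal ((C' * E * T powr (6 / r - 1)) powr (r / 2))" for j
    proof -
      have "(\<Sum>\<^sub>+l. ennreal ((C * E * cell_weight T j l) powr (r / 2)))
        = (\<Sum>\<^sub>+l. ennreal ((C * E) powr (r / 2)) * ennreal (cell_weight T j l powr (3 * (r / 6))))"
        using C E T cell_weight_pos[of T j] by (intro nn_integral_cong) (simp add: powr_mult less_imp_le ennreal_mult'[symmetric])
      also have "... = ennreal ((C * E) powr (r / 2)) * (\<Sum>\<^sub>+l. ennreal (cell_weight T j l powr (3 * (r / 6))))"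
        by (rule nn_integral_cmult) simp
      also have "... \<le> ennreal ((C * E) powr (r / 2)) * ennreal (A * T powr (3 - 3 * (r / 6)))"
        unfolding A_def using r T by (intro mult_left_mono nn_integral_cell_weight) auto
      also have "... = ennreal ((C * E) powr (r / 2) * (A * T powr (3 - r / 2)))"
        by (simp add: ennreal_mult'[symmetric])
      also have "(C * E) powr (r / 2) * (A * T powr (3 - r / 2)) = (C' * E * T powr (6 / r - 1)) powr (r / 2)"
      proof -
        have "(C' * E * T powr (6 / r - 1)) powr (r / 2) = (C * E) powr (r / 2) * ((A powr (2 / r)) powr (r / 2) * (T powr (6 / r - 1)) powr (r / 2))"
          using C A E T by (simp add: C'_def powr_mult mult_ac)
        also have "(A powr (2 / r)) powr (r / 2) = A" using A r by (simp add: powr_powr)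
        also have "(T powr (6 / r - 1)) powr (r / 2) = T powr (3 - r / 2)"
        proof -
          have "(6 / r - 1) * (r / 2) = 3 - r / 2" using r by (simp add: field_simps)
          then show ?thesis by (simp only: powr_powr)
        qed
        finally show ?thesis by simp
      qed
      finally show ?thesis .
    qed
    show "(\<Sum>\<^sub>+l. ennreal ((C * sing_weight b t * cell_weight (1 + \<bar>t\<bar>) j l) powr (r / 2)))
      \<le> ennreal ((C' * sing_weight b t * (1 + \<bar>t\<bar>) powr (6 / r - 1)) powr (r / 2))" for j
      using glob by (simp only: E_def T_def)
    show "(\<Sum>\<^sub>+j. ennreal ((C * sing_weight b t * cell_weight (1 + \<bar>t\<bar>) j l) powr (r / 2)))
      \<le> ennreal ((C' * sing_weight b t * (1 + \<bar>t\<bar>) powr (6 / r - 1)) powr (r / 2))" for l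
      using glob[of l] by (simp only: E_def T_def cell_weight_commute[of _ _ l])
  qed (use c d w v in auto)
  then show ?thesis using C' unfolding kernel_form_le_def by blast
qed

section \<open>Truncated Dirac waves\<close>

lemma inv_power_antimono: "\<bar>x\<bar> \<le> \<bar>y\<bar> ==> c \<ge> 0 ==> inv_power c y \<le> inv_power c x"
  by (auto simp: inv_power_def intro!: ennreal_leI powr_mono2')

lemma inv_power_add: "0 \<le> c ==> 0 \<le> d ==> inv_power c x * inv_power d x = inv_power (c + d) x"
  by (auto simp: inv_power_def ennreal_mult'[symmetric] powr_add[symmetric] ennreal_mult_eq_top_iff add_nonneg_eq_0_iff
        simp del: powr_minus)

text \<open>Both pointwise bounds with \<open>s = 1 - a\<close>, the space bound if
  \<open>|z|\<close> is the larger variable and the time bound otherwise. The condition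
  \<open>s < 2 * \<sigma> - 2\<close> is \<open>3 - 2 * \<sigma> < a\<close>.\<close>

lemma kg_kernel_le_inv_power:
  assumes \<sigma>: "\<sigma> > 1" and a: "0 < a" "a \<le> 1" "3 - 2 * \<sigma> < a"
  shows "\<exists>C>0. \<forall>R\<ge>0. \<forall>t z. ennreal (norm (kg_kernel R \<sigma> t z)) \<le> ennreal C * inv_power a (max \<bar>t\<bar> (norm z))"
proof -
  define c where "c = 2 powr ((2 * \<sigma> - 1 - (1 - a)) / 2) / (2 * \<sigma> - 1 - (1 - a) - 1)"
  have c: "c > 0" unfolding c_def using a by (intro divide_pos_pos) auto
  define C where "C = max (4 * pi * c) (2 * pi * (4 + 8 * \<sigma> * c))"
  have C: "C > 0" using c by (simp add: C_def less_max_iff_disj)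
  have "ennreal (norm (kg_kernel R \<sigma> t z)) \<le> ennreal C * inv_power a (max \<bar>t\<bar> (norm z))" if R: "R \<ge> 0" for R t z
  proof (cases "t = 0 \<and> z = 0")
    case True
    then show ?thesis using a C by (simp add: inv_power_def ennreal_mult_top)
  next
    case False
    define M where "M = max \<bar>t\<bar> (norm z)"
    have M: "M > 0" using False by (auto simp: M_def less_max_iff_disj)
    have "norm (kg_kernel R \<sigma> t z) \<le> C * M powr (- a)"
    proof (cases "\<bar>t\<bar> \<le> norm z")
      case True
      then have "norm (kg_kernel R \<sigma> t z) \<le> 4 * pi * norm z powr (1 - a - 1) * c"
        unfolding c_def using False \<sigma> a R by (intro kg_kernel_space_bound) auto
      also have "... = (4 * pi * c) * M powr (- a)" using True by (simp add: M_def)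
      also have "... \<le> C * M powr (- a)" by (intro mult_right_mono) (auto simp: C_def)
      finally show ?thesis .
    next
      case le: False
      then have "t \<noteq> 0" using norm_ge_zero[of z] by (auto simp del: norm_ge_zero)
      then have "norm (kg_kernel R \<sigma> t z) \<le> 2 * pi * \<bar>t\<bar> powr (1 - a - 1) * (4 + 8 * \<sigma> * c)"
        unfolding c_def using \<sigma> a R by (intro kg_kernel_time_bound) auto
      also have "... = (2 * pi * (4 + 8 * \<sigma> * c)) * M powr (- a)" using le by (simp add: M_def)
      also have "... \<le> C * M powr (- a)" by (intro mult_right_mono) (auto simp: C_def)
      finally show ?thesis .
    qed
    then show ?thesis unfolding M_def[symmetric] using M C
      by (simp add: inv_power_eq ennreal_mult'[symmetric] ennreal_leI)
  qed
  then show ?thesis using C by blast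
qed

text \<open>The previous bound is used for \<open>a\<close> and for the exponent 1, which is
  admissible because \<sigma> > 1. The maximum dominates both variables, so its power
  \<open>a\<close> splits into powers \<open>b\<close> and \<open>a - b\<close> of the two.\<close>

lemma kg_kernel_le_kernel_bound:
  assumes \<sigma>: "\<sigma> > 1" and a: "0 < a" "a \<le> 1" "3 - 2 * \<sigma> < a" and b: "0 \<le> b" "b \<le> a"
  shows "\<exists>C>0. \<forall>R\<ge>0. \<forall>t z. ennreal (norm (kg_kernel R \<sigma> t z)) \<le> ennreal C * kernel_bound a b t z"
proof -
  obtain C where C: "C > 0" "\<And>R t z. R \<ge> 0 ==> ennreal (norm (kg_kernel R \<sigma> t z)) \<le> ennreal C * inv_power a (max \<bar>t\<bar> (norm z))"
    using kg_kernel_le_inv_power[OF \<sigma> a] by blast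
  obtain D where D: "D > 0" "\<And>R t z. R \<ge> 0 ==> ennreal (norm (kg_kernel R \<sigma> t z)) \<le> ennreal D * inv_power 1 (max \<bar>t\<bar> (norm z))"
    using kg_kernel_le_inv_power[OF \<sigma>, of 1] \<sigma> by auto
  have "ennreal (norm (kg_kernel R \<sigma> t z)) \<le> ennreal (max C D) * kernel_bound a b t z" if R: "R \<ge> 0" for R t z
  proof -
    have "ennreal (norm (kg_kernel R \<sigma> t z)) \<le> ennreal (max C D) * (inv_power b t * inv_power (a - b) (norm z))"
    proof -
      have "inv_power a (max \<bar>t\<bar> (norm z)) = inv_power b (max \<bar>t\<bar> (norm z)) * inv_power (a - b) (max \<bar>t\<bar> (norm z))"
        using b by (simp add: inv_power_add)
      also have "... \<le> inv_power b t * inv_power (a - b) (norm z)"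
        using b by (intro mult_mono inv_power_antimono) auto
      finally show ?thesis
        using C(2)[OF R, of t z] by (elim order_trans) (intro mult_mono, auto intro: ennreal_leI)
    qed
    moreover have "ennreal (norm (kg_kernel R \<sigma> t z)) \<le> ennreal (max C D) * inv_power 1 (max \<bar>t\<bar> (norm z))"
      using D(2)[OF R, of t z] by (elim order_trans) (intro mult_mono, auto intro: ennreal_leI)
    ultimately show ?thesis unfolding kernel_bound_def by (simp add: min_def)
  qed
  then show ?thesis using C by (intro exI[of _ "max C D"]) auto
qed

text \<open>The dual form of the \<open>T T\<^sup>*\<close> argument: testing \<open>\<bar>T F\<bar>\<close> against \<open>h\<close> amounts to pairing
  \<open>F\<close> with \<open>T\<^sup>* H\<close>, where \<open>H\<close> is \<open>h\<close> times the conjugate phase of \<open>T F\<close>.\<close>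

lemma dual_quadratic_form_le:
  fixes e :: "'a => 'b => complex" and F :: "'b => complex" and h :: "'a => real" and m \<omega> :: "'b => real"
  assumes M: "sigma_finite_measure M" and N: "sigma_finite_measure N"
    and e_meas [measurable]: "(\<lambda>(p, \<xi>). e p \<xi>) \<in> borel_measurable (M \<Otimes>\<^sub>M N)"
    and e: "\<And>p \<xi>. norm (e p \<xi>) \<le> 1"
    and h: "integrable M h" "\<And>p. h p \<ge> 0" and F: "integrable N F" and m: "integrable N m" and m0: "\<And>\<xi>. m \<xi> \<ge> 0"
    and \<omega> [measurable]: "\<omega> \<in> borel_measurable N" and \<omega>0: "\<And>\<xi>. \<omega> \<xi> > 0"
    and F0: "\<And>\<xi>. F \<xi> \<noteq> 0 ==> m \<xi> * (\<omega> \<xi>)\<^sup>2 = 1"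
    and k [measurable]: "(\<lambda>(p, p'). k p p') \<in> borel_measurable (M \<Otimes>\<^sub>M M)"
    and \<kappa>: "\<And>p p'. ennreal (norm (LINT \<xi>|N. of_real (m \<xi>) * (e p \<xi> * cnj (e p' \<xi>)))) \<le> k p p'"
  shows "(\<integral>\<^sup>+p. ennreal (norm (LINT \<xi>|N. e p \<xi> * F \<xi>)) * ennreal (h p) \<partial>M)\<^sup>2
    \<le> (\<integral>\<^sup>+\<xi>. ennreal ((\<omega> \<xi> * norm (F \<xi>))\<^sup>2) \<partial>N) * (\<integral>\<^sup>+p. \<integral>\<^sup>+p'. ennreal (h p) * ennreal (h p') * k p p' \<partial>M \<partial>M)"
proof -
  interpret M: sigma_finite_measure M by fact
  interpret N: sigma_finite_measure N by fact
  interpret P: pair_sigma_finite M N ..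
  have hm [measurable]: "h \<in> borel_measurable M" and Fm [measurable]: "F \<in> borel_measurable N"
    and mm [measurable]: "m \<in> borel_measurable N" using h F m by auto
  define v where "v p = (LINT \<xi>|N. e p \<xi> * F \<xi>)" for p
  have [measurable]: "v \<in> borel_measurable M" unfolding v_def by measurable
  define H where "H p = of_real (h p) * cnj (sgn (v p))" for p
  have [measurable]: "H \<in> borel_measurable M"
    unfolding H_def sgn_div_norm by measurable
  have normH: "norm (H p) \<le> h p" for p
    using h(2)[of p] by (simp add: H_def norm_mult norm_sgn)
  have H: "integrable M H"
    by (rule Bochner_Integration.integrable_bound[OF h(1)]) (use normH h(2) in auto)
  have vH: "v p * H p = of_real (norm (v p) * h p)" for p
  proof -
    have "v p * cnj (sgn (v p)) = of_real (norm (v p))"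
    proof (cases "v p = 0")
      case False
      then show ?thesis
        by (simp add: sgn_div_norm scaleR_conv_of_real complex_norm_square[symmetric] power2_eq_square
              complex_cnj_mult mult.left_commute[of _ "inverse _"] field_simps)
    qed simp
    then show ?thesis by (simp add: H_def mult_ac)
  qed
  define G where "G \<xi> = (LINT p|M. e p \<xi> * H p)" for \<xi>
  have [measurable]: "G \<in> borel_measurable N" unfolding G_def by measurable
  have int2: "integrable (M \<Otimes>\<^sub>M N) (\<lambda>(p, \<xi>). H p * (e p \<xi> * F \<xi>))"
    by (rule Bochner_Integration.integrable_bound[OF integrable_pair_mult[OF M N H F]])
       (auto simp: norm_mult mult_le_cancel_left intro!: AE_I2 mult_left_mono mult_left_le_one_le e)
  have intF: "integrable N (\<lambda>\<xi>. e p \<xi> * F \<xi>)" if p: "p \<in> space M" for p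
  proof -
    have [measurable]: "e p \<in> borel_measurable N"
      using measurable_compose[OF measurable_Pair1'[OF p] e_meas] by simp
    show ?thesis
    by (rule Bochner_Integration.integrable_bound[OF F]) (auto simp: norm_mult intro!: AE_I2 mult_left_le_one_le e)
  qed
  have eq: "(LINT p|M. v p * H p) = (LINT \<xi>|N. F \<xi> * G \<xi>)"
  proof -
    have "(LINT p|M. v p * H p) = (LINT p|M. LINT \<xi>|N. H p * (e p \<xi> * F \<xi>))"
      unfolding v_def by (simp add: mult.commute)
    also have "... = (LINT \<xi>|N. LINT p|M. H p * (e p \<xi> * F \<xi>))"
      using P.Fubini_integral[of "\<lambda>p \<xi>. H p * (e p \<xi> * F \<xi>)"] int2 by simp
    also have "... = (LINT \<xi>|N. F \<xi> * G \<xi>)"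
      unfolding G_def by (simp add: mult_ac flip: integral_mult_right_zero)
    finally show ?thesis .
  qed
  have ivH: "integrable M (\<lambda>p. norm (v p) * h p)"
  proof (rule Bochner_Integration.integrable_bound[OF integrable_mult_right[OF h(1), of "LINT \<xi>|N. norm (F \<xi>)"]])
    have "norm (v p) \<le> (LINT \<xi>|N. norm (F \<xi>))" if "p \<in> space M" for p
      unfolding v_def
      by (rule order_trans[OF integral_norm_bound integral_mono])
         (use integrable_norm[OF intF[OF that]] F in \<open>auto simp: norm_mult intro!: mult_left_le_one_le e\<close>)
    then show "AE p in M. norm (norm (v p) * h p) \<le> norm ((LINT \<xi>|N. norm (F \<xi>)) * h p)"
      using h(2) by (auto simp: abs_mult intro!: AE_I2 mult_right_mono order_trans[OF _ abs_ge_self])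
  qed measurable
  have "(\<integral>\<^sup>+p. ennreal (norm (v p)) * ennreal (h p) \<partial>M) = (\<integral>\<^sup>+p. ennreal (norm (v p) * h p) \<partial>M)"
    by (simp add: ennreal_mult h(2))
  also have "... = ennreal (LINT p|M. norm (v p) * h p)"
    by (intro nn_integral_eq_integral ivH AE_I2) (simp add: h(2))
  also have "(LINT p|M. norm (v p) * h p) = norm (LINT p|M. v p * H p)"
    unfolding vH integral_complex_of_real norm_of_real using h(2) by (simp add: integral_nonneg_AE)
  also have "ennreal ... \<le> (\<integral>\<^sup>+\<xi>. ennreal (norm (F \<xi> * G \<xi>)) \<partial>N)"
    unfolding eq by (rule norm_integral_le_nn_integral)
  \<comment> \<open>Where \<open>F\<close> does not vanish, \<open>F0\<close> says that the square
    root of \<open>m\<close> times \<omega> is 1. Inserting this factor distributes the weights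
    before Cauchy-Schwarz: \<omega> goes to \<open>F\<close> and the root of \<open>m\<close> to
    \<open>G\<close>.\<close>
  also have "... = (\<integral>\<^sup>+\<xi>. ennreal (\<omega> \<xi> * norm (F \<xi>)) * ennreal (sqrt (m \<xi>) * norm (G \<xi>)) \<partial>N)"
  proof (intro nn_integral_cong)
    fix \<xi>
    show "ennreal (norm (F \<xi> * G \<xi>)) = ennreal (\<omega> \<xi> * norm (F \<xi>)) * ennreal (sqrt (m \<xi>) * norm (G \<xi>))"
    proof (cases "F \<xi> = 0")
      case False
      have "sqrt (m \<xi>) * \<omega> \<xi> = sqrt (m \<xi> * (\<omega> \<xi>)\<^sup>2)"
        using \<omega>0[of \<xi>] by (simp add: real_sqrt_mult)
      also have "... = 1" using F0[OF False] by simp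
      finally have 1: "sqrt (m \<xi>) * \<omega> \<xi> = 1" .
      have "(\<omega> \<xi> * norm (F \<xi>)) * (sqrt (m \<xi>) * norm (G \<xi>)) = (sqrt (m \<xi>) * \<omega> \<xi>) * (norm (F \<xi>) * norm (G \<xi>))"
        by (simp only: mult_ac)
      then show ?thesis using \<omega>0[of \<xi>] m0[of \<xi>] unfolding 1
        by (simp add: norm_mult ennreal_mult'[symmetric])
    qed simp
  qed
  finally have "(\<integral>\<^sup>+p. ennreal (norm (v p)) * ennreal (h p) \<partial>M)\<^sup>2
    \<le> (\<integral>\<^sup>+\<xi>. ennreal (\<omega> \<xi> * norm (F \<xi>)) * ennreal (sqrt (m \<xi>) * norm (G \<xi>)) \<partial>N)\<^sup>2"
    by (intro power_mono) auto
  also have "... \<le> (\<integral>\<^sup>+\<xi>. (ennreal (\<omega> \<xi> * norm (F \<xi>)))\<^sup>2 \<partial>N) * (\<integral>\<^sup>+\<xi>. (ennreal (sqrt (m \<xi>) * norm (G \<xi>)))\<^sup>2 \<partial>N)"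
    by (rule Cauchy_Schwarz_nn_integral) measurable
  also have "(\<integral>\<^sup>+\<xi>. (ennreal (\<omega> \<xi> * norm (F \<xi>)))\<^sup>2 \<partial>N) = (\<integral>\<^sup>+\<xi>. ennreal ((\<omega> \<xi> * norm (F \<xi>))\<^sup>2) \<partial>N)"
    by (intro nn_integral_cong) (simp add: ennreal_power less_imp_le[OF \<omega>0])
  also have "(\<integral>\<^sup>+\<xi>. (ennreal (sqrt (m \<xi>) * norm (G \<xi>)))\<^sup>2 \<partial>N) = (\<integral>\<^sup>+\<xi>. ennreal (m \<xi> * (cmod (G \<xi>))\<^sup>2) \<partial>N)"
    by (intro nn_integral_cong) (simp add: ennreal_power m0 power_mult_distrib)
  also have "... \<le> (\<integral>\<^sup>+p. \<integral>\<^sup>+p'. ennreal (norm (H p)) * ennreal (norm (H p')) * k p p' \<partial>M \<partial>M)"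
    unfolding G_def by (rule quadratic_form_kernel_le[OF M N e_meas e H m m0 k \<kappa>])
  also have "... \<le> (\<integral>\<^sup>+p. \<integral>\<^sup>+p'. ennreal (h p) * ennreal (h p') * k p p' \<partial>M \<partial>M)"
    by (intro nn_integral_mono mult_right_mono mult_mono ennreal_leI normH) auto
  finally show ?thesis unfolding v_def by (simp add: mult_left_mono)
qed

lemma kernel_bound_abs: "\<bar>d\<bar> = 1 ==> kernel_bound a b (d * t) z = kernel_bound a b t z"
  using abs_eq_iff[of d 1] by (auto simp: kernel_bound_def)

lemma borel_measurable_fst_snd:
  fixes f :: "'a => 'b::second_countable_topology \<times> 'c::second_countable_topology"
  assumes "f \<in> borel_measurable M"
  shows "(\<lambda>x. fst (f x)) \<in> borel_measurable M" "(\<lambda>x. snd (f x)) \<in> borel_measurable M"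
  by (rule borel_measurable_continuous_on[OF _ assms], intro continuous_intros)+

lemma sets_lborel_pair:
  "sets (lborel \<Otimes>\<^sub>M lborel) = sets (borel :: ('a::euclidean_space \<times> 'b::euclidean_space) measure)"
  unfolding borel_prod[symmetric] by (intro sets_pair_measure_cong) simp_all

text \<open>The dual estimate over space-time and frequency, with \<open>m\<close> the cut off power
  \<open>- 2 * \<sigma>\<close> of the bracket and \<omega> its power \<sigma>. The kernel is
  \<open>kg_kernel\<close> at the differences of times and points, and the sign \<open>d\<close> of
  the phase is invisible to its bound.\<close>

lemma truncated_wave_dual:
  fixes F :: "real^3 => complex" and h :: "real \<times> (real^3) => real"
  assumes \<sigma>: "\<sigma> > 1" and d: "\<bar>d\<bar> = 1" and R: "R \<ge> 0"
    and C: "\<And>t z. ennreal (norm (kg_kernel R \<sigma> t z)) \<le> ennreal C * kernel_bound a b t z"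
    and [measurable]: "F \<in> borel_fun" and fin: "(\<integral>y. ennreal ((bracket y powr \<sigma> * norm (F y))\<^sup>2)) < top"
    and h: "integrable lborel h" "\<And>p. h p \<ge> 0"
  shows "(\<integral>p. ennreal (norm (LINT y|lborel. indicator (cball 0 R) y *\<^sub>R (cis (snd p \<bullet> y + d * fst p * bracket y) * F y))) * ennreal (h p))\<^sup>2
    \<le> (\<integral>y. ennreal ((bracket y powr \<sigma> * norm (F y))\<^sup>2))
      * (\<integral>p. \<integral>p'. ennreal (h p) * ennreal (h p') * (ennreal C * kernel_bound a b (fst p - fst p') (snd p - snd p')))"
proof -
  define e where "e p y = cis (snd p \<bullet> y + d * fst p * bracket y)" for p :: "real \<times> (real^3)" and y :: "real^3"
  define F' where "F' y = indicator (cball 0 R) y *\<^sub>R F y" for y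
  define m where "m y = indicator (cball 0 R) y * bracket y powr (- 2 * \<sigma>)" for y :: "real^3"
  have b1: "bracket y powr \<sigma> \<ge> 1" for y :: "real^3" using bracket_ge_1[of y] \<sigma> by (intro ge_one_powr_ge_zero) auto
  have [measurable]: "F' \<in> borel_fun" unfolding F'_def by measurable
  have F': "integrable lborel F'"
  proof (rule Bochner_Integration.integrable_bound[where f = "\<lambda>y. indicator (cball 0 R) y * 1 + (bracket y powr \<sigma> * norm (F y))\<^sup>2"])
    show "integrable lborel (\<lambda>y::real^3. indicator (cball 0 R) y * 1 + (bracket y powr \<sigma> * norm (F y))\<^sup>2)"
    proof (intro Bochner_Integration.integrable_add)
      show "integrable lborel (\<lambda>y::real^3. indicator (cball 0 R) y * 1 :: real)"
        using emeasure_bounded_finite[of "cball 0 R :: (real^3) set"] by (simp add: integrable_indicator_iff)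
      show "integrable lborel (\<lambda>y. (bracket y powr \<sigma> * norm (F y))\<^sup>2)"
        using fin by (intro integrableI_nonneg) auto
    qed
    have "norm (F' y) \<le> indicator (cball 0 R) y * 1 + (bracket y powr \<sigma> * norm (F y))\<^sup>2" for y
    proof (cases "y \<in> cball 0 R")
      case True
      have "norm (F y) \<le> 1 + (norm (F y))\<^sup>2"
        using zero_le_power2[of "norm (F y) - 1"] norm_ge_zero[of "F y"]
        unfolding power2_diff power_one by linarith
      also have "... \<le> 1 + (bracket y powr \<sigma> * norm (F y))\<^sup>2"
        using b1[of y] by (intro add_left_mono power_mono) (auto simp: mult_le_cancel_right1)
      finally show ?thesis using True by (simp add: F'_def)
    next
      case False
      then show ?thesis by (simp add: F'_def)
    qed
    then show "AE y in lborel. norm (F' y) \<le> norm (indicator (cball 0 R) y * 1 + (bracket y powr \<sigma> * norm (F y))\<^sup>2)"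
      by (auto intro!: AE_I2 order_trans[OF _ abs_ge_self])
  qed measurable
  have [measurable]: "m \<in> borel_fun" unfolding m_def[abs_def] by measurable
  have bs: "bracket y powr (- 2 * \<sigma>) * (bracket y powr \<sigma>)\<^sup>2 = 1" for y :: "real^3"
    by (simp add: power2_eq_square powr_add[symmetric] del: powr_minus)
  have m: "integrable lborel m"
  proof (rule Bochner_Integration.integrable_bound[where f = "\<lambda>y. indicator (cball 0 R) y :: real"])
    show "integrable lborel (\<lambda>y::real^3. indicator (cball 0 R) y :: real)"
      using emeasure_bounded_finite[of "cball 0 R :: (real^3) set"] by (simp add: integrable_indicator_iff)
    show "AE y in lborel. norm (m y) \<le> norm (indicator (cball 0 R) y :: real)"
      using bracket_ge_1 powr_mono[of "- 2 * \<sigma>" 0 "bracket (_ :: real^3)"] \<sigma>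
      by (auto simp: m_def split: split_indicator)
  qed simp
  have "(\<integral>p. ennreal (norm (LINT y|lborel. e p y * F' y)) * ennreal (h p))\<^sup>2
    \<le> (\<integral>y. ennreal ((bracket y powr \<sigma> * norm (F' y))\<^sup>2))
      * (\<integral>p. \<integral>p'. ennreal (h p) * ennreal (h p') * (ennreal C * kernel_bound a b (fst p - fst p') (snd p - snd p')))"
  proof (rule dual_quadratic_form_le[where m = m])
    show "norm (e p y) \<le> 1" for p y by (simp add: e_def)
    show "(\<lambda>(p, y). e p y) \<in> borel_measurable (lborel \<Otimes>\<^sub>M lborel)"
      unfolding e_def split_beta
      by (intro borel_measurable_cis borel_measurable_add borel_measurable_times borel_measurable_inner borel_measurable_fst_snd
            measurable_compose[OF _ borel_measurable_bracket])
         (auto intro: measurable_ident_sets[OF sets_lborel_pair])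
    show "m y * (bracket y powr \<sigma>)\<^sup>2 = 1" if "F' y \<noteq> 0" for y
      using that bs[of y] by (auto simp: F'_def m_def split: split_indicator_asm)
    show "ennreal (norm (LINT y|lborel. of_real (m y) * (e p y * cnj (e p' y)))) \<le> ennreal C * kernel_bound a b (fst p - fst p') (snd p - snd p')" for p p'
    proof -
      have "(LINT y|lborel. of_real (m y) * (e p y * cnj (e p' y))) = kg_kernel R \<sigma> (d * (fst p - fst p')) (snd p - snd p')"
        unfolding kg_kernel_def
        by (intro Bochner_Integration.integral_cong)
           (auto simp: m_def e_def cis_cnj cis_mult scaleR_conv_of_real algebra_simps inner_diff_left split: split_indicator)
      then show ?thesis using C[of "d * (fst p - fst p')" "snd p - snd p'"] by (simp only: kernel_bound_abs[OF d])
    qed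
    show "(\<lambda>(p, p'). ennreal C * kernel_bound a b (fst p - fst p') (snd p - snd p')) \<in> borel_measurable (lborel \<Otimes>\<^sub>M lborel)"
      unfolding split_beta
      by (intro borel_measurable_times_ennreal measurable_kernel_bound borel_measurable_diff borel_measurable_fst_snd)
         (auto intro: measurable_ident_sets[OF sets_lborel_pair])
    show "m y \<ge> 0" for y by (simp add: m_def)
    show "bracket y powr \<sigma> > 0" for y :: "real^3" by simp
  qed (use h F' m in \<open>auto intro: sigma_finite_lborel\<close>)
  also have "(\<integral>y. ennreal ((bracket y powr \<sigma> * norm (F' y))\<^sup>2)) \<le> (\<integral>y. ennreal ((bracket y powr \<sigma> * norm (F y))\<^sup>2))"
    by (intro nn_integral_mono) (auto simp: F'_def split: split_indicator)
  finally show ?thesis by (simp add: e_def F'_def mult_right_mono)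
qed

lemma ennreal_powr_2: "epowr x 2 = x\<^sup>2"
  by (cases x) (auto simp: powr_numeral ennreal_power power2_eq_square ennreal_top_mult ennreal_mult')

lemma power2_ennreal_powr_half [simp]: "(epowr x (1 / 2))\<^sup>2 = x"
  unfolding ennreal_powr_2[symmetric] ennreal_powr_powr by simp

lemma power2_le_iff_ennreal_powr: "x\<^sup>2 \<le> y \<longleftrightarrow> x \<le> epowr y (1 / 2)"
  using ennreal_powr_le_iff[of 2 x "epowr y (1 / 2)"] unfolding ennreal_powr_2 by simp

lemma power2_sum_le_ennreal:
  fixes f :: "'i => ennreal"
  assumes "finite J" and le: "\<And>j. j \<in> J ==> (f j)\<^sup>2 \<le> B"
  shows "(\<Sum>j\<in>J. f j)\<^sup>2 \<le> of_nat ((card J)\<^sup>2) * B"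
proof -
  have "(\<Sum>j\<in>J. f j) \<le> (\<Sum>j\<in>J. epowr B (1 / 2))"
    using le by (intro sum_mono) (simp add: power2_le_iff_ennreal_powr)
  then have "(\<Sum>j\<in>J. f j)\<^sup>2 \<le> (of_nat (card J) * epowr B (1 / 2))\<^sup>2" by (intro power_mono) auto
  also have "... = of_nat ((card J)\<^sup>2) * B"
    by (simp add: power_mult_distrib)
  finally show ?thesis .
qed

section \<open>The truncated Dirac wave and its scalar pieces\<close>

definition dirac_multiplier :: "(real^3 => complex^4) => real => real^3 => complex^4" where
  "dirac_multiplier F t \<xi> = cis (t * bracket \<xi>) *s half_wave 1 F \<xi> + cis (- (t * bracket \<xi>)) *s half_wave (- 1) F \<xi>"

lemma norm_dirac_multiplier: "norm (dirac_multiplier F t \<xi>) \<le> 18 * norm (F \<xi>)"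
  unfolding dirac_multiplier_def
  by (rule order_trans[OF norm_triangle_ineq])
     (use norm_half_wave[of 1 F \<xi>] norm_half_wave[of "- 1" F \<xi>] in \<open>simp add: norm_vector_scalar_mult\<close>)

lemma borel_measurable_dirac_multiplier_joint:
  assumes F [measurable]: "F \<in> borel_fun" and [measurable]: "s \<in> borel_measurable M" "g \<in> M \<rightarrow>\<^sub>M borel"
  shows "(\<lambda>x. dirac_multiplier F (s x) (g x)) \<in> borel_measurable M"
proof -
  have [measurable]: "(\<lambda>x. half_wave e F (g x)) \<in> borel_measurable M" for e
    by (rule measurable_compose[OF _ borel_measurable_half_wave[OF F]]) measurable
  show ?thesis unfolding dirac_multiplier_def by measurable
qed

definition truncated_dirac_wave :: "(real^3 => complex^4) => real => real \<times> (real^3) => complex^4" where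
  "truncated_dirac_wave F R p = truncated_transform 1 R (dirac_multiplier F (fst p)) (snd p)"

lemma borel_measurable_truncated_dirac_wave:
  assumes [measurable]: "F \<in> borel_fun"
  shows "truncated_dirac_wave F R \<in> borel_fun"
proof -
  have fst: "fst \<in> (borel :: (real \<times> (real^3)) measure) \<Otimes>\<^sub>M (lborel :: (real^3) measure) \<rightarrow>\<^sub>M borel" by measurable
  have snd: "snd \<in> (borel :: (real \<times> (real^3)) measure) \<Otimes>\<^sub>M (lborel :: (real^3) measure) \<rightarrow>\<^sub>M borel" by measurable
  note 1 = borel_measurable_fst_snd[OF fst]
  have 2 [measurable]: "(\<lambda>x. dirac_multiplier F (fst (fst x)) (snd x)) \<in> borel_measurable ((borel :: (real \<times> (real^3)) measure) \<Otimes>\<^sub>M (lborel :: (real^3) measure))"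
    by (rule borel_measurable_dirac_multiplier_joint[OF assms 1(1) snd])
  have 3 [measurable]: "(\<lambda>x. 1 * (snd x \<bullet> snd (fst x))) \<in> borel_measurable ((borel :: (real \<times> (real^3)) measure) \<Otimes>\<^sub>M (lborel :: (real^3) measure))"
    using 1(2) by measurable
  have "(\<lambda>p. LINT \<xi>|lborel. (\<lambda>(p, \<xi>). indicator (cball 0 R) \<xi> *\<^sub>R (cis (1 * (\<xi> \<bullet> snd p)) *s dirac_multiplier F (fst p) \<xi>)) (p, \<xi>)) \<in> borel_fun"
    by (intro lborel.borel_measurable_lebesgue_integral)
       (simp only: split_beta' fst_conv snd_conv, intro borel_measurable_scaleR borel_measurable_vector_scalar_mult borel_measurable_cis 2 3, measurable)
  then show ?thesis unfolding truncated_dirac_wave_def truncated_transform_def by simp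
qed

text \<open>The index is a sign together with a component, so there are eight pieces; each is a
  scalar wave to which \<open>truncated_wave_dual\<close> applies.\<close>

definition half_wave_part :: "(real^3 => complex^4) => real => real \<times> 4 => real \<times> (real^3) => complex" where
  "half_wave_part F R j p = (LINT \<xi>|lborel. indicator (cball 0 R) \<xi> *\<^sub>R
     (cis (snd p \<bullet> \<xi> + fst j * fst p * bracket \<xi>) * half_wave (fst j) F \<xi> $ snd j))"

lemma norm_truncated_dirac_wave_le:
  assumes F [measurable]: "F \<in> borel_fun" and fin: "energy F < \<infinity>"
  shows "norm (truncated_dirac_wave F R p) \<le> (\<Sum>j\<in>{1, -1} \<times> UNIV. norm (half_wave_part F R j p))"
proof -
  have Gm [measurable]: "dirac_multiplier F t \<in> borel_fun" for t
    by (rule borel_measurable_dirac_multiplier_joint) auto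
  have efin: "energy f < \<infinity>" if "\<And>\<xi>. norm (f \<xi>) \<le> 18 * norm (F \<xi>)" for f :: "real^3 => complex^4"
  proof -
    have "energy f \<le> (\<integral>\<xi>. ennreal (18\<^sup>2) * ennreal ((norm (F \<xi>))\<^sup>2))"
      unfolding energy_def
      by (intro nn_integral_mono, subst ennreal_mult'[symmetric], simp, subst power_mult_distrib[symmetric])
         (intro ennreal_leI power_mono that, simp)
    also have "... = ennreal (18\<^sup>2) * energy F" unfolding energy_def by (rule nn_integral_cmult) measurable
    also have "... < \<infinity>" using fin by (simp add: ennreal_mult_less_top)
    finally show ?thesis .
  qed
  have ih: "integrable lborel (\<lambda>\<xi>. indicator (cball 0 R) \<xi> *\<^sub>R (cis (snd p \<bullet> \<xi> + e * fst p * bracket \<xi>) * half_wave e F \<xi> $ i))"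
    if "\<bar>e\<bar> = 1" for e i
  proof (rule Bochner_Integration.integrable_bound)
    have "norm (half_wave e F \<xi>) \<le> 18 * norm (F \<xi>)" for \<xi>
      using norm_half_wave[OF that, of F \<xi>] norm_ge_zero[of "F \<xi>"] by linarith
    then show "integrable lborel (\<lambda>\<xi>. indicator (cball 0 R) \<xi> *\<^sub>R half_wave e F \<xi>)"
      by (intro integrable_of_energy_bounded efin) auto
    show "(\<lambda>\<xi>. indicator (cball 0 R) \<xi> *\<^sub>R (cis (snd p \<bullet> \<xi> + e * fst p * bracket \<xi>) * half_wave e F \<xi> $ i)) \<in> borel_measurable lborel"
      by measurable
    show "AE \<xi> in lborel. norm (indicator (cball 0 R) \<xi> *\<^sub>R (cis (snd p \<bullet> \<xi> + e * fst p * bracket \<xi>) * half_wave e F \<xi> $ i))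
       \<le> norm (indicator (cball 0 R) \<xi> *\<^sub>R half_wave e F \<xi>)"
      by (simp add: norm_mult mult_left_mono Finite_Cartesian_Product.norm_nth_le)
  qed
  have comp: "norm (truncated_dirac_wave F R p $ i) \<le> norm (half_wave_part F R (1, i) p) + norm (half_wave_part F R (-1, i) p)" for i
  proof -
    have "truncated_dirac_wave F R p $ i = (2 * pi) powr (- 3 / 2) *\<^sub>R
        (LINT \<xi>|lborel. cis (1 * (\<xi> \<bullet> snd p)) * (indicator (cball 0 R) \<xi> *\<^sub>R dirac_multiplier F (fst p) \<xi> $ i))"
      unfolding truncated_dirac_wave_def
      by (subst truncated_transform_nth[OF Gm efin[of "dirac_multiplier F (fst p)", OF norm_dirac_multiplier]]) (simp add: fourier_integral_def)
    also have "(LINT \<xi>|lborel. cis (1 * (\<xi> \<bullet> snd p)) * (indicator (cball 0 R) \<xi> *\<^sub>R dirac_multiplier F (fst p) \<xi> $ i))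
      = (LINT \<xi>|lborel. indicator (cball 0 R) \<xi> *\<^sub>R (cis (snd p \<bullet> \<xi> + 1 * fst p * bracket \<xi>) * half_wave 1 F \<xi> $ i)
         + indicator (cball 0 R) \<xi> *\<^sub>R (cis (snd p \<bullet> \<xi> + (- 1) * fst p * bracket \<xi>) * half_wave (- 1) F \<xi> $ i))"
      by (intro Bochner_Integration.integral_cong)
         (auto simp: dirac_multiplier_def scaleR_conv_of_real[where 'a=complex] algebra_simps inner_commute cis_mult[symmetric]
            cis_divide[symmetric] divide_inverse split: split_indicator)
    also have "... = half_wave_part F R (1, i) p + half_wave_part F R (-1, i) p"
      unfolding half_wave_part_def fst_conv snd_conv by (rule Bochner_Integration.integral_add; rule ih; simp)
    finally have "norm (truncated_dirac_wave F R p $ i) = (2 * pi) powr (- 3 / 2) * norm (half_wave_part F R (1, i) p + half_wave_part F R (-1, i) p)"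
      by simp
    also have "... \<le> 1 * norm (half_wave_part F R (1, i) p + half_wave_part F R (-1, i) p)"
      using powr_mono[of "- 3 / 2" 0 "2 * pi"] pi_ge_two by (intro mult_right_mono) auto
    also have "... \<le> norm (half_wave_part F R (1, i) p) + norm (half_wave_part F R (-1, i) p)"
      using norm_triangle_ineq by simp
    finally show ?thesis .
  qed
  have "norm (truncated_dirac_wave F R p) \<le> (\<Sum>i\<in>UNIV. norm (truncated_dirac_wave F R p $ i))"
    unfolding norm_vec_def by (rule L2_set_le_sum) simp
  also have "... \<le> (\<Sum>i\<in>UNIV. norm (half_wave_part F R (1, i) p) + norm (half_wave_part F R (-1, i) p))"
    by (intro sum_mono comp)
  also have "... = (\<Sum>j\<in>{1, -1} \<times> UNIV. norm (half_wave_part F R j p))"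
    by (simp add: sum.cartesian_product' sum.distrib)
  finally show ?thesis .
qed

definition kernel_form :: "real => real => (real \<times> (real^3) => ennreal) => ennreal" where
  "kernel_form a b h = (\<integral>p. \<integral>p'. h p * h p' * kernel_bound a b (fst p - fst p') (snd p - snd p'))"

definition weighted_energy :: "real => (real^3 => complex^4) => ennreal" where
  "weighted_energy \<sigma> F = (\<integral>\<xi>. ennreal ((bracket \<xi> powr \<sigma> * norm (F \<xi>))\<^sup>2))"

lemma energy_le_weighted_energy:
  assumes "\<sigma> \<ge> 0" shows "energy F \<le> weighted_energy \<sigma> F"
  unfolding energy_def weighted_energy_def
proof (intro nn_integral_mono ennreal_leI power_mono)
  fix y :: "real^3"
  have "1 * norm (F y) \<le> bracket y powr \<sigma> * norm (F y)"
    using bracket_ge_1[of y] assms by (intro mult_right_mono ge_one_powr_ge_zero) auto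
  then show "norm (F y) \<le> bracket y powr \<sigma> * norm (F y)" by simp
qed simp

lemma measurable_kernel_bound_diff:
  "(\<lambda>x :: (real \<times> (real^3)) \<times> (real \<times> (real^3)). kernel_bound a b (fst (fst x) - fst (snd x)) (snd (fst x) - snd (snd x))) \<in> borel_measurable (lborel \<Otimes>\<^sub>M lborel)"
  by (intro measurable_kernel_bound borel_measurable_diff borel_measurable_fst_snd)
     (auto intro: measurable_ident_sets[OF sets_lborel_pair])

text \<open>The scalar estimate for each piece, with the pointwise bound 9 for half waves, summed
  over the pieces.\<close>

lemma truncated_dirac_wave_dual:
  assumes \<sigma>: "\<sigma> > 1" and a: "0 < a" "a \<le> 1" "3 - 2 * \<sigma> < a" and b: "0 \<le> b" "b \<le> a"
  shows "\<exists>D>0. \<forall>F h R. R \<ge> 0 \<longrightarrow> F \<in> borel_fun \<longrightarrow> weighted_energy \<sigma> F < top \<longrightarrow> integrable lborel h \<longrightarrow> (\<forall>p. h p \<ge> 0) \<longrightarrow>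
    (\<integral>p. ennreal (norm (truncated_dirac_wave F R p)) * ennreal (h p))\<^sup>2
      \<le> ennreal D * weighted_energy \<sigma> F * kernel_form a b (\<lambda>p. ennreal (h p))"
proof -
  obtain C where C: "C > 0" "\<And>R \<tau> z. R \<ge> 0 ==> ennreal (norm (kg_kernel R \<sigma> \<tau> z)) \<le> ennreal C * kernel_bound a b \<tau> z"
    using kg_kernel_le_kernel_bound[OF \<sigma> a b] by blast
  \<comment> \<open>64 is the square of the number of pieces, 81 the square of the bound 9 for half
    waves.\<close>
  define D where "D = 64 * (81 * C)"
  have "(\<integral>p. ennreal (norm (truncated_dirac_wave F R p)) * ennreal (h p))\<^sup>2
      \<le> ennreal D * weighted_energy \<sigma> F * kernel_form a b (\<lambda>p. ennreal (h p))"
    if R: "R \<ge> 0" and F [measurable]: "F \<in> borel_fun" and fin: "weighted_energy \<sigma> F < top"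
      and h: "integrable lborel h" "\<And>p. h p \<ge> 0" for F h R
  proof -
    have [measurable]: "h \<in> borel_measurable lborel" using h by auto
    let ?Q = "kernel_form a b (\<lambda>p. ennreal (h p))"
    let ?J = "{1, -1 :: real} \<times> (UNIV :: 4 set)"
    have fin': "energy F < \<infinity>" using energy_le_weighted_energy[of \<sigma> F] \<sigma> fin by (simp add: le_less_trans)
    have part: "(\<integral>p. ennreal (norm (half_wave_part F R j p)) * ennreal (h p))\<^sup>2 \<le> ennreal (81 * C) * weighted_energy \<sigma> F * ?Q"
      if j: "j \<in> ?J" for j
    proof -
      obtain e i where ei: "j = (e, i)" "\<bar>e\<bar> = 1" using j by auto
      have le: "(\<integral>\<xi>. ennreal ((bracket \<xi> powr \<sigma> * norm (half_wave e F \<xi> $ i))\<^sup>2)) \<le> ennreal 81 * weighted_energy \<sigma> F"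
      proof -
        have "(\<integral>\<xi>. ennreal ((bracket \<xi> powr \<sigma> * norm (half_wave e F \<xi> $ i))\<^sup>2))
          \<le> (\<integral>\<xi>. ennreal 81 * ennreal ((bracket \<xi> powr \<sigma> * norm (F \<xi>))\<^sup>2))"
        proof (intro nn_integral_mono)
          fix \<xi>
          have "norm (half_wave e F \<xi> $ i) \<le> 9 * norm (F \<xi>)"
            using norm_half_wave[OF ei(2), of F \<xi>] Finite_Cartesian_Product.norm_nth_le[of "half_wave e F \<xi>" i] by linarith
          then have "(bracket \<xi> powr \<sigma> * norm (half_wave e F \<xi> $ i))\<^sup>2 \<le> (bracket \<xi> powr \<sigma> * (9 * norm (F \<xi>)))\<^sup>2"
            by (intro power_mono mult_left_mono) auto
          also have "... = 81 * (bracket \<xi> powr \<sigma> * norm (F \<xi>))\<^sup>2" by (simp add: power_mult_distrib)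
          finally show "ennreal ((bracket \<xi> powr \<sigma> * norm (half_wave e F \<xi> $ i))\<^sup>2) \<le> ennreal 81 * ennreal ((bracket \<xi> powr \<sigma> * norm (F \<xi>))\<^sup>2)"
            by (subst ennreal_mult'[symmetric]) (auto intro: ennreal_leI)
        qed
        also have "... = ennreal 81 * weighted_energy \<sigma> F" unfolding weighted_energy_def by (rule nn_integral_cmult) measurable
        finally show ?thesis .
      qed
      have fin2: "(\<integral>\<xi>. ennreal ((bracket \<xi> powr \<sigma> * norm (half_wave e F \<xi> $ i))\<^sup>2)) < top"
        using le fin by (auto simp: ennreal_mult_less_top intro: le_less_trans)
      have "(\<integral>p. ennreal (norm (half_wave_part F R j p)) * ennreal (h p))\<^sup>2
        \<le> (\<integral>\<xi>. ennreal ((bracket \<xi> powr \<sigma> * norm (half_wave e F \<xi> $ i))\<^sup>2))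
      * (\<integral>p. \<integral>p'. ennreal (h p) * ennreal (h p') * (ennreal C * kernel_bound a b (fst p - fst p') (snd p - snd p')))"
        unfolding half_wave_part_def ei(1) fst_conv snd_conv
        by (rule truncated_wave_dual[OF \<sigma> ei(2) R C(2)[OF R] _ fin2 h]) measurable
      also have "(\<integral>p. \<integral>p'. ennreal (h p) * ennreal (h p') * (ennreal C * kernel_bound a b (fst p - fst p') (snd p - snd p')))
        = (\<integral>p. \<integral>p'. ennreal C * (ennreal (h p) * ennreal (h p') * kernel_bound a b (fst p - fst p') (snd p - snd p')))"
        by (simp only: mult_ac)
      also have "... = ennreal C * ?Q"
      proof -
        have m: "(\<lambda>x. ennreal (h (fst x)) * ennreal (h (snd x)) * kernel_bound a b (fst (fst x) - fst (snd x)) (snd (fst x) - snd (snd x))) \<in> borel_measurable (lborel \<Otimes>\<^sub>M lborel)"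
          by (intro borel_measurable_times_ennreal measurable_kernel_bound_diff) measurable
        have m1: "(\<lambda>p'. ennreal (h p) * ennreal (h p') * kernel_bound a b (fst p - fst p') (snd p - snd p')) \<in> borel_measurable lborel" for p
          using measurable_compose[OF measurable_Pair1' m, of p] by simp
        have m2: "(\<lambda>p. (\<integral>p'. ennreal (h p) * ennreal (h p') * kernel_bound a b (fst p - fst p') (snd p - snd p'))) \<in> borel_measurable lborel"
          using lborel.borel_measurable_nn_integral_fst[OF m] by simp
        show ?thesis unfolding kernel_form_def by (simp only: nn_integral_cmult[OF m1] nn_integral_cmult[OF m2])
      qed
      finally have "(\<integral>p. ennreal (norm (half_wave_part F R j p)) * ennreal (h p))\<^sup>2
        \<le> (ennreal 81 * weighted_energy \<sigma> F) * (ennreal C * ?Q)"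
        by (rule order_trans) (intro mult_right_mono le, simp)
      also have "... = (ennreal 81 * ennreal C) * weighted_energy \<sigma> F * ?Q" by (simp only: mult_ac)
      also have "ennreal 81 * ennreal C = ennreal (81 * C)" by (rule ennreal_mult'[symmetric]) simp
      finally show ?thesis .
    qed
    have [measurable]: "(\<lambda>p. half_wave_part F R j p) \<in> borel_measurable lborel" for j
    proof -
      have 1: "(\<lambda>x. cis (snd (fst x) \<bullet> snd x + fst j * fst (fst x) * bracket (snd x))) \<in> borel_measurable (lborel \<Otimes>\<^sub>M (lborel :: (real^3) measure))"
        by (intro borel_measurable_cis borel_measurable_add borel_measurable_times borel_measurable_inner borel_measurable_fst_snd
            measurable_compose[OF _ borel_measurable_bracket]) (auto intro: measurable_ident_sets[OF sets_lborel_pair])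
      have snd: "snd \<in> (lborel :: (real \<times> (real^3)) measure) \<Otimes>\<^sub>M (lborel :: (real^3) measure) \<rightarrow>\<^sub>M borel" by measurable
      have 2: "(\<lambda>x. half_wave (fst j) F (snd x) $ snd j) \<in> borel_measurable ((lborel :: (real \<times> (real^3)) measure) \<Otimes>\<^sub>M (lborel :: (real^3) measure))"
        by (rule measurable_compose[OF snd]) measurable
      have 3: "(\<lambda>x. indicator (cball 0 R) (snd x) :: real) \<in> borel_measurable ((lborel :: (real \<times> (real^3)) measure) \<Otimes>\<^sub>M (lborel :: (real^3) measure))"
        by (rule measurable_compose[OF snd]) measurable
      have "(\<lambda>p. LINT \<xi>|lborel. (\<lambda>(p, \<xi>). indicator (cball 0 R) \<xi> *\<^sub>R
     (cis (snd p \<bullet> \<xi> + fst j * fst p * bracket \<xi>) * half_wave (fst j) F \<xi> $ snd j)) (p, \<xi>)) \<in> borel_measurable lborel"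
        by (intro lborel.borel_measurable_lebesgue_integral)
           (simp only: split_beta' fst_conv snd_conv, intro borel_measurable_scaleR borel_measurable_times 1 2 3)
      then show ?thesis unfolding half_wave_part_def by simp
    qed
    have "(\<integral>p. ennreal (norm (truncated_dirac_wave F R p)) * ennreal (h p))
      \<le> (\<integral>p. (\<Sum>j\<in>?J. ennreal (norm (half_wave_part F R j p)) * ennreal (h p)))"
      using norm_truncated_dirac_wave_le[OF F fin', of R]
      by (intro nn_integral_mono) (simp add: sum_distrib_right[symmetric] ennreal_leI mult_right_mono)
    also have "... = (\<Sum>j\<in>?J. (\<integral>p. ennreal (norm (half_wave_part F R j p)) * ennreal (h p)))"
      by (rule nn_integral_sum) measurable
    finally have "(\<integral>p. ennreal (norm (truncated_dirac_wave F R p)) * ennreal (h p))\<^sup>2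
      \<le> (\<Sum>j\<in>?J. (\<integral>p. ennreal (norm (half_wave_part F R j p)) * ennreal (h p)))\<^sup>2"
      by (intro power_mono) auto
    also have "... \<le> of_nat ((card ?J)\<^sup>2) * (ennreal (81 * C) * weighted_energy \<sigma> F * ?Q)"
      by (rule power2_sum_le_ennreal) (auto intro: part)
    also have "of_nat ((card ?J)\<^sup>2) = ennreal 64" by (simp add: card_cartesian_product)
    also have "ennreal 64 * (ennreal (81 * C) * weighted_energy \<sigma> F * ?Q) = (ennreal 64 * ennreal (81 * C)) * weighted_energy \<sigma> F * ?Q"
      by (simp only: mult_ac)
    also have "ennreal 64 * ennreal (81 * C) = ennreal D" unfolding D_def by (rule ennreal_mult'[symmetric]) simp
    finally show ?thesis .
  qed
  moreover have "D > 0" using C(1) by (simp add: D_def)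
  ultimately show ?thesis by blast
qed

section \<open>The envelope of the truncated waves\<close>

definition wave_envelope :: "(real^3 => complex^4) => (nat => real) => real \<times> (real^3) => ennreal" where
  "wave_envelope F R p = liminf (\<lambda>n. ennreal (norm (truncated_dirac_wave F (R n) p)))"

lemma borel_measurable_wave_envelope [measurable]:
  assumes F: "F \<in> borel_fun"
  shows "wave_envelope F R \<in> borel_fun"
proof -
  note [measurable] = borel_measurable_truncated_dirac_wave[OF F]
  show ?thesis unfolding wave_envelope_def[abs_def] by measurable
qed

lemma kernel_form_mono: "(\<And>p. h p \<le> h' p) ==> kernel_form a b h \<le> kernel_form a b h'"
  unfolding kernel_form_def by (intro nn_integral_mono mult_right_mono mult_mono) auto

text \<open>Fatou's lemma: the bound for every truncation survives the lower limit because it is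
  uniform in the cutoff.\<close>

lemma wave_envelope_dual_integrable:
  assumes F: "F \<in> borel_fun" and h: "h \<in> borel_fun" "\<And>p. h p \<ge> 0"
    and le: "\<And>n. (\<integral>p. ennreal (norm (truncated_dirac_wave F (R n) p)) * ennreal (h p))\<^sup>2 \<le> B"
  shows "(\<integral>p. wave_envelope F R p * ennreal (h p))\<^sup>2 \<le> B"
proof -
  note [measurable] = borel_measurable_truncated_dirac_wave[OF F] h(1)
  define u where "u n p = ennreal (norm (truncated_dirac_wave F (R n) p))" for n p
  have [measurable]: "u n \<in> borel_fun" for n unfolding u_def by measurable
  have "(\<integral>p. wave_envelope F R p * ennreal (h p)) \<le> (\<integral>p. liminf (\<lambda>n. u n p * ennreal (h p)))"
  proof (intro nn_integral_mono)
    fix p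
    have "wave_envelope F R p * ennreal (h p) = (SUP n. (INF m\<in>{n..}. u m p) * ennreal (h p))"
      unfolding wave_envelope_def liminf_SUP_INF u_def[symmetric] by (rule SUP_mult_right_ennreal)
    also have "... \<le> liminf (\<lambda>n. u n p * ennreal (h p))"
      unfolding liminf_SUP_INF
      by (intro SUP_mono) (auto intro!: INF_greatest mult_right_mono INF_lower bexI)
    finally show "wave_envelope F R p * ennreal (h p) \<le> liminf (\<lambda>n. u n p * ennreal (h p))" .
  qed
  also have "... \<le> liminf (\<lambda>n. (\<integral>p. u n p * ennreal (h p)))"
    by (rule nn_integral_liminf) measurable
  also have "... \<le> liminf (\<lambda>n. epowr B (1 / 2))"
    using le by (intro Liminf_mono always_eventually) (simp add: power2_le_iff_ennreal_powr u_def)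
  also have "... = epowr B (1 / 2)" by (simp add: Liminf_const)
  finally show ?thesis by (simp add: power2_le_iff_ennreal_powr)
qed

text \<open>Finite, bounded and boundedly supported approximations from below of an arbitrary value.
  They make extremizers and Bochner integrals legitimate for the test functions, for the envelope
  and for the norms in time.\<close>

lemma ennreal_truncation_SUP:
  fixes x :: ennreal and y :: "'a::real_normed_vector"
  shows "incseq (\<lambda>k::nat. ennreal (enn2real (min x (of_nat k)) * indicator (cball 0 (real k)) y))"
    and "(SUP k::nat. ennreal (enn2real (min x (of_nat k)) * indicator (cball 0 (real k)) y)) = x"
proof -
  have eq: "ennreal (enn2real (min x (of_nat k)) * indicator (cball 0 (real k)) y) = min x (of_nat k) * indicator (cball 0 (real k)) y" for k :: nat
  proof -
    have "ennreal (enn2real (min x (of_nat k))) = min x (of_nat k)"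
      by (rule ennreal_enn2real) (simp add: min_def less_top[symmetric], meson leI le_less_trans not_less_iff_gr_or_eq of_nat_less_top ennreal_of_nat_neq_top top.not_eq_extremum)
    then show ?thesis by (auto split: split_indicator)
  qed
  show "incseq (\<lambda>k::nat. ennreal (enn2real (min x (of_nat k)) * indicator (cball 0 (real k)) y))"
    unfolding eq
  proof (rule monoI)
    fix k l :: nat assume "k \<le> l"
    then have "min x (of_nat k) \<le> min x (of_nat l)" by (intro min.mono) auto
    then show "min x (of_nat k) * indicator (cball 0 (real k)) y \<le> min x (of_nat l) * indicator (cball 0 (real l)) y"
      using \<open>k \<le> l\<close> by (auto split: split_indicator)
  qed
  show "(SUP k::nat. ennreal (enn2real (min x (of_nat k)) * indicator (cball 0 (real k)) y)) = x"
    unfolding eq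
  proof (rule antisym)
    show "(SUP k::nat. min x (of_nat k) * indicator (cball 0 (real k)) y) \<le> x"
      by (intro SUP_least) (auto split: split_indicator)
    obtain m :: nat where m: "norm y \<le> real m" using real_arch_simple by blast
    show "x \<le> (SUP k::nat. min x (of_nat k) * indicator (cball 0 (real k)) y)"
    proof (rule dense_le)
      fix z assume z: "z < x"
      then obtain n :: nat where n: "z \<le> of_nat n"
        using ennreal_Ex_less_of_nat[OF less_le_trans[OF z top_greatest]] by (auto dest: less_imp_le)
      have "z \<le> min x (of_nat (max m n))" using z n by (auto intro: order_trans)
      also have "... = min x (of_nat (max m n)) * indicator (cball 0 (real (max m n))) y" using m by simp
      also have "... \<le> (SUP k::nat. min x (of_nat k) * indicator (cball 0 (real k)) y)" by (rule SUP_upper) simp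
      finally show "z \<le> (SUP k::nat. min x (of_nat k) * indicator (cball 0 (real k)) y)" .
    qed
  qed
qed

text \<open>Integrable real test functions are replaced by arbitrary Borel functions with values in
  \<open>ennreal\<close>: the truncations of \<open>h\<close> satisfy the bound with the form of
  \<open>h\<close> itself on the right, and monotone convergence does the rest.\<close>

theorem wave_envelope_dual:
  assumes \<sigma>: "\<sigma> > 1" and a: "0 < a" "a \<le> 1" "3 - 2 * \<sigma> < a" and b: "0 \<le> b" "b \<le> a"
  shows "\<exists>D>0. \<forall>F R h. (\<forall>n. R n \<ge> 0) \<longrightarrow> F \<in> borel_fun \<longrightarrow> weighted_energy \<sigma> F < top \<longrightarrow> h \<in> borel_fun \<longrightarrow>
    (\<integral>p. wave_envelope F R p * h p)\<^sup>2 \<le> ennreal D * weighted_energy \<sigma> F * kernel_form a b h"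
proof -
  obtain D where D: "D > 0" "\<And>F h R. R \<ge> 0 ==> F \<in> borel_fun ==> weighted_energy \<sigma> F < top ==> integrable lborel h ==> (\<forall>p. h p \<ge> 0) ==>
    (\<integral>p. ennreal (norm (truncated_dirac_wave F R p)) * ennreal (h p))\<^sup>2
      \<le> ennreal D * weighted_energy \<sigma> F * kernel_form a b (\<lambda>p. ennreal (h p))"
    using truncated_dirac_wave_dual[OF assms] by blast
  have "(\<integral>p. wave_envelope F R p * h p)\<^sup>2 \<le> ennreal D * weighted_energy \<sigma> F * kernel_form a b h"
    if R: "\<And>n. R n \<ge> 0" and F [measurable]: "F \<in> borel_fun" and fin: "weighted_energy \<sigma> F < top"
      and h [measurable]: "h \<in> borel_fun" for F R h
  proof -
    define g where "g k p = enn2real (min (h p) (of_nat k)) * indicator (cball 0 (real k)) p" for k :: nat and p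
    have g0: "g k p \<ge> 0" for k p by (simp add: g_def)
    have [measurable]: "g k \<in> borel_fun" for k unfolding g_def by measurable
    have gh: "(SUP k. ennreal (g k p)) = h p" "incseq (\<lambda>k. ennreal (g k p))" for p
      unfolding g_def by (rule ennreal_truncation_SUP)+
    have gi: "integrable lborel (g k)" for k
    proof (rule Bochner_Integration.integrable_bound[where f = "\<lambda>p. real k * indicator (cball 0 (real k)) p"])
      show "integrable lborel (\<lambda>p::real \<times> (real^3). real k * indicator (cball 0 (real k)) p)"
        using emeasure_bounded_finite[of "cball 0 (real k) :: (real \<times> (real^3)) set"] by (auto simp: integrable_indicator_iff)
      have "enn2real (min x (of_nat k)) \<le> real k" for x
        by (intro enn2real_leI) (auto simp: ennreal_of_nat_eq_real_of_nat)
      then show "AE p in lborel. norm (g k p) \<le> norm (real k * indicator (cball 0 (real k)) p)"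
        by (auto simp: g_def split: split_indicator)
    qed measurable
    have le: "(\<integral>p. wave_envelope F R p * ennreal (g k p))\<^sup>2 \<le> ennreal D * weighted_energy \<sigma> F * kernel_form a b h" for k
    proof (rule wave_envelope_dual_integrable[OF F])
      fix n
      have "(\<integral>p. ennreal (norm (truncated_dirac_wave F (R n) p)) * ennreal (g k p))\<^sup>2
        \<le> ennreal D * weighted_energy \<sigma> F * kernel_form a b (\<lambda>p. ennreal (g k p))"
        using g0 by (intro D(2) R F fin gi) auto
      also have "... \<le> ennreal D * weighted_energy \<sigma> F * kernel_form a b h"
      proof (intro mult_left_mono kernel_form_mono)
        show "ennreal (g k p) \<le> h p" for p unfolding gh(1)[symmetric] by (rule SUP_upper) simp
      qed simp
      finally show "(\<integral>p. ennreal (norm (truncated_dirac_wave F (R n) p)) * ennreal (g k p))\<^sup>2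
        \<le> ennreal D * weighted_energy \<sigma> F * kernel_form a b h" .
    qed (use g0 in auto)
    have "(\<integral>p. wave_envelope F R p * h p) = (\<integral>p. (SUP k. wave_envelope F R p * ennreal (g k p)))"
      by (simp add: gh(1)[symmetric] SUP_mult_left_ennreal)
    also have "... = (SUP k. (\<integral>p. wave_envelope F R p * ennreal (g k p)))"
      using gh(2) by (intro nn_integral_monotone_convergence_SUP) (auto simp: incseq_def le_fun_def intro!: mult_left_mono)
    also have "... \<le> epowr (ennreal D * weighted_energy \<sigma> F * kernel_form a b h) (1 / 2)"
      using le by (intro SUP_least) (simp add: power2_le_iff_ennreal_powr)
    finally show ?thesis by (simp add: power2_le_iff_ennreal_powr)
  qed
  then show ?thesis using D(1) by blast
qed

text \<open>The multiplier is bounded by \<open>18 * norm (F \<xi>)\<close> at every time, so one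
  sequence of radii with tails below \<open>(1/8) ^ n\<close> serves all \<open>t\<close>. By
  inversion the truncated waves approach the flow at this rate in energy, hence almost
  everywhere.\<close>

lemma dirac_flow_eq_envelope:
  assumes F [measurable]: "F \<in> borel_fun" and fF: "AE \<xi> in lborel. fourier f \<xi> = F \<xi>" and fin: "energy F < \<infinity>"
    and tail: "\<And>n. ennreal 324 * energy (\<lambda>\<xi>. indicator (- cball 0 (R n)) \<xi> *\<^sub>R F \<xi>) \<le> ennreal ((1 / 8) ^ n)"
  shows "AE x in lborel. ennreal (norm (dirac_flow f t x)) = wave_envelope F R (t, x)"
    and "dirac_flow f t \<in> borel_measurable lebesgue"
proof -
  let ?G = "dirac_multiplier F t"
  have [measurable]: "?G \<in> borel_fun" by (rule borel_measurable_dirac_multiplier_joint) auto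
  have eG: "energy (\<lambda>\<xi>. indicator A \<xi> *\<^sub>R ?G \<xi>) \<le> ennreal 324 * energy (\<lambda>\<xi>. indicator A \<xi> *\<^sub>R F \<xi>)"
    if [measurable]: "A \<in> sets borel" for A
  proof -
    have "energy (\<lambda>\<xi>. indicator A \<xi> *\<^sub>R ?G \<xi>) \<le> (\<integral>\<xi>. ennreal 324 * ennreal ((norm (indicator A \<xi> *\<^sub>R F \<xi>))\<^sup>2))"
      unfolding energy_def
    proof (intro nn_integral_mono)
      fix \<xi>
      have "(norm (?G \<xi>))\<^sup>2 \<le> (18 * norm (F \<xi>))\<^sup>2" by (intro power_mono norm_dirac_multiplier) simp
      also have "... = 324 * (norm (F \<xi>))\<^sup>2" by (simp add: power_mult_distrib)
      finally show "ennreal ((norm (indicator A \<xi> *\<^sub>R ?G \<xi>))\<^sup>2) \<le> ennreal 324 * ennreal ((norm (indicator A \<xi> *\<^sub>R F \<xi>))\<^sup>2)"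
        by (subst ennreal_mult'[symmetric]) (auto intro!: ennreal_leI split: split_indicator)
    qed
    also have "... = ennreal 324 * energy (\<lambda>\<xi>. indicator A \<xi> *\<^sub>R F \<xi>)"
      unfolding energy_def by (rule nn_integral_cmult) measurable
    finally show ?thesis .
  qed
  have eGfin: "energy ?G < \<infinity>"
    using eG[of UNIV] fin by (auto intro: le_less_trans simp: ennreal_mult_less_top)
  let ?g = "\<lambda>\<xi>. matrix_exp (mat (- \<i> * complex_of_real t) ** dirac_symbol \<xi>) *v fourier f \<xi>"
  have gG: "AE \<xi> in lborel. ?g \<xi> = ?G \<xi>"
    using fF by eventually_elim (simp only: matrix_exp_half_wave dirac_multiplier_def)
  have "?g \<in> L2"
    unfolding L2_iff using borel_measurable_lebesgue_AE[OF _ gG] energy_cong_AE[OF gG] eGfin by simp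
  then have isf: "is_fourier (dirac_flow f t) ?g"
    unfolding dirac_flow_def by (rule is_fourier_inverse_fourier)
  then show m: "dirac_flow f t \<in> borel_measurable lebesgue" by (simp add: is_fourier_def L2_iff)
  obtain D' where D' [measurable]: "D' \<in> borel_fun" and DD: "AE x in lborel. dirac_flow f t x = D' x"
    using ex_borel_measurable_AE_eq[OF m] by blast
  define u where "u n x = truncated_transform 1 (R n) ?G x" for n x
  have [measurable]: "u n \<in> borel_fun" for n unfolding u_def by measurable
  have "AE x in lborel. summable (\<lambda>k. norm (D' x - u k x))"
  proof (rule AE_summable_of_energy)
    fix k
    have "energy (\<lambda>x. D' x - u k x) = energy (\<lambda>x. dirac_flow f t x - u k x)"
      using DD by (intro energy_cong_AE) (auto elim: eventually_mono)
    also have "... = energy (\<lambda>\<xi>. indicator (- cball 0 (R k)) \<xi> *\<^sub>R ?G \<xi>)"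
      unfolding u_def by (rule is_fourier_inversion[OF isf _ gG]) measurable
    also have "... \<le> ennreal ((1 / 8) ^ k)"
      by (rule order_trans[OF eG tail]) simp
    finally show "energy (\<lambda>x. D' x - u k x) \<le> ennreal ((1 / 8) ^ k)" .
  qed measurable
  with DD show "AE x in lborel. ennreal (norm (dirac_flow f t x)) = wave_envelope F R (t, x)"
  proof eventually_elim
    case (elim x)
    have "(\<lambda>k. D' x - u k x) \<longlonglongrightarrow> 0" using summable_LIMSEQ_zero[OF elim(2)] by (rule tendsto_norm_zero_cancel)
    then have "(\<lambda>k. D' x - (D' x - u k x)) \<longlonglongrightarrow> D' x - 0" by (intro tendsto_intros)
    then have "(\<lambda>k. ennreal (norm (u k x))) \<longlonglongrightarrow> ennreal (norm (D' x))"
      by (intro tendsto_ennrealI tendsto_norm) simp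
    then have "liminf (\<lambda>k. ennreal (norm (u k x))) = ennreal (norm (D' x))"
      by (intro lim_imp_Liminf) auto
    then show ?case using elim(1) by (simp add: wave_envelope_def truncated_dirac_wave_def u_def)
  qed
qed

lemma ex_tail_radii:
  fixes F :: "real^3 => complex^4"
  assumes F: "F \<in> borel_fun" and fin: "energy F < \<infinity>"
  shows "\<exists>R. (\<forall>n. R n \<ge> 0) \<and> (\<forall>n. ennreal 324 * energy (\<lambda>y. indicator (- cball 0 (R n)) y *\<^sub>R F y) \<le> ennreal ((1 / 8) ^ n))"
proof -
  have "\<exists>r\<ge>0. ennreal 324 * energy (\<lambda>y. indicator (- cball 0 r) y *\<^sub>R F y) \<le> ennreal ((1 / 8) ^ n)" for n
  proof -
    have "eventually (\<lambda>m. energy (\<lambda>y. indicator (- cball 0 (real m)) y *\<^sub>R F y) < ennreal ((1 / 8) ^ n / 324)) sequentially"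
      by (rule order_tendstoD(2)[OF energy_tail_tendsto_0[OF F fin]]) simp
    then obtain m where m: "energy (\<lambda>y. indicator (- cball 0 (real m)) y *\<^sub>R F y) < ennreal ((1 / 8) ^ n / 324)"
      by (auto simp: eventually_sequentially)
    have "ennreal 324 * energy (\<lambda>y. indicator (- cball 0 (real m)) y *\<^sub>R F y) \<le> ennreal 324 * ennreal ((1 / 8) ^ n / 324)"
      using m by (intro mult_left_mono) auto
    also have "... = ennreal (324 * ((1 / 8) ^ n / 324))" by (rule ennreal_mult'[symmetric]) simp
    also have "324 * ((1 / 8 :: real) ^ n / 324) = (1 / 8) ^ n" by simp
    finally show ?thesis by (intro exI[of _ "real m"]) simp
  qed
  then show ?thesis by metis
qed

section \<open>Amalgam norms in space\<close>

lemma borel_measurable_nn_integral_countable [measurable (raw)]: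
  fixes f :: "'a => 'i::countable => ennreal"
  assumes [measurable]: "\<And>j. (\<lambda>t. f t j) \<in> borel_measurable M"
  shows "(\<lambda>t. (\<Sum>\<^sub>+j. f t j)) \<in> borel_measurable M"
proof (rule sigma_finite_measure.borel_measurable_nn_integral[OF sigma_finite_measure_count_space_countable])
  have "(\<lambda>p. f (fst p) (snd p)) \<in> borel_measurable (M \<Otimes>\<^sub>M count_space UNIV)"
    by (rule measurable_compose_countable[where f = "\<lambda>j p. f (fst p) j" and g = snd]) measurable
  then show "(\<lambda>(t, j). f t j) \<in> borel_measurable (M \<Otimes>\<^sub>M count_space UNIV)" by (simp add: split_beta')
qed simp

definition cell_power :: "real => (real^3 => ennreal) => int \<times> int \<times> int => ennreal" where
  "cell_power rt g k = (\<integral>x. epowr (g x) rt * indicator {k} (cell x))"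

definition amalgam_norm :: "real => real => (real^3 => ennreal) => ennreal" where
  "amalgam_norm r rt g = epowr (\<Sum>\<^sub>+k. epowr (cell_power rt g k) (r / rt)) (1 / r)"

text \<open>Extremizer of \<open>dual_extremizer\<close> for the sum over the cubes;
  \<open>dual_density\<close> is the one inside each cube. The formulas are explicit so that the
  dependence on a time parameter stays measurable.\<close>

definition dual_coefficient :: "real => real => (real^3 => ennreal) => int \<times> int \<times> int => ennreal" where
  "dual_coefficient r rt g k = epowr (epowr (cell_power rt g k) (1 / rt)) (r - 1)
     * epowr (\<Sum>\<^sub>+k. epowr (cell_power rt g k) (r / rt)) (1 / r - 1)"

definition dual_density :: "real => (real^3 => ennreal) => real^3 => ennreal" where
  "dual_density rt g x = epowr (g x) (rt - 1) * epowr (cell_power rt g (cell x)) (1 / rt - 1)"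

lemma indicator_cell_measurable [measurable]:
  assumes "g \<in> borel_measurable M"
  shows "(\<lambda>x. indicator {k} (cell (g x)) :: ennreal) \<in> borel_measurable M"
  using measurable_compose[OF measurable_compose[OF assms measurable_cell], of "indicator {k}" borel] by simp

lemma finite_cells_bounded: "finite (cell ` cball 0 R)"
proof (rule finite_subset)
  show "cell ` cball 0 R \<subseteq> {\<lfloor>- R\<rfloor>..\<lfloor>R\<rfloor>} \<times> {\<lfloor>- R\<rfloor>..\<lfloor>R\<rfloor>} \<times> {\<lfloor>- R\<rfloor>..\<lfloor>R\<rfloor>}"
  proof
    fix k assume "k \<in> cell ` cball 0 R"
    then obtain x where x: "k = cell x" "norm x \<le> R" by auto
    have "- R \<le> x $ i \<and> x $ i \<le> R" for i
      using component_le_norm_cart[of x i] x(2) by linarith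
    then show "k \<in> {\<lfloor>- R\<rfloor>..\<lfloor>R\<rfloor>} \<times> {\<lfloor>- R\<rfloor>..\<lfloor>R\<rfloor>} \<times> {\<lfloor>- R\<rfloor>..\<lfloor>R\<rfloor>}"
      unfolding x(1) cell_def by (auto intro: floor_mono)
  qed
qed auto

text \<open>Boundedness and bounded support make every cell power finite and only finitely many of
  them nonzero. Extremizing inside each cube gives the local norms, and extremizing over the cubes
  gives the full norm.\<close>

lemma amalgam_dual:
  assumes r: "r > 1" "rt > 1" and [measurable]: "g \<in> borel_fun"
    and bd: "\<And>x. g x \<le> ennreal (N * indicator (cball 0 R) x)"
  shows "(\<Sum>\<^sub>+k. epowr (dual_coefficient r rt g k) (r / (r - 1))) \<le> 1"
    and "(\<integral>x. epowr (dual_density rt g x) (rt / (rt - 1)) * indicator {k} (cell x)) \<le> 1"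
    and "(\<integral>x. g x * (dual_coefficient r rt g (cell x) * dual_density rt g x)) = amalgam_norm r rt g"
proof -
  have gfin: "g x \<noteq> top" for x using le_less_trans[OF bd[of x]] by (simp add: less_top)
  have cell_le: "cell_power rt g k \<le> ennreal (\<bar>N\<bar> powr rt)" for k
  proof -
    have "cell_power rt g k \<le> (\<integral>x. ennreal (\<bar>N\<bar> powr rt) * indicator {k} (cell x))"
      unfolding cell_power_def
    proof (intro nn_integral_mono mult_right_mono)
      fix x
      have "g x \<le> ennreal \<bar>N\<bar>" using bd[of x] by (rule order_trans) (auto intro!: ennreal_leI split: split_indicator)
      then show "epowr (g x) rt \<le> ennreal (\<bar>N\<bar> powr rt)"
        using ennreal_powr_mono[of "g x" "ennreal \<bar>N\<bar>" rt] r by simp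
    qed simp
    also have "... = ennreal (\<bar>N\<bar> powr rt) * (\<integral>x. indicator {k} (cell x))"
      by (rule nn_integral_cmult) measurable
    also have "... \<le> ennreal (\<bar>N\<bar> powr rt) * 1" by (intro mult_left_mono emeasure_cell_le) simp
    finally show ?thesis by simp
  qed
  then have cfin: "cell_power rt g k \<noteq> top" for k using le_less_trans[OF cell_le[of k]] by (simp add: less_top)
  have c0: "cell_power rt g k = 0" if "k \<notin> cell ` cball 0 R" for k
  proof -
    have z: "epowr (g x) rt * indicator {k} (cell x) = 0" for x
      using that bd[of x] by (cases "x \<in> cball 0 R") (auto split: split_indicator)
    show ?thesis unfolding cell_power_def z by simp
  qed
  have pr: "epowr (epowr (cell_power rt g k) (1 / rt)) r = epowr (cell_power rt g k) (r / rt)" for k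
    by (simp add: ennreal_powr_powr)
  have Yfin: "(\<Sum>\<^sub>+k. epowr (cell_power rt g k) (r / rt)) \<noteq> top"
  proof -
    have "(\<Sum>\<^sub>+k. epowr (cell_power rt g k) (r / rt))
      = (\<Sum>k\<in>cell ` cball 0 R. epowr (cell_power rt g k) (r / rt))"
      by (rule nn_integral_count_space'[OF finite_cells_bounded]) (auto simp: c0)
    also have "... < top"
      using cfin by (subst ennreal_sum_less_top[OF finite_cells_bounded]) (simp add: less_top[symmetric])
    finally show ?thesis by simp
  qed
  note de = dual_extremizer[OF r(1), of "\<lambda>k. epowr (cell_power rt g k) (1 / rt)" "count_space UNIV", unfolded pr]
  show "(\<Sum>\<^sub>+k. epowr (dual_coefficient r rt g k) (r / (r - 1))) \<le> 1"
    unfolding dual_coefficient_def by (rule de(1)) (use Yfin cfin in auto)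
  have X: "(\<integral>x. epowr (g x * indicator {k} (cell x)) rt) = cell_power rt g k" for k
    unfolding cell_power_def by (intro nn_integral_cong) (auto split: split_indicator)
  note dx = dual_extremizer[OF r(2), of "\<lambda>x. g x * indicator {k} (cell x)" lborel for k, unfolded X]
  have "(\<integral>x. epowr (dual_density rt g x) (rt / (rt - 1)) * indicator {k} (cell x))
    = (\<integral>x. epowr (epowr (g x * indicator {k} (cell x)) (rt - 1) * epowr (cell_power rt g k) (1 / rt - 1)) (rt / (rt - 1)))"
    unfolding dual_density_def by (intro nn_integral_cong) (auto split: split_indicator)
  also have "... \<le> 1" by (rule dx(1)) (use cfin gfin in \<open>auto split: split_indicator\<close>)
  finally show "(\<integral>x. epowr (dual_density rt g x) (rt / (rt - 1)) * indicator {k} (cell x)) \<le> 1" .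
  have du: "(\<integral>x. (g x * indicator {k} (cell x)) * (epowr (g x * indicator {k} (cell x)) (rt - 1) * epowr (cell_power rt g k) (1 / rt - 1)))
    = epowr (cell_power rt g k) (1 / rt)" for k
    by (rule dx(2)) (use cfin gfin in \<open>auto split: split_indicator\<close>)
  have [measurable]: "(\<lambda>x. f (cell x)) \<in> borel_fun" for f :: "_ => ennreal"
    by (rule measurable_compose[OF measurable_cell]) simp
  have "(\<integral>x. g x * (dual_coefficient r rt g (cell x) * dual_density rt g x))
    = (\<Sum>\<^sub>+k. (\<integral>x. g x * (dual_coefficient r rt g (cell x) * dual_density rt g x) * indicator {k} (cell x)))"
    unfolding dual_density_def by (rule nn_integral_partition) measurable
  also have "... = (\<Sum>\<^sub>+k. epowr (cell_power rt g k) (1 / rt) * dual_coefficient r rt g k)"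
  proof (intro nn_integral_cong)
    fix k
    have "(\<integral>x. g x * (dual_coefficient r rt g (cell x) * dual_density rt g x) * indicator {k} (cell x))
      = (\<integral>x. (g x * indicator {k} (cell x)) * (epowr (g x * indicator {k} (cell x)) (rt - 1) * epowr (cell_power rt g k) (1 / rt - 1)) * dual_coefficient r rt g k)"
      unfolding dual_density_def by (intro nn_integral_cong) (auto simp: mult_ac split: split_indicator)
    also have "... = epowr (cell_power rt g k) (1 / rt) * dual_coefficient r rt g k"
      unfolding du[symmetric] by (rule nn_integral_multc) measurable
    finally show "(\<integral>x. g x * (dual_coefficient r rt g (cell x) * dual_density rt g x) * indicator {k} (cell x))
      = epowr (cell_power rt g k) (1 / rt) * dual_coefficient r rt g k" .
  qed
  also have "... = amalgam_norm r rt g"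
    unfolding dual_coefficient_def amalgam_norm_def by (rule de(2)) (use Yfin cfin in auto)
  finally show "(\<integral>x. g x * (dual_coefficient r rt g (cell x) * dual_density rt g x)) = amalgam_norm r rt g" .
qed

lemma amalgam_norm_SUP:
  assumes r: "r > 0" "rt > 0" and [measurable]: "\<And>n. g n \<in> borel_fun"
    and inc: "\<And>x. incseq (\<lambda>n. g n x)"
  shows "amalgam_norm r rt (\<lambda>x. SUP n. g n x) = (SUP n. amalgam_norm r rt (g n))"
    and "incseq (\<lambda>n. amalgam_norm r rt (g n))"
proof -
  have inc1: "incseq (\<lambda>n. cell_power rt (g n) k)" for k
    unfolding cell_power_def using r inc
    by (intro monoI nn_integral_mono mult_right_mono ennreal_powr_mono) (auto simp: incseq_def)
  have inc2: "incseq (\<lambda>n. epowr (cell_power rt (g n) k) (r / rt))" for k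
    using r inc1 by (intro monoI ennreal_powr_mono) (auto simp: incseq_def)
  have 1: "cell_power rt (\<lambda>x. SUP n. g n x) k = (SUP n. cell_power rt (g n) k)" for k
  proof -
    have "cell_power rt (\<lambda>x. SUP n. g n x) k = (\<integral>x. (SUP n. epowr (g n x) rt * indicator {k} (cell x)))"
      unfolding cell_power_def using r by (simp add: ennreal_powr_SUP SUP_mult_right_ennreal)
    also have "... = (SUP n. cell_power rt (g n) k)"
      unfolding cell_power_def using r inc
      by (intro nn_integral_monotone_convergence_SUP) (auto simp: incseq_def le_fun_def intro!: mult_right_mono ennreal_powr_mono)
    finally show ?thesis .
  qed
  show "amalgam_norm r rt (\<lambda>x. SUP n. g n x) = (SUP n. amalgam_norm r rt (g n))"
    unfolding amalgam_norm_def 1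
    by (subst ennreal_powr_SUP, use r in simp, subst nn_integral_monotone_convergence_SUP)
       (use inc2 r in \<open>auto simp: ennreal_powr_SUP incseq_def le_fun_def\<close>)
  show "incseq (\<lambda>n. amalgam_norm r rt (g n))"
    unfolding amalgam_norm_def using r inc1
    by (intro monoI ennreal_powr_mono nn_integral_mono) (auto simp: incseq_def)
qed

lemma borel_measurable_cell_power:
  assumes [measurable]: "(\<lambda>(t, x). g t x) \<in> borel_measurable (M \<Otimes>\<^sub>M borel)"
  shows "(\<lambda>t. cell_power rt (g t) k) \<in> borel_measurable M"
  unfolding cell_power_def by measurable

lemma borel_measurable_amalgam_norm:
  assumes [measurable]: "(\<lambda>(t, x). g t x) \<in> borel_measurable (M \<Otimes>\<^sub>M borel)"
  shows "(\<lambda>t. amalgam_norm r rt (g t)) \<in> borel_measurable M"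
  unfolding amalgam_norm_def
  by (intro ennreal_powr_measurable borel_measurable_nn_integral_countable borel_measurable_cell_power assms)

lemma borel_measurable_dual:
  assumes [measurable]: "(\<lambda>(t, x). g t x) \<in> borel_measurable (M \<Otimes>\<^sub>M borel)"
  shows "(\<lambda>(t, x). dual_coefficient r rt (g t) (cell x) * dual_density rt (g t) x) \<in> borel_measurable (M \<Otimes>\<^sub>M borel)"
proof -
  note [measurable] = borel_measurable_cell_power[OF assms]
  have 1: "(\<lambda>t. dual_coefficient r rt (g t) k) \<in> borel_measurable M" for k
    unfolding dual_coefficient_def by measurable
  have 2: "(\<lambda>p. dual_coefficient r rt (g (fst p)) (cell (snd p))) \<in> borel_measurable (M \<Otimes>\<^sub>M borel)"
    by (rule measurable_compose_countable[where f = "\<lambda>k p. dual_coefficient r rt (g (fst p)) k"])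
       (rule measurable_compose[OF measurable_fst 1], measurable)
  have 3: "(\<lambda>p. cell_power rt (g (fst p)) (cell (snd p))) \<in> borel_measurable (M \<Otimes>\<^sub>M borel)"
    by (rule measurable_compose_countable[where f = "\<lambda>k p. cell_power rt (g (fst p)) k"])
       (rule measurable_compose[OF measurable_fst borel_measurable_cell_power[OF assms]], measurable)
  have 4: "(\<lambda>p. g (fst p) (snd p)) \<in> borel_measurable (M \<Otimes>\<^sub>M borel)" using assms by (simp add: split_beta')
  show ?thesis unfolding split_beta' dual_density_def
    by (intro borel_measurable_times_ennreal 2 ennreal_powr_measurable 3 4)
qed

text \<open>Testing against \<open>h(t, x) = w(t) c\<^sub>t(cell x) u\<^sub>t(x)\<close>, with \<open>c\<^sub>t\<close> and \<open>u\<^sub>t\<close> the extremizers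
  in the duality for the amalgam norm at time \<open>t\<close>, turns a bound for the space-time pairing into
  one for the pairing of \<open>w\<close> with the amalgam norms.\<close>

lemma amalgam_norm_dual_bounded:
  assumes r: "r > 6" "rt \<ge> r"
    and V [measurable]: "(\<lambda>(t, x). V t x) \<in> borel_measurable (borel \<Otimes>\<^sub>M borel)"
    and bd: "\<And>t x. V t x \<le> ennreal (N * indicator (cball 0 R) x)"
    and dual: "\<And>h. h \<in> borel_measurable (borel \<Otimes>\<^sub>M borel) ==>
       (\<integral>t. \<integral>x. V t x * h (t, x))\<^sup>2 \<le> B * kernel_form a b h"
    and kern: "kernel_form_le a b r rt K"
    and [measurable]: "w \<in> borel_fun"
  shows "(\<integral>t. amalgam_norm r rt (V t) * w t)\<^sup>2
    \<le> B * (\<integral>t. \<integral>s. w t * w s * K (t - s))"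
proof -
  define H where "H t x = dual_coefficient r rt (V t) (cell x) * dual_density rt (V t) x" for t x
  define h where "h p = w (fst p) * H (fst p) (snd p)" for p
  have Hm [measurable]: "(\<lambda>(t, x). H t x) \<in> borel_measurable (borel \<Otimes>\<^sub>M borel)"
    unfolding H_def by (rule borel_measurable_dual[OF V])
  have Ht [measurable]: "H t \<in> borel_fun" for t by measurable
  have Vt [measurable]: "V t \<in> borel_fun" for t by measurable
  have hm [measurable]: "h \<in> borel_measurable (borel \<Otimes>\<^sub>M borel)"
    using Hm unfolding h_def split_beta' by measurable
  have "(\<integral>t. \<integral>x. V t x * h (t, x)) = (\<integral>t. amalgam_norm r rt (V t) * w t)"
  proof (intro nn_integral_cong)
    fix t
    have "(\<integral>x. V t x * h (t, x)) = (\<integral>x. (V t x * H t x) * w t)"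
      by (simp add: h_def mult_ac)
    also have "... = (\<integral>x. V t x * H t x) * w t" by (rule nn_integral_multc) measurable
    also have "(\<integral>x. V t x * H t x) = amalgam_norm r rt (V t)"
      unfolding H_def using r by (intro amalgam_dual(3)[OF _ _ Vt bd]) auto
    finally show "(\<integral>x. V t x * h (t, x)) = amalgam_norm r rt (V t) * w t" .
  qed
  with dual[OF hm] have "(\<integral>t. amalgam_norm r rt (V t) * w t)\<^sup>2 \<le> B * kernel_form a b h" by simp
  also have "kernel_form a b h \<le> (\<integral>t. \<integral>s. w t * w s * K (t - s))"
  proof -
    define \<Phi> where "\<Phi> t x s y = h (t, x) * h (s, y) * kernel_bound a b (t - s) (x - y)" for t x s y
    have \<Phi> [measurable]: "(\<lambda>(p, p'). \<Phi> (fst p) (snd p) (fst p') (snd p')) \<in> borel_measurable ((borel \<Otimes>\<^sub>M borel) \<Otimes>\<^sub>M (borel \<Otimes>\<^sub>M borel))"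
      unfolding \<Phi>_def by measurable
    have P: "(\<lambda>p'. \<Phi> t x (fst p') (snd p')) \<in> borel_fun" for t x
    proof -
      have "(\<lambda>p'. \<Phi> t x (fst p') (snd p')) \<in> borel_measurable (borel \<Otimes>\<^sub>M borel)"
        unfolding \<Phi>_def by measurable
      then show ?thesis by (simp add: borel_prod)
    qed
    have Q: "(\<lambda>p. (\<integral>s. \<integral>y. \<Phi> (fst p) (snd p) s y)) \<in> borel_fun"
    proof -
      have "(\<lambda>p. (\<integral>s. \<integral>y. \<Phi> (fst p) (snd p) s y)) \<in> borel_measurable (borel \<Otimes>\<^sub>M borel)"
        unfolding \<Phi>_def by measurable
      then show ?thesis by (simp add: borel_prod)
    qed
    have "kernel_form a b h = (\<integral>p. \<integral>p'. \<Phi> (fst p) (snd p) (fst p') (snd p'))"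
      by (simp add: kernel_form_def \<Phi>_def)
    also have "... = (\<integral>p. \<integral>s. \<integral>y. \<Phi> (fst p) (snd p) s y)"
      by (subst nn_integral_lborel_pair[OF P]) simp
    also have "... = (\<integral>t. \<integral>x. \<integral>s. \<integral>y. \<Phi> t x s y)"
      by (subst nn_integral_lborel_pair[OF Q]) simp
    also have "... = (\<integral>t. \<integral>s. \<integral>x. \<integral>y. \<Phi> t x s y)"
    proof (intro nn_integral_cong)
      fix t :: real
      show "(\<integral>x. \<integral>s. \<integral>y. \<Phi> t x s y) = (\<integral>s. \<integral>x. \<integral>y. \<Phi> t x s y)"
        by (rule lborel_pair.Fubini') (unfold \<Phi>_def split_beta', measurable)
    qed
    also have "... \<le> (\<integral>t. \<integral>s. w t * w s * K (t - s))"
    proof (rule nn_integral_mono, rule nn_integral_mono_AE)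
      fix t :: real
      \<comment> \<open>The spatial form is controlled only for a nonzero lag when
        \<open>b > 0\<close>, which is enough under the integral.\<close>
      have "AE s in lborel. s \<noteq> t" by (rule AE_lborel_singleton)
      then show "AE s in lborel. (\<integral>x. \<integral>y. \<Phi> t x s y) \<le> w t * w s * K (t - s)"
      proof eventually_elim
        case (elim s)
        have "(\<integral>x. \<integral>y. \<Phi> t x s y)
          = (\<integral>x. \<integral>y. (w t * w s) * (H t x * H s y * kernel_bound a b (t - s) (x - y)))"
          unfolding \<Phi>_def h_def fst_conv snd_conv by (simp only: mult_ac)
        also have "... = (\<integral>x. (w t * w s) * (\<integral>y. H t x * H s y * kernel_bound a b (t - s) (x - y)))"
          by (intro nn_integral_cong nn_integral_cmult) measurable
        also have "... = (w t * w s) * (\<integral>x. \<integral>y. H t x * H s y * kernel_bound a b (t - s) (x - y))"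
          by (rule nn_integral_cmult) measurable
        also have "... \<le> (w t * w s) * K (t - s)"
          unfolding H_def
        proof (rule mult_left_mono[OF kern[unfolded kernel_form_le_def, rule_format, where c = "dual_coefficient r rt (V t)" and d = "dual_coefficient r rt (V s)"
              and w = "dual_density rt (V t)" and v = "dual_density rt (V s)"]])
          have dd: "dual_density rt (V t) \<in> borel_fun" for t
          proof -
            have "(\<lambda>x. f (cell x)) \<in> borel_fun" for f :: "_ => ennreal"
              by (rule measurable_compose[OF measurable_cell]) simp
            then show ?thesis unfolding dual_density_def[abs_def] by measurable
          qed
          show "dual_density rt (V t) \<in> borel_fun" "dual_density rt (V s) \<in> borel_fun"
            by (rule dd)+
          show "(\<integral>x. epowr (dual_density rt (V t) x) (rt / (rt - 1)) * indicator {j} (cell x)) \<le> 1"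
            "(\<integral>x. epowr (dual_density rt (V s) x) (rt / (rt - 1)) * indicator {j} (cell x)) \<le> 1" for j
            using r by (intro amalgam_dual(2)[OF _ _ Vt bd, of r]; simp)+
          show "(\<Sum>\<^sub>+j. epowr (dual_coefficient r rt (V t) j) (r / (r - 1))) \<le> 1"
            "(\<Sum>\<^sub>+j. epowr (dual_coefficient r rt (V s) j) (r / (r - 1))) \<le> 1"
            using r by (intro amalgam_dual(1)[OF _ _ Vt bd]; simp)+
        qed (use elim in auto)
        finally show ?case .
      qed
    qed
    finally show ?thesis .
  qed
  finally show ?thesis by (simp add: mult_left_mono)
qed

text \<open>The truncations of \<open>V\<close> satisfy the hypothesis because they lie below
  \<open>V\<close>, and their amalgam norms increase to that of \<open>V\<close>.\<close>

theorem amalgam_norm_dual: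
  assumes r: "r > 6" "rt \<ge> r"
    and V [measurable]: "V \<in> borel_fun"
    and dual: "\<And>h. h \<in> borel_fun ==> (\<integral>p. V p * h p)\<^sup>2 \<le> B * kernel_form a b h"
    and kern: "kernel_form_le a b r rt K"
    and w [measurable]: "w \<in> borel_fun"
  shows "(\<integral>t. amalgam_norm r rt (\<lambda>x. V (t, x)) * w t)\<^sup>2
    \<le> B * (\<integral>t. \<integral>s. w t * w s * K (t - s))"
proof -
  define g where "g k t x = ennreal (enn2real (min (V (t, x)) (of_nat k)) * indicator (cball 0 (real k)) x)" for k :: nat and t :: real and x :: "real^3"
  have Vp [measurable]: "V \<in> borel_measurable (borel \<Otimes>\<^sub>M borel)" using V by (simp add: borel_prod)
  have gm [measurable]: "(\<lambda>(t, x). g k t x) \<in> borel_measurable (borel \<Otimes>\<^sub>M borel)" for k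
    unfolding g_def by measurable
  have gt [measurable]: "g k t \<in> borel_fun" for k t by measurable
  have inc: "incseq (\<lambda>k. g k t x)" and sup: "(SUP k. g k t x) = V (t, x)" for t x
    unfolding g_def by (rule ennreal_truncation_SUP)+
  have le: "(\<integral>t. amalgam_norm r rt (g k t) * w t)\<^sup>2
    \<le> B * (\<integral>t. \<integral>s. w t * w s * K (t - s))" for k
  proof (rule amalgam_norm_dual_bounded[OF r gm _ _ kern w])
    have "enn2real (min x (of_nat k)) \<le> real k" for x
      by (intro enn2real_leI) (auto simp: ennreal_of_nat_eq_real_of_nat)
    then show "g k t x \<le> ennreal (real k * indicator (cball 0 (real k)) x)" for t x
      unfolding g_def by (intro ennreal_leI mult_right_mono) auto
    fix h :: "real \<times> (real^3) => ennreal" assume h [measurable]: "h \<in> borel_measurable (borel \<Otimes>\<^sub>M borel)"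
    then have hb: "h \<in> borel_fun" by (simp add: borel_prod)
    have Vh: "(\<lambda>p. V p * h p) \<in> borel_fun" using V hb by measurable
    have "(\<integral>t. \<integral>x. g k t x * h (t, x)) \<le> (\<integral>t. \<integral>x. V (t, x) * h (t, x))"
      unfolding sup[symmetric] by (intro nn_integral_mono mult_right_mono SUP_upper) auto
    also have "... = (\<integral>p. V p * h p)" by (rule nn_integral_lborel_pair[OF Vh, symmetric])
    finally have "(\<integral>t. \<integral>x. g k t x * h (t, x))\<^sup>2 \<le> (\<integral>p. V p * h p)\<^sup>2"
      by (intro power_mono) auto
    also note dual[OF hb]
    finally show "(\<integral>t. \<integral>x. g k t x * h (t, x))\<^sup>2 \<le> B * kernel_form a b h" .
  qed
  have r0: "r > 0" "rt > 0" using r by auto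
  note [measurable] = borel_measurable_amalgam_norm[OF gm]
  have "(\<integral>t. amalgam_norm r rt (\<lambda>x. V (t, x)) * w t)
    = (\<integral>t. (SUP k. amalgam_norm r rt (g k t) * w t))"
    unfolding sup[symmetric] by (simp add: amalgam_norm_SUP(1)[OF r0 gt inc] SUP_mult_right_ennreal)
  also have "... = (SUP k. (\<integral>t. amalgam_norm r rt (g k t) * w t))"
    using amalgam_norm_SUP(2)[OF r0 gt inc]
    by (intro nn_integral_monotone_convergence_SUP) (auto simp: incseq_def le_fun_def intro!: mult_right_mono)
  also have "... \<le> epowr (B * (\<integral>t. \<integral>s. w t * w s * K (t - s))) (1 / 2)"
    using le by (intro SUP_least) (simp add: power2_le_iff_ennreal_powr)
  finally show ?thesis by (simp add: power2_le_iff_ennreal_powr)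
qed

section \<open>Amalgam norms in time\<close>

lemma nn_integral_count_space_int_le:
  fixes g :: "int => ennreal"
  assumes "\<And>M. finite M ==> (\<Sum>m\<in>M. g m) \<le> Z"
  shows "(\<Sum>\<^sub>+m. g m) \<le> Z"
proof -
  have sup: "(SUP n::nat. g m * indicator {- int n..int n} m) = g m" for m
  proof (rule antisym)
    show "(SUP n::nat. g m * indicator {- int n..int n} m) \<le> g m" by (intro SUP_least) (auto split: split_indicator)
    have "g m = g m * indicator {- int (nat \<bar>m\<bar>)..int (nat \<bar>m\<bar>)} m" by (auto split: split_indicator)
    also have "... \<le> (SUP n::nat. g m * indicator {- int n..int n} m)" by (rule SUP_upper) simp
    finally show "g m \<le> (SUP n::nat. g m * indicator {- int n..int n} m)" .
  qed
  have "(\<Sum>\<^sub>+m. g m) = (\<Sum>\<^sub>+m. (SUP n::nat. g m * indicator {- int n..int n} m))"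
    by (simp add: sup)
  also have "... = (SUP n::nat. (\<Sum>\<^sub>+m. g m * indicator {- int n..int n} m))"
    by (intro nn_integral_monotone_convergence_SUP) (auto simp: incseq_def le_fun_def split: split_indicator)
  also have "... \<le> Z"
  proof (intro SUP_least)
    fix n :: nat
    have "(\<Sum>\<^sub>+m. g m * indicator {- int n..int n} m) = (\<Sum>m\<in>{- int n..int n}. g m * indicator {- int n..int n} m)"
      by (rule nn_integral_count_space') auto
    also have "... = (\<Sum>m\<in>{- int n..int n}. g m)" by (intro sum.cong) auto
    also have "... \<le> Z" by (rule assms) simp
    finally show "(\<Sum>\<^sub>+m. g m * indicator {- int n..int n} m) \<le> Z" .
  qed
  finally show ?thesis .
qed

text \<open>One test function per interval is fixed, and the hypothesis is tested with the
  combination \<open>W\<close> of them whose coefficients extremize the sum of \<open>q\<close>-th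
  powers of the pairings. The quadratic form of \<open>W\<close> expands into the pair bounds, which
  the discrete inequality sums.\<close>

lemma discrete_norm_le_finite:
  fixes S :: "real => ennreal" and \<kappa> :: "real => real => ennreal" and w :: "int => real => ennreal"
  assumes q: "q > 2" and B: "B < top" and K: "K \<ge> 0" and [measurable]: "S \<in> borel_fun"
    and [measurable]: "(\<lambda>(t, s). \<kappa> t s) \<in> borel_measurable (borel \<Otimes>\<^sub>M borel)"
    and dual: "\<And>w. w \<in> borel_fun ==>
      (\<integral>t. S t * w t)\<^sup>2 \<le> B * (\<integral>t. \<integral>s. w t * w s * \<kappa> t s)"
    and [measurable]: "\<And>m. w m \<in> borel_fun"
    and pair: "\<And>m n. (\<integral>t. \<integral>s. w m t * w n s * \<kappa> t s) \<le> ennreal (K * (1 + real_of_int \<bar>m - n\<bar>) powr (- 2 / q))"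
    and M: "finite M"
  shows "(\<Sum>m\<in>M. epowr (\<integral>t. S t * w m t) q)
    \<le> epowr (epowr (B * ennreal (K * (2 * (4 / (1 - 2 / q) + 3)))) (1 / 2)) q"
proof -
  define y where "y m = (\<integral>t. S t * w m t)" for m
  \<comment> \<open>The hypothesis for \<open>w m\<close> alone bounds its pairing; without
    finiteness the extremal coefficients would not be available.\<close>
  have yfin: "y m \<noteq> top" for m
  proof
    assume "y m = top"
    then have "top \<le> B * (\<integral>t. \<integral>s. w m t * w m s * \<kappa> t s)"
      using dual[of "w m"] by (simp add: y_def power2_eq_square ennreal_top_mult)
    also have "... \<le> B * ennreal (K * (1 + real_of_int \<bar>m - m\<bar>) powr (- 2 / q))" by (intro mult_left_mono pair) simp
    also have "... < top" using B by (simp add: ennreal_mult_less_top)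
    finally show False by simp
  qed
  define X where "X = (\<Sum>m\<in>M. epowr (y m) q)"
  have Xc: "(\<integral>\<^sup>+m. epowr (y m) q \<partial>count_space M) = X"
    unfolding X_def by (rule nn_integral_count_space_finite[OF M])
  have Xfin: "X \<noteq> top" unfolding X_def less_top
    using yfin by (subst ennreal_sum_less_top[OF M]) (simp add: less_top[symmetric])
  define c where "c m = epowr (y m) (q - 1) * epowr X (1 / q - 1)" for m
  have cfin: "c m \<noteq> top" for m using yfin Xfin by (simp add: c_def ennreal_mult_eq_top_iff)
  define c' where "c' m = enn2real (c m)" for m
  have cc: "c m = ennreal (c' m)" for m using cfin by (simp add: c'_def less_top)
  have c0: "c' m \<ge> 0" for m by (simp add: c'_def)
  have q1: "q > 1" using q by simp
  have de: "(\<integral>\<^sup>+m. epowr (c m) (q / (q - 1)) \<partial>count_space M) \<le> 1" "(\<integral>\<^sup>+m. y m * c m \<partial>count_space M) = epowr X (1 / q)"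
    using dual_extremizer[OF q1, of y "count_space M", unfolded Xc] Xfin yfin unfolding c_def by auto
  have "ennreal (\<Sum>m\<in>M. c' m powr (q / (q - 1))) = (\<integral>\<^sup>+m. epowr (c m) (q / (q - 1)) \<partial>count_space M)"
    unfolding nn_integral_count_space_finite[OF M] cc using c0 by (subst sum_ennreal[symmetric]) auto
  also note de(1)
  finally have csum: "(\<Sum>m\<in>M. c' m powr (q / (q - 1))) \<le> 1" by simp
  \<comment> \<open>\<open>discrete_hls\<close> is used with the conjugate exponent
    \<open>p = q / (q - 1)\<close>, for which \<open>2/p - 2 = - 2/q\<close>; \<open>q > 2\<close>
    gives the strict \<open>p < 2\<close>.\<close>
  have "q / (q - 1) > 1" "q / (q - 1) < 2" using q by (auto simp: field_simps)
  then have hls: "(\<Sum>m\<in>M. \<Sum>n\<in>M. c' m * c' n * (1 + real_of_int \<bar>m - n\<bar>) powr (- 2 / q)) \<le> 2 * (4 / (1 - 2 / q) + 3)"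
  proof -
    have "2 / (q / (q - 1)) - 2 = - 2 / q" "2 / (q / (q - 1)) - 1 = 1 - 2 / q" using q by (auto simp: field_simps)
    then show ?thesis
      using discrete_hls[OF \<open>q / (q - 1) > 1\<close> \<open>q / (q - 1) < 2\<close> M c0 csum] by (simp only:)
  qed
  define W where "W t = (\<Sum>m\<in>M. c m * w m t)" for t
  have [measurable]: "W \<in> borel_fun" unfolding W_def by measurable
  have "epowr X (1 / q) = (\<Sum>m\<in>M. y m * c m)"
    unfolding de(2)[symmetric] by (rule nn_integral_count_space_finite[OF M])
  also have "... = (\<integral>t. (\<Sum>m\<in>M. S t * w m t * c m))"
    unfolding y_def by (subst nn_integral_sum) (auto intro!: sum.cong nn_integral_multc[symmetric])
  also have "... = (\<integral>t. S t * W t)"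
    unfolding W_def sum_distrib_left by (simp only: mult_ac)
  finally have "(epowr X (1 / q))\<^sup>2 \<le> B * (\<integral>t. \<integral>s. W t * W s * \<kappa> t s)"
    using dual[of W] by simp
  also have "(\<integral>t. \<integral>s. W t * W s * \<kappa> t s) \<le> ennreal (K * (2 * (4 / (1 - 2 / q) + 3)))"
  proof -
    have "(\<integral>t. \<integral>s. W t * W s * \<kappa> t s)
      = (\<integral>t. \<integral>s. (\<Sum>m\<in>M. \<Sum>n\<in>M. (c m * c n) * (w m t * w n s * \<kappa> t s)))"
      unfolding W_def sum_product unfolding sum_distrib_right by (simp only: mult_ac)
    also have "... = (\<Sum>m\<in>M. \<Sum>n\<in>M. (c m * c n) * (\<integral>t. \<integral>s. w m t * w n s * \<kappa> t s))"
      by (simp add: nn_integral_sum nn_integral_cmult)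
    also have "... \<le> (\<Sum>m\<in>M. \<Sum>n\<in>M. (c m * c n) * ennreal (K * (1 + real_of_int \<bar>m - n\<bar>) powr (- 2 / q)))"
      by (intro sum_mono mult_left_mono pair) simp
    also have "... = (\<Sum>m\<in>M. \<Sum>n\<in>M. ennreal (K * (c' m * c' n * (1 + real_of_int \<bar>m - n\<bar>) powr (- 2 / q))))"
      unfolding cc using c0 K by (intro sum.cong refl) (simp add: ennreal_mult'[symmetric] mult_ac)
    also have "... = ennreal (K * (\<Sum>m\<in>M. \<Sum>n\<in>M. c' m * c' n * (1 + real_of_int \<bar>m - n\<bar>) powr (- 2 / q)))"
      using c0 K by (simp add: sum_ennreal sum_nonneg sum_distrib_left)
    also have "... \<le> ennreal (K * (2 * (4 / (1 - 2 / q) + 3)))" by (intro ennreal_leI mult_left_mono hls K)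
    finally show ?thesis .
  qed
  finally have "(epowr X (1 / q))\<^sup>2 \<le> B * ennreal (K * (2 * (4 / (1 - 2 / q) + 3)))" by (simp add: mult_left_mono)
  then show ?thesis using q unfolding X_def[unfolded y_def, symmetric]
    by (subst ennreal_powr_le_powr_iff[symmetric]) (auto simp: power2_le_iff_ennreal_powr)
qed

text \<open>The predicate \<open>P m\<close> describes the functions that are dual to the local norm on the \<open>m\<close>-th
  interval, so that \<open>N m\<close> is that local norm of \<open>S\<close>.\<close>

theorem discrete_norm_le:
  fixes S :: "real => ennreal" and \<kappa> :: "real => real => ennreal" and P :: "int => (real => ennreal) => bool"
  assumes q: "q > 2" and B: "B < top" and K: "K \<ge> 0" and S: "S \<in> borel_fun"
    and \<kappa>: "(\<lambda>(t, s). \<kappa> t s) \<in> borel_measurable (borel \<Otimes>\<^sub>M borel)"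
    and dual: "\<And>w. w \<in> borel_fun ==>
      (\<integral>t. S t * w t)\<^sup>2 \<le> B * (\<integral>t. \<integral>s. w t * w s * \<kappa> t s)"
    and Pm: "\<And>m w. P m w ==> w \<in> borel_fun" and P0: "\<And>m. P m (\<lambda>_. 0)"
    and pair: "\<And>m n w v. P m w ==> P n v ==>
      (\<integral>t. \<integral>s. w t * v s * \<kappa> t s) \<le> ennreal (K * (1 + real_of_int \<bar>m - n\<bar>) powr (- 2 / q))"
    and N: "\<And>m. N m \<le> Sup {(\<integral>t. S t * w t) |w. P m w}"
  shows "(\<Sum>\<^sub>+m. epowr (N m) q)
    \<le> epowr (epowr (B * ennreal (K * (2 * (4 / (1 - 2 / q) + 3)))) (1 / 2)) q"
proof (rule nn_integral_count_space_int_le)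
  fix M :: "int set" assume M: "finite M"
  \<comment> \<open>A sequence with increasing pairings for every \<open>m\<close>, so that a single
    index \<open>j\<close> can be used on all intervals of the finite set and the supremum commutes
    with the sum.\<close>
  have "\<exists>w. (\<forall>j::nat. P m (w j)) \<and> incseq (\<lambda>j. (\<integral>t. S t * w j t)) \<and> N m \<le> (SUP j. (\<integral>t. S t * w j t))" for m
  proof -
    have "{(\<integral>t. S t * w t) |w. P m w} \<noteq> {}" using P0[of m] by blast
    from ennreal_Sup_countable_SUP[OF this] obtain f :: "nat => ennreal"
      where f: "incseq f" "range f \<subseteq> {(\<integral>t. S t * w t) |w. P m w}"
        "Sup {(\<integral>t. S t * w t) |w. P m w} = (SUP i. f i)" by blast
    then have "\<forall>j. \<exists>w. P m w \<and> f j = (\<integral>t. S t * w t)" by blast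
    then obtain w where w: "\<And>j. P m (w j)" "\<And>j. f j = (\<integral>t. S t * w j t)" by metis
    then have "f = (\<lambda>j. (\<integral>t. S t * w j t))" by auto
    then show ?thesis using w(1) f(1,3) N[of m] by auto
  qed
  then obtain w where w: "\<And>m (j::nat). P m (w m j)" "\<And>m. incseq (\<lambda>j. (\<integral>t. S t * w m j t))"
    "\<And>m. N m \<le> (SUP j. (\<integral>t. S t * w m j t))" by metis
  let ?Z = "epowr (epowr (B * ennreal (K * (2 * (4 / (1 - 2 / q) + 3)))) (1 / 2)) q"
  have "(\<Sum>m\<in>M. epowr (N m) q) \<le> (\<Sum>m\<in>M. epowr (SUP j. (\<integral>t. S t * w m j t)) q)"
    using q w(3) by (intro sum_mono ennreal_powr_mono) auto
  also have "... = (\<Sum>m\<in>M. SUP j. epowr (\<integral>t. S t * w m j t) q)"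
    using q by (simp add: ennreal_powr_SUP)
  also have "... = (SUP j. \<Sum>m\<in>M. epowr (\<integral>t. S t * w m j t) q)"
    by (rule ennreal_SUP_sum[symmetric]) (use w(2) q in \<open>auto simp: incseq_def intro!: ennreal_powr_mono\<close>)
  also have "... \<le> ?Z"
  proof (rule SUP_least)
    fix j
    show "(\<Sum>m\<in>M. epowr (\<integral>t. S t * w m j t) q) \<le> ?Z"
      by (rule discrete_norm_le_finite[where w = "\<lambda>m. w m j", OF q B K S \<kappa> dual Pm[OF w(1)] pair[OF w(1) w(1)] M])
  qed
  finally show "(\<Sum>m\<in>M. epowr (N m) q) \<le> ?Z" .
qed

section \<open>Local norms in time: the time kernel on pairs of unit intervals\<close>

lemma indicator_floor_measurable [measurable]:
  fixes g :: "'a => real"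
  assumes "g \<in> borel_measurable M"
  shows "(\<lambda>x. indicator {k} \<lfloor>g x\<rfloor> :: ennreal) \<in> borel_measurable M"
  using measurable_compose[OF measurable_compose[OF assms measurable_real_floor], of "indicator {k}" borel] by simp

lemma emeasure_floor_cell_le: "(\<integral>s. indicator {n} \<lfloor>s::real\<rfloor>) \<le> 1"
proof -
  have "(\<integral>s. indicator {n} \<lfloor>s::real\<rfloor>) \<le> (\<integral>s. indicator {of_int n..of_int n + 1 :: real} s)"
    by (intro nn_integral_mono) (auto split: split_indicator simp: floor_eq_iff)
  then show ?thesis by simp
qed

text \<open>For lags up to 2 the singularity is integrable since \<open>b * e < 1\<close>; beyond,
  the weight is at most 2 on an interval of unit length. The constant does not depend on
  \<open>t\<close> or on the interval.\<close>

lemma sing_weight_cell: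
  assumes b: "b \<ge> 0" and e: "e \<ge> 1" and be: "b * e < 1"
  shows "\<exists>E>0. \<forall>t n. (\<integral>s. ennreal (sing_weight b (t - s) powr e) * indicator {n} \<lfloor>s\<rfloor>) \<le> ennreal E"
proof -
  define g where "g u = inv_power (b * e) u * indicator {-2..2} u" for u :: real
  have [measurable]: "g \<in> borel_fun" unfolding g_def by measurable
  define I where "I = (\<integral>u. g u)"
  have "I < top" unfolding I_def g_def using assms by (intro nn_integral_inv_power_finite) auto
  then obtain i where i: "I = ennreal i" "i \<ge> 0" by (cases I) auto
  have shift: "(\<integral>s. g (t - s)) = I" for t
    unfolding I_def using nn_integral_real_affine[of g "- 1" t] by simp
  have bound: "ennreal (sing_weight b u powr e) \<le> ennreal (2 powr e) * (2 + g u)" for u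
  proof (cases "b = 0")
    case True
    have "ennreal (2 powr e) * 1 \<le> ennreal (2 powr e) * (2 + g u)"
      by (intro mult_left_mono add_increasing2) auto
    then show ?thesis using True by (simp add: sing_weight_def)
  next
    case False
    define x where "x = \<bar>u\<bar> powr (- b)"
    have x: "x \<ge> 0" by (simp add: x_def)
    have "sing_weight b u powr e \<le> (2 * max 1 x) powr e"
      using False x e by (intro powr_mono2) (auto simp: sing_weight_def x_def)
    also have "... = 2 powr e * max 1 x powr e" by (simp add: powr_mult)
    also have "... \<le> 2 powr e * (1 + x powr e)"
      by (intro mult_left_mono) (auto simp: max_def)
    finally have 1: "ennreal (sing_weight b u powr e) \<le> ennreal (2 powr e) * ennreal (1 + x powr e)"
      by (subst ennreal_mult'[symmetric]) (auto intro: ennreal_leI)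
    have "ennreal (x powr e) \<le> 1 + g u"
    proof (cases "u = 0 \<or> \<bar>u\<bar> \<le> 2")
      case True
      then show ?thesis
        by (auto simp: g_def inv_power_def x_def powr_powr intro: add_increasing split: split_indicator)
    next
      case F: False
      have "x powr e = \<bar>u\<bar> powr (- (b * e))" by (simp add: x_def powr_powr)
      also have "... \<le> \<bar>u\<bar> powr 0" using F b e by (intro powr_mono) auto
      finally have "x powr e \<le> 1" using F by simp
      then show ?thesis by (intro order_trans[OF _ add_increasing2[of "g u" 1 1]]) auto
    qed
    then have "1 + ennreal (x powr e) \<le> 1 + (1 + g u)" by (rule add_left_mono)
    then have "ennreal (1 + x powr e) \<le> 2 + g u" by (simp add: add.assoc[symmetric])
    with 1 show ?thesis by (elim order_trans) (intro mult_left_mono, auto)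
  qed
  define E where "E = 2 powr e * (2 + i)"
  have "(\<integral>s. ennreal (sing_weight b (t - s) powr e) * indicator {n} \<lfloor>s\<rfloor>) \<le> ennreal E" for t n
  proof -
    have "(\<integral>s. ennreal (sing_weight b (t - s) powr e) * indicator {n} \<lfloor>s\<rfloor>)
      \<le> (\<integral>s. ennreal (2 powr e) * (2 * indicator {n} \<lfloor>s\<rfloor> + g (t - s)))"
      using bound by (intro nn_integral_mono) (auto split: split_indicator)
    also have "... = ennreal (2 powr e) * (2 * (\<integral>s. indicator {n} \<lfloor>s::real\<rfloor>) + I)"
      by (subst nn_integral_cmult, measurable, subst nn_integral_add, measurable, subst nn_integral_cmult, measurable)
         (simp only: shift)
    also have "... \<le> ennreal (2 powr e) * (2 * 1 + I)"
      by (intro mult_left_mono add_right_mono emeasure_floor_cell_le) auto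
    also have "... = ennreal E" using i(2)
      by (simp add: i(1) E_def ennreal_mult' ennreal_plus)
    finally show ?thesis .
  qed
  moreover have "E > 0" using i(2) by (auto simp: E_def)
  ultimately show ?thesis by blast
qed

text \<open>The floors differ by at most \<open>|t - s| + 1\<close>, so \<open>1 + |m - n|\<close>
  is at most twice \<open>1 + |t - s|\<close>.\<close>

lemma decay_on_cells:
  assumes "d \<ge> 0" "\<lfloor>t\<rfloor> = m" "\<lfloor>s\<rfloor> = n"
  shows "(1 + \<bar>t - s\<bar>) powr (- d) \<le> 2 powr d * (1 + real_of_int \<bar>m - n\<bar>) powr (- d)"
proof -
  have "of_int m \<le> t" "t < of_int m + 1" "of_int n \<le> s" "s < of_int n + 1" using assms by (auto simp: floor_eq_iff)
  then have "(1 + real_of_int \<bar>m - n\<bar>) / 2 \<le> 1 + \<bar>t - s\<bar>" by (auto simp: field_simps abs_if split: if_splits)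
  then have "(1 + \<bar>t - s\<bar>) powr (- d) \<le> ((1 + real_of_int \<bar>m - n\<bar>) / 2) powr (- d)"
    using assms by (intro powr_mono2') auto
  also have "... = 2 powr d * (1 + real_of_int \<bar>m - n\<bar>) powr (- d)"
    by (simp add: powr_divide powr_minus_divide)
  finally show ?thesis .
qed

lemma borel_measurable_sing_weight [measurable]:
  assumes [measurable]: "f \<in> borel_measurable M"
  shows "(\<lambda>x. sing_weight b (f x)) \<in> borel_measurable M"
  unfolding sing_weight_def by measurable

definition time_kernel :: "real => real => real => real => ennreal" where
  "time_kernel C b d \<tau> = ennreal (C * sing_weight b \<tau> * (1 + \<bar>\<tau>\<bar>) powr (- d))"

lemma borel_measurable_time_kernel [measurable]:
  assumes [measurable]: "f \<in> borel_measurable M"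
  shows "(\<lambda>x. time_kernel C b d (f x)) \<in> borel_measurable M"
  unfolding time_kernel_def by measurable

text \<open>What the spatial analysis delivers for the amalgam norm as a function of time: a dual
  quadratic estimate with the kernel left after summing over the cubes.\<close>

definition time_form_bounded :: "real => real => real => (real => ennreal) => ennreal => bool" where
  "time_form_bounded C b d S B \<longleftrightarrow> S \<in> borel_fun \<and> B < top \<and> (\<forall>w. w \<in> borel_fun \<longrightarrow>
    (\<integral>t. S t * w t)\<^sup>2 \<le> B * (\<integral>t. \<integral>s. w t * w s * time_kernel C b d (t - s)))"

lemma time_kernel_cells:
  assumes "C > 0" "d \<ge> 0" "\<lfloor>t\<rfloor> = m" "\<lfloor>s\<rfloor> = n"
  shows "time_kernel C b d (t - s) \<le> ennreal (C * 2 powr d * (1 + real_of_int \<bar>m - n\<bar>) powr (- d) * sing_weight b (t - s))"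
proof -
  have "C * sing_weight b (t - s) * (1 + \<bar>t - s\<bar>) powr (- d)
    \<le> C * sing_weight b (t - s) * (2 powr d * (1 + real_of_int \<bar>m - n\<bar>) powr (- d))"
    using assms sing_weight_ge_1[of b "t - s"] by (intro mult_left_mono decay_on_cells) auto
  then show ?thesis unfolding time_kernel_def by (intro ennreal_leI) (simp add: mult_ac)
qed

text \<open>On a pair of unit intervals the decay is essentially constant and factors out; Young's
  inequality with exponent \<open>qs / 2\<close> handles the remaining singular weight because
  \<open>b * (qs / 2) < 1\<close>.\<close>

lemma time_norm_le_finite:
  fixes q qs :: real
  assumes q: "q > 2" and qs: "qs \<ge> 2" and C: "C > 0" and b: "b \<ge> 0" "b * (qs / 2) < 1"
  shows "\<exists>D>0. \<forall>S B. time_form_bounded C b (2 / q) S B \<longrightarrow>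
    (\<Sum>\<^sub>+m. epowr (epowr (\<integral>t. epowr (S t * indicator {m} \<lfloor>t\<rfloor>) qs) (1 / qs)) q)
      \<le> epowr (epowr (B * ennreal D) (1 / 2)) q"
proof -
  define e where "e = qs / 2"
  have e: "e \<ge> 1" using qs by (simp add: e_def)
  obtain E where E: "E > 0" "\<And>t n. (\<integral>s. ennreal (sing_weight b (t - s) powr e) * indicator {n} \<lfloor>s\<rfloor>) \<le> ennreal E"
    using sing_weight_cell[OF b(1) e] b(2) unfolding e_def by blast
  define K where "K = C * 2 powr (2 / q) * E powr (1 / e)"
  have K: "K > 0" unfolding K_def using C E(1) by simp
  define D where "D = K * (2 * (4 / (1 - 2 / q) + 3))"
  have D: "D > 0" unfolding D_def using K q by (intro mult_pos_pos add_pos_pos divide_pos_pos) auto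
  define ps where "ps = qs / (qs - 1)"
  have ps: "ps > 1" "ps \<le> 2" "qs = ps / (ps - 1)" using qs by (auto simp: ps_def field_simps)
  \<comment> \<open>The unit ball of the conjugate \<open>L^ps\<close> on the \<open>m\<close>-th
    interval, whose pairings with \<open>S\<close> recover the local \<open>L^qs\<close>
    norm.\<close>
  define P where "P m w \<longleftrightarrow> w \<in> borel_fun \<and> (\<forall>t. w t = w t * indicator {m} \<lfloor>t\<rfloor>) \<and> (\<integral>t. epowr (w t) ps) \<le> 1"
    for m :: int and w :: "real => ennreal"
  have "(\<Sum>\<^sub>+m. epowr (epowr (\<integral>t. epowr (S t * indicator {m} \<lfloor>t\<rfloor>) qs) (1 / qs)) q)
      \<le> epowr (epowr (B * ennreal (K * (2 * (4 / (1 - 2 / q) + 3)))) (1 / 2)) q"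
    if bd: "time_form_bounded C b (2 / q) S B" for S B
  proof (rule discrete_norm_le[where P = P, OF q])
    show S [measurable]: "S \<in> borel_fun" and "B < top" using bd by (auto simp: time_form_bounded_def)
    show "(\<integral>t. S t * w t)\<^sup>2 \<le> B * (\<integral>t. \<integral>s. w t * w s * time_kernel C b (2 / q) (t - s))"
      if "w \<in> borel_fun" for w using bd that by (simp add: time_form_bounded_def)
    show "K \<ge> 0" using K by simp
    show "(\<lambda>(t, s). time_kernel C b (2 / q) (t - s)) \<in> borel_measurable (borel \<Otimes>\<^sub>M borel)" by measurable
    show "w \<in> borel_fun" if "P m w" for m w using that by (simp add: P_def)
    show "P m (\<lambda>_. 0)" for m by (simp add: P_def)
    show "(\<integral>t. \<integral>s. w t * v s * time_kernel C b (2 / q) (t - s)) \<le> ennreal (K * (1 + real_of_int \<bar>m - n\<bar>) powr (- 2 / q))"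
      if w: "P m w" and v: "P n v" for m n w v
    proof -
      have [measurable]: "w \<in> borel_fun" "v \<in> borel_fun" using w v by (auto simp: P_def)
      define k where "k t s = time_kernel C b (2 / q) (t - s) * (indicator {m} \<lfloor>t\<rfloor> * indicator {n} \<lfloor>s\<rfloor>)" for t s
      define A where "A = C * 2 powr (2 / q) * (1 + real_of_int \<bar>m - n\<bar>) powr (- 2 / q)"
      have A: "A > 0" unfolding A_def using C by simp
      have kb: "epowr (k t s) e \<le> ennreal (A powr e) * (ennreal (sing_weight b (t - s) powr e) * (indicator {m} \<lfloor>t\<rfloor> * indicator {n} \<lfloor>s\<rfloor>))" for t s
      proof (cases "\<lfloor>t\<rfloor> = m \<and> \<lfloor>s\<rfloor> = n")
        case True
        have "k t s \<le> ennreal (A * sing_weight b (t - s))"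
          using time_kernel_cells[OF C, of "2 / q" t m s n b] True q by (simp add: k_def A_def)
        then have "epowr (k t s) e \<le> epowr (ennreal (A * sing_weight b (t - s))) e"
          using e by (intro ennreal_powr_mono) auto
        also have "... = ennreal ((A * sing_weight b (t - s)) powr e)"
          using A sing_weight_ge_1[of b "t - s"] by (intro ennreal_powr_ennreal) simp
        also have "... = ennreal (A powr e) * ennreal (sing_weight b (t - s) powr e)"
          using A sing_weight_ge_1[of b "t - s"] by (simp add: powr_mult ennreal_mult')
        finally show ?thesis using True by simp
      next
        case False
        then have "k t s = 0" by (auto simp: k_def)
        then show ?thesis by simp
      qed
      have KA: "K * (1 + real_of_int \<bar>m - n\<bar>) powr (- 2 / q) = A * E powr (1 / e)"
        by (simp add: K_def A_def mult_ac)
      have KAe: "(A * E powr (1 / e)) powr e = A powr e * E" using A E(1) e by (simp add: powr_mult powr_powr)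
      have "(\<integral>t. \<integral>s. w t * v s * k t s) \<le> ennreal (A * E powr (1 / e))"
      proof (rule trilinear_young[OF sigma_finite_lborel sigma_finite_lborel ps])
        show "A * E powr (1 / e) > 0" using A E(1) by simp
        show "(\<lambda>(x, y). k x y) \<in> borel_measurable (lborel \<Otimes>\<^sub>M lborel)" unfolding k_def by measurable
        show "(\<integral>t. epowr (w t) ps) \<le> 1" "(\<integral>s. epowr (v s) ps) \<le> 1" using w v by (auto simp: P_def)
        have kE: "(\<integral>s. g s) \<le> ennreal ((A * E powr (1 / e)) powr (qs / 2))"
          if g: "\<And>s. g s \<le> ennreal (A powr e) * (ennreal (sing_weight b (t - s) powr e) * indicator {l} \<lfloor>s\<rfloor>)" for g t l
        proof -
          have "(\<integral>s. g s) \<le> ennreal (A powr e) * (\<integral>s. ennreal (sing_weight b (t - s) powr e) * indicator {l} \<lfloor>s\<rfloor>)"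
            using g by (subst nn_integral_cmult[symmetric], measurable) (rule nn_integral_mono)
          also have "... \<le> ennreal (A powr e) * ennreal E" by (intro mult_left_mono E(2)) simp
          finally show ?thesis unfolding e_def[symmetric] KAe by (simp add: ennreal_mult')
        qed
        show "(\<integral>s. epowr (k t s) (qs / 2)) \<le> ennreal ((A * E powr (1 / e)) powr (qs / 2))" for t
          unfolding e_def[symmetric] by (rule kE[of _ t n, unfolded e_def[symmetric]], rule order_trans[OF kb]) (auto split: split_indicator)
        show "(\<integral>t. epowr (k t s) (qs / 2)) \<le> ennreal ((A * E powr (1 / e)) powr (qs / 2))" for s
          unfolding e_def[symmetric] by (rule kE[of _ s m, unfolded e_def[symmetric]], rule order_trans[OF kb])
            (auto simp: sing_weight_def abs_minus_commute split: split_indicator)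
      qed measurable
      moreover have "w t * v s * time_kernel C b (2 / q) (t - s) = w t * v s * k t s" for t s
      proof -
        have "w t = w t * indicator {m} \<lfloor>t\<rfloor>" "v s = v s * indicator {n} \<lfloor>s\<rfloor>" using w v by (auto simp: P_def)
        then show ?thesis unfolding k_def by (auto split: split_indicator)
      qed
      ultimately show ?thesis by (simp only: KA)
    qed
    fix m
    \<comment> \<open>The local norm of \<open>S\<close> may be infinite a priori, so extremizers
      are taken for its bounded truncations.\<close>
    define f where "f k t = ennreal (enn2real (min (S t) (of_nat k)) * indicator (cball 0 (real k)) t) * indicator {m} \<lfloor>t\<rfloor>" for k :: nat and t
    have [measurable]: "f k \<in> borel_fun" for k unfolding f_def by measurable
    have fS: "(SUP k. f k t) = S t * indicator {m} \<lfloor>t\<rfloor>" and finc: "incseq (\<lambda>k. f k t)" for t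
    proof -
      show "(SUP k. f k t) = S t * indicator {m} \<lfloor>t\<rfloor>"
        unfolding f_def SUP_mult_right_ennreal[symmetric] by (simp add: ennreal_truncation_SUP(2))
      show "incseq (\<lambda>k. f k t)" using ennreal_truncation_SUP(1)[of "S t" t]
        unfolding f_def incseq_def by (auto intro!: mult_right_mono)
    qed
    have qs0: "qs > 0" "qs > 1" using qs by auto
    have "(\<integral>t. epowr (S t * indicator {m} \<lfloor>t\<rfloor>) qs) = (\<integral>t. (SUP k. epowr (f k t) qs))"
      unfolding fS[symmetric] using qs0 by (simp add: ennreal_powr_SUP)
    also have "... = (SUP k. (\<integral>t. epowr (f k t) qs))"
      using finc qs0 by (intro nn_integral_monotone_convergence_SUP) (auto simp: incseq_def le_fun_def intro!: ennreal_powr_mono)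
    finally have "epowr (\<integral>t. epowr (S t * indicator {m} \<lfloor>t\<rfloor>) qs) (1 / qs)
      = (SUP k. epowr (\<integral>t. epowr (f k t) qs) (1 / qs))"
      using qs0 by (simp add: ennreal_powr_SUP)
    also have "... \<le> Sup {(\<integral>t. S t * w t) |w. P m w}"
    proof (rule SUP_least)
      fix k :: nat
      have ffin: "f k t \<noteq> top" for t unfolding f_def by (auto split: split_indicator)
      have fle: "f k t \<le> ennreal (real k) * indicator {m} \<lfloor>t\<rfloor>" for t
      proof -
        have "enn2real (min (S t) (of_nat k)) \<le> real k"
          by (intro enn2real_leI) (auto simp: ennreal_of_nat_eq_real_of_nat)
        then show ?thesis unfolding f_def by (intro mult_right_mono ennreal_leI) (auto split: split_indicator)
      qed
      have "(\<integral>t. epowr (f k t) qs) \<le> (\<integral>t. ennreal (real k powr qs) * indicator {m} \<lfloor>t::real\<rfloor>)"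
      proof (intro nn_integral_mono)
        fix t
        have "epowr (f k t) qs \<le> epowr (ennreal (real k) * indicator {m} \<lfloor>t\<rfloor>) qs"
          using qs0 fle by (intro ennreal_powr_mono) auto
        then show "epowr (f k t) qs \<le> ennreal (real k powr qs) * indicator {m} \<lfloor>t\<rfloor>"
          by (auto split: split_indicator)
      qed
      also have "... = ennreal (real k powr qs) * (\<integral>t. indicator {m} \<lfloor>t::real\<rfloor>)" by (rule nn_integral_cmult) measurable
      also have "... \<le> ennreal (real k powr qs) * 1" by (intro mult_left_mono emeasure_floor_cell_le) simp
      finally have fin: "(\<integral>t. epowr (f k t) qs) \<noteq> top"
        by (auto simp: top_unique)
      define w where "w t = epowr (f k t) (qs - 1) * epowr (\<integral>t. epowr (f k t) qs) (1 / qs - 1)" for t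
      note de = dual_extremizer[OF qs0(2) _ fin ffin, folded w_def]
      have "P m w"
        unfolding P_def
      proof (intro conjI allI)
        show "w \<in> borel_fun" unfolding w_def by measurable
        show "w t = w t * indicator {m} \<lfloor>t\<rfloor>" for t
          unfolding w_def f_def by (auto split: split_indicator)
        show "(\<integral>t. epowr (w t) ps) \<le> 1" unfolding ps_def by (rule de(1)) measurable
      qed
      have "epowr (\<integral>t. epowr (f k t) qs) (1 / qs) = (\<integral>t. f k t * w t)"
        by (rule de(2)[symmetric]) measurable
      also have "... \<le> (\<integral>t. S t * w t)"
      proof (intro nn_integral_mono mult_right_mono)
        fix t
        have "f k t \<le> (SUP k. f k t)" by (rule SUP_upper) simp
        also have "... \<le> S t" unfolding fS by (auto split: split_indicator)
        finally show "f k t \<le> S t" .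
      qed simp
      also have "... \<le> Sup {(\<integral>t. S t * w t) |w. P m w}" using \<open>P m w\<close> by (intro Sup_upper) blast
      finally show "epowr (\<integral>t. epowr (f k t) qs) (1 / qs) \<le> Sup {(\<integral>t. S t * w t) |w. P m w}" .
    qed
    finally show "epowr (\<integral>t. epowr (S t * indicator {m} \<lfloor>t\<rfloor>) qs) (1 / qs)
      \<le> Sup {(\<integral>t. S t * w t) |w. P m w}" .
  qed
  then show ?thesis using D unfolding D_def by blast
qed

text \<open>With \<open>b = 0\<close> the kernel is bounded on pairs of intervals, so the unit ball
  of \<open>L^1\<close> can be used; the factor 2 in \<open>K\<close> is the value of
  \<open>sing_weight 0\<close>.\<close>

lemma time_norm_le_esssup:
  fixes q :: real
  assumes q: "q > 2" and C: "C > 0"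
  shows "\<exists>D>0. \<forall>S B. time_form_bounded C 0 (2 / q) S B \<longrightarrow>
    (\<Sum>\<^sub>+m. epowr (esssup lborel (\<lambda>t. S t * indicator {m} \<lfloor>t\<rfloor>)) q)
      \<le> epowr (epowr (B * ennreal D) (1 / 2)) q"
proof -
  define K where "K = C * 2 powr (2 / q) * 2"
  have K: "K > 0" unfolding K_def using C by simp
  define D where "D = K * (2 * (4 / (1 - 2 / q) + 3))"
  have D: "D > 0" unfolding D_def using K q by (intro mult_pos_pos add_pos_pos divide_pos_pos) auto
  define P where "P m w \<longleftrightarrow> w \<in> borel_fun \<and> (\<forall>t. w t = w t * indicator {m} \<lfloor>t\<rfloor>) \<and> (\<integral>t. w t) \<le> 1"
    for m :: int and w :: "real => ennreal"
  have "(\<Sum>\<^sub>+m. epowr (esssup lborel (\<lambda>t. S t * indicator {m} \<lfloor>t\<rfloor>)) q)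
      \<le> epowr (epowr (B * ennreal (K * (2 * (4 / (1 - 2 / q) + 3)))) (1 / 2)) q"
    if bd: "time_form_bounded C 0 (2 / q) S B" for S B
  proof (rule discrete_norm_le[where P = P, OF q])
    show S [measurable]: "S \<in> borel_fun" and "B < top" using bd by (auto simp: time_form_bounded_def)
    show "(\<integral>t. S t * w t)\<^sup>2 \<le> B * (\<integral>t. \<integral>s. w t * w s * time_kernel C 0 (2 / q) (t - s))"
      if "w \<in> borel_fun" for w using bd that by (simp add: time_form_bounded_def)
    show "K \<ge> 0" using K by simp
    show "(\<lambda>(t, s). time_kernel C 0 (2 / q) (t - s)) \<in> borel_measurable (borel \<Otimes>\<^sub>M borel)" by measurable
    show "w \<in> borel_fun" if "P m w" for m w using that by (simp add: P_def)
    show "P m (\<lambda>_. 0)" for m by (simp add: P_def)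
    show "(\<integral>t. \<integral>s. w t * v s * time_kernel C 0 (2 / q) (t - s)) \<le> ennreal (K * (1 + real_of_int \<bar>m - n\<bar>) powr (- 2 / q))"
      if w: "P m w" and v: "P n v" for m n w v
    proof -
      have [measurable]: "w \<in> borel_fun" "v \<in> borel_fun" using w v by (auto simp: P_def)
      let ?A = "ennreal (K * (1 + real_of_int \<bar>m - n\<bar>) powr (- 2 / q))"
      have "w t * v s * time_kernel C 0 (2 / q) (t - s) \<le> ?A * (w t * v s)" for t s
      proof (cases "\<lfloor>t\<rfloor> = m \<and> \<lfloor>s\<rfloor> = n")
        case True
        have "time_kernel C 0 (2 / q) (t - s) \<le> ?A"
          using time_kernel_cells[OF C, of "2 / q" t m s n 0] True q by (simp add: K_def sing_weight_def mult_ac)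
        then have "(w t * v s) * time_kernel C 0 (2 / q) (t - s) \<le> (w t * v s) * ?A" by (rule mult_left_mono) simp
        then show ?thesis by (simp only: mult.commute)
      next
        case False
        have "w t = w t * indicator {m} \<lfloor>t\<rfloor>" "v s = v s * indicator {n} \<lfloor>s\<rfloor>" using w v by (auto simp: P_def)
        then have "w t * v s = 0" using False by (auto split: split_indicator_asm)
        then show ?thesis by auto
      qed
      then have "(\<integral>t. \<integral>s. w t * v s * time_kernel C 0 (2 / q) (t - s)) \<le> (\<integral>t. \<integral>s. ?A * (w t * v s))"
        by (intro nn_integral_mono)
      also have "... = ?A * ((\<integral>t. w t) * (\<integral>s. v s))"
        by (simp add: nn_integral_cmult nn_integral_multc)
      also have "... \<le> ?A * (1 * 1)" using w v by (intro mult_left_mono mult_mono) (auto simp: P_def)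
      finally show ?thesis by simp
    qed
    fix m
    define g where "g t = S t * indicator {m} \<lfloor>t\<rfloor>" for t
    have [measurable]: "g \<in> borel_fun" unfolding g_def by measurable
    have "esssup lborel g \<le> Sup {(\<integral>t. S t * w t) |w. P m w}"
    \<comment> \<open>Below the essential supremum every level \<open>z\<close> is exceeded on a set
      of positive measure, and the normalized indicator of that set is a test function whose pairing
      is at least \<open>z\<close>.\<close>
    proof (rule dense_le)
      fix z assume "z < esssup lborel g"
      then have pos: "emeasure lborel {t \<in> space lborel. g t > z} > 0" by (intro esssup_pos_measure) auto
      define E where "E = {t. g t > z}"
      have Em [measurable]: "E \<in> sets borel" unfolding E_def by measurable
      have Em0: "emeasure lborel E > 0" using pos by (simp add: E_def)
      have Ecell: "\<lfloor>t\<rfloor> = m" if "t \<in> E" for t using that by (auto simp: E_def g_def split: split_indicator_asm)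
      have "emeasure lborel E = (\<integral>t. indicator E t)" by simp
      also have "... \<le> (\<integral>t. indicator {m} \<lfloor>t::real\<rfloor>)"
        by (intro nn_integral_mono) (auto split: split_indicator dest: Ecell)
      also have "... \<le> 1" by (rule emeasure_floor_cell_le)
      finally obtain u where u: "emeasure lborel E = ennreal u" "u > 0"
        using Em0 by (cases "emeasure lborel E") (auto simp: top_unique)
      define w where "w t = ennreal (1 / u) * indicator E t" for t
      have 1: "ennreal (1 / u) * emeasure lborel E = 1" using u by (simp add: ennreal_mult'[symmetric])
      have "P m w"
        unfolding P_def w_def using 1 Ecell by (auto simp: nn_integral_cmult split: split_indicator)
      have "z = (\<integral>t. z * w t)"
        unfolding w_def by (simp add: nn_integral_cmult 1)
      also have "... \<le> (\<integral>t. S t * w t)"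
      proof (intro nn_integral_mono)
        fix t
        show "z * w t \<le> S t * w t"
          by (cases "t \<in> E") (auto simp: w_def E_def g_def intro!: mult_right_mono split: split_indicator_asm)
      qed
      also have "... \<le> Sup {(\<integral>t. S t * w t) |w. P m w}" using \<open>P m w\<close> by (intro Sup_upper) blast
      finally show "z \<le> Sup {(\<integral>t. S t * w t) |w. P m w}" .
    qed
    then show "esssup lborel (\<lambda>t. S t * indicator {m} \<lfloor>t\<rfloor>) \<le> Sup {(\<integral>t. S t * w t) |w. P m w}"
      by (simp add: g_def[abs_def])
  qed
  then show ?thesis using D unfolding D_def by blast
qed

section \<open>Wiener norms\<close>

lemma Lp_norm_finite_eq:
  assumes "p \<noteq> top" "h \<in> borel_measurable lebesgue"
  shows "Lp_norm p h = epowr (\<integral>x. epowr (h x) (enn2real p)) (1 / enn2real p)"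
  using assms by (simp add: Lp_norm_def nn_integral_completion)

lemma borel_measurable_lebesgueI: "h \<in> borel_fun ==> h \<in> borel_measurable lebesgue"
  by (rule measurable_completion) simp

lemma esssup_le_iff:
  fixes h :: "'a => ennreal"
  assumes "h \<in> borel_measurable M" shows "esssup M h \<le> c \<longleftrightarrow> (AE x in M. h x \<le> c)"
proof
  assume "esssup M h \<le> c"
  with esssup_AE[of h M] show "AE x in M. h x \<le> c" by (auto elim: eventually_mono)
qed (rule esssup_I[OF assms])

lemma esssup_lebesgue_eq:
  fixes h :: "'a::euclidean_space => ennreal"
  assumes h: "h \<in> borel_fun" shows "esssup lebesgue h = esssup lborel h"
proof -
  have "esssup lebesgue h \<le> c \<longleftrightarrow> esssup lborel h \<le> c" for c
    using h by (simp add: esssup_le_iff borel_measurable_lebesgueI AE_completion_iff)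
  then show ?thesis by (meson antisym order_refl)
qed

lemma Lp_norm_top_eq:
  assumes "h \<in> borel_fun" shows "Lp_norm top h = esssup lborel h"
  using assms by (simp add: Lp_norm_def esssup_lebesgue_eq)

lemma Lp_norm_mono:
  assumes p: "p > 0" and f: "f \<in> borel_measurable lebesgue" and le: "\<And>x. f x \<le> g x"
  shows "Lp_norm p f \<le> Lp_norm p g"
proof (cases "p = top")
  case True
  then show ?thesis using esssup_mono[OF f le] by (simp add: Lp_norm_def)
next
  case False
  have "enn2real p > 0" using False p by (simp add: enn2real_positive_iff less_top)
  then have "g \<in> borel_measurable lebesgue ==> ?thesis" using False f le
    by (auto simp: Lp_norm_finite_eq intro!: ennreal_powr_mono nn_integral_mono)
  moreover have "g \<notin> borel_measurable lebesgue ==> ?thesis" using False by (simp add: Lp_norm_def[of p g])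
  ultimately show ?thesis by blast
qed

lemma Lp_norm_cong_AE:
  assumes "f \<in> borel_measurable lebesgue" "g \<in> borel_measurable lebesgue" "p \<noteq> top" "AE x in lborel. f x = g x"
  shows "Lp_norm p f = Lp_norm p g"
proof -
  have "(\<integral>x. epowr (f x) (enn2real p)) = (\<integral>x. epowr (g x) (enn2real p))"
    using assms(4) by (intro nn_integral_cong_AE) auto
  then show ?thesis using assms by (simp add: Lp_norm_finite_eq)
qed

lemma Lp_norm_cmult_le:
  assumes p: "p > 0" and h [measurable]: "h \<in> borel_fun"
  shows "Lp_norm p (\<lambda>x. c * h x) \<le> c * Lp_norm p h"
proof (cases "p = top")
  case True
  have [measurable]: "h \<in> borel_measurable lborel" using h by simp
  have "AE x in lborel. c * h x \<le> c * esssup lborel h"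
    using esssup_AE[of h lborel] by eventually_elim (rule mult_left_mono, auto)
  then show ?thesis unfolding True by (subst (1 2) Lp_norm_top_eq) (auto intro!: esssup_I)
next
  case False
  have e: "enn2real p > 0" using False p by (simp add: enn2real_positive_iff less_top)
  have m: "(\<lambda>x. c * h x) \<in> borel_measurable lebesgue" "h \<in> borel_measurable lebesgue"
    by (rule borel_measurable_lebesgueI, measurable)+
  have "Lp_norm p (\<lambda>x. c * h x) = epowr (epowr c (enn2real p) * (\<integral>x. epowr (h x) (enn2real p))) (1 / enn2real p)"
    unfolding Lp_norm_finite_eq[OF False m(1)] ennreal_powr_mult by (subst nn_integral_cmult) (auto simp: ennreal_powr_mult)
  also have "... = c * Lp_norm p h"
    unfolding Lp_norm_finite_eq[OF False m(2)] ennreal_powr_mult using e by simp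
  finally show ?thesis by simp
qed

text \<open>\<open>ennreal_powr_sum_le\<close> inside and outside the integral costs
  \<open>n\<close> times \<open>n powr (1 / e)\<close> for \<open>n\<close> summands, which is at
  most \<open>(n + 1)^2\<close>; a constant depending on \<open>card J\<close> alone is
  sufficient.\<close>

lemma Lp_norm_sum_le:
  assumes p: "p \<ge> 1" and J: "finite J" and f [measurable]: "\<And>j. f j \<in> borel_fun"
  shows "Lp_norm p (\<lambda>x. \<Sum>j\<in>J. f j x) \<le> ennreal ((real (card J) + 1)\<^sup>2) * (\<Sum>j\<in>J. Lp_norm p (f j))"
proof (cases "p = top")
  case True
  have "AE x in lborel. \<forall>j\<in>J. f j x \<le> esssup lborel (f j)"
    using J esssup_AE by (intro AE_finite_allI) auto
  then have "AE x in lborel. (\<Sum>j\<in>J. f j x) \<le> (\<Sum>j\<in>J. esssup lborel (f j))"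
    by eventually_elim (intro sum_mono, auto)
  then have "esssup lborel (\<lambda>x. \<Sum>j\<in>J. f j x) \<le> (\<Sum>j\<in>J. esssup lborel (f j))"
    by (intro esssup_I) auto
  also have "... \<le> ennreal ((real (card J) + 1)\<^sup>2) * (\<Sum>j\<in>J. esssup lborel (f j))"
  proof -
    have "(1::real) \<le> (real (card J) + 1)\<^sup>2" by (intro one_le_power) simp
    then have "1 * (\<Sum>j\<in>J. esssup lborel (f j)) \<le> ennreal ((real (card J) + 1)\<^sup>2) * (\<Sum>j\<in>J. esssup lborel (f j))"
      by (intro mult_right_mono) auto
    then show ?thesis by simp
  qed
  finally show ?thesis unfolding True by (simp add: Lp_norm_top_eq)
next
  case False
  define e where "e = enn2real p"
  have e: "e \<ge> 1" using False p enn2real_mono[of 1 p] by (simp add: e_def less_top)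
  have m: "(\<lambda>x. \<Sum>j\<in>J. f j x) \<in> borel_measurable lebesgue" "\<And>j. f j \<in> borel_measurable lebesgue"
    by (rule borel_measurable_lebesgueI, measurable)+
  let ?n = "real (card J)"
  have "Lp_norm p (\<lambda>x. \<Sum>j\<in>J. f j x) = epowr (\<integral>x. epowr (\<Sum>j\<in>J. f j x) e) (1 / e)"
    unfolding Lp_norm_finite_eq[OF False m(1)] e_def ..
  also have "... \<le> epowr (\<integral>x. ennreal (?n powr e) * (\<Sum>j\<in>J. epowr (f j x) e)) (1 / e)"
    using e J by (intro ennreal_powr_mono nn_integral_mono ennreal_powr_sum_le) auto
  also have "(\<integral>x. ennreal (?n powr e) * (\<Sum>j\<in>J. epowr (f j x) e))
    = ennreal (?n powr e) * (\<Sum>j\<in>J. (\<integral>x. epowr (f j x) e))"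
    by (simp add: nn_integral_cmult nn_integral_sum)
  also have "epowr ... (1 / e) = ennreal ?n * epowr (\<Sum>j\<in>J. (\<integral>x. epowr (f j x) e)) (1 / e)"
    using e by (simp add: ennreal_powr_mult powr_powr)
  also have "... \<le> ennreal ?n * (ennreal (?n powr (1 / e)) * (\<Sum>j\<in>J. epowr (\<integral>x. epowr (f j x) e) (1 / e)))"
    using e J by (intro mult_left_mono ennreal_powr_sum_le) auto
  also have "... = ennreal (?n * ?n powr (1 / e)) * (\<Sum>j\<in>J. Lp_norm p (f j))"
    unfolding Lp_norm_finite_eq[OF False m(2)] e_def by (simp add: ennreal_mult' mult.assoc)
  also have "... \<le> ennreal ((?n + 1)\<^sup>2) * (\<Sum>j\<in>J. Lp_norm p (f j))"
  proof (intro mult_right_mono ennreal_leI)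
    have "?n powr (1 / e) \<le> (?n + 1) powr (1 / e)" using e by (intro powr_mono2) auto
    also have "... \<le> (?n + 1) powr 1" using e by (intro powr_mono) auto
    finally have "?n powr (1 / e) \<le> ?n + 1" by simp
    then show "?n * ?n powr (1 / e) \<le> (?n + 1)\<^sup>2"
      unfolding power2_eq_square by (intro mult_mono) auto
  qed simp
  finally show ?thesis .
qed

text \<open>For the essential supremum the sublevel sets are described by the vanishing of a
  parameter integral, which is measurable by Fubini.\<close>

lemma borel_measurable_Lp_norm:
  assumes [measurable]: "(\<lambda>(x, y). k x y) \<in> borel_measurable (borel \<Otimes>\<^sub>M borel)"
  shows "(\<lambda>x. Lp_norm p (k x)) \<in> borel_fun"
proof -
  have kx [measurable]: "k x \<in> borel_fun" for x by measurable
  show ?thesis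
  proof (cases "p = top")
    case False
    show ?thesis
      unfolding Lp_norm_finite_eq[OF False borel_measurable_lebesgueI[OF kx]] by measurable
  next
    case True
    show ?thesis
    proof (rule borel_measurableI_le)
      fix c
      have "Lp_norm p (k x) \<le> c \<longleftrightarrow> (\<integral>y. indicator {c<..} (k x y)) = 0" for x
      proof -
        have "Lp_norm p (k x) \<le> c \<longleftrightarrow> (AE y in lborel. k x y \<le> c)"
          unfolding True by (simp add: Lp_norm_top_eq esssup_le_iff)
        also have "... \<longleftrightarrow> (AE y in lborel. indicator {c<..} (k x y) = (0::ennreal))"
          by (intro AE_cong) (auto split: split_indicator)
        also have "... \<longleftrightarrow> (\<integral>y. indicator {c<..} (k x y)) = 0"
          by (rule nn_integral_0_iff_AE[symmetric]) measurable
        finally show ?thesis .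
      qed
      then show "{x \<in> space borel. Lp_norm p (k x) \<le> c} \<in> sets borel" by simp
    qed
  qed
qed

text \<open>The set \<open>J\<close> expresses that a window meets a number of cells that is bounded independently
  of its position.\<close>

theorem wiener_norm_le:
  fixes \<iota> :: "'a::euclidean_space => 'i::{countable, ab_group_add}" and \<phi> :: "'a => complex"
  assumes \<iota> [measurable]: "\<iota> \<in> borel \<rightarrow>\<^sub>M count_space UNIV"
    and cells: "\<And>k. (\<integral>x. indicator {k} (\<iota> x)) \<le> 1"
    and \<phi> [measurable]: "\<phi> \<in> borel_fun" and M: "M > 0" "\<And>z. norm (\<phi> z) \<le> M"
    and J: "finite J" "\<And>x y. \<phi> (y - x) \<noteq> 0 ==> \<iota> y - \<iota> x \<in> J"
    and p: "p \<ge> 1" and q: "q \<ge> 1"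
  shows "\<exists>C>0. \<forall>h. h \<in> borel_fun \<longrightarrow> wiener_norm \<phi> p (ennreal q) h
    \<le> ennreal C * epowr (\<Sum>\<^sub>+k. epowr (Lp_norm p (\<lambda>y. h y * indicator {k} (\<iota> y))) q) (1 / q)"
proof -
  \<comment> \<open>\<open>M\<close> bounds the window, and the square is the constant of
    \<open>Lp_norm_sum_le\<close> for the cells that the window meets. The two factors added in
    \<open>C\<close> bound the cost of summing over \<open>J\<close> in the global norm.\<close>
  define c where "c = M * (real (card J) + 1)\<^sup>2"
  have c: "c > 0" unfolding c_def using M(1) by (intro mult_pos_pos zero_less_power) auto
  define C where "C = c * (real (card J) + 1) * (real (card J) + 1)"
  have C: "C > 0" unfolding C_def using c by (intro mult_pos_pos) auto
  have p0: "p > 0" using p by (rule less_le_trans[rotated]) simp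
  have [measurable]: "(\<lambda>x. indicator {k} (\<iota> x) :: ennreal) \<in> borel_fun" for k
    using measurable_compose[OF \<iota>, of "indicator {k}" borel] by simp
  have "wiener_norm \<phi> p (ennreal q) h
    \<le> ennreal C * epowr (\<Sum>\<^sub>+k. epowr (Lp_norm p (\<lambda>y. h y * indicator {k} (\<iota> y))) q) (1 / q)"
    if h [measurable]: "h \<in> borel_fun" for h
  proof -
    define N where "N k = Lp_norm p (\<lambda>y. h y * indicator {k} (\<iota> y))" for k
    define G where "G x = Lp_norm p (\<lambda>y. h y * ennreal (norm (\<phi> (y - x))))" for x
    have Gm [measurable]: "G \<in> borel_fun"
      unfolding G_def by (rule borel_measurable_Lp_norm) measurable
    have G: "G x \<le> ennreal c * (\<Sum>j\<in>J. N (\<iota> x + j))" for x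
    proof -
      have "G x \<le> Lp_norm p (\<lambda>y. ennreal M * (\<Sum>j\<in>J. h y * indicator {\<iota> x + j} (\<iota> y)))"
        unfolding G_def
      proof (rule Lp_norm_mono[OF p0])
        show "(\<lambda>y. h y * ennreal (norm (\<phi> (y - x)))) \<in> borel_measurable lebesgue"
          by (rule borel_measurable_lebesgueI) measurable
        fix y
        show "h y * ennreal (norm (\<phi> (y - x))) \<le> ennreal M * (\<Sum>j\<in>J. h y * indicator {\<iota> x + j} (\<iota> y))"
        proof (cases "\<phi> (y - x) = 0")
          case False
          have eq: "\<iota> x + (\<iota> y - \<iota> x) = \<iota> y" by simp
          have "h y * ennreal (norm (\<phi> (y - x))) \<le> h y * ennreal M" using M by (intro mult_left_mono ennreal_leI) auto
          also have "... = ennreal M * (h y * indicator {\<iota> x + (\<iota> y - \<iota> x)} (\<iota> y))" unfolding eq by (simp add: mult.commute)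
          also have "... \<le> ennreal M * (\<Sum>j\<in>J. h y * indicator {\<iota> x + j} (\<iota> y))"
            by (intro mult_left_mono member_le_sum[OF J(2)[OF False]] J(1)) auto
          finally show ?thesis .
        qed simp
      qed
      also have "... \<le> ennreal M * Lp_norm p (\<lambda>y. \<Sum>j\<in>J. h y * indicator {\<iota> x + j} (\<iota> y))"
        by (rule Lp_norm_cmult_le[OF p0]) measurable
      also have "... \<le> ennreal M * (ennreal ((real (card J) + 1)\<^sup>2) * (\<Sum>j\<in>J. Lp_norm p (\<lambda>y. h y * indicator {\<iota> x + j} (\<iota> y))))"
        by (intro mult_left_mono Lp_norm_sum_le p J(1)) measurable
      also have "... = ennreal c * (\<Sum>j\<in>J. N (\<iota> x + j))"
        using M(1) by (simp add: N_def c_def ennreal_mult' mult.assoc)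
      finally show ?thesis .
    qed
    define X where "X = (\<Sum>\<^sub>+k. epowr (N k) q)"
    \<comment> \<open>The integrand is constant on cells, each of measure at most 1, and translation
      by \<open>j\<close> permutes the cells.\<close>
    have shift: "(\<integral>x. epowr (N (\<iota> x + j)) q) \<le> X" for j
    proof -
      have [measurable]: "(\<lambda>x. epowr (N (\<iota> x + j)) q) \<in> borel_fun"
        by (rule measurable_compose[OF \<iota>]) simp
      have "(\<integral>x. epowr (N (\<iota> x + j)) q)
        = (\<Sum>\<^sub>+k. (\<integral>x. epowr (N (\<iota> x + j)) q * indicator {k} (\<iota> x)))"
        by (rule nn_integral_partition) measurable
      also have "... = (\<Sum>\<^sub>+k. (\<integral>x. epowr (N (k + j)) q * indicator {k} (\<iota> x)))"
        by (intro nn_integral_cong) (auto split: split_indicator)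
      also have "... = (\<Sum>\<^sub>+k. epowr (N (k + j)) q * (\<integral>x. indicator {k} (\<iota> x)))"
        by (intro nn_integral_cong nn_integral_cmult) measurable
      also have "... \<le> (\<Sum>\<^sub>+k. epowr (N (k + j)) q * 1)"
        by (intro nn_integral_mono mult_left_mono cells) simp
      also have "... = X"
        unfolding X_def mult_1_right
        by (rule nn_integral_bij_count_space) (rule bij_betwI[of _ _ _ "\<lambda>k. k - j"], auto)
      finally show ?thesis .
    qed
    have "wiener_norm \<phi> p (ennreal q) h = epowr (\<integral>x. epowr (G x) q) (1 / q)"
      unfolding wiener_norm_def G_def[symmetric] using q
      by (subst Lp_norm_finite_eq) (auto intro: borel_measurable_lebesgueI)
    also have "... \<le> epowr (ennreal (c powr q) * (ennreal (real (card J) powr q) * (of_nat (card J) * X))) (1 / q)"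
    proof (intro ennreal_powr_mono)
      have [measurable]: "(\<lambda>x. epowr (N (\<iota> x + j)) q) \<in> borel_fun" for j
        by (rule measurable_compose[OF \<iota>]) simp
      have "(\<integral>x. epowr (G x) q)
        \<le> (\<integral>x. ennreal (c powr q) * (ennreal (real (card J) powr q) * (\<Sum>j\<in>J. epowr (N (\<iota> x + j)) q)))"
      proof (intro nn_integral_mono)
        fix x
        have "epowr (G x) q \<le> epowr (ennreal c * (\<Sum>j\<in>J. N (\<iota> x + j))) q"
          using q by (intro ennreal_powr_mono G) auto
        also have "... = ennreal (c powr q) * epowr (\<Sum>j\<in>J. N (\<iota> x + j)) q"
          using c by (simp add: ennreal_powr_mult)
        also have "... \<le> ennreal (c powr q) * (ennreal (real (card J) powr q) * (\<Sum>j\<in>J. epowr (N (\<iota> x + j)) q))"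
          using q J(1) by (intro mult_left_mono ennreal_powr_sum_le) auto
        finally show "epowr (G x) q \<le> ennreal (c powr q) * (ennreal (real (card J) powr q) * (\<Sum>j\<in>J. epowr (N (\<iota> x + j)) q))" .
      qed
      also have "... = ennreal (c powr q) * (ennreal (real (card J) powr q) * (\<Sum>j\<in>J. (\<integral>x. epowr (N (\<iota> x + j)) q)))"
        by (simp add: nn_integral_cmult nn_integral_sum)
      also have "... \<le> ennreal (c powr q) * (ennreal (real (card J) powr q) * (\<Sum>j\<in>J. X))"
        by (intro mult_left_mono sum_mono shift) auto
      finally show "(\<integral>x. epowr (G x) q) \<le> ennreal (c powr q) * (ennreal (real (card J) powr q) * (of_nat (card J) * X))"
        by simp
    qed (use q in simp)
    also have "... = ennreal (c * (real (card J) * real (card J) powr (1 / q))) * epowr X (1 / q)"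
      using q c by (simp add: ennreal_powr_mult powr_powr ennreal_mult' ennreal_of_nat_eq_real_of_nat mult.assoc)
    also have "... \<le> ennreal C * epowr X (1 / q)"
    proof (intro mult_right_mono ennreal_leI)
      have "real (card J) powr (1 / q) \<le> (real (card J) + 1) powr (1 / q)" using q by (intro powr_mono2) auto
      also have "... \<le> (real (card J) + 1) powr 1" using q by (intro powr_mono) auto
      finally have "real (card J) powr (1 / q) \<le> real (card J) + 1" by simp
      then show "c * (real (card J) * real (card J) powr (1 / q)) \<le> C"
        unfolding C_def mult.assoc using c by (intro mult_left_mono mult_mono) auto
    qed simp
    finally show ?thesis by (simp only: X_def N_def)
  qed
  then show ?thesis using C by blast
qed

section \<open>Comparison of the window norms with norms over unit cells\<close>

lemma windowD:
  fixes \<phi> :: "'a::euclidean_space => complex"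
  assumes "window \<phi>"
  shows "\<phi> \<in> borel_fun" "\<exists>M>0. \<forall>z. norm (\<phi> z) \<le> M" "\<exists>L. \<forall>z. \<phi> z \<noteq> 0 \<longrightarrow> norm z \<le> L"
proof -
  have t: "test_function \<phi>" using assms by (simp add: window_def)
  then have "continuously_differentiable 0 \<phi>" unfolding test_function_def by blast
  then have cont: "continuous_on UNIV \<phi>" by simp
  then show "\<phi> \<in> borel_fun" by (rule borel_measurable_continuous_onI)
  let ?K = "closure {x. \<phi> x \<noteq> 0}"
  have K: "compact ?K" using t by (simp add: test_function_def)
  have out: "\<phi> z = 0" if "z \<notin> ?K" for z using that closure_subset[of "{x. \<phi> x \<noteq> 0}"] by auto
  have "bounded (\<phi> ` ?K)"
    by (intro compact_imp_bounded compact_continuous_image K continuous_on_subset[OF cont]) simp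
  then obtain M where M: "M > 0" "\<forall>z\<in>?K. norm (\<phi> z) \<le> M" unfolding bounded_pos by auto
  then have "norm (\<phi> z) \<le> M" for z using out[of z] by (cases "z \<in> ?K") auto
  then show "\<exists>M>0. \<forall>z. norm (\<phi> z) \<le> M" using M(1) by blast
  from compact_imp_bounded[OF K] obtain L where "\<forall>z\<in>?K. norm z \<le> L" unfolding bounded_iff by blast
  then show "\<exists>L. \<forall>z. \<phi> z \<noteq> 0 \<longrightarrow> norm z \<le> L" using out by blast
qed

lemma floor_diff_bound:
  fixes x y L :: real
  assumes "\<bar>y - x\<bar> \<le> L" shows "\<lfloor>y\<rfloor> - \<lfloor>x\<rfloor> \<in> {- \<lceil>L\<rceil> - 1..\<lceil>L\<rceil> + 1}"
  using assms by simp linarith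

lemma wiener_norm_time_le:
  fixes \<phi> :: "real => complex"
  assumes \<phi>: "window \<phi>" and p: "p \<ge> 1" and q: "q \<ge> 1"
  shows "\<exists>C>0. \<forall>h. h \<in> borel_fun \<longrightarrow> wiener_norm \<phi> p (ennreal q) h
    \<le> ennreal C * epowr (\<Sum>\<^sub>+k. epowr (Lp_norm p (\<lambda>t. h t * indicator {k} \<lfloor>t\<rfloor>)) q) (1 / q)"
proof -
  obtain M where M: "M > 0" "\<And>z. norm (\<phi> z) \<le> M" using windowD(2)[OF \<phi>] by blast
  obtain L where L: "\<And>z. \<phi> z \<noteq> 0 ==> norm z \<le> L" using windowD(3)[OF \<phi>] by blast
  show ?thesis
  proof (rule wiener_norm_le[OF measurable_real_floor emeasure_floor_cell_le windowD(1)[OF \<phi>] M _ _ p q])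
    show "finite {- \<lceil>L\<rceil> - 1..\<lceil>L\<rceil> + 1}" by simp
    show "\<lfloor>y\<rfloor> - \<lfloor>x\<rfloor> \<in> {- \<lceil>L\<rceil> - 1..\<lceil>L\<rceil> + 1}" if "\<phi> (y - x) \<noteq> 0" for x y
      using L[OF that] by (intro floor_diff_bound) simp
  qed
qed

lemma wiener_norm_space_le:
  fixes \<psi> :: "real^3 => complex"
  assumes \<psi>: "window \<psi>" and r: "r \<ge> 1" and rt: "rt \<ge> 1"
  shows "\<exists>C>0. \<forall>h. h \<in> borel_fun \<longrightarrow> wiener_norm \<psi> (ennreal rt) (ennreal r) h
    \<le> ennreal C * amalgam_norm r rt h"
proof -
  obtain M where M: "M > 0" "\<And>z. norm (\<psi> z) \<le> M" using windowD(2)[OF \<psi>] by blast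
  obtain L where L: "\<And>z. \<psi> z \<noteq> 0 ==> norm z \<le> L" using windowD(3)[OF \<psi>] by blast
  let ?I = "{- \<lceil>L\<rceil> - 1..\<lceil>L\<rceil> + 1}"
  have "\<exists>C>0. \<forall>h. h \<in> borel_fun \<longrightarrow> wiener_norm \<psi> (ennreal rt) (ennreal r) h
    \<le> ennreal C * epowr (\<Sum>\<^sub>+k. epowr (Lp_norm (ennreal rt) (\<lambda>x. h x * indicator {k} (cell x))) r) (1 / r)"
  proof (rule wiener_norm_le[OF measurable_cell emeasure_cell_le windowD(1)[OF \<psi>] M _ _ _ r])
    show "finite (?I \<times> ?I \<times> ?I)" by simp
    show "cell y - cell x \<in> ?I \<times> ?I \<times> ?I" if "\<psi> (y - x) \<noteq> 0" for x y
    proof -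
      have "\<bar>y $ i - x $ i\<bar> \<le> L" for i
        using component_le_norm_cart[of "y - x" i] L[OF that] by simp
      then have "\<lfloor>y $ i\<rfloor> - \<lfloor>x $ i\<rfloor> \<in> ?I" for i by (rule floor_diff_bound)
      then show ?thesis unfolding cell_def diff_Pair mem_Times_iff fst_conv snd_conv by blast
    qed
    show "ennreal rt \<ge> 1" using rt ennreal_leI[of 1 rt] by simp
  qed
  moreover have "epowr (Lp_norm (ennreal rt) (\<lambda>x. h x * indicator {k} (cell x))) r = epowr (cell_power rt h k) (r / rt)"
    if [measurable]: "h \<in> borel_fun" for h k
  proof -
    have "(\<lambda>x. h x * indicator {k} (cell x)) \<in> borel_measurable lebesgue"
      by (rule borel_measurable_lebesgueI) measurable
    then show ?thesis using rt
      by (simp add: Lp_norm_finite_eq ennreal_powr_indicator ennreal_powr_powr cell_power_def)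
  qed
  ultimately show ?thesis by (simp add: amalgam_norm_def)
qed

lemma time_norm_le:
  fixes q :: real and p :: ennreal
  assumes q: "q > 2" and p: "p \<ge> 2" and C: "C > 0"
    and b: "if p = top then b = 0 else b \<ge> 0 \<and> b * (enn2real p / 2) < 1"
  shows "\<exists>D>0. \<forall>S B. time_form_bounded C b (2 / q) S B \<longrightarrow>
    (\<Sum>\<^sub>+m. epowr (Lp_norm p (\<lambda>t. S t * indicator {m} \<lfloor>t\<rfloor>)) q)
      \<le> epowr (epowr (B * ennreal D) (1 / 2)) q"
proof (cases "p = top")
  case True
  have "Lp_norm p (\<lambda>t. S t * indicator {m} \<lfloor>t\<rfloor>) = esssup lborel (\<lambda>t. S t * indicator {m} \<lfloor>t\<rfloor>)"
    if [measurable]: "S \<in> borel_fun" for S :: "real => ennreal" and m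
    unfolding True by (rule Lp_norm_top_eq) measurable
  then show ?thesis using time_norm_le_esssup[OF q C] b True by (simp add: time_form_bounded_def)
next
  case False
  have "enn2real p \<ge> 2" using False p enn2real_mono[of 2 p] by (simp add: less_top)
  moreover have "Lp_norm p (\<lambda>t. S t * indicator {m} \<lfloor>t\<rfloor>)
      = epowr (\<integral>t. epowr (S t * indicator {m} \<lfloor>t\<rfloor>) (enn2real p)) (1 / enn2real p)"
    if [measurable]: "S \<in> borel_fun" for S :: "real => ennreal" and m
    by (rule Lp_norm_finite_eq[OF False borel_measurable_lebesgueI]) measurable
  ultimately show ?thesis using time_norm_le_finite[OF q _ C, of "enn2real p" b] b False by (simp add: time_form_bounded_def)
qed

section \<open>The estimate\<close>

text \<open>Doubling the gap condition gives \<open>3 - 2 * \<sigma> < 2 * u + 6 / r'\<close> with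
  \<open>u\<close> the inverse of \<open>q'\<close>, and \<sigma> > 1 gives
  \<open>3 - 2 * \<sigma> < 1\<close>, so some \<open>a\<close> fits in between. Then
  \<open>b\<close> is taken between \<open>a - 6 / r'\<close> and \<open>2 * u\<close>, the
  thresholds for space and time; for infinite \<open>q'\<close> both \<open>u\<close> and
  \<open>b\<close> are 0.\<close>

lemma exponent_choice:
  fixes \<sigma> r r' :: real and q' :: ennreal
  assumes \<sigma>: "\<sigma> > 1" and q': "2 \<le> q'" and r': "r' > 6"
    and gap: "enn2real (1 / q') + 3 / r' > 3 / 2 - \<sigma>"
  obtains a b where "0 < a" "a \<le> 1" "3 - 2 * \<sigma> < a" "0 \<le> b" "b \<le> a" "(a - b) * (r' / 2) < 3"
    "if q' = top then b = 0 else b \<ge> 0 \<and> b * (enn2real q' / 2) < 1"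
proof -
  define u where "u = enn2real (1 / q')"
  have u0: "u \<ge> 0" by (simp add: u_def)
  have "max (3 - 2 * \<sigma>) 0 < min 1 (2 * u + 6 / r')"
    using \<sigma> r' gap u0 by (auto simp: u_def add_nonneg_pos)
  then obtain a where a: "max (3 - 2 * \<sigma>) 0 < a" "a < min 1 (2 * u + 6 / r')" using dense by blast
  show ?thesis
  proof (cases "q' = top")
    case True
    then have "u = 0" by (simp add: u_def)
    then have "(a - 0) * (r' / 2) < 3" using a r' by (simp add: field_simps)
    then show ?thesis using that[of a 0] a True by auto
  next
    case False
    then obtain qs where qs: "q' = ennreal qs" "qs \<ge> 0" by (cases q') auto
    then have qs2: "qs \<ge> 2" using q' ennreal_le_iff[of qs 2] by simp
    have u: "u = 1 / qs" unfolding u_def qs using qs2 by (simp add: divide_ennreal[of 1 qs, simplified])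
    have "max (a - 6 / r') 0 < min a (2 * u)" using a r' qs2 by (auto simp: u)
    then obtain b where b: "max (a - 6 / r') 0 < b" "b < min a (2 * u)" using dense by blast
    have "(a - b) * (r' / 2) < 3" using b r' by (simp add: field_simps)
    moreover have "b * (qs / 2) < 1" using b qs2 by (simp add: u field_simps)
    ultimately show ?thesis using that[of a b] a b False qs by auto
  qed
qed

lemma sobolev_norm_eq:
  assumes f: "f \<in> L2" and F [measurable]: "F \<in> borel_fun" and fF: "AE \<xi> in lborel. fourier f \<xi> = F \<xi>"
  shows "sobolev_norm \<sigma> f = epowr (weighted_energy \<sigma> F) (1 / 2)"
proof -
  have "fourier f \<in> borel_measurable lebesgue"
    using is_fourier_fourier[OF f] by (simp add: is_fourier_def L2_iff)
  then have [measurable]: "fourier f \<in> borel_measurable lebesgue" .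
  have [measurable]: "bracket \<in> borel_measurable (lebesgue :: (real^3) measure)"
    using measurable_completion[of bracket "lborel :: (real^3) measure" borel] by simp
  let ?h = "\<lambda>\<xi>. bracket \<xi> powr \<sigma> * norm (fourier f \<xi>)"
  have "sobolev_norm \<sigma> f = Lp_norm 2 (\<lambda>\<xi>. ennreal (norm (?h \<xi>)))"
    by (simp add: sobolev_norm_def bracket_def)
  also have "... = epowr (energy ?h) (1 / 2)"
    by (rule Lp_norm_2_eq) measurable
  also have "energy ?h = weighted_energy \<sigma> F"
    unfolding energy_def weighted_energy_def using fF
    by (intro nn_integral_cong_AE) (auto simp: power_mult_distrib elim: eventually_mono)
  finally show ?thesis .
qed

text \<open>Allows the flow at a fixed time, which is defined up to a null set, to be replaced by
  the jointly measurable envelope.\<close>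

lemma wiener_norm_cong_AE:
  fixes h h' :: "'a::euclidean_space => ennreal"
  assumes [measurable]: "\<psi> \<in> borel_fun" and h: "h \<in> borel_measurable lebesgue" "h' \<in> borel_measurable lebesgue"
    and p: "p \<noteq> top" and ae: "AE x in lborel. h x = h' x"
  shows "wiener_norm \<psi> p q h = wiener_norm \<psi> p q h'"
proof -
  have "Lp_norm p (\<lambda>y. h y * ennreal (norm (\<psi> (y - x)))) = Lp_norm p (\<lambda>y. h' y * ennreal (norm (\<psi> (y - x))))" for x
  proof (rule Lp_norm_cong_AE[OF _ _ p])
    have "(\<lambda>y. ennreal (norm (\<psi> (y - x)))) \<in> borel_measurable lebesgue"
      by (rule borel_measurable_lebesgueI) measurable
    then show "(\<lambda>y. h y * ennreal (norm (\<psi> (y - x)))) \<in> borel_measurable lebesgue"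
      "(\<lambda>y. h' y * ennreal (norm (\<psi> (y - x)))) \<in> borel_measurable lebesgue"
      using h by auto
    show "AE y in lborel. h y * ennreal (norm (\<psi> (y - x))) = h' y * ennreal (norm (\<psi> (y - x)))"
      using ae by (auto elim: eventually_mono)
  qed
  then show ?thesis by (simp add: wiener_norm_def)
qed

lemma borel_measurable_wiener_norm:
  fixes V :: "real \<times> (real^3) => ennreal" and \<psi> :: "real^3 => complex"
  assumes V: "V \<in> borel_fun" and [measurable]: "\<psi> \<in> borel_fun"
  shows "(\<lambda>t. wiener_norm \<psi> p q (\<lambda>x. V (t, x))) \<in> borel_fun"
proof -
  have [measurable]: "V \<in> borel_measurable (borel \<Otimes>\<^sub>M borel)" using V by (simp add: borel_prod)
  have "(\<lambda>z. Lp_norm p (\<lambda>y. V (fst z, y) * ennreal (norm (\<psi> (y - snd z))))) \<in> borel_measurable (borel :: (real \<times> (real^3)) measure)"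
  proof (rule borel_measurable_Lp_norm)
    have "(\<lambda>(z, y). V (fst z, y) * ennreal (norm (\<psi> (y - snd z)))) \<in> borel_measurable ((borel \<Otimes>\<^sub>M borel) \<Otimes>\<^sub>M borel)"
      by measurable
    then show "(\<lambda>(z, y). V (fst z, y) * ennreal (norm (\<psi> (y - snd z)))) \<in> borel_measurable ((borel :: (real \<times> (real^3)) measure) \<Otimes>\<^sub>M borel)"
      by (simp only: borel_prod)
  qed
  then have "(\<lambda>(t, x). Lp_norm p (\<lambda>y. V (t, y) * ennreal (norm (\<psi> (y - x))))) \<in> borel_measurable (borel \<Otimes>\<^sub>M borel)"
    by (simp add: split_beta' borel_prod)
  then show ?thesis unfolding wiener_norm_def by (rule borel_measurable_Lp_norm)
qed

theorem theorem1p1: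
  fixes \<sigma> q r r' :: real and q' :: ennreal
    and \<phi> :: "real => complex" and \<psi> :: "real ^ 3 => complex"
  assumes "window \<phi>" and "window \<psi>"
    and "\<sigma> > 1"
    and "2 \<le> q'" and "2 < q"
    and "6 < r" and "r \<le> r'"
    and "enn2real (1 / q') + 3 / r' > 3 / 2 - \<sigma>"
    and "1 / q + 3 / r = 1 / 2"
  shows "\<exists>C>0. \<forall>f\<in>sobolev_space \<sigma>.
           mixed_wiener_norm \<phi> \<psi> q' (ennreal q) (ennreal r') (ennreal r) (dirac_flow f)
             \<le> ennreal C * sobolev_norm \<sigma> f"
proof -
  have r'6: "r' > 6" using assms by simp
  obtain a b where a: "0 < a" "a \<le> 1" "3 - 2 * \<sigma> < a" and b: "0 \<le> b" "b \<le> a" and ab: "(a - b) * (r' / 2) < 3"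
    and bq: "if q' = top then b = 0 else b \<ge> 0 \<and> b * (enn2real q' / 2) < 1"
    by (rule exponent_choice[OF assms(3,4) r'6 assms(8)])
  obtain D1 where D1: "D1 > 0" and wave: "\<And>F R h. (\<forall>n. R n \<ge> 0) ==> F \<in> borel_fun ==> weighted_energy \<sigma> F < top ==> h \<in> borel_fun ==>
    (\<integral>p. wave_envelope F R p * h p)\<^sup>2 \<le> ennreal D1 * weighted_energy \<sigma> F * kernel_form a b h"
    using wave_envelope_dual[OF assms(3) a b] by blast
  obtain C2 where C2: "C2 > 0" and kern: "kernel_form_le a b r r' (\<lambda>\<tau>. ennreal (C2 * sing_weight b \<tau> * (1 + \<bar>\<tau>\<bar>) powr (6 / r - 1)))"
    using kernel_form_bound[OF b assms(6,7) ab] by blast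
  \<comment> \<open>The scaling relation between \<open>q\<close> and \<open>r\<close>: the decay
    left by the cubes is exactly the critical one for the discrete inequality in time.\<close>
  have expo: "6 / r - 1 = - (2 / q)" using assms(9) by (simp add: field_simps)
  obtain D3 where D3: "D3 > 0" and time: "\<And>S B. time_form_bounded C2 b (2 / q) S B ==>
    (\<Sum>\<^sub>+m. epowr (Lp_norm q' (\<lambda>t. S t * indicator {m} \<lfloor>t\<rfloor>)) q)
      \<le> epowr (epowr (B * ennreal D3) (1 / 2)) q"
    using time_norm_le[OF assms(5,4) C2 bq] by blast
  have q'1: "q' \<ge> 1" using assms(4) by (rule order_trans[rotated]) simp
  have q'0: "q' > 0" using q'1 by (rule less_le_trans[rotated]) simp
  obtain C4 where C4: "C4 > 0" and wt: "\<And>h. h \<in> borel_fun ==> wiener_norm \<phi> q' (ennreal q) h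
    \<le> ennreal C4 * epowr (\<Sum>\<^sub>+k. epowr (Lp_norm q' (\<lambda>t. h t * indicator {k} \<lfloor>t\<rfloor>)) q) (1 / q)"
    using wiener_norm_time_le[OF assms(1) q'1, of q] assms(5) by auto
  obtain C1 where C1: "C1 > 0" and ws: "\<And>h. h \<in> borel_fun ==> wiener_norm \<psi> (ennreal r') (ennreal r) h \<le> ennreal C1 * amalgam_norm r r' h"
    using wiener_norm_space_le[OF assms(2), of r r'] assms(6,7) by auto
  \<comment> \<open>\<open>C4\<close> and \<open>C1\<close> compare the windows with cells in time
    and in space; the root appears because the dual estimates bound squares.\<close>
  define C where "C = C4 * (C1 * (D1 * D3) powr (1 / 2))"
  have C: "C > 0" unfolding C_def using C1 C4 D1 D3 by simp
  have "mixed_wiener_norm \<phi> \<psi> q' (ennreal q) (ennreal r') (ennreal r) (dirac_flow f) \<le> ennreal C * sobolev_norm \<sigma> f"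
    if f: "f \<in> sobolev_space \<sigma>" for f
  proof -
    have fL: "f \<in> L2" and sob: "sobolev_norm \<sigma> f < top" using f by (auto simp: sobolev_space_def)
    have "fourier f \<in> borel_measurable lebesgue" using is_fourier_fourier[OF fL] by (simp add: is_fourier_def L2_iff)
    then obtain F where F [measurable]: "F \<in> borel_fun" and fF: "AE \<xi> in lborel. fourier f \<xi> = F \<xi>"
      using ex_borel_measurable_AE_eq by blast
    note sn = sobolev_norm_eq[OF fL F fF, of \<sigma>]
    have we: "weighted_energy \<sigma> F < top" using sob unfolding sn by (simp add: less_top[symmetric])
    then have en: "energy F < \<infinity>" using energy_le_weighted_energy[of \<sigma> F] assms(3) by (simp add: le_less_trans)
    obtain R where R: "\<forall>n. R n \<ge> 0" and tail: "\<And>n. ennreal 324 * energy (\<lambda>\<xi>. indicator (- cball 0 (R n)) \<xi> *\<^sub>R F \<xi>) \<le> ennreal ((1 / 8) ^ n)"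
      using ex_tail_radii[OF F en] by blast
    define V where "V = wave_envelope F R"
    have V: "V \<in> borel_fun" unfolding V_def by measurable
    have Vp [measurable]: "V \<in> borel_measurable (borel \<Otimes>\<^sub>M borel)" using V by (simp add: borel_prod)
    have Vt [measurable]: "(\<lambda>x. V (t, x)) \<in> borel_fun" for t by measurable
    define S where "S t = amalgam_norm r r' (\<lambda>x. V (t, x))" for t
    have Sm [measurable]: "S \<in> borel_fun"
      unfolding S_def by (rule borel_measurable_amalgam_norm) measurable
    define H where "H t = wiener_norm \<psi> (ennreal r') (ennreal r) (\<lambda>x. V (t, x))" for t
    have Hm [measurable]: "H \<in> borel_fun"
      unfolding H_def by (rule borel_measurable_wiener_norm[OF V windowD(1)[OF assms(2)]])
    have HS: "H t \<le> ennreal C1 * S t" for t unfolding H_def S_def by (rule ws[OF Vt])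
    \<comment> \<open>The equality holds at every time, so the outer norm may be computed with the
      measurable function \<open>H\<close>.\<close>
    have flow: "wiener_norm \<psi> (ennreal r') (ennreal r) (\<lambda>x. ennreal (norm (dirac_flow f t x))) = H t" for t
      unfolding H_def
    proof (rule wiener_norm_cong_AE[OF windowD(1)[OF assms(2)]])
      note eq = dirac_flow_eq_envelope[OF F fF en tail, of t]
      show "(\<lambda>x. ennreal (norm (dirac_flow f t x))) \<in> borel_measurable lebesgue" using eq(2) by measurable
      show "(\<lambda>x. V (t, x)) \<in> borel_measurable lebesgue" by (rule borel_measurable_lebesgueI[OF Vt])
      show "AE x in lborel. ennreal (norm (dirac_flow f t x)) = V (t, x)" unfolding V_def by (rule eq(1))
    qed simp
    define B where "B = ennreal D1 * weighted_energy \<sigma> F"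
    have B: "B < top" using we by (simp add: B_def ennreal_mult_less_top)
    have bounded: "time_form_bounded C2 b (2 / q) S B"
      unfolding time_form_bounded_def S_def time_kernel_def expo[symmetric]
    proof (intro conjI allI impI amalgam_norm_dual[OF assms(6,7) V _ kern])
      show "(\<integral>p. V p * h p)\<^sup>2 \<le> B * kernel_form a b h" if "h \<in> borel_fun" for h
        unfolding V_def B_def by (rule wave[OF R F we that])
    qed (use B Sm in \<open>auto simp: S_def[abs_def]\<close>)
    have q0: "q > 0" using assms(5) by simp
    have "mixed_wiener_norm \<phi> \<psi> q' (ennreal q) (ennreal r') (ennreal r) (dirac_flow f) = wiener_norm \<phi> q' (ennreal q) H"
      unfolding mixed_wiener_norm_def flow ..
    also have "... \<le> ennreal C4 * epowr (\<Sum>\<^sub>+k. epowr (Lp_norm q' (\<lambda>t. H t * indicator {k} \<lfloor>t\<rfloor>)) q) (1 / q)"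
      by (rule wt[OF Hm])
    also have "... \<le> ennreal C4 * epowr (ennreal (C1 powr q) * (\<Sum>\<^sub>+k. epowr (Lp_norm q' (\<lambda>t. S t * indicator {k} \<lfloor>t\<rfloor>)) q)) (1 / q)"
    proof (rule mult_left_mono[OF ennreal_powr_mono])
      have "epowr (Lp_norm q' (\<lambda>t. H t * indicator {k} \<lfloor>t\<rfloor>)) q \<le> ennreal (C1 powr q) * epowr (Lp_norm q' (\<lambda>t. S t * indicator {k} \<lfloor>t\<rfloor>)) q" for k
      proof -
        have "Lp_norm q' (\<lambda>t. H t * indicator {k} \<lfloor>t\<rfloor>) \<le> Lp_norm q' (\<lambda>t. ennreal C1 * (S t * indicator {k} \<lfloor>t\<rfloor>))"
        proof (rule Lp_norm_mono[OF q'0])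
          show "(\<lambda>t. H t * indicator {k} \<lfloor>t\<rfloor>) \<in> borel_measurable lebesgue" by (rule borel_measurable_lebesgueI) measurable
          show "H t * indicator {k} \<lfloor>t\<rfloor> \<le> ennreal C1 * (S t * indicator {k} \<lfloor>t\<rfloor>)" for t
            using HS[of t] by (simp add: mult.assoc[symmetric] mult_right_mono)
        qed
        also have "... \<le> ennreal C1 * Lp_norm q' (\<lambda>t. S t * indicator {k} \<lfloor>t\<rfloor>)"
          by (rule Lp_norm_cmult_le[OF q'0]) measurable
        finally have "epowr (Lp_norm q' (\<lambda>t. H t * indicator {k} \<lfloor>t\<rfloor>)) q \<le> epowr (ennreal C1 * Lp_norm q' (\<lambda>t. S t * indicator {k} \<lfloor>t\<rfloor>)) q"
          using q0 by (intro ennreal_powr_mono) auto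
        then show ?thesis using C1 by (simp add: ennreal_powr_mult)
      qed
      then have "(\<Sum>\<^sub>+k. epowr (Lp_norm q' (\<lambda>t. H t * indicator {k} \<lfloor>t\<rfloor>)) q)
        \<le> (\<Sum>\<^sub>+k. ennreal (C1 powr q) * epowr (Lp_norm q' (\<lambda>t. S t * indicator {k} \<lfloor>t\<rfloor>)) q)"
        by (intro nn_integral_mono)
      then show "(\<Sum>\<^sub>+k. epowr (Lp_norm q' (\<lambda>t. H t * indicator {k} \<lfloor>t\<rfloor>)) q)
        \<le> ennreal (C1 powr q) * (\<Sum>\<^sub>+k. epowr (Lp_norm q' (\<lambda>t. S t * indicator {k} \<lfloor>t\<rfloor>)) q)"
        by (simp add: nn_integral_cmult)
    qed (use q0 in auto)
    also have "... \<le> ennreal C4 * epowr (ennreal (C1 powr q) * epowr (epowr (B * ennreal D3) (1 / 2)) q) (1 / q)"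
      using q0 bounded by (intro mult_left_mono ennreal_powr_mono time) auto
    also have "... = ennreal C4 * (ennreal C1 * epowr (B * ennreal D3) (1 / 2))"
      using q0 C1 by (simp add: ennreal_powr_mult powr_powr)
    also have "epowr (B * ennreal D3) (1 / 2) = ennreal ((D1 * D3) powr (1 / 2)) * sobolev_norm \<sigma> f"
    proof -
      have "B * ennreal D3 = ennreal (D1 * D3) * weighted_energy \<sigma> F"
        using D1 D3 by (simp add: B_def ennreal_mult' mult_ac)
      then show ?thesis unfolding sn using D1 D3 by (simp only: ennreal_powr_mult) (simp add: less_imp_le)
    qed
    also have "ennreal C4 * (ennreal C1 * (ennreal ((D1 * D3) powr (1 / 2)) * sobolev_norm \<sigma> f)) = ennreal C * sobolev_norm \<sigma> f"
      using C1 C4 by (simp add: C_def ennreal_mult' mult.assoc)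
    finally show ?thesis .
  qed
  then show ?thesis using C by blast
qed

end
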